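(* Let $M$ be a connected smooth surface (2-manifold without boundary) and let $F\colon M\to\mathbf{R}^{3}$ be a complete $C^{2}$ immersion having the central cross-cut property. Suppose there is a plane $P\subset\mathbf{R}^{3}$ such that $F$ and $P$ are in general position and some clean cross-cut $\Gamma\subset F^{-1}(P)$ has image $F(\Gamma)\subset P$ which is a clean figure-8. Then $F(M)$ is a central cylinder.
   Context: Complete means complete for the Riemannian metric induced by $F$. General position: a unit normal to an immersion $F\colon M^{n}\to\mathbf{R}^{n+1}$ at $x\in M$ is a unit vector orthogonal to the hyperplane $dF(T_xM)$. $F$ has general position if, whenever $y\in\mathbf{R}^{n+1}$ and $\nu_1,\dots,\nu_k$ are unit normals to $F$ at distinct points of $F^{-1}(y)$, one has $\nu_1\wedge\cdots\wedge\nu_k\neq 0$. $F$ and a hyperplane $P$ are in general position if this holds for the extension of $F$ to the disjoint union $M\cup P$ by the inclusion map on $P$ (so in particular $F$ itself has general position). $P$ meets $F$ transversally if the condition holds for this extension with $k=2$. Cross-cuts: when a hyperplane $P$ meets $F$ transversally, a cross-cut of $F$ relative to $P$ is a compact connected component $\Gamma$ of $F^{-1}(P)$ (its image $F(\Gamma)$ is also called a cross-cut). It is a clean cross-cut when $F$ and $P$ are in general position. A set $X\subset\mathbf{R}^{n+1}$ is central (has central symmetry) if for some point $c$ the reflection $x\mapsto 2c-x$ maps $X$ to itself. Central cross-cut property: $F$ has it when (a) at least one clean cross-cut exists, and (b) the image of every clean cross-cut has central symmetry. Clean loops and figure-8's: an immersed loop $\alpha\colon\mathbf{S}^1\to\mathbf{R}^2$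 is clean if, whenever $t_1\ne t_2$ are preimages of a single point, they have respective neighborhoods $U_1,U_2$ whose images $\alpha(U_1),\alpha(U_2)$ intersect transversally. A clean figure-8 is a clean immersed loop in a plane with total signed curvature (equivalently rotation index) zero, i.e. regularly homotopic to the figure-8 $t\mapsto(\cos t,\sin 2t)$. Central cylinder: an immersed surface having a cross-cut, whose image is preserved by all translations parallel to some line and also by a central reflection. *)

theory Defs
  imports "HOL-Analysis.Analysis"
begin

text \<open>Maps of class $C^k$ on an open set: all iterated directional derivatives up to
  order \<open>k\<close> exist and are continuous.\<close>

primrec Ck_on :: "nat \<Rightarrow> 'a::real_normed_vector set \<Rightarrow> ('a \<Rightarrow> 'b::real_normed_vector) \<Rightarrow> bool"
where
  "Ck_on 0 S f \<longleftrightarrow> continuous_on S f"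
| "Ck_on (Suc k) S f \<longleftrightarrow> (\<forall>x\<in>S. f differentiable (at x)) \<and>
     (\<forall>v. Ck_on k S (\<lambda>x. frechet_derivative f (at x) v))"

section \<open>Surfaces and immersions into space\<close>

text \<open>A surface is a type of class \<open>t2_space\<close> and \<open>second_countable_topology\<close> together with a
  (not necessarily maximal) smooth atlas, a chart being a pair of its domain and its coordinate
  map. The values of a coordinate map outside its domain are irrelevant.\<close>

type_synonym 'm chart = "'m set \<times> ('m \<Rightarrow> real^2)"

definition is_chart :: "'m::topological_space chart \<Rightarrow> bool" where
  "is_chart c \<longleftrightarrow> (case c of (U, \<phi>) \<Rightarrow>
     open U \<and> open (\<phi> ` U) \<and> (\<exists>\<psi>. homeomorphism U (\<phi> ` U) \<phi> \<psi>))"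

definition smoothly_compatible :: "'m chart \<Rightarrow> 'm chart \<Rightarrow> bool" where
  "smoothly_compatible c d \<longleftrightarrow> (case c of (U, \<phi>) \<Rightarrow> case d of (V, \<psi>) \<Rightarrow>
     (\<forall>k. Ck_on k (\<phi> ` (U \<inter> V)) (\<psi> \<circ> inv_into U \<phi>)))"

definition smooth_surface ::
  "'m::{t2_space, second_countable_topology} chart set \<Rightarrow> bool" where
  "smooth_surface A \<longleftrightarrow> (\<forall>c\<in>A. is_chart c) \<and> (\<Union>(U, \<phi>)\<in>A. U) = UNIV \<and>
     (\<forall>c\<in>A. \<forall>d\<in>A. smoothly_compatible c d)"

definition C2_immersion :: "'m chart set \<Rightarrow> ('m \<Rightarrow> real^3) \<Rightarrow> bool" where
  "C2_immersion A F \<longleftrightarrow> (\<forall>(U, \<phi>)\<in>A. Ck_on 2 (\<phi> ` U) (F \<circ> inv_into U \<phi>) \<and>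
     (\<forall>z\<in>\<phi> ` U. inj (frechet_derivative (F \<circ> inv_into U \<phi>) (at z))))"

text \<open>The plane $dF(T_xM)$. All charts around \<open>x\<close> contribute the same plane.\<close>

definition tangent_plane :: "'m chart set \<Rightarrow> ('m \<Rightarrow> real^3) \<Rightarrow> 'm \<Rightarrow> (real^3) set" where
  "tangent_plane A F x = (\<Union>(U, \<phi>)\<in>{(U, \<phi>)\<in>A. x \<in> U}.
     range (frechet_derivative (F \<circ> inv_into U \<phi>) (at (\<phi> x))))"

definition unit_normals :: "'m chart set \<Rightarrow> ('m \<Rightarrow> real^3) \<Rightarrow> 'm \<Rightarrow> (real^3) set" where
  "unit_normals A F x = {\<nu>. norm \<nu> = 1 \<and> (\<forall>v\<in>tangent_plane A F x. \<nu> \<bullet> v = 0)}"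

section \<open>The induced Riemannian distance\<close>

definition C1_curve :: "'m::topological_space chart set \<Rightarrow> real \<Rightarrow> real \<Rightarrow> (real \<Rightarrow> 'm) \<Rightarrow> bool" where
  "C1_curve A a b \<gamma> \<longleftrightarrow> continuous_on {a..b} \<gamma> \<and>
     (\<forall>(U, \<phi>)\<in>A. \<exists>D. continuous_on {t\<in>{a..b}. \<gamma> t \<in> U} D \<and>
        (\<forall>t\<in>{a..b}. \<gamma> t \<in> U \<longrightarrow> (\<phi> \<circ> \<gamma> has_vector_derivative D t) (at t within {a..b})))"

definition piecewise_C1_curve :: "'m::topological_space chart set \<Rightarrow> (real \<Rightarrow> 'm) \<Rightarrow> bool" where
  "piecewise_C1_curve A \<gamma> \<longleftrightarrow> (\<exists>(n::nat) (p::nat \<Rightarrow> real).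
     p 0 = 0 \<and> p n = 1 \<and> (\<forall>i<n. p i < p (Suc i) \<and> C1_curve A (p i) (p (Suc i)) \<gamma>))"

text \<open>In the metric induced by \<open>F\<close>, the vector $\gamma'(t)$ has length
  $|dF(\gamma'(t))| = |(F\circ\gamma)'(t)|$. The finitely many break points of a piecewise
  curve do not affect the integral.\<close>

definition induced_length :: "('m \<Rightarrow> real^3) \<Rightarrow> (real \<Rightarrow> 'm) \<Rightarrow> real" where
  "induced_length F \<gamma> = integral {0..1} (\<lambda>t. norm (vector_derivative (F \<circ> \<gamma>) (at t)))"

definition induced_dist ::
  "'m::topological_space chart set \<Rightarrow> ('m \<Rightarrow> real^3) \<Rightarrow> 'm \<Rightarrow> 'm \<Rightarrow> real" where
  "induced_dist A F x y =
     Inf {induced_length F \<gamma> |\<gamma>. piecewise_C1_curve A \<gamma> \<and> \<gamma> 0 = x \<and> \<gamma> 1 = y}"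

definition complete_immersion :: "'m::topological_space chart set \<Rightarrow> ('m \<Rightarrow> real^3) \<Rightarrow> bool" where
  "complete_immersion A F \<longleftrightarrow> Metric_space.mcomplete UNIV (induced_dist A F)"

section \<open>General position\<close>

text \<open>The exterior product $v_0\wedge\cdots\wedge v_{k-1}$ as an antisymmetric tensor
  $\sum_{p} \mathrm{sgn}(p)\, v_{p(0)}\otimes\cdots\otimes v_{p(k-1)}$, given by its components,
  which are indexed by the lists of \<open>k\<close> coordinates.\<close>

definition wedge :: "(real^'n) list \<Rightarrow> 'n list \<Rightarrow> real" where
  "wedge vs is = (if length is = length vs
     then \<Sum>p | p permutes {..<length vs}.
            of_int (sign p) * (\<Prod>i<length vs. (vs ! p i) $ (is ! i))
     else 0)"

text \<open>The condition on a map \<open>G\<close> on \<open>S\<close>, with set of unit normals \<open>N x\<close> at \<open>x\<close>, that any \<open>k\<close>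
  unit normals at distinct points of a fibre of \<open>G\<close> have nonzero exterior product.\<close>

definition normals_condition ::
  "nat \<Rightarrow> 'a set \<Rightarrow> ('a \<Rightarrow> real^3) \<Rightarrow> ('a \<Rightarrow> (real^3) set) \<Rightarrow> bool" where
  "normals_condition k S G N \<longleftrightarrow> (\<forall>y xs \<nu>s.
     length xs = k \<and> length \<nu>s = k \<and> distinct xs \<and> set xs \<subseteq> {x\<in>S. G x = y} \<and>
     (\<forall>i<k. \<nu>s ! i \<in> N (xs ! i)) \<longrightarrow> wedge \<nu>s \<noteq> (\<lambda>_. 0))"

definition is_plane :: "(real^3) set \<Rightarrow> bool" where
  "is_plane P \<longleftrightarrow> (\<exists>a b. a \<noteq> 0 \<and> P = {x. a \<bullet> x = b})"

definition plane_unit_normals :: "(real^3) set \<Rightarrow> (real^3) set" where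
  "plane_unit_normals P = {\<nu>. norm \<nu> = 1 \<and> (\<forall>p\<in>P. \<forall>q\<in>P. \<nu> \<bullet> (q - p) = 0)}"

text \<open>The condition for the extension of \<open>F\<close> to the disjoint union of the surface and \<open>P\<close> by
  the inclusion of \<open>P\<close>.\<close>

definition extension_condition ::
  "nat \<Rightarrow> 'm chart set \<Rightarrow> ('m \<Rightarrow> real^3) \<Rightarrow> (real^3) set \<Rightarrow> bool" where
  "extension_condition k A F P \<longleftrightarrow> normals_condition k (UNIV <+> P) (case_sum F (\<lambda>p. p))
     (case_sum (unit_normals A F) (\<lambda>p. plane_unit_normals P))"

definition in_general_position :: "'m chart set \<Rightarrow> ('m \<Rightarrow> real^3) \<Rightarrow> (real^3) set \<Rightarrow> bool" where
  "in_general_position A F P \<longleftrightarrow> (\<forall>k. extension_condition k A F P)"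

definition meets_transversally :: "'m chart set \<Rightarrow> ('m \<Rightarrow> real^3) \<Rightarrow> (real^3) set \<Rightarrow> bool" where
  "meets_transversally A F P \<longleftrightarrow> extension_condition 2 A F P"

section \<open>Cross-cuts\<close>

definition cross_cut ::
  "'m::topological_space chart set \<Rightarrow> ('m \<Rightarrow> real^3) \<Rightarrow> (real^3) set \<Rightarrow> 'm set \<Rightarrow> bool" where
  "cross_cut A F P \<Gamma> \<longleftrightarrow> is_plane P \<and> meets_transversally A F P \<and>
     \<Gamma> \<in> components (F -` P) \<and> compact \<Gamma>"

definition clean_cross_cut ::
  "'m::topological_space chart set \<Rightarrow> ('m \<Rightarrow> real^3) \<Rightarrow> (real^3) set \<Rightarrow> 'm set \<Rightarrow> bool" where
  "clean_cross_cut A F P \<Gamma> \<longleftrightarrow> cross_cut A F P \<Gamma> \<and> in_general_position A F P"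

definition central :: "(real^3) set \<Rightarrow> bool" where
  "central X \<longleftrightarrow> (\<exists>c. (\<lambda>x. 2 *\<^sub>R c - x) ` X = X)"

definition central_cross_cut_property ::
  "'m::topological_space chart set \<Rightarrow> ('m \<Rightarrow> real^3) \<Rightarrow> bool" where
  "central_cross_cut_property A F \<longleftrightarrow> (\<exists>P \<Gamma>. clean_cross_cut A F P \<Gamma>) \<and>
     (\<forall>P \<Gamma>. clean_cross_cut A F P \<Gamma> \<longrightarrow> central (F ` \<Gamma>))"

definition central_cylinder ::
  "'m::topological_space chart set \<Rightarrow> ('m \<Rightarrow> real^3) \<Rightarrow> bool" where
  "central_cylinder A F \<longleftrightarrow> (\<exists>P \<Gamma>. cross_cut A F P \<Gamma>) \<and>
     (\<exists>v. v \<noteq> 0 \<and> (\<forall>t::real. (\<lambda>x. x + t *\<^sub>R v) ` range F = range F)) \<and> central (range F)"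

section \<open>Clean figure-8's\<close>

text \<open>A loop is a map on the unit circle of the complex plane, parametrized by \<open>cis\<close>; its values
  off the circle are irrelevant.\<close>

definition velocity :: "(complex \<Rightarrow> real^2) \<Rightarrow> real \<Rightarrow> real^2" where
  "velocity \<alpha> t = vector_derivative (\<lambda>s. \<alpha> (cis s)) (at t)"

definition acceleration :: "(complex \<Rightarrow> real^2) \<Rightarrow> real \<Rightarrow> real^2" where
  "acceleration \<alpha> t = vector_derivative (velocity \<alpha>) (at t)"

definition immersed_loop :: "(complex \<Rightarrow> real^2) \<Rightarrow> bool" where
  "immersed_loop \<alpha> \<longleftrightarrow> Ck_on 2 UNIV (\<lambda>t. \<alpha> (cis t)) \<and> (\<forall>t. velocity \<alpha> t \<noteq> 0)"

text \<open>The two arcs of a loop over parameter sets \<open>U\<close> and \<open>V\<close> intersect transversally.\<close>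

definition arcs_transversal :: "(complex \<Rightarrow> real^2) \<Rightarrow> real set \<Rightarrow> real set \<Rightarrow> bool" where
  "arcs_transversal \<alpha> U V \<longleftrightarrow> (\<forall>u\<in>U. \<forall>v\<in>V. \<alpha> (cis u) = \<alpha> (cis v) \<longrightarrow>
     span {velocity \<alpha> u, velocity \<alpha> v} = UNIV)"

definition clean_loop :: "(complex \<Rightarrow> real^2) \<Rightarrow> bool" where
  "clean_loop \<alpha> \<longleftrightarrow> immersed_loop \<alpha> \<and>
     (\<forall>s t. cis s \<noteq> cis t \<and> \<alpha> (cis s) = \<alpha> (cis t) \<longrightarrow>
        (\<exists>U V. open U \<and> open V \<and> s \<in> U \<and> t \<in> V \<and> arcs_transversal \<alpha> U V))"

definition signed_curvature :: "(complex \<Rightarrow> real^2) \<Rightarrow> real \<Rightarrow> real" where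
  "signed_curvature \<alpha> t =
     (velocity \<alpha> t $ 1 * acceleration \<alpha> t $ 2 - velocity \<alpha> t $ 2 * acceleration \<alpha> t $ 1)
       / norm (velocity \<alpha> t) ^ 3"

definition total_signed_curvature :: "(complex \<Rightarrow> real^2) \<Rightarrow> real" where
  "total_signed_curvature \<alpha> =
     integral {0..2 * pi} (\<lambda>t. signed_curvature \<alpha> t * norm (velocity \<alpha> t))"

definition clean_figure8 :: "(complex \<Rightarrow> real^2) \<Rightarrow> bool" where
  "clean_figure8 \<alpha> \<longleftrightarrow> clean_loop \<alpha> \<and> total_signed_curvature \<alpha> = 0"

text \<open>A subset of a plane \<open>P\<close> in space is a clean figure-8 if it is the image of one under an
  isometric identification of the coordinate plane with \<open>P\<close>; the choice of the identification
  affects the total signed curvature only by a sign.\<close>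

definition clean_figure8_in :: "(real^3) set \<Rightarrow> (real^3) set \<Rightarrow> bool" where
  "clean_figure8_in P X \<longleftrightarrow> (\<exists>(J::real^2 \<Rightarrow> real^3) \<alpha>. (\<forall>x y. dist (J x) (J y) = dist x y) \<and>
     range J = P \<and> clean_figure8 \<alpha> \<and> X = J ` \<alpha> ` sphere 0 1)"

end

theory Submission
 imports Defs "HOL-Library.Real_Mod" "HOL-Analysis.Analysis"
begin

text \<open>
 The proof compares the given cross-cut with cross-cuts by nearby planes. Planes are written as
 \<open>{p. n \<bullet> (p - \<omega>) = 1}\<close>, so that they depend on the vector \<open>n\<close>, and \<open>e\<close> denotes the vector of the given
 plane \<open>P\<close>.

 A centrally symmetric figure-8 passes twice through its centre. Following branches, the reflection lifts to an involution
 of the circle. Since the total signed curvature vanishes, the direction of the velocity has a continuous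
 periodic angle; as the reflection reverses directions, the involution must reverse the orientation of the circle. So it
 has two fixed points, and both are mapped to the centre (\<open>figure8_center_double\<close>). Hence the centre \<open>c\<close> of the given
 cross-cut \<open>\<Gamma>\<close> is a double point of \<open>F\<close>, at which two sheets of the surface cross transversally along a double curve.

 The cross-cut persists for planes close to \<open>P\<close> (\<open>nearby_sections\<close>). Almost every plane is in general position
 (\<open>generic_dense\<close>), so nearby sections are centrally symmetric for a dense set of planes and, by passing to limits, for
 all of them. Their centres stay on both sheets, so each centre is the point where the plane
 crosses the double curve (\<open>centres_are_crossings\<close>). Hence all sections by planes through a point \<open>q\<close> of the double
 curve are symmetric about the same point \<open>q\<close>. These planes sweep out a neighbourhood of the section, so the surface
 itself is symmetric about \<open>q\<close> there. Two such symmetries compose to a translation between parallel sections, and the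
 translations turn out to be linear in the height (\<open>local_translation\<close>). Therefore the surface near \<open>\<Gamma>\<close> is ruled
 by lines in one direction \<open>v\<close> (\<open>local_ruling\<close>).

 Completeness makes it possible to continue the lines: a lift of a bounded line segment is a curve of finite length,
 so it converges at its ends (\<open>complete_line_limit\<close>), and the section through the ends is again a symmetric loop with a
 double point at its centre, from which the ruling extends (\<open>global_ruling\<close>). The union of all lines is open and closed, hence it is the
 whole connected surface (\<open>ruling_surjective\<close>). So the image of \<open>F\<close> consists of the lines in the direction \<open>v\<close> through
 the centrally symmetric set \<open>F ` \<Gamma>\<close>, which is a central cylinder.

 The only local property of an immersion that most of the argument uses is that short secants are nearly
 orthogonal to a normal vector at one of the points; it is isolated in the locale \<open>immersed_surface\<close>.
\<close>

section \<open>Centrally symmetric figure-8's\<close>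

definition det2 :: "real^2 => real^2 => real" where
 "det2 u v = u $ 1 * v $ 2 - u $ 2 * v $ 1"

lemma det2_minus_swap: "det2 v u = - det2 u v"
 by (simp add: det2_def mult.commute)

lemma det2_continuous [continuous_intros]:
 "continuous_on S f ==> continuous_on S g ==> continuous_on S (%x. det2 (f x) (g x))"
 unfolding det2_def by (intro continuous_intros)

lemma det2_tendsto [tendsto_intros]:
 "(f \<longlongrightarrow> a) H ==> (g \<longlongrightarrow> b) H ==> ((%x. det2 (f x) (g x)) \<longlongrightarrow> det2 a b) H"
 unfolding det2_def by (intro tendsto_intros)

lemma det2_eq_0_iff_multiple:
 assumes "u ~= 0"
 shows "det2 u v = 0 \<longleftrightarrow> (\<exists>k. v = k *\<^sub>R u)"
proof
 assume d: "det2 u v = 0"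
 have n: "u \<bullet> u ~= 0" using assms by simp
 have *: "(u \<bullet> u) *\<^sub>R v = (u \<bullet> v) *\<^sub>R u"
  using d unfolding vec_eq_iff det2_def inner_vec_def
  by (auto simp: sum_2 forall_2 algebra_simps)
 have "v = inverse (u \<bullet> u) *\<^sub>R ((u \<bullet> u) *\<^sub>R v)" using n by simp
 then have "v = (inverse (u \<bullet> u) * (u \<bullet> v)) *\<^sub>R u" unfolding * by simp
 then show "\<exists>k. v = k *\<^sub>R u" by blast
qed (auto simp: det2_def)

lemma span_UNIV_imp_det2:
 assumes "span {u, v :: real^2} = UNIV"
 shows "det2 u v ~= 0"
proof
 assume d: "det2 u v = 0"
 have "dim (span {u, v}) = 2" using assms by simp
 then have 2: "dim {u, v} = 2" by simp
 show False
 proof (cases "u = 0")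
  case True
  then have "dim {u, v} <= 1" using dim_le_card[of "{u,v}" "{v}"] by (auto simp: span_base span_0)
  then show False using 2 by simp
 next
  case False
  then obtain k where "v = k *\<^sub>R u" using d det2_eq_0_iff_multiple by blast
  then have "{u, v} <= span {u}" by (auto simp: span_base span_mul)
  then have "dim {u, v} <= 1" using dim_le_card[of "{u,v}" "{u}"] by auto
  then show False using 2 by simp
 qed
qed

lemma vector_derivative_quotient:
 fixes a :: "real => 'b::real_normed_vector"
 assumes d: "(a has_vector_derivative v) (at s)"
 shows "((%r. (a r - a s) /\<^sub>R (r - s)) \<longlongrightarrow> v) (at s)"
proof (rule Lim_null[THEN iffD2])
 have "(%r. norm ((a r - a s - (r - s) *\<^sub>R v) /\<^sub>R \<bar>r - s\<bar>)) \<midarrow>s\<rightarrow> 0"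
  using d unfolding has_vector_derivative_def has_derivative_at_within
  by (intro tendsto_norm_zero) simp
 moreover have "\<forall>\<^sub>F r in at s. norm ((a r - a s - (r - s) *\<^sub>R v) /\<^sub>R \<bar>r - s\<bar>)
   = norm ((a r - a s) /\<^sub>R (r - s) - v)"
 proof (rule eventually_mono[OF eventually_neq_at_within[of s]])
  fix r assume "r ~= s"
  then have "(a r - a s - (r - s) *\<^sub>R v) = (r - s) *\<^sub>R ((a r - a s) /\<^sub>R (r - s) - v)"
   by (simp add: scaleR_right_diff_distrib)
  then show "norm ((a r - a s - (r - s) *\<^sub>R v) /\<^sub>R \<bar>r - s\<bar>) = norm ((a r - a s) /\<^sub>R (r - s) - v)"
   using \<open>r ~= s\<close> by (simp add: abs_mult)
 qed
 ultimately have "(%r. norm ((a r - a s) /\<^sub>R (r - s) - v)) \<midarrow>s\<rightarrow> 0"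
  by (rule Lim_transform_eventually)
 then show "(%r. (a r - a s) /\<^sub>R (r - s) - v) \<midarrow>s\<rightarrow> 0" by (rule tendsto_norm_zero_cancel)
qed

text \<open>Secants of a regular curve through a fixed point turn towards its tangent there.\<close>

lemma curve_secant_det2:
 fixes a :: "real => real^2"
 assumes d: "(a has_vector_derivative v) (at s)" and v: "v ~= 0" and e: "eps > 0"
 shows "\<forall>\<^sub>F r in nhds s. \<bar>det2 v (a r - a s)\<bar> <= eps * norm (a r - a s)"
proof -
 note lim = vector_derivative_quotient[OF d]
 have "((%r. \<bar>det2 v ((a r - a s) /\<^sub>R (r - s))\<bar> - eps * norm ((a r - a s) /\<^sub>R (r - s)))
   \<longlongrightarrow> \<bar>det2 v v\<bar> - eps * norm v) (at s)"
  by (intro tendsto_intros lim)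
 moreover have "\<bar>det2 v v\<bar> - eps * norm v < 0" using v e by (simp add: det2_def)
 ultimately have "\<forall>\<^sub>F r in at s. \<bar>det2 v ((a r - a s) /\<^sub>R (r - s))\<bar>
   - eps * norm ((a r - a s) /\<^sub>R (r - s)) < 0"
  by (rule order_tendstoD)
 then have "\<forall>\<^sub>F r in at s. \<bar>det2 v (a r - a s)\<bar> <= eps * norm (a r - a s)"
 proof (rule eventually_elim2[OF _ eventually_neq_at_within[of s]])
  fix r assume r: "\<bar>det2 v ((a r - a s) /\<^sub>R (r - s))\<bar> - eps * norm ((a r - a s) /\<^sub>R (r - s)) < 0"
   and rs: "r ~= s"
  have "det2 v ((a r - a s) /\<^sub>R (r - s)) = det2 v (a r - a s) / (r - s)"
   using rs by (simp add: det2_def divide_inverse algebra_simps)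
  moreover have "norm ((a r - a s) /\<^sub>R (r - s)) = norm (a r - a s) / \<bar>r - s\<bar>"
   by (simp add: divide_inverse_commute)
  ultimately have "(\<bar>det2 v (a r - a s)\<bar> - eps * norm (a r - a s)) / \<bar>r - s\<bar> < 0"
   using r by (simp add: diff_divide_distrib)
  then show "\<bar>det2 v (a r - a s)\<bar> <= eps * norm (a r - a s)"
   using rs by (simp add: divide_less_0_iff)
 qed
 then show ?thesis by (auto simp: eventually_at_filter elim: eventually_mono) (auto elim!: eventually_mono simp: det2_def)
qed

lemma Ck_on_2_curve:
 fixes a :: "real => 'b::real_normed_vector"
 assumes "Ck_on 2 UNIV a"
 obtains v w where "!!t. (a has_vector_derivative v t) (at t)"
  "!!t. (v has_vector_derivative w t) (at t)" "continuous_on UNIV w"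
proof -
 have 1: "!!t. a differentiable (at t)"
  and 2: "!!x t. (%t. frechet_derivative a (at t) x) differentiable (at t)"
  and 3: "!!x y. continuous_on UNIV
    (%t. frechet_derivative (%t. frechet_derivative a (at t) x) (at t) y)"
  using assms unfolding numeral_2_eq_2 by auto
 have d: "(f has_vector_derivative frechet_derivative f (at t) 1) (at t)"
  if "f differentiable (at t)" for f :: "real => 'b" and t
  using that frechet_derivative_works vector_derivative_works
  by (metis differentiableI_vector frechet_derivative_eq_vector_derivative scaleR_one)
 show thesis
  by (rule that[OF d[OF 1] d[OF 2] 3])
qed

lemma immersed_loop_derivatives:
 assumes "immersed_loop \<alpha>"
 shows "((%t. \<alpha> (cis t)) has_vector_derivative velocity \<alpha> t) (at t)"
  and "(velocity \<alpha> has_vector_derivative acceleration \<alpha> t) (at t)"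
  and "continuous_on UNIV (acceleration \<alpha>)"
  and "velocity \<alpha> t ~= 0"
proof -
 obtain v w where v: "!!t. ((%t. \<alpha> (cis t)) has_vector_derivative v t) (at t)"
  and w: "!!t. (v has_vector_derivative w t) (at t)" and c: "continuous_on UNIV w"
  using assms Ck_on_2_curve unfolding immersed_loop_def by blast
 have "velocity \<alpha> = v" using v by (auto simp: velocity_def vector_derivative_at)
 moreover have "acceleration \<alpha> = w" using w calculation by (auto simp: acceleration_def vector_derivative_at)
 ultimately show "((%t. \<alpha> (cis t)) has_vector_derivative velocity \<alpha> t) (at t)"
  "(velocity \<alpha> has_vector_derivative acceleration \<alpha> t) (at t)"
  "continuous_on UNIV (acceleration \<alpha>)"
  using v w c by auto
 show "velocity \<alpha> t ~= 0" using assms by (simp add: immersed_loop_def)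
qed

text \<open>If the total signed curvature vanishes, the direction of the velocity has a continuous
 angle on the whole circle, not only on the line that covers it.\<close>

lemma periodic_tangent_angle:
 assumes L: "immersed_loop \<alpha>" and T: "total_signed_curvature \<alpha> = 0"
 obtains th :: "real => real" and u :: complex
 where "continuous_on UNIV th" "!!t. th (t + 2 * pi) = th t" "u ~= 0"
  "!!t. Complex (velocity \<alpha> t $ 1) (velocity \<alpha> t $ 2) = of_real (norm (velocity \<alpha> t)) * u * cis (th t)"
proof -
 note D = immersed_loop_derivatives[OF L]
 let ?v = "velocity \<alpha>" and ?w = "acceleration \<alpha>"
 define \<kappa> where "\<kappa> t = det2 (?v t) (?w t) / (norm (?v t))^2" for t
 have cv: "continuous_on UNIV ?v" using D(2) has_vector_derivative_continuous continuous_at_imp_continuous_on by blast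
 have c\<kappa>: "continuous_on S \<kappa>" for S unfolding \<kappa>_def
  by (intro continuous_intros continuous_on_subset[OF cv] continuous_on_subset[OF D(3)]) (auto simp: D(4))
 have sk: "signed_curvature \<alpha> t * norm (?v t) = \<kappa> t" for t
  using D(4)[of t] by (simp add: signed_curvature_def \<kappa>_def det2_def field_simps power2_eq_square power3_eq_cube)
 have k2: "integral {0..2*pi} \<kappa> = 0" using T sk by (simp add: total_signed_curvature_def)
 \<comment> \<open>an antiderivative of the curvature on the whole line\<close>
 have "\<exists>th. \<forall>t. (th has_real_derivative \<kappa> t) (at t)"
 proof -
  have cf: "!!t. isCont \<kappa> t" using c\<kappa>[of UNIV] by (simp add: continuous_on_eq_continuous_at)
  then obtain g where "!!x::real. -\<infinity> < ereal x ==> ereal x < \<infinity> ==> DERIV g x :> \<kappa> x"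
   using einterval_antiderivative[of "-\<infinity>" "\<infinity>" \<kappa>]
   by (auto simp: has_real_derivative_iff_has_vector_derivative)
  then show ?thesis by auto
 qed
 then obtain th where th: "!!t. (th has_real_derivative \<kappa> t) (at t)" by blast
 have shift: "((%s. g (s + 2*pi)) has_vector_derivative g') (at t)"
  if "(g has_vector_derivative g') (at (t + 2*pi))" for g :: "real => real^2" and g' t
 proof -
  have "((%s. s + 2*pi) has_vector_derivative 1) (at t)"
   by (auto intro!: derivative_eq_intros simp flip: has_real_derivative_iff_has_vector_derivative)
  from vector_diff_chain_at[OF this, of g g'] that show ?thesis by (simp add: o_def)
 qed
 have per: "?v (t + 2*pi) = ?v t" for t
 proof -
  have "((%s. \<alpha> (cis (s + 2*pi))) has_vector_derivative ?v (t + 2*pi)) (at t)"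
   by (rule shift[OF D(1)])
  moreover have "(%s. \<alpha> (cis (s + 2*pi))) = (%s. \<alpha> (cis s))" by (simp add: cis.code)
  ultimately show ?thesis using vector_derivative_unique_at[OF _ D(1)[of t]] by simp
 qed
 have perw: "?w (t + 2*pi) = ?w t" for t
 proof -
  have "((%s. ?v (s + 2*pi)) has_vector_derivative ?w (t + 2*pi)) (at t)"
   by (rule shift[OF D(2)])
  then show ?thesis using vector_derivative_unique_at[OF _ D(2)[of t]] per by simp
 qed
 have "((%t. th (t + 2*pi) - th t) has_real_derivative 0) (at t)" for t
  using DERIV_diff[OF DERIV_shift[THEN iffD1, OF th[of "t+2*pi"]] th[of t]]
  by (simp add: \<kappa>_def per perw)
 then have "th (t + 2*pi) - th t = th (0 + 2*pi) - th 0" for t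
  using DERIV_isconst_all[of "%t. th (t + 2*pi) - th t"] by blast
 moreover have "th (2*pi) - th 0 = 0"
 proof -
  have "(\<kappa> has_integral (th (2*pi) - th 0)) {0..2*pi}"
   using th by (intro fundamental_theorem_of_calculus)
    (auto simp: has_real_derivative_iff_has_vector_derivative intro: has_vector_derivative_at_within)
  then show ?thesis using k2 by (simp add: integral_unique)
 qed
 ultimately have pth: "th (t + 2*pi) = th t" for t by (metis add_0 eq_iff_diff_eq_0)
 define z where "z t = Complex (?v t $ 1) (?v t $ 2)" for t
 have nz: "cmod (z t) = norm (?v t)" for t by (simp add: z_def cmod_def norm_vec_def L2_set_def sum_2)
 have z0: "z t ~= 0" for t using nz[of t] D(4)[of t] by (metis norm_eq_zero)
 define zz where "zz t = Complex (?w t $ 1) (?w t $ 2)" for t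
 have dz: "(z has_vector_derivative zz t) (at t)" for t
 proof -
  have c: "((%t. ?v t $ i) has_real_derivative ?w t $ i) (at t)" for i
   using bounded_linear.has_vector_derivative[OF bounded_linear_vec_nth D(2)]
   by (simp add: has_real_derivative_iff_has_vector_derivative)
  show ?thesis unfolding z_def zz_def
   using has_vector_derivative_complex_iff c by simp
 qed
 \<comment> \<open>the unit tangent, turned back by the angle, is constant\<close>
 define r where "r t = norm (?v t)" for t
 define u where "u t = z t * cis (- th t) / of_real (r t)" for t
 have r0: "r t > 0" for t using D(4)[of t] by (simp add: r_def)
 have dr: "(r has_real_derivative (?v t \<bullet> ?w t) / r t) (at t)" for t
  using has_derivative_compose[OF D(2)[of t, unfolded has_vector_derivative_def] has_derivative_norm[OF D(4)[of t]]]
  unfolding r_def[abs_def] has_field_derivative_def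
  by (rule has_derivative_eq_rhs) (simp add: sgn_div_norm inner_commute divide_inverse_commute mult_ac fun_eq_iff)
 have du: "(u has_vector_derivative 0) (at t)" for t
 proof -
  have c: "((%t. cis (- th t)) has_vector_derivative (- \<kappa> t) *\<^sub>R (\<i> * cis (- th t))) (at t)"
   using has_derivative_cis[OF DERIV_minus[OF th[of t], unfolded has_field_derivative_def]]
   unfolding has_vector_derivative_def by (rule has_derivative_eq_rhs) (simp add: fun_eq_iff)
  have ir: "((%t. inverse (r t)) has_real_derivative - ((?v t \<bullet> ?w t) / r t) / (r t)\<^sup>2) (at t)"
   using DERIV_inverse_fun[OF dr[of t]] r0[of t]
   by (simp add: power2_eq_square field_simps)
  have "(u has_vector_derivative
    inverse (r t) *\<^sub>R (z t * ((- \<kappa> t) *\<^sub>R (\<i> * cis (- th t))) + zz t * cis (- th t))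
    + (- ((?v t \<bullet> ?w t) / r t) / (r t)\<^sup>2) *\<^sub>R (z t * cis (- th t))) (at t)"
   using has_vector_derivative_scaleR[OF ir has_vector_derivative_mult[OF dz c]]
   by (simp add: u_def[abs_def] divide_inverse scaleR_conv_of_real mult_ac)
  moreover have "inverse (r t) *\<^sub>R (z t * ((- \<kappa> t) *\<^sub>R (\<i> * cis (- th t))) + zz t * cis (- th t))
    + (- ((?v t \<bullet> ?w t) / r t) / (r t)\<^sup>2) *\<^sub>R (z t * cis (- th t)) = 0"
  proof -
   have rr: "(r t)\<^sup>2 = (?v t $ 1)\<^sup>2 + (?v t $ 2)\<^sup>2"
    by (simp add: r_def norm_vec_def L2_set_def sum_2 real_sqrt_pow2)
   have "(r t)\<^sup>2 *\<^sub>R (z t * ((- \<kappa> t) *\<^sub>R \<i>) + zz t) = (?v t \<bullet> ?w t) *\<^sub>R z t"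
   proof -
    have rk: "(r t)\<^sup>2 * \<kappa> t = det2 (?v t) (?w t)"
     using r0[of t] by (simp add: \<kappa>_def r_def[symmetric])
    have "(r t)\<^sup>2 * (\<kappa> t * ?v t $ 2 + ?w t $ 1) = (?v t \<bullet> ?w t) * ?v t $ 1"
     unfolding distrib_left mult.assoc[symmetric] rk unfolding rr
     by (simp add: det2_def inner_vec_def sum_2 algebra_simps power2_eq_square)
    moreover have "(r t)\<^sup>2 * (- \<kappa> t * ?v t $ 1 + ?w t $ 2) = (?v t \<bullet> ?w t) * ?v t $ 2"
     unfolding distrib_left mult.assoc[symmetric] mult_minus_left mult_minus_right rk unfolding rr
     by (simp add: det2_def inner_vec_def sum_2 algebra_simps power2_eq_square)
    ultimately show ?thesis by (simp add: complex_eq_iff z_def zz_def add.commute)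
   qed
   then have *: "z t * ((- \<kappa> t) *\<^sub>R \<i>) + zz t = ((?v t \<bullet> ?w t) / (r t)\<^sup>2) *\<^sub>R z t"
    using r0[of t] by (metis (no_types) divide_inverse_commute less_numeral_extra(3)
     power_not_zero real_vector.scale_scale scaleR_one left_inverse)
   have "z t * ((- \<kappa> t) *\<^sub>R (\<i> * cis (- th t))) + zz t * cis (- th t)
     = (z t * ((- \<kappa> t) *\<^sub>R \<i>) + zz t) * cis (- th t)" by (simp add: algebra_simps)
   also have "\<dots> = ((?v t \<bullet> ?w t) / (r t)\<^sup>2) *\<^sub>R (z t * cis (- th t))" unfolding * by simp
   finally show ?thesis by (simp add: divide_inverse mult_ac flip: scaleR_left_distrib)
  qed
  ultimately show ?thesis by simp
 qed
 have cu: "u t = u 0" for t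
  using has_vector_derivative_zero_constant[of UNIV u] du by (metis UNIV_I convex_UNIV has_vector_derivative_at_within)
 have "z t = of_real (norm (?v t)) * u 0 * cis (th t)" for t
  unfolding cu[of t, symmetric] using r0[of t]
  by (simp add: u_def r_def[symmetric] mult.assoc cis_mult)
 moreover have "u 0 ~= 0" using z0[of 0] r0[of 0] by (simp add: u_def)
 moreover have "continuous_on UNIV th" using th DERIV_isCont continuous_at_imp_continuous_on by blast
 ultimately show thesis using that pth unfolding z_def by metis
qed

text \<open>On an interval the maximum can only be attained at the left end, since just before any other point the function takes larger
 values.\<close>

lemma continuous_locally_decreasing_imp_less:
 fixes f :: "real => real"
 assumes c: "continuous_on UNIV f"
  and l: "!!t. \<exists>dl>0. \<forall>h>0. h < dl --> f (t - h) > f t"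
  and "x < y"
 shows "f y < f x"
proof -
 have no: "\<exists>t\<in>{x..y}. f t > f m" if m: "m \<in> {x<..y}" for m
 proof -
  obtain dl where "dl > 0" and dl: "!!h. h > 0 ==> h < dl ==> f (m - h) > f m" using l by blast
  let ?h = "min (dl / 2) (m - x)"
  have "m - ?h \<in> {x..y}" "f (m - ?h) > f m" using m \<open>dl > 0\<close> by (auto intro!: dl)
  then show ?thesis by blast
 qed
 obtain m where m: "m \<in> {x..y}" "!!t. t \<in> {x..y} ==> f t <= f m"
  using continuous_attains_sup[of "{x..y}" f] continuous_on_subset[OF c] \<open>x < y\<close> by auto
 then have "m = x" using no[of m] by (force simp: not_le)
 moreover have "\<not> (\<forall>t\<in>{x..y}. f t <= f y)" using no[of y] \<open>x < y\<close> by force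
 ultimately show ?thesis using m(2)[of y] m \<open>x < y\<close> by (metis atLeastAtMost_iff le_less less_imp_le order_trans)
qed

text \<open>In a clean loop the tangent direction selects one of the branches through a point.
 Following branches lifts the reflection of the image to an involution of the circle, here to a
 map \<open>\<sigma>\<close> of its universal cover. A continuous angle of the velocity on the circle can only be
 preserved by the involution. So \<open>\<sigma>\<close> preserves the direction of the velocity, while the reflection
 reverses it: \<open>\<sigma>\<close> is decreasing, and an orientation reversing involution of the circle has two fixed
 points. These are mapped to the centre.\<close>

lemma figure8_center_double:
 assumes f8: "clean_figure8 \<alpha>"
  and sym: "!!z. z \<in> \<alpha> ` sphere 0 1 ==> 2 *\<^sub>R c - z \<in> \<alpha> ` sphere 0 1"
 obtains s t where "\<alpha> (cis s) = c" "\<alpha> (cis t) = c" "det2 (velocity \<alpha> s) (velocity \<alpha> t) ~= 0"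
proof -
 have L: "immersed_loop \<alpha>" and cl: "clean_loop \<alpha>" and T: "total_signed_curvature \<alpha> = 0"
  using f8 by (auto simp: clean_figure8_def clean_loop_def)
 note D = immersed_loop_derivatives[OF L]
 define a where "a t = \<alpha> (cis t)" for t
 define v where "v = velocity \<alpha>"
 have da: "(a has_vector_derivative v t) (at t)" for t using D(1) by (simp add: a_def[abs_def] v_def)
 have v0: "v t ~= 0" for t using D(4) by (simp add: v_def)
 have ca: "continuous_on UNIV a" using da has_vector_derivative_continuous continuous_at_imp_continuous_on by blast
 have cv: "continuous_on UNIV v" unfolding v_def
  using D(2) has_vector_derivative_continuous continuous_at_imp_continuous_on by blast
 have vper: "v s = v t" "a s = a t" if "cis s = cis t" for s t
 proof -
  have "cis (s + h) = cis (t + h)" for h using that by (simp flip: cis_mult)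
  then have sh: "(%h. a (s + h)) = (%h. a (t + h))" by (simp add: a_def)
  have *: "((%h. a (r + h)) has_vector_derivative v r) (at 0)" for r
  proof -
   have "((%h. r + h) has_vector_derivative 1) (at 0)"
    by (auto intro!: derivative_eq_intros simp flip: has_real_derivative_iff_has_vector_derivative)
   from vector_diff_chain_at[OF this, of a "v r"] da[of r] show ?thesis by (simp add: o_def)
  qed
  show "v s = v t" using vector_derivative_unique_at *[of s] *[of t] sh by metis
  show "a s = a t" using that by (simp add: a_def)
 qed
 have clean: "det2 (v s) (v t) ~= 0" if "cis s ~= cis t" "a s = a t" for s t
  using cl that span_UNIV_imp_det2 unfolding clean_loop_def arcs_transversal_def a_def v_def by metis
 have norm1: "\<exists>s. s \<in> {0..2*pi} & z = cis s" if "norm z = 1" for z :: complex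
 proof -
  obtain t where "0 <= t" "t < 2 * pi" "z = Complex (cos t) (sin t)" using complex_unimodular_polar[OF \<open>norm z = 1\<close>] by blast
  then show ?thesis by (intro exI[of _ t]) (auto simp: cis.code)
 qed
 have pre: "\<exists>s\<in>{0..2*pi}. a s = 2 *\<^sub>R c - a t" for t
 proof -
  have "2 *\<^sub>R c - a t \<in> \<alpha> ` sphere 0 1" by (rule sym) (auto simp: a_def)
  then obtain z where "norm z = 1" "\<alpha> z = 2 *\<^sub>R c - a t" by auto
  then show ?thesis using norm1[of z] by (auto simp: a_def)
 qed
 define R where "R t s \<longleftrightarrow> a s = 2 *\<^sub>R c - a t & det2 (v s) (v t) = 0" for t s
 \<comment> \<open>the branch is found as a limit of reflected points: secants through both ends converge
  to the tangents\<close>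
 have ex: "\<exists>s\<in>{0..2*pi}. R t s" for t
 proof -
  define \<tau> where "\<tau> n = t + inverse (real (Suc n))" for n
  have \<tau>: "\<tau> \<longlonglongrightarrow> t" unfolding \<tau>_def using LIMSEQ_inverse_real_of_nat_add[of t] by simp
  have "\<forall>n. \<exists>s\<in>{0..2*pi}. a s = 2 *\<^sub>R c - a (\<tau> n)" using pre by blast
  then obtain s where s: "!!n. s n \<in> {0..2*pi}" "!!n. a (s n) = 2 *\<^sub>R c - a (\<tau> n)" by metis
  obtain l ph where l: "l \<in> {0..2*pi}" "strict_mono ph" "(s \<circ> ph) \<longlonglongrightarrow> l"
   using compact_Icc[of 0 "2*pi"] s(1) unfolding compact_def by metis
  have \<tau>': "(\<tau> \<circ> ph) \<longlonglongrightarrow> t" using LIMSEQ_subseq_LIMSEQ[OF \<tau> l(2)] .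
  have iso: "isCont a x" for x using ca by (simp add: continuous_on_eq_continuous_at)
  have 1: "a l = 2 *\<^sub>R c - a t"
  proof (rule LIMSEQ_unique)
   show "(%n. a ((s \<circ> ph) n)) \<longlonglongrightarrow> a l" by (rule isCont_tendsto_compose[OF iso l(3)])
   have "(%n. 2 *\<^sub>R c - a ((\<tau> \<circ> ph) n)) \<longlonglongrightarrow> 2 *\<^sub>R c - a t"
    by (intro tendsto_intros isCont_tendsto_compose[OF iso \<tau>'])
   then show "(%n. a ((s \<circ> ph) n)) \<longlonglongrightarrow> 2 *\<^sub>R c - a t" by (simp add: s(2))
  qed
  have "\<bar>det2 (v l) (v t)\<bar> <= eps * norm (v t)" if e: "eps > 0" for eps
  proof -
   have "\<forall>\<^sub>F n in sequentially. \<bar>det2 (v l) (a ((s \<circ> ph) n) - a l)\<bar> <= eps * norm (a ((s \<circ> ph) n) - a l)"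
    using curve_secant_det2[OF da v0 e, of l] l(3) filterlim_iff by blast
   note sec = this
   have eq: "a ((s \<circ> ph) n) - a l = - (a ((\<tau> \<circ> ph) n) - a t)" for n using 1 s(2) by simp
   have ev: "\<forall>\<^sub>F n in sequentially. \<bar>det2 (v l) (a ((\<tau> \<circ> ph) n) - a t)\<bar>
     <= eps * norm (a ((\<tau> \<circ> ph) n) - a t)"
   proof (rule eventually_mono[OF sec])
    fix n assume h: "\<bar>det2 (v l) (a ((s \<circ> ph) n) - a l)\<bar> <= eps * norm (a ((s \<circ> ph) n) - a l)"
    have m: "det2 x (- y) = - det2 x y" for x y by (simp add: det2_def)
    show "\<bar>det2 (v l) (a ((\<tau> \<circ> ph) n) - a t)\<bar> <= eps * norm (a ((\<tau> \<circ> ph) n) - a t)"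
     using h unfolding eq m norm_minus_cancel by simp
   qed
   have lim: "((%r. (a r - a t) /\<^sub>R (r - t)) \<longlongrightarrow> v t) (at t)"
    by (rule vector_derivative_quotient[OF da])
   have "filterlim (\<tau> \<circ> ph) (at t) sequentially"
    unfolding filterlim_at using \<tau>' by (auto simp: \<tau>_def)
   then have q: "(%n. (a ((\<tau> \<circ> ph) n) - a t) /\<^sub>R ((\<tau> \<circ> ph) n - t)) \<longlonglongrightarrow> v t"
    by (rule filterlim_compose[OF lim])
   show ?thesis
   proof (rule tendsto_le)
    show "(%n. \<bar>det2 (v l) ((a ((\<tau> \<circ> ph) n) - a t) /\<^sub>R ((\<tau> \<circ> ph) n - t))\<bar>) \<longlonglongrightarrow> \<bar>det2 (v l) (v t)\<bar>"
     by (intro tendsto_intros q)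
    show "(%n. eps * norm ((a ((\<tau> \<circ> ph) n) - a t) /\<^sub>R ((\<tau> \<circ> ph) n - t))) \<longlonglongrightarrow> eps * norm (v t)"
     by (intro tendsto_intros q)
    show "\<forall>\<^sub>F n in sequentially. \<bar>det2 (v l) ((a ((\<tau> \<circ> ph) n) - a t) /\<^sub>R ((\<tau> \<circ> ph) n - t))\<bar>
      <= eps * norm ((a ((\<tau> \<circ> ph) n) - a t) /\<^sub>R ((\<tau> \<circ> ph) n - t))"
    proof (rule eventually_mono[OF ev])
     fix n assume n: "\<bar>det2 (v l) (a ((\<tau> \<circ> ph) n) - a t)\<bar> <= eps * norm (a ((\<tau> \<circ> ph) n) - a t)"
     let ?i = "inverse ((\<tau> \<circ> ph) n - t)" and ?w = "a ((\<tau> \<circ> ph) n) - a t"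
     have "det2 (v l) (?i *\<^sub>R ?w) = ?i * det2 (v l) ?w" by (simp add: det2_def algebra_simps)
     then have "\<bar>det2 (v l) (?i *\<^sub>R ?w)\<bar> = \<bar>?i\<bar> * \<bar>det2 (v l) ?w\<bar>" by (simp add: abs_mult)
     also have "\<dots> <= \<bar>?i\<bar> * (eps * norm ?w)" by (rule mult_left_mono[OF n]) simp
     finally show "\<bar>det2 (v l) (?i *\<^sub>R ?w)\<bar> <= eps * norm (?i *\<^sub>R ?w)" by (simp add: mult_ac)
    qed
   qed simp
  qed
  then have "\<bar>det2 (v l) (v t)\<bar> <= 0"
   using field_le_epsilon[of "\<bar>det2 (v l) (v t)\<bar>" 0] v0[of t]
   by (metis add_0 divide_pos_pos nonzero_eq_divide_eq norm_eq_zero zero_less_norm_iff)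
  then show ?thesis using 1 l(1) by (auto simp: R_def)
 qed
 have uniq: "cis r = cis s" if Rrs: "R t r" "R t s" for t r s
 proof (rule ccontr)
  assume "cis r ~= cis s"
  then have "det2 (v r) (v s) ~= 0" using clean that by (auto simp: R_def)
  moreover obtain k m where "v r = k *\<^sub>R v t" "v s = m *\<^sub>R v t"
  proof -
   have "det2 (v t) (v r) = 0" "det2 (v t) (v s) = 0" using Rrs det2_minus_swap[of "v t"] by (auto simp: R_def)
   then show thesis using that det2_eq_0_iff_multiple[OF v0] by blast
  qed
  ultimately show False by (simp add: det2_def)
 qed
 have Rper: "R t' s'" if "R t s" "cis t = cis t'" "cis s = cis s'" for t t' s s'
  using that(1) vper[OF that(2)] vper[OF that(3)] unfolding R_def by simp
 obtain \<zeta> where \<zeta>: "!!t. \<zeta> t \<in> {0..2*pi}" "!!t. R t (\<zeta> t)" using ex by metis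
 have cz: "continuous_on UNIV (%t. cis (\<zeta> t))"
 proof -
  have "closed ((%t. (t, cis (\<zeta> t))) ` UNIV)"
  proof (clarsimp simp: closed_sequential_limits)
   fix x l m assume x: "\<forall>n. x n \<in> range (%t. (t, cis (\<zeta> t)))" and lim: "x \<longlonglongrightarrow> (l, m)"
   define t where "t n = fst (x n)" for n
   have xn: "x n = (t n, cis (\<zeta> (t n)))" for n using x by (auto simp: t_def image_iff dest!: spec[of _ n])
   have tl: "t \<longlonglongrightarrow> l" using tendsto_fst[OF lim] by (simp add: t_def[abs_def])
   have ml: "(%n. cis (\<zeta> (t n))) \<longlonglongrightarrow> m" using tendsto_snd[OF lim] xn by simp
   obtain s ph where s: "s \<in> {0..2*pi}" "strict_mono ph" "((%n. \<zeta> (t n)) \<circ> ph) \<longlonglongrightarrow> s"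
    using compact_Icc[of 0 "2*pi"] \<zeta>(1) unfolding compact_def by metis
   have tl': "(t \<circ> ph) \<longlonglongrightarrow> l" using LIMSEQ_subseq_LIMSEQ[OF tl s(2)] .
   have ia: "isCont a r" and iv: "isCont v r" for r
    using ca cv by (auto simp: continuous_on_eq_continuous_at)
   have "m = cis s"
   proof (rule LIMSEQ_unique)
    show "(%n. cis (((%n. \<zeta> (t n)) \<circ> ph) n)) \<longlonglongrightarrow> cis s" by (intro tendsto_intros s(3))
    show "(%n. cis (((%n. \<zeta> (t n)) \<circ> ph) n)) \<longlonglongrightarrow> m" using LIMSEQ_subseq_LIMSEQ[OF ml s(2)] by (simp add: o_def)
   qed
   moreover have "R l s" unfolding R_def
   proof
    show "a s = 2 *\<^sub>R c - a l"
    proof (rule LIMSEQ_unique)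
     show "(%n. a (((%n. \<zeta> (t n)) \<circ> ph) n)) \<longlonglongrightarrow> a s" by (rule isCont_tendsto_compose[OF ia s(3)])
     have "(%n. 2 *\<^sub>R c - a ((t \<circ> ph) n)) \<longlonglongrightarrow> 2 *\<^sub>R c - a l"
      by (intro tendsto_intros isCont_tendsto_compose[OF ia tl'])
     then show "(%n. a (((%n. \<zeta> (t n)) \<circ> ph) n)) \<longlonglongrightarrow> 2 *\<^sub>R c - a l" using \<zeta>(2) by (simp add: R_def)
    qed
    have "(%n. det2 (v (((%n. \<zeta> (t n)) \<circ> ph) n)) (v ((t \<circ> ph) n))) \<longlonglongrightarrow> det2 (v s) (v l)"
     by (intro tendsto_intros isCont_tendsto_compose[OF iv s(3)] isCont_tendsto_compose[OF iv tl'])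
    then show "det2 (v s) (v l) = 0" using \<zeta>(2) by (simp add: R_def LIMSEQ_const_iff)
   qed
   ultimately have "m = cis (\<zeta> l)" using uniq[OF _ \<zeta>(2)] by simp
   then show "(l, m) \<in> range (%t. (t, cis (\<zeta> t)))" by auto
  qed
  then show ?thesis
   using continuous_closed_graph_eq[of "sphere 0 1" "%t. cis (\<zeta> t)" UNIV]
   by (auto intro: closed_subset simp: closedin_closed_eq closed_Times)
 qed
 obtain g where g: "continuous_on UNIV g" "!!t. cis (\<zeta> t) = exp (g t)"
  using continuous_logarithm_on_contractible[OF cz] by auto
 define \<sigma> where "\<sigma> t = Im (g t)" for t
 have c\<sigma>: "continuous_on UNIV \<sigma>" unfolding \<sigma>_def by (intro continuous_intros g)
 have cis\<sigma>: "cis (\<sigma> t) = cis (\<zeta> t)" for t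
 proof -
  have "norm (exp (g t)) = 1" using g(2)[of t] by (metis norm_cis)
  then have "Re (g t) = 0" by (simp add: norm_exp_eq_Re)
  then have "exp (g t) = cis (\<sigma> t)" by (simp add: exp_eq_polar \<sigma>_def)
  then show ?thesis using g(2)[of t] by simp
 qed
 have R\<sigma>: "R t (\<sigma> t)" for t by (rule Rper[OF \<zeta>(2)[of t]]) (auto simp: cis\<sigma>)
 have invol: "cis (\<sigma> (\<sigma> t)) = cis t" for t
 proof -
  have "R (\<sigma> t) t" using R\<sigma>[of t] det2_minus_swap[of "v t"] by (auto simp: R_def)
  then show ?thesis using uniq R\<sigma> by blast
 qed
 have \<sigma>per: "cis (\<sigma> (2*pi)) = cis (\<sigma> 0)"
  using uniq[OF R\<sigma>[of 0] Rper[OF R\<sigma>[of "2*pi"]], of "\<sigma> (2*pi)"] by simp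
 obtain th and u :: complex where th: "continuous_on UNIV th" "!!t. th (t + 2 * pi) = th t" "u ~= 0"
  and ang: "!!t. Complex (v t $ 1) (v t $ 2) = of_real (norm (v t)) * u * cis (th t)"
  using periodic_tangent_angle[OF L T] unfolding v_def by metis
 have thcis: "th s = th t" if st: "cis s = cis t" for s t
 proof -
  have nat: "th (t + of_nat n * (2 * pi)) = th t" for n t
  proof (induction n)
   case (Suc n)
   have "t + of_nat (Suc n) * (2*pi) = (t + of_nat n * (2*pi)) + 2*pi" by (simp add: algebra_simps)
   then show ?case using th(2) Suc by metis
  qed simp
  obtain n :: int where n: "s = t + of_int n * (2*pi)"
  proof -
   have "cis (s - t) = 1" using st by (simp flip: cis_divide)
   then show thesis using that cis_eq_1_iff by (metis add.commute diff_add_cancel)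
  qed
  show ?thesis
  proof (cases "n \<ge> 0")
   case True then show ?thesis using nat[of t "nat n"] n by simp
  next
   case False
   then have "t = s + of_nat (nat (-n)) * (2*pi)" using n by (simp add: algebra_simps)
   then show ?thesis using nat[of s "nat (-n)"] by simp
  qed
 qed
 define q where "q t = (th (\<sigma> t) - th t) / pi" for t
 have par: "\<exists>k::int. q t = of_int k" for t
 proof -
  obtain m where m: "v (\<sigma> t) = m *\<^sub>R v t"
   using R\<sigma>[of t] det2_eq_0_iff_multiple[OF v0[of t], of "v (\<sigma> t)"] det2_minus_swap[of "v t"] by (auto simp: R_def)
  have "of_real (norm (v (\<sigma> t))) * u * cis (th (\<sigma> t)) = of_real m * (of_real (norm (v t)) * u * cis (th t))"
   unfolding ang[symmetric] by (simp add: m complex_eq_iff)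
  then have "of_real (norm (v (\<sigma> t))) * cis (th (\<sigma> t)) = of_real (m * norm (v t)) * cis (th t)"
   using th(3) by (simp add: mult_ac)
  then have "of_real (norm (v (\<sigma> t))) * cis (th (\<sigma> t)) * cis (- th t) = of_real (m * norm (v t)) * cis (th t) * cis (- th t)"
   by simp
  then have "of_real (norm (v (\<sigma> t))) * cis (th (\<sigma> t) - th t) = of_real (m * norm (v t))"
   by (simp add: mult.assoc cis_mult)
  then have "Im (of_real (norm (v (\<sigma> t))) * cis (th (\<sigma> t) - th t)) = 0" by simp
  then have "sin (th (\<sigma> t) - th t) = 0" using v0[of "\<sigma> t"] by simp
  then show ?thesis unfolding sin_zero_iff_int2 q_def by auto
 qed
 have cq: "continuous_on UNIV q" unfolding q_def
  by (intro continuous_intros th(1) continuous_on_compose2[OF th(1) c\<sigma>]) auto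
 have "q constant_on UNIV"
 proof (rule continuous_discrete_range_constant[OF connected_UNIV cq])
  fix x :: real
  have "1 <= norm (q y - q x)" if ne: "q y ~= q x" for y
  proof -
   obtain k j :: int where kj: "q y = of_int k" "q x = of_int j" using par by metis
   then have "k ~= j" using ne by auto
   then have "1 <= \<bar>k - j\<bar>" by linarith
   then have "(1::real) <= \<bar>of_int (k - j)\<bar>" by linarith
   then show ?thesis using kj by simp
  qed
  then show "\<exists>e>0. \<forall>y. y \<in> UNIV & q y ~= q x --> e <= norm (q y - q x)" by (intro exI[of _ 1]) auto
 qed
 then obtain q0 where q0: "!!t. q t = q0" by (auto simp: constant_on_def)
 \<comment> \<open>the involution changes the angle by a constant and hence, as it is an involution, by \<open>0\<close>\<close>
 have "q 0 + q (\<sigma> 0) = 0" unfolding q_def using thcis[OF invol[of 0]] by (simp flip: add_divide_distrib)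
 then have "q0 = 0" using q0 by simp
 then have same: "th (\<sigma> t) = th t" for t using q0[of t] by (simp add: q_def)
 have pos: "v (\<sigma> t) = (norm (v (\<sigma> t)) / norm (v t)) *\<^sub>R v t" for t
 proof -
  have "Complex (v (\<sigma> t) $ 1) (v (\<sigma> t) $ 2) = of_real (norm (v (\<sigma> t)) / norm (v t)) * Complex (v t $ 1) (v t $ 2)"
   unfolding ang[of "\<sigma> t"] ang[of t] same using v0[of t] by simp
  then show ?thesis by (simp add: complex_eq_iff vec_eq_iff forall_2)
 qed
 have "\<exists>dl>0. \<forall>h>0. h < dl --> \<sigma> (t - h) > \<sigma> t" for t
 proof -
  let ?k = "norm (v (\<sigma> t)) / norm (v t)"
  have k: "?k > 0" using v0 by simp
  define f where "f s = v t \<bullet> a s" for s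
  have df: "(f has_real_derivative v t \<bullet> v s) (at s)" for s
   unfolding f_def[abs_def] has_real_derivative_iff_has_vector_derivative
   using bounded_linear.has_vector_derivative[OF bounded_linear_inner_right da] .
  have "v t \<bullet> v (\<sigma> t) = ?k * (v t \<bullet> v t)" by (subst pos) simp
  moreover have "0 < ?k * (v t \<bullet> v t)" using k v0[of t] by (intro mult_pos_pos) auto
  ultimately have "v t \<bullet> v (\<sigma> t) > 0" by linarith
  from DERIV_pos_inc_left[OF df this] obtain d1 where d1: "d1 > 0" "!!h. 0 < h ==> h < d1 ==> f (\<sigma> t - h) < f (\<sigma> t)" by blast
  have "v t \<bullet> v t > 0" using v0[of t] by simp
  from DERIV_pos_inc_left[OF df this] obtain d2 where d2: "d2 > 0" "!!h. 0 < h ==> h < d2 ==> f (t - h) < f t" by blast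
  have "isCont \<sigma> t" using c\<sigma> by (simp add: continuous_on_eq_continuous_at)
  then obtain d3 where d3: "d3 > 0" "!!s. \<bar>s - t\<bar> < d3 ==> \<bar>\<sigma> s - \<sigma> t\<bar> < d1"
   unfolding continuous_at_eps_delta dist_real_def using d1(1) by metis
  have "\<sigma> (t - h) > \<sigma> t" if h: "0 < h" "h < min d2 d3" for h
  proof (rule ccontr)
   assume n: "\<not> \<sigma> (t - h) > \<sigma> t"
   have s: "f (\<sigma> s) = 2 * (v t \<bullet> c) - f s" for s
    using R\<sigma>[of s] by (simp add: f_def R_def inner_diff_right)
   have "f (\<sigma> (t - h)) > f (\<sigma> t)" unfolding s using d2(2)[of h] h by simp
   moreover have "f (\<sigma> (t - h)) <= f (\<sigma> t)"
    using d1(2)[of "\<sigma> t - \<sigma> (t - h)"] d3(2)[of "t - h"] n h by (cases "\<sigma> (t - h) = \<sigma> t") auto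
   ultimately show False by simp
  qed
  then show ?thesis using d2(1) d3(1) by (intro exI[of _ "min d2 d3"]) auto
 qed
 then have dec: "\<sigma> y < \<sigma> x" if "x < y" for x y
  using continuous_locally_decreasing_imp_less[OF c\<sigma>] that by blast
 define h where "h t = \<sigma> t - t" for t
 have ch: "continuous_on S h" for S unfolding h_def by (intro continuous_intros continuous_on_subset[OF c\<sigma>]) auto
 have hdec: "h y < h x" if "x < y" for x y using dec[OF that] that by (simp add: h_def)
 have h2: "h (2*pi) <= h 0 - 4*pi"
 proof -
  have "cis (\<sigma> (2*pi) - \<sigma> 0) = 1" using \<sigma>per by (simp flip: cis_divide)
  then obtain n :: int where n: "\<sigma> (2*pi) - \<sigma> 0 = of_int n * (2*pi)" using cis_eq_1_iff by blast
  moreover have "\<sigma> (2*pi) < \<sigma> 0" using dec by simp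
  ultimately have "of_int n * (2*pi) < 0" by linarith
  then have "n < 0" using pi_gt_zero by (auto simp: mult_less_0_iff)
  then have "of_int n <= (-1::real)" by linarith
  then have "of_int n * (2*pi) <= -1 * (2*pi)" by (intro mult_right_mono) auto
  then show ?thesis unfolding h_def using n by linarith
 qed
 define k where "k = \<lfloor>h 0 / (2*pi)\<rfloor>"
 have k1: "of_int k * (2*pi) <= h 0" unfolding k_def
  using pi_gt_zero by (metis of_int_floor_le pos_le_divide_eq mult_2 add_pos_pos)
 have k2: "of_int (k - 1) * (2*pi) > h 0 - 4 * pi"
 proof -
  have "h 0 / (2*pi) < of_int k + 1" unfolding k_def by linarith
  then have "h 0 < (of_int k + 1) * (2*pi)" using pi_gt_zero by (simp add: pos_divide_less_eq)
  then show ?thesis by (simp add: algebra_simps)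
 qed
 have k3: "of_int (k - 1) * (2*pi) < of_int k * (2*pi)" by simp
 have "\<exists>t\<ge>0. t <= 2*pi & h t = of_int k * (2*pi)"
  by (rule IVT2'[OF _ k1 _ ch]) (use k2 k3 h2 pi_ge_zero in linarith)+
 then obtain t1 where t1: "0 <= t1" "t1 <= 2*pi" "h t1 = of_int k * (2*pi)" by blast
 have "\<exists>t\<ge>0. t <= 2*pi & h t = of_int (k - 1) * (2*pi)"
  by (rule IVT2'[OF _ _ _ ch]) (use k1 k2 k3 h2 pi_ge_zero in linarith)+
 then obtain t2 where t2: "0 <= t2" "t2 <= 2*pi" "h t2 = of_int (k - 1) * (2*pi)" by blast
 have "t2 ~= 2*pi" using t2 k2 h2 by auto
 have "t1 < t2"
 proof (rule ccontr)
  assume "\<not> t1 < t2"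
  then have "h t1 <= h t2" using hdec[of t2 t1] by (cases "t1 = t2") auto
  then show False using t1(3) t2(3) k3 by linarith
 qed
 have "cis t1 ~= cis t2"
 proof
  assume "cis t1 = cis t2"
  then have "cis (t2 - t1) = 1" by (simp flip: cis_divide)
  then obtain n :: int where n: "t2 - t1 = of_int n * (2*pi)" using cis_eq_1_iff by blast
  have pos: "of_int n * (2*pi) > 0" and less: "of_int n * (2*pi) < 2*pi"
   using n \<open>t1 < t2\<close> \<open>t2 ~= 2*pi\<close> t1(1,2) t2(1,2) by linarith+
  have "n > 0" using pos pi_gt_zero by (auto simp: zero_less_mult_iff)
  then have "1 * (2*pi) <= of_int n * (2*pi)" by (intro mult_right_mono) auto
  then show False using less by simp
 qed
 moreover have fixpt: "a t = c" if "h t = of_int j * (2*pi)" for t and j :: int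
 proof -
  have "cis (\<sigma> t - t) = 1" using that cis_eq_1_iff by (auto simp: h_def)
  then have "cis (\<sigma> t) = cis t" by (simp flip: cis_divide)
  then have "a (\<sigma> t) = a t" by (rule vper)
  then have "2 *\<^sub>R a t = 2 *\<^sub>R c" using R\<sigma>[of t] by (simp add: R_def scaleR_2 algebra_simps)
  then show ?thesis by simp
 qed
 ultimately have "det2 (v t1) (v t2) ~= 0" using clean[of t1 t2] fixpt[OF t1(3)] fixpt[OF t2(3)] by simp
 then show thesis using that[of t1 t2] fixpt[OF t1(3)] fixpt[OF t2(3)] by (simp add: a_def v_def)
qed

section \<open>Surfaces with secant control\<close>

definition indep3 :: "real^3 => real^3 => real^3 => bool" where
 "indep3 a b c \<longleftrightarrow> (\<forall>w. a \<bullet> w = 0 & b \<bullet> w = 0 & c \<bullet> w = 0 --> w = 0)"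

lemma indep3_coercive:
 assumes "indep3 a b c"
 obtains B where "B > 0" "!!w. B * norm w <= \<bar>a \<bullet> w\<bar> + \<bar>b \<bullet> w\<bar> + \<bar>c \<bullet> w\<bar>"
proof -
 let ?f = "%w. (a \<bullet> w, b \<bullet> w, c \<bullet> w)"
 have l: "linear ?f" by (auto intro!: linearI simp: inner_add_right)
 have "inj ?f" unfolding linear_injective_0[OF l] using assms by (auto simp: indep3_def zero_prod_def)
 then obtain B where B: "B > 0" "!!w. B * norm w <= norm (?f w)"
  using linear_inj_bounded_below_pos[OF l] by metis
 have "norm (?f w) <= \<bar>a \<bullet> w\<bar> + \<bar>b \<bullet> w\<bar> + \<bar>c \<bullet> w\<bar>" for w
  using norm_Pair_le[of "a \<bullet> w" "(b \<bullet> w, c \<bullet> w)"] norm_Pair_le[of "b \<bullet> w" "c \<bullet> w"] by simp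
 then show thesis using that B order_trans by blast
qed

lemma indep3_cross:
 assumes "cross3 n e ~= 0"
 shows "indep3 (cross3 n e) e n"
 unfolding indep3_def
proof safe
 fix w assume w: "cross3 n e \<bullet> w = 0" "e \<bullet> w = 0" "n \<bullet> w = 0"
 have "cross3 w (cross3 n e) = 0" unfolding Lagrange using w by (simp add: inner_commute)
 then show "w = 0" using norm_and_cross_eq_0[of w "cross3 n e"] w assms by (simp add: inner_commute)
qed

text \<open>A triple is robustly independent: a vector that is nearly orthogonal to all three
 vanishes.\<close>

lemma indep3_nearly_orthogonal:
 assumes "indep3 a b c"
 obtains eps where "eps > 0"
  "!!w. \<bar>a \<bullet> w\<bar> <= eps * norm w ==> \<bar>b \<bullet> w\<bar> <= eps * norm w ==> \<bar>c \<bullet> w\<bar> <= eps * norm w ==> w = 0"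
proof -
 obtain B where B: "B > 0" "!!w. B * norm w <= \<bar>a \<bullet> w\<bar> + \<bar>b \<bullet> w\<bar> + \<bar>c \<bullet> w\<bar>"
  using indep3_coercive[OF assms] by metis
 show thesis
 proof (rule that[of "B / 4"])
  fix w assume h: "\<bar>a \<bullet> w\<bar> <= B / 4 * norm w" "\<bar>b \<bullet> w\<bar> <= B / 4 * norm w" "\<bar>c \<bullet> w\<bar> <= B / 4 * norm w"
  have "B * norm w <= 3 / 4 * (B * norm w)" using B(2)[of w] h by (simp add: algebra_simps)
  then have "B * norm w <= 0" by simp
  then show "w = 0" using B(1) by (simp add: mult_le_0_iff)
 qed (use B in simp)
qed

text \<open>All that is used of an immersion locally is the following: secants between nearby points
 of the surface are nearly orthogonal to the normal. Together with invariance of domain this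
 replaces the inverse function theorem, and it is stable enough for the estimates below.\<close>

locale immersed_surface =
 fixes F :: "'m::{t2_space,second_countable_topology} => real^3" and nu :: "'m => real^3"
 assumes F_cont: "continuous_on UNIV F"
  and secant: "0 < eps ==> \<exists>U. open U & x \<in> U & inj_on F U &
   (\<forall>y\<in>U. \<forall>z\<in>U. \<bar>nu x \<bullet> (F y - F z)\<bar> <= eps * norm (F y - F z))"
  and planar: "\<exists>U ph (\<psi> :: real^2 => 'm). open U & x \<in> U & open (ph ` U) & homeomorphism U (ph ` U) ph \<psi>"
begin

lemma F_continuous [continuous_intros]: "continuous_on S g ==> continuous_on S (%x. F (g x))"
 using continuous_on_compose2[OF F_cont] by blast

lemma F_tendsto: "(g \<longlongrightarrow> x) H ==> ((%t. F (g t)) \<longlongrightarrow> F x) H"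
 using F_cont continuous_on_tendsto_compose by fastforce

text \<open>Two linear forms that are independent on the tangent plane at \<open>x\<close> are coordinates of the
 surface near \<open>x\<close>, with values in a square.\<close>

lemma coordinate_box:
 assumes ind: "indep3 a b (nu x)" and W: "open W" "x \<in> W"
 obtains U r k L where "open U" "x \<in> U" "U <= W" "r > 0" "L > 0" "inj_on F U"
  "homeomorphism U ({-r<..<r} \<times> {-r<..<r}) (%y. (a \<bullet> (F y - F x), b \<bullet> (F y - F x))) k"
  "!!y z. y \<in> U ==> z \<in> U ==> norm (F y - F z) <= L * (\<bar>a \<bullet> (F y - F z)\<bar> + \<bar>b \<bullet> (F y - F z)\<bar>)"
proof -
 obtain B where B: "B > 0" "!!w. B * norm w <= \<bar>a \<bullet> w\<bar> + \<bar>b \<bullet> w\<bar> + \<bar>nu x \<bullet> w\<bar>"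
  using indep3_coercive[OF ind] by metis
 obtain U1 where U1: "open U1" "x \<in> U1" "inj_on F U1"
  "!!y z. y \<in> U1 ==> z \<in> U1 ==> \<bar>nu x \<bullet> (F y - F z)\<bar> <= B / 2 * norm (F y - F z)"
  using secant[of "B / 2" x] B(1) by auto
 obtain U2 ph and \<psi> :: "real^2 => 'm" where U2: "open U2" "x \<in> U2" "open (ph ` U2)" and hom: "homeomorphism U2 (ph ` U2) ph \<psi>"
  using planar[of x] by blast
 define V where "V = U1 Int U2 Int W"
 have V: "open V" "x \<in> V" "V <= U1" "V <= U2" "V <= W" using U1 U2 W by (auto simp: V_def)
 let ?\<kappa> = "%y. (a \<bullet> (F y - F x), b \<bullet> (F y - F x))"
 have lip: "norm (F y - F z) <= 2 / B * (\<bar>a \<bullet> (F y - F z)\<bar> + \<bar>b \<bullet> (F y - F z)\<bar>)" if "y \<in> V" "z \<in> V" for y z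
 proof -
  have "\<bar>nu x \<bullet> (F y - F z)\<bar> <= B / 2 * norm (F y - F z)" using U1(4) V that by blast
  then have "B / 2 * norm (F y - F z) <= \<bar>a \<bullet> (F y - F z)\<bar> + \<bar>b \<bullet> (F y - F z)\<bar>"
   using B(2)[of "F y - F z"] by linarith
  then show ?thesis using B(1) by (simp add: field_simps)
 qed
 have c\<kappa>: "continuous_on S ?\<kappa>" for S by (intro continuous_intros)
 have inj: "inj_on ?\<kappa> V"
 proof (rule inj_onI)
  fix y z assume yz: "y \<in> V" "z \<in> V" "?\<kappa> y = ?\<kappa> z"
  then have "a \<bullet> (F y - F z) = 0" "b \<bullet> (F y - F z) = 0" by (auto simp: inner_diff_right)
  then have "F y = F z" using lip[OF yz(1,2)] by simp
  then show "y = z" using U1(3) V yz by (meson inj_onD subsetD)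
 qed
 have op: "open (?\<kappa> ` V')" if V': "open V'" "V' <= V" for V'
 proof -
  have V'2: "V' <= U2" using V' V by blast
  have "openin (top_of_set U2) V'" using V'(1) V'2 U2(1) by (simp add: openin_open_eq)
  from homeomorphism_imp_open_map[OF hom this]
  have o: "open (ph ` V')" using U2(3) openin_open_trans by blast
  have sub: "ph ` V' <= ph ` U2" using V' V by blast
  have img: "\<psi> ` ph ` V' = V'"
   unfolding image_image using homeomorphism_apply1[OF hom] V'2 by (auto simp: image_iff) (metis subsetD)+
  have c: "continuous_on (ph ` V') \<psi>" using hom sub by (meson continuous_on_subset homeomorphism_def)
  have "inj_on \<psi> (ph ` V')" 
   by (rule inj_on_inverseI[of _ ph]) (use homeomorphism_apply2[OF hom] sub in blast)
  moreover have "inj_on ?\<kappa> (\<psi> ` ph ` V')" unfolding img using inj V' by (meson inj_on_subset)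
  ultimately have "inj_on (?\<kappa> \<circ> \<psi>) (ph ` V')" by (rule comp_inj_on)
  moreover have "continuous_on (ph ` V') (?\<kappa> \<circ> \<psi>)"
   by (rule continuous_on_compose[OF c c\<kappa>])
  ultimately have "open ((?\<kappa> \<circ> \<psi>) ` ph ` V')"
   by (intro invariance_of_domain_gen[OF o]) auto
  then show ?thesis unfolding image_comp[symmetric] img .
 qed
 obtain k where k: "homeomorphism V (?\<kappa> ` V) ?\<kappa> k"
 proof (rule homeomorphism_injective_open_map[OF c\<kappa>[of V] refl inj])
  fix U assume "openin (top_of_set V) U"
  then have "open U" "U <= V" using V(1) by (auto simp: openin_open_eq)
  then show "openin (top_of_set (?\<kappa> ` V)) (?\<kappa> ` U)" using op by (simp add: image_mono open_subset)
 qed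
 have "(0, 0) \<in> ?\<kappa> ` V" using V(2) by force
 from open_prod_elim[OF op[OF V(1) order_refl] this]
 obtain A C where AC: "open A" "open C" "(0, 0) \<in> A \<times> C" "A \<times> C <= ?\<kappa> ` V" .
 obtain r1 where r1: "r1 > 0" "ball 0 r1 <= A" using openE[OF AC(1), of 0] AC(3) by blast
 obtain r2 where r2: "r2 > 0" "ball 0 r2 <= C" using openE[OF AC(2), of 0] AC(3) by blast
 define r where "r = min r1 r2"
 let ?Q = "{-r<..<r} \<times> {-r<..<r}"
 have r: "r > 0" "?Q <= ?\<kappa> ` V"
 proof -
  have "{-r<..<r} <= ball 0 r1" "{-r<..<r} <= ball 0 r2" by (auto simp: r_def)
  then have "?Q <= A \<times> C" using r1 r2 by blast
  then show "?Q <= ?\<kappa> ` V" using AC by blast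
 qed (use r1 r2 in \<open>simp add: r_def\<close>)
 define U where "U = V Int ?\<kappa> -` ?Q"
 have UV: "U <= V" by (auto simp: U_def)
 have "open U" unfolding U_def by (intro open_Int V open_vimage[OF _ c\<kappa>] open_Times) auto
 moreover have "x \<in> U" using V r by (auto simp: U_def)
 moreover have "U <= W" using UV V by blast
 moreover have "2 / B > 0" using B by simp
 moreover have "inj_on F U" using U1(3) V UV by (meson inj_on_subset)
 moreover have "homeomorphism U ?Q ?\<kappa> k"
  by (rule homeomorphism_of_subsets[OF k]) (use r in \<open>auto simp: U_def\<close>)
 moreover have "norm (F y - F z) <= 2 / B * (\<bar>a \<bullet> (F y - F z)\<bar> + \<bar>b \<bullet> (F y - F z)\<bar>)"
  if "y \<in> U" "z \<in> U" for y z using lip UV that by blast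
 ultimately show thesis using r(1) by (intro that[of U r "2 / B" k])
qed

end

section \<open>Compact sections by nearby planes\<close>

context immersed_surface
begin

text \<open>The planes that do not contain \<open>\<omega>\<close> are the sets \<open>{p. n \<bullet> (p - \<omega>) = 1}\<close>, parametrized by
 the nonzero vectors \<open>n\<close>. In this dual description the planes through a point form a plane of
 parameters, and no chart of the space of planes is needed.\<close>

definition slice :: "real^3 => real^3 => 'm set" where
 "slice \<omega> n = {y. n \<bullet> (F y - \<omega>) = 1}"

lemma closed_slice: "closed (slice \<omega> n)"
 unfolding slice_def by (intro closed_Collect_eq continuous_intros)

text \<open>In a box whose second coordinate is the height over a plane transversal to the surface,
 the section by every nearby plane is a graph over the first coordinate.\<close>

lemma section_box:
 assumes x: "x \<in> slice \<omega> e" and tr: "cross3 (nu x) e ~= 0" and W: "open W" "x \<in> W"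
 obtains U dl r L where "open U" "x \<in> U" "U <= W" "dl > 0" "r > 0" "inj_on F U" "L > 0"
  "!!y z. y \<in> U ==> z \<in> U ==>
   norm (F y - F z) <= L * (\<bar>cross3 (nu x) e \<bullet> (F y - F z)\<bar> + \<bar>e \<bullet> (F y - F z)\<bar>)"
  "!!n. norm (n - e) < dl ==> connected (slice \<omega> n Int U)"
  "!!n. norm (n - e) < dl ==> bij_betw (%y. cross3 (nu x) e \<bullet> (F y - F x)) (slice \<omega> n Int U) {-r<..<r}"
  "!!n y V. norm (n - e) < dl ==> y \<in> slice \<omega> n Int U ==> open V ==> y \<in> V ==>
    \<exists>et>0. \<forall>n'. norm (n' - n) < et --> V Int slice \<omega> n' ~= {}"
proof -
 let ?d = "cross3 (nu x) e"
 let ?\<kappa> = "%y. (?d \<bullet> (F y - F x), e \<bullet> (F y - F x))"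
 obtain U r L k where U: "open U" "x \<in> U" "U <= W" "r > 0" "L > 0" "inj_on F U"
  and hom: "homeomorphism U ({-r<..<r} \<times> {-r<..<r}) ?\<kappa> k"
  and lip: "!!y z. y \<in> U ==> z \<in> U ==> norm (F y - F z) <= L * (\<bar>?d \<bullet> (F y - F z)\<bar> + \<bar>e \<bullet> (F y - F z)\<bar>)"
  by (rule coordinate_box[OF indep3_cross[OF tr] W]) (rule that)
 let ?I = "{-r<..<r}"
 have kU: "k p \<in> U" if "p \<in> ?I \<times> ?I" for p using hom that unfolding homeomorphism_def by blast
 have \<kappa>k: "?\<kappa> (k p) = p" if "p \<in> ?I \<times> ?I" for p using homeomorphism_apply2[OF hom that] .
 have k\<kappa>: "k (?\<kappa> y) = y" if "y \<in> U" for y using homeomorphism_apply1[OF hom that] .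
 have \<kappa>U: "?\<kappa> y \<in> ?I \<times> ?I" if "y \<in> U" for y using hom that unfolding homeomorphism_def by blast
 have ck: "continuous_on (?I \<times> ?I) k" using hom homeomorphism_def by blast
 have d1: "?d \<bullet> (F (k (l,z)) - F x) = l" "e \<bullet> (F (k (l,z)) - F x) = z" if "l \<in> ?I" "z \<in> ?I" for l z
  using \<kappa>k[of "(l,z)"] that by auto
 define R where "R = norm (F x - \<omega>) + 2 * L * r + 1"
 have R0: "R > 0" using U by (simp add: R_def add_nonneg_pos)
 have R: "norm (F y - \<omega>) <= R" if "y \<in> U" for y
 proof -
  have "\<bar>?d \<bullet> (F y - F x)\<bar> <= r" "\<bar>e \<bullet> (F y - F x)\<bar> <= r" using \<kappa>U[OF that] by auto
  then have "L * (\<bar>?d \<bullet> (F y - F x)\<bar> + \<bar>e \<bullet> (F y - F x)\<bar>) <= L * (r + r)"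
   using U by (intro mult_left_mono) auto
  then have "norm (F y - F x) <= 2 * L * r" using lip[OF that U(2)] by (simp add: algebra_simps)
  moreover have "norm (F y - \<omega>) <= norm (F y - F x) + norm (F x - \<omega>)"
   using norm_triangle_ineq[of "F y - F x" "F x - \<omega>"] by simp
  ultimately show ?thesis by (simp add: R_def)
 qed
 define dl where "dl = min (r / (4 * R)) (1 / (2 * L))"
 have dl0: "dl > 0" using U R0 by (simp add: dl_def)
 define E where "E n l z = n \<bullet> (F (k (l,z)) - \<omega>) - 1" for n l z
 have E_eq: "E n l z = z + (n - e) \<bullet> (F (k (l,z)) - \<omega>)" if "l \<in> ?I" "z \<in> ?I" for n l z
 proof -
  have "E n l z = e \<bullet> (F (k (l,z)) - \<omega>) - 1 + (n - e) \<bullet> (F (k (l,z)) - \<omega>)"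
   by (simp add: E_def inner_diff_left)
  moreover have "e \<bullet> (F (k (l,z)) - \<omega>) - 1 = z"
   using d1(2)[OF that] x unfolding slice_def by (simp add: inner_diff_right)
  ultimately show ?thesis by simp
 qed
 have E_diff: "\<bar>(E n l z - E n l' z') - (z - z')\<bar> <= 1/2 * (\<bar>l - l'\<bar> + \<bar>z - z'\<bar>)"
  if n: "norm (n - e) < dl" and "l \<in> ?I" "z \<in> ?I" "l' \<in> ?I" "z' \<in> ?I" for n l z l' z'
 proof -
  let ?y = "k (l,z)" and ?y' = "k (l',z')"
  have "(E n l z - E n l' z') - (z - z') = (n - e) \<bullet> (F ?y - F ?y')"
   unfolding E_eq[OF that(2,3)] E_eq[OF that(4,5)] by (simp add: inner_diff_right)
  then have "\<bar>(E n l z - E n l' z') - (z - z')\<bar> <= norm (n - e) * norm (F ?y - F ?y')"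
   by (simp add: Cauchy_Schwarz_ineq2)
  also have "\<dots> <= 1 / (2 * L) * norm (F ?y - F ?y')"
   using n by (intro mult_right_mono) (auto simp: dl_def)
  finally have *: "\<bar>(E n l z - E n l' z') - (z - z')\<bar> <= 1 / (2 * L) * norm (F ?y - F ?y')" .
  have "norm (F ?y - F ?y') <= L * (\<bar>l - l'\<bar> + \<bar>z - z'\<bar>)"
  proof -
   have "F ?y - F ?y' = (F ?y - F x) - (F ?y' - F x)" by simp
   then have "?d \<bullet> (F ?y - F ?y') = l - l'" "e \<bullet> (F ?y - F ?y') = z - z'"
    using d1[OF that(2,3)] d1[OF that(4,5)] by (simp_all only: inner_diff_right[of _ "F ?y - F x"])
   then show ?thesis using lip[of ?y ?y'] kU that by auto
  qed
  then have "1 / (2 * L) * norm (F ?y - F ?y') <= 1 / (2 * L) * (L * (\<bar>l - l'\<bar> + \<bar>z - z'\<bar>))"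
   using U by (intro mult_left_mono) auto
  note order_trans[OF * this]
  also have "\<dots> = 1 / 2 * (\<bar>l - l'\<bar> + \<bar>z - z'\<bar>)" using U by simp
  finally show ?thesis .
 qed
 have E_mono: "E n l z < E n l z'" if "norm (n - e) < dl" "l \<in> ?I" "z \<in> ?I" "z' \<in> ?I" "z < z'" for n l z z'
  using abs_le_D1[OF E_diff[OF that(1,2,3,2,4)]] that(5) by simp
 have E_cont: "continuous_on S (E n l)" if "l \<in> ?I" "S <= ?I" for n l S
  unfolding E_def using that
  by (intro continuous_intros continuous_on_compose2[OF ck]) auto
 have ex: "\<exists>z\<in>?I. E n l z = 0" if n: "norm (n - e) < dl" and l: "l \<in> ?I" for n l
 proof -
  have b: "\<bar>E n l z - z\<bar> < r / 2" if "z \<in> ?I" for z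
  proof -
   have "\<bar>E n l z - z\<bar> <= norm (n - e) * norm (F (k (l,z)) - \<omega>)"
    unfolding E_eq[OF l that] by (simp add: Cauchy_Schwarz_ineq2)
   also have "\<dots> <= norm (n - e) * R" using R[OF kU[of "(l,z)"]] l that by (intro mult_left_mono) auto
   also have "\<dots> <= r / (4 * R) * R" using n R0 by (intro mult_right_mono) (auto simp: dl_def)
   also have "\<dots> = r / 4" using R0 by simp
   finally show ?thesis using U(4) by simp
  qed
  have sub: "{- (r / 2)..r / 2} <= ?I" using U(4) by auto
  have "\<bar>E n l (- (r / 2)) - - (r / 2)\<bar> < r / 2" by (rule b) (use U(4) in simp)
  moreover have "\<bar>E n l (r / 2) - r / 2\<bar> < r / 2" by (rule b) (use U(4) in simp)
  ultimately have "E n l (- (r / 2)) <= 0" "0 <= E n l (r / 2)" by linarith+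
  from IVT'[OF this _ E_cont[OF l sub]] U(4)
  obtain z where "- (r / 2) <= z" "z <= r / 2" "E n l z = 0" by auto
  then show ?thesis using U(4) by (intro bexI[of _ z]) auto
 qed
 have E0: "E n l z = 0 \<longleftrightarrow> k (l,z) \<in> slice \<omega> n" for n l z by (simp add: E_def slice_def)
 have conn: "connected (slice \<omega> n Int U)" if n: "norm (n - e) < dl" for n
 proof -
  obtain Z where Z: "!!l. l \<in> ?I ==> Z l \<in> ?I & E n l (Z l) = 0" using ex[OF n] by metis
  have Zlip: "\<bar>Z l - Z l'\<bar> <= \<bar>l - l'\<bar>" if "l \<in> ?I" "l' \<in> ?I" for l l'
  proof -
   have "E n l (Z l) = 0" "E n l' (Z l') = 0" using Z that by auto
   moreover have "\<bar>(E n l (Z l) - E n l' (Z l')) - (Z l - Z l')\<bar> <= 1/2 * (\<bar>l - l'\<bar> + \<bar>Z l - Z l'\<bar>)"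
    using Z that by (intro E_diff n) auto
   ultimately have "\<bar>Z l - Z l'\<bar> <= 1/2 * (\<bar>l - l'\<bar> + \<bar>Z l - Z l'\<bar>)"
    by (simp add: abs_minus_commute)
   then show ?thesis by simp
  qed
  have cZ: "continuous_on ?I Z"
   unfolding continuous_on_iff dist_real_def using Zlip by (meson le_less_trans)
  have "slice \<omega> n Int U = (%l. k (l, Z l)) ` ?I"
  proof (intro set_eqI iffI)
   fix y assume y: "y \<in> slice \<omega> n Int U"
   obtain l z where lz: "?\<kappa> y = (l,z)" by blast
   then have I: "l \<in> ?I" "z \<in> ?I" using \<kappa>U[of y] y by auto
   have yk: "y = k (l,z)" using k\<kappa>[of y] y lz by simp
   have "E n l z = 0" using y yk E0 by simp
   then have "z = Z l" using Z[OF I(1)] E_mono[OF n I(1), of z "Z l"] E_mono[OF n I(1), of "Z l" z] I(2)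
    by (cases z "Z l" rule: linorder_cases) auto
   then show "y \<in> (%l. k (l, Z l)) ` ?I" using yk I by blast
  next
   fix y assume "y \<in> (%l. k (l, Z l)) ` ?I"
   then show "y \<in> slice \<omega> n Int U" using Z E0 kU by auto
  qed
  moreover have "connected ((%l. k (l, Z l)) ` ?I)"
   using Z by (intro connected_continuous_image continuous_on_compose2[OF ck] continuous_intros cZ) auto
  ultimately show ?thesis by simp
 qed
 have bij: "bij_betw (%y. ?d \<bullet> (F y - F x)) (slice \<omega> n Int U) ?I" if n: "norm (n - e) < dl" for n
  unfolding bij_betw_def
 proof
  show "inj_on (%y. ?d \<bullet> (F y - F x)) (slice \<omega> n Int U)"
  proof (rule inj_onI)
   fix y y' assume y: "y \<in> slice \<omega> n Int U" and y': "y' \<in> slice \<omega> n Int U"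
    and eq: "?d \<bullet> (F y - F x) = ?d \<bullet> (F y' - F x)"
   obtain l z where lz: "?\<kappa> y = (l,z)" by blast
   obtain z' where lz': "?\<kappa> y' = (l,z')" using eq lz by auto
   have I: "l \<in> ?I" "z \<in> ?I" "z' \<in> ?I" using \<kappa>U[of y] \<kappa>U[of y'] y y' lz lz' by auto
   have yk: "y = k (l,z)" "y' = k (l,z')" using k\<kappa>[of y] k\<kappa>[of y'] y y' lz lz' by auto
   then have "E n l z = 0" "E n l z' = 0" using y y' E0 by auto
   then have "z = z'" using E_mono[OF n I(1,2,3)] E_mono[OF n I(1,3,2)]
    by (cases z z' rule: linorder_cases) auto
   then show "y = y'" using yk by simp
  qed
  show "(%y. ?d \<bullet> (F y - F x)) ` (slice \<omega> n Int U) = ?I"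
  proof (intro set_eqI iffI)
   fix l assume "l \<in> (%y. ?d \<bullet> (F y - F x)) ` (slice \<omega> n Int U)"
   then show "l \<in> ?I" using \<kappa>U by auto
  next
   fix l assume l: "l \<in> ?I"
   obtain z where z: "z \<in> ?I" "E n l z = 0" using ex[OF n l] by blast
   then have "k (l,z) \<in> slice \<omega> n Int U" using E0 kU l by auto
   then show "l \<in> (%y. ?d \<bullet> (F y - F x)) ` (slice \<omega> n Int U)"
    using d1(1)[OF l z(1)] by (metis imageI)
  qed
 qed
 have pers: "\<exists>et>0. \<forall>n'. norm (n' - n) < et --> V Int slice \<omega> n' ~= {}"
  if n: "norm (n - e) < dl" and y: "y \<in> slice \<omega> n Int U" and V: "open V" "y \<in> V" for n y V
 proof -
  obtain l z where lz: "?\<kappa> y = (l,z)" by blast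
  have I: "l \<in> ?I" "z \<in> ?I" using \<kappa>U[of y] y lz by auto
  have yk: "y = k (l,z)" using k\<kappa>[of y] y lz by simp
  have cl: "continuous_on ?I (%z. k (l,z))"
   using I by (intro continuous_on_compose2[OF ck] continuous_intros) auto
  have "open ((%z. k (l,z)) -` V Int ?I)"
   using continuous_on_open_vimage[of ?I "%z. k (l,z)"] cl V(1) by auto
  moreover have "z \<in> (%z. k (l,z)) -` V Int ?I" using yk V I by auto
  ultimately obtain s where s: "s > 0" "cball z s <= (%z. k (l,z)) -` V Int ?I"
   using open_contains_cball by blast
  then have J: "{z-s..z+s} <= ?I" and JV: "!!t. t \<in> {z-s..z+s} ==> k (l,t) \<in> V"
   by (auto simp: cball_eq_atLeastAtMost)
  have zI: "z - s \<in> ?I" "z + s \<in> ?I" using J s(1) by (auto simp: subset_iff)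
  have "E n l z = 0" using y yk E0 by simp
  then have sg: "E n l (z - s) < 0" "E n l (z + s) > 0"
   using E_mono[OF n I(1) zI(1) I(2)] E_mono[OF n I(1) I(2) zI(2)] s(1) by auto
  define et where "et = min (- E n l (z - s)) (E n l (z + s)) / R"
  have "V Int slice \<omega> n' ~= {}" if n': "norm (n' - n) < et" for n'
  proof -
   have "norm (n' - n) * R < et * R" using n' R0 by (rule mult_strict_right_mono)
   then have lt: "norm (n' - n) * R < - E n l (z - s)" "norm (n' - n) * R < E n l (z + s)"
    using R0 by (auto simp: et_def)
   have b: "\<bar>E n' l t - E n l t\<bar> <= norm (n' - n) * R" if "t \<in> ?I" for t
   proof -
    have "E n' l t - E n l t = (n' - n) \<bullet> (F (k (l,t)) - \<omega>)" by (simp add: E_def inner_diff_left)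
    then have "\<bar>E n' l t - E n l t\<bar> <= norm (n' - n) * norm (F (k (l,t)) - \<omega>)"
     by (simp add: Cauchy_Schwarz_ineq2)
    also have "\<dots> <= norm (n' - n) * R" using R[OF kU[of "(l,t)"]] I that by (intro mult_left_mono) auto
    finally show ?thesis .
   qed
   have "E n' l (z - s) <= 0" "0 <= E n' l (z + s)"
    using b[OF zI(1)] b[OF zI(2)] lt by linarith+
   from IVT'[OF this _ E_cont[OF I(1) J]] s(1)
   obtain t where "z - s <= t" "t <= z + s" "E n' l t = 0" by auto
   then show ?thesis using JV[of t] E0 by auto
  qed
  moreover have "et > 0" using sg R0 by (simp add: et_def)
  ultimately show ?thesis by blast
 qed
 show thesis by (rule that[OF U(1,2,3) dl0 U(4,6,5) lip conn bij pers])
qed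

end

context immersed_surface
begin

text \<open>Surfaces are locally compact, because charts map onto open subsets of the plane.\<close>

lemma compact_neighbourhood:
 fixes x :: 'm
 assumes "open W" "x \<in> W"
 obtains V K where "open V" "compact K" "x \<in> V" "V <= K" "K <= W"
proof -
 obtain U ph and \<psi> :: "real^2 => 'm" where U: "open U" "x \<in> U" "open (ph ` U)" and hom: "homeomorphism U (ph ` U) ph \<psi>"
  using planar[of x] by blast
 have "openin (top_of_set U) (U Int W)" using U(1) assms(1) by (simp add: openin_open_eq open_Int)
 from homeomorphism_imp_open_map[OF hom this]
 have o: "open (ph ` (U Int W))" using U(3) openin_open_trans by blast
 moreover have "ph x \<in> ph ` (U Int W)" using U(2) assms(2) by blast
 ultimately obtain r where r: "r > 0" "cball (ph x) r <= ph ` (U Int W)"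
  using open_contains_cball_eq by blast
 have c\<psi>: "continuous_on (ph ` U) \<psi>" and cph: "continuous_on U ph" using hom by (auto simp: homeomorphism_def)
 have inv: "\<psi> (ph y) = y" if "y \<in> U" for y using homeomorphism_apply1[OF hom that] .
 have sub: "cball (ph x) r <= ph ` U" using r(2) by blast
 show thesis
 proof (rule that[of "U Int W Int (ph -` ball (ph x) r Int U)" "\<psi> ` cball (ph x) r"])
  show "open (U Int W Int (ph -` ball (ph x) r Int U))"
   using continuous_on_open_vimage[OF U(1), of ph] cph U(1) assms(1) by auto
  show "compact (\<psi> ` cball (ph x) r)"
   by (intro compact_continuous_image continuous_on_subset[OF c\<psi> sub]) auto
  show "x \<in> U Int W Int (ph -` ball (ph x) r Int U)" using U assms r by auto
  show "U Int W Int (ph -` ball (ph x) r Int U) <= \<psi> ` cball (ph x) r"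
  proof
   fix y assume y: "y \<in> U Int W Int (ph -` ball (ph x) r Int U)"
   then have "y = \<psi> (ph y)" "ph y \<in> cball (ph x) r" using inv by auto
   then show "y \<in> \<psi> ` cball (ph x) r" by blast
  qed
  show "\<psi> ` cball (ph x) r <= W"
  proof
   fix y assume "y \<in> \<psi> ` cball (ph x) r"
   then obtain z where z: "z \<in> U Int W" "y = \<psi> (ph z)" using r(2) by blast
   then show "y \<in> W" using inv by auto
  qed
 qed
qed

lemma slice_avoids_compact:
 assumes "compact C" "slice \<omega> e Int C = {}"
 shows "\<forall>\<^sub>F n in nhds e. slice \<omega> n Int C = {}"
proof (cases "C = {}")
 case False
 have "\<exists>y0\<in>C. \<forall>y\<in>C. \<bar>e \<bullet> (F y0 - \<omega>) - 1\<bar> <= \<bar>e \<bullet> (F y - \<omega>) - 1\<bar>"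
  by (rule continuous_attains_inf[OF assms(1) False]) (intro continuous_intros)
 then obtain y0 where y0: "y0 \<in> C" "!!y. y \<in> C ==> \<bar>e \<bullet> (F y0 - \<omega>) - 1\<bar> <= \<bar>e \<bullet> (F y - \<omega>) - 1\<bar>"
  by blast
 define m where "m = \<bar>e \<bullet> (F y0 - \<omega>) - 1\<bar>"
 have m: "m > 0" using y0(1) assms(2) by (auto simp: m_def slice_def)
 have "compact ((%y. F y - \<omega>) ` C)" by (intro compact_continuous_image continuous_intros assms)
 then have "bounded ((%y. F y - \<omega>) ` C)" by (rule compact_imp_bounded)
 then obtain R where R: "R > 0" "!!y. y \<in> C ==> norm (F y - \<omega>) <= R"
  unfolding bounded_pos by blast
 have "slice \<omega> n Int C = {}" if n: "dist n e < m / R" for n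
 proof -
  have "n \<bullet> (F y - \<omega>) ~= 1" if y: "y \<in> C" for y
  proof
   assume "n \<bullet> (F y - \<omega>) = 1"
   then have "\<bar>e \<bullet> (F y - \<omega>) - 1\<bar> = \<bar>(n - e) \<bullet> (F y - \<omega>)\<bar>" by (simp add: inner_diff_left)
   also have "\<dots> <= norm (n - e) * norm (F y - \<omega>)" by (rule Cauchy_Schwarz_ineq2)
   also have "\<dots> <= norm (n - e) * R" using R(2)[OF y] by (rule mult_left_mono) simp
   also have "\<dots> < m / R * R" using n R(1) by (intro mult_strict_right_mono) (auto simp: dist_norm)
   finally show False using y0(2)[OF y] R(1) by (simp add: m_def)
  qed
  then show ?thesis by (auto simp: slice_def)
 qed
 then show ?thesis unfolding eventually_nhds_metric using m R by (intro exI[of _ "m / R"]) auto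
qed simp

text \<open>A compact transversal section persists: finitely many boxes cover it, in each box the
 section by a nearby plane is connected, boxes that overlap along the given section still overlap
 along the nearby one, and no part of the nearby section escapes.\<close>

lemma nearby_sections:
 assumes \<Gamma>: "compact \<Gamma>" "connected \<Gamma>" "\<Gamma> ~= {}"
  and N0: "open N0" "slice \<omega> e Int N0 = \<Gamma>"
  and tr: "!!x. x \<in> \<Gamma> ==> cross3 (nu x) e ~= 0"
 obtains N K dl where "open N" "\<Gamma> <= N" "N <= N0" "compact K" "K <= N" "dl > 0"
  "!!n. norm (n - e) < dl ==> slice \<omega> n Int N <= K"
  "!!n. norm (n - e) < dl ==> slice \<omega> n Int N \<in> components (slice \<omega> n)"
  "!!n y V. norm (n - e) < dl ==> y \<in> slice \<omega> n Int N ==> open V ==> y \<in> V ==>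
    \<forall>\<^sub>F n' in nhds n. V Int slice \<omega> n' ~= {}"
proof -
 define P where "P x U dl V K C \<longleftrightarrow> open U & open V & compact K & compact C & x \<in> V & V <= K & K <= U &
   U <= C & C <= N0 & dl > 0 & (\<forall>n. norm (n - e) < dl --> connected (slice \<omega> n Int U)) &
   (\<forall>n y V. norm (n - e) < dl --> y \<in> slice \<omega> n Int U --> open V --> y \<in> V -->
    (\<forall>\<^sub>F n' in nhds n. V Int slice \<omega> n' ~= {}))" for x :: 'm and U dl V K C
 have "\<exists>U dl V K C. P x U dl V K C" if x: "x \<in> \<Gamma>" for x
 proof -
  have xs: "x \<in> slice \<omega> e" "x \<in> N0" using x N0 by auto
  obtain W C where W: "open W" "compact C" "x \<in> W" "W <= C" "C <= N0"
   using compact_neighbourhood[OF N0(1) xs(2)] by blast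
  obtain U dl r L where U: "open U" "x \<in> U" "U <= W" "dl > 0"
   "!!n. norm (n - e) < dl ==> connected (slice \<omega> n Int U)"
   "!!n y V. norm (n - e) < dl ==> y \<in> slice \<omega> n Int U ==> open V ==> y \<in> V ==>
    \<exists>et>0. \<forall>n'. norm (n' - n) < et --> V Int slice \<omega> n' ~= {}"
   by (rule section_box[OF xs(1) tr[OF x] W(1,3)]) (rule that)
  obtain V K where V: "open V" "compact K" "x \<in> V" "V <= K" "K <= U"
   using compact_neighbourhood[OF U(1,2)] by blast
  have "\<forall>\<^sub>F n' in nhds n. V Int slice \<omega> n' ~= {}"
   if "norm (n - e) < dl" "y \<in> slice \<omega> n Int U" "open V" "y \<in> V" for n y V
   using U(6)[OF that] unfolding eventually_nhds_metric dist_norm .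
  note pers = this
  have UC: "U <= C" using U(3) W(4) by (rule subset_trans)
  have "P x U dl V K C" unfolding P_def
   by (intro conjI allI impI U(1,4) V W(2,5) UC) (rule U(5) pers; assumption)+
  then show ?thesis by blast
 qed
 then obtain U dl V K C where P: "!!x. x \<in> \<Gamma> ==> P x (U x) (dl x) (V x) (K x) (C x)" by metis
 have "open (V x)" "x \<in> V x" if "x \<in> \<Gamma>" for x
  using P[OF that, unfolded P_def] by - (elim conjE, assumption)+
 then have oV: "!!x. x \<in> \<Gamma> ==> open (V x)" and "\<Gamma> <= (\<Union>x\<in>\<Gamma>. V x)" by auto
 from compactE_image[OF \<Gamma>(1) this] obtain T where T: "T <= \<Gamma>" "finite T" "\<Gamma> <= (\<Union>x\<in>T. V x)" .
 have PT: "P x (U x) (dl x) (V x) (K x) (C x)" if "x \<in> T" for x using P T that by blast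
 have Q: "open (U x)" "open (V x)" "compact (K x)" "compact (C x)" "x \<in> V x" "V x <= K x" "K x <= U x"
  "U x <= C x" "C x <= N0" "dl x > 0" if "x \<in> T" for x
  using PT[OF that, unfolded P_def] by - (elim conjE, assumption)+
 have Qconn: "connected (slice \<omega> n Int U x)" if "x \<in> T" "norm (n - e) < dl x" for n x
  using PT[OF that(1), unfolded P_def] that(2) by blast
 have Qpers: "\<forall>\<^sub>F n' in nhds n. W Int slice \<omega> n' ~= {}"
  if "x \<in> T" "norm (n - e) < dl x" "y \<in> slice \<omega> n Int U x" "open W" "y \<in> W" for n x y W
  using PT[OF that(1), unfolded P_def] that(2-) by blast
 define N where "N = (\<Union>x\<in>T. U x)"
 define KK where "KK = (\<Union>x\<in>T. K x)"
 define CC where "CC = (\<Union>x\<in>T. C x)"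
 define VV where "VV = (\<Union>x\<in>T. V x)"
 have N4: "N <= CC" unfolding N_def CC_def by (rule UN_mono[OF order_refl Q(8)])
 have N5: "CC <= N0" unfolding CC_def by (rule UN_least[OF Q(9)])
 have N6: "KK <= N" unfolding KK_def N_def by (rule UN_mono[OF order_refl Q(7)])
 have N7: "VV <= KK" unfolding KK_def VV_def by (rule UN_mono[OF order_refl Q(6)])
 have N8: "\<Gamma> <= VV" using T(3) by (simp add: VV_def)
 have N1: "open N" "open VV" unfolding N_def VV_def using Q by blast+
 note N = N1(1) subset_trans[OF subset_trans[OF N8 N7] N6] subset_trans[OF N4 N5] N4 N5 N6 N7 N8 N1(2)
 have cpt: "compact KK" "compact CC" unfolding KK_def CC_def using Q T(2) by auto
 have "slice \<omega> e Int (CC - VV) = {}" using N0(2) N by blast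
 then have ev1: "\<forall>\<^sub>F n in nhds e. slice \<omega> n Int (CC - VV) = {}"
  by (intro slice_avoids_compact compact_diff cpt N)
 have ev2: "\<forall>\<^sub>F n in nhds e. \<forall>x\<in>T. norm (n - e) < dl x"
 proof (rule eventually_ball_finite[OF T(2)], rule ballI)
  fix x assume "x \<in> T"
  then have "dl x > 0" by (rule Q)
  then show "\<forall>\<^sub>F n in nhds e. norm (n - e) < dl x" unfolding eventually_nhds_metric dist_norm by blast
 qed
 have ev3: "\<forall>\<^sub>F n in nhds e. \<forall>x\<in>T. \<forall>y\<in>T. U x Int U y Int \<Gamma> ~= {} --> (U x Int U y) Int slice \<omega> n ~= {}"
 proof (intro eventually_ball_finite[OF T(2)] ballI)
  fix x y assume xy: "x \<in> T" "y \<in> T"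
  show "\<forall>\<^sub>F n in nhds e. U x Int U y Int \<Gamma> ~= {} --> (U x Int U y) Int slice \<omega> n ~= {}"
  proof (cases "U x Int U y Int \<Gamma> = {}")
   case False
   then obtain z where z: "z \<in> U x Int U y" "z \<in> slice \<omega> e" using N0 by blast
   have "\<forall>\<^sub>F n' in nhds e. (U x Int U y) Int slice \<omega> n' ~= {}"
   proof (rule Qpers[OF xy(1)])
    show "norm (e - e) < dl x" using Q(10)[OF xy(1)] by simp
    show "z \<in> slice \<omega> e Int U x" "open (U x Int U y)" using z Q(1) xy by auto
   qed (rule z)
   then show ?thesis by (rule eventually_mono) simp
  qed simp
 qed
 have "\<forall>\<^sub>F n in nhds e. slice \<omega> n Int (CC - VV) = {} & (\<forall>x\<in>T. norm (n - e) < dl x) &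
   (\<forall>x\<in>T. \<forall>y\<in>T. U x Int U y Int \<Gamma> ~= {} --> (U x Int U y) Int slice \<omega> n ~= {})"
  using ev1 ev2 ev3 by (intro eventually_conj)
 then obtain d where d: "d > 0" and D: "!!n. norm (n - e) < d ==> slice \<omega> n Int (CC - VV) = {}"
   "!!n x. norm (n - e) < d ==> x \<in> T ==> norm (n - e) < dl x"
   "!!n x y. norm (n - e) < d ==> x \<in> T ==> y \<in> T ==> U x Int U y Int \<Gamma> ~= {} ==> (U x Int U y) Int slice \<omega> n ~= {}"
  unfolding eventually_nhds_metric dist_norm by blast
 have sK: "slice \<omega> n Int N <= KK" if "norm (n - e) < d" for n using D(1)[OF that] N by blast
 have comp: "slice \<omega> n Int N \<in> components (slice \<omega> n)" if n: "norm (n - e) < d" for n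
 proof -
  let ?S = "slice \<omega> n Int N"
  have cU: "connected (slice \<omega> n Int U x)" if "x \<in> T" for x by (rule Qconn[OF that D(2)[OF n that]])
  have meet: "U x Int \<Gamma> ~= {}" if "x \<in> T" for x using Q(5-7)[OF that] T(1) that by blast
  have neU: "slice \<omega> n Int U x ~= {}" if "x \<in> T" for x
   using D(3)[OF n that that] meet[OF that] by blast
  have "T ~= {}" using T(3) \<Gamma>(3) by auto
  then have ne: "?S ~= {}" using neU by (auto simp: N_def)
  have conn: "connected ?S"
  proof (rule ccontr)
   assume "\<not> connected ?S"
   then obtain A B where AB: "open A" "open B" "?S <= A \<union> B" "A Int B Int ?S = {}" "A Int ?S ~= {}" "B Int ?S ~= {}"
    unfolding connected_def by blast
   define TA where "TA = {x\<in>T. slice \<omega> n Int U x <= A}"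
   define TB where "TB = {x\<in>T. slice \<omega> n Int U x <= B}"
   have split: "x \<in> TA \<or> x \<in> TB" if x: "x \<in> T" for x
   proof (rule ccontr)
    assume "\<not> (x \<in> TA \<or> x \<in> TB)"
    moreover have sub: "slice \<omega> n Int U x <= ?S" using x by (auto simp: N_def)
    ultimately have "A Int (slice \<omega> n Int U x) ~= {}" "B Int (slice \<omega> n Int U x) ~= {}"
     using AB(3) x unfolding TA_def TB_def by blast+
    moreover have "A Int B Int (slice \<omega> n Int U x) = {}" "slice \<omega> n Int U x <= A \<union> B"
     using sub AB(3,4) by blast+
    ultimately show False using cU[OF x] AB(1,2) unfolding connected_def by blast
   qed
   have neT: "TA ~= {}" "TB ~= {}"
   proof -
    obtain y where "y \<in> A" "y \<in> ?S" using AB(5) by blast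
    then obtain x where "x \<in> T" "y \<in> slice \<omega> n Int U x" by (auto simp: N_def)
    then have "x \<notin> TB" using AB(4) \<open>y \<in> A\<close> \<open>y \<in> ?S\<close> unfolding TB_def by blast
    then show "TA ~= {}" using split[OF \<open>x \<in> T\<close>] by blast
    obtain y where "y \<in> B" "y \<in> ?S" using AB(6) by blast
    then obtain x where "x \<in> T" "y \<in> slice \<omega> n Int U x" by (auto simp: N_def)
    then have "x \<notin> TA" using AB(4) \<open>y \<in> B\<close> \<open>y \<in> ?S\<close> unfolding TA_def by blast
    then show "TB ~= {}" using split[OF \<open>x \<in> T\<close>] by blast
   qed
   let ?A = "\<Union>x\<in>TA. U x" and ?B = "\<Union>x\<in>TB. U x"
   have "open ?A" "open ?B" using Q(1) by (auto simp: TA_def TB_def)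
   moreover have "\<Gamma> <= ?A \<union> ?B"
   proof
    fix z assume "z \<in> \<Gamma>"
    then obtain x where "x \<in> T" "z \<in> U x" using N(2) by (auto simp: N_def)
    then show "z \<in> ?A \<union> ?B" using split[of x] by blast
   qed
   moreover have "?A Int \<Gamma> ~= {}" "?B Int \<Gamma> ~= {}"
    using neT meet unfolding TA_def TB_def by blast+
   ultimately have "?A Int ?B Int \<Gamma> ~= {}" using connectedD[OF \<Gamma>(2), of ?A ?B] by blast
   then obtain z where z: "z \<in> ?A" "z \<in> ?B" "z \<in> \<Gamma>" by blast
   then obtain x y where xy: "x \<in> TA" "y \<in> TB" "z \<in> U x Int U y Int \<Gamma>" by blast
   then have "(U x Int U y) Int slice \<omega> n ~= {}" using D(3)[OF n, of x y] unfolding TA_def TB_def by blast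
   then obtain p where "p \<in> U x" "p \<in> U y" "p \<in> slice \<omega> n" by blast
   then show False using xy AB(4) unfolding TA_def TB_def N_def by blast
  qed
  show ?thesis unfolding in_components_maximal
  proof (intro conjI allI impI)
   show "?S ~= {}" "?S <= slice \<omega> n" "connected ?S" using ne conn by auto
   fix D assume D: "D ~= {} & ?S <= D & D <= slice \<omega> n & connected D"
   \<comment> \<open>the section is both relatively open and closed in the whole intersection\<close>
   have cl: "closed (KK Int slice \<omega> n)" by (intro closed_Int compact_imp_closed cpt closed_slice)
   have eq: "?S = KK Int slice \<omega> n" using sK[OF n] N(6) by blast
   have "N Int D = {} \<or> - (KK Int slice \<omega> n) Int D = {}"
   proof (rule connectedD[OF _ N(1) open_Compl[OF cl]])
    show "connected D" using D by blast
    show "N Int - (KK Int slice \<omega> n) Int D = {}" "D <= N \<union> - (KK Int slice \<omega> n)"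
     using D eq N(6) by blast+
   qed
   moreover have "N Int D ~= {}" using D ne by blast
   ultimately have "- (KK Int slice \<omega> n) Int D = {}" by blast
   then show "D = ?S" using D eq by blast
  qed
 qed
 have pers: "\<forall>\<^sub>F n' in nhds n. W Int slice \<omega> n' ~= {}"
  if n: "norm (n - e) < d" and y: "y \<in> slice \<omega> n Int N" and W: "open W" "y \<in> W" for n y W
 proof -
  obtain x where x: "x \<in> T" "y \<in> slice \<omega> n Int U x" using y by (auto simp: N_def)
  then show ?thesis by (intro Qpers[OF x(1) D(2)[OF n x(1)] x(2) W])
 qed
 show thesis by (rule that[OF N(1,2,3) cpt(1) N(6) d sK comp pers])
qed

end

section \<open>Centres of nearby sections\<close>

text \<open>The composition of two point reflections is a translation, which moves a bounded nonempty set to itself only if it is the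
 identity.\<close>

lemma symmetric_bounded_center_unique:
 fixes X :: "'a::real_normed_vector set"
 assumes b: "bounded X" and p: "p \<in> X"
  and c: "!!p. p \<in> X ==> 2 *\<^sub>R c - p \<in> X" and d: "!!p. p \<in> X ==> 2 *\<^sub>R d - p \<in> X"
 shows "c = d"
proof (rule ccontr)
 assume "c ~= d"
 have it: "p + real j *\<^sub>R (2 *\<^sub>R (d - c)) \<in> X" for j
 proof (induction j)
  case (Suc j)
  have "2 *\<^sub>R d - (2 *\<^sub>R c - (p + real j *\<^sub>R (2 *\<^sub>R (d - c)))) \<in> X" by (intro c d Suc)
  moreover have "2 *\<^sub>R d - (2 *\<^sub>R c - (p + real j *\<^sub>R (2 *\<^sub>R (d - c)))) = p + real (Suc j) *\<^sub>R (2 *\<^sub>R (d - c))"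
   by (simp add: algebra_simps)
  ultimately show ?case by (simp only:)
 qed (use p in simp)
 obtain R where R: "!!x. x \<in> X ==> norm x <= R" using b unfolding bounded_iff by blast
 define w where "w = 2 *\<^sub>R (d - c)"
 have w: "norm w > 0" using \<open>c ~= d\<close> by (simp add: w_def)
 obtain j :: nat where j: "real j * norm w > 2 * R" using reals_Archimedean3[OF w] by blast
 have "real j * norm w = norm ((p + real j *\<^sub>R w) - p)" by simp
 also have "\<dots> <= norm (p + real j *\<^sub>R w) + norm p" by (rule norm_triangle_ineq4)
 also have "\<dots> <= R + R" using R[OF it[of j]] R[OF p] unfolding w_def by (rule add_mono)
 finally show False using j by simp
qed

context immersed_surface
begin

definition centred :: "'m set => real^3 => bool" where
 "centred S c \<longleftrightarrow> (\<forall>p\<in>F ` S. 2 *\<^sub>R c - p \<in> F ` S)"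

lemma compact_subseq:
 fixes y :: "nat => 'm"
 assumes "compact K" "!!i. y i \<in> K"
 obtains l ph where "l \<in> K" "strict_mono ph" "(%i. y (ph i)) \<longlonglongrightarrow> l"
 using assms seq_compact_eq_compact[of K] unfolding seq_compact_def o_def by metis

lemma slice_limit:
 assumes "!!i. y i \<in> slice \<omega> (m i)" "m \<longlonglongrightarrow> n" "y \<longlonglongrightarrow> l"
 shows "l \<in> slice \<omega> n"
proof -
 have "(%i. m i \<bullet> (F (y i) - \<omega>)) \<longlonglongrightarrow> n \<bullet> (F l - \<omega>)"
  by (intro tendsto_intros assms F_tendsto)
 then show ?thesis using assms(1) by (simp add: slice_def LIMSEQ_const_iff)
qed

text \<open>The situation produced by the persistence of compact sections.\<close>

definition section_nbhd :: "real^3 => real^3 => 'm set => 'm set => real => bool" where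
 "section_nbhd \<omega> e N K dl \<longleftrightarrow> open N & compact K & K <= N & dl > 0 &
  (\<forall>n. norm (n - e) < dl --> slice \<omega> n Int N <= K & slice \<omega> n Int N \<in> components (slice \<omega> n)) &
  (\<forall>n y V. norm (n - e) < dl --> y \<in> slice \<omega> n Int N --> open V --> y \<in> V -->
    (\<forall>\<^sub>F n' in nhds n. V Int slice \<omega> n' ~= {}))"

lemma section_nbhd_compact:
 assumes "section_nbhd \<omega> e N K dl" "norm (n - e) < dl"
 shows "compact (slice \<omega> n Int N)"
proof -
 have "slice \<omega> n Int N = slice \<omega> n Int K" using assms unfolding section_nbhd_def by blast
 then show ?thesis using assms closed_slice
  unfolding section_nbhd_def by (simp add: closed_Int_compact)
qed

text \<open>Every point of a section is a limit of points of sections that converge to it.\<close>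

lemma section_points_limit:
 assumes sn: "section_nbhd \<omega> e N K dl" and n: "norm (n - e) < dl" and m: "m \<longlonglongrightarrow> n"
  and md: "!!i. norm (m i - e) < dl" and y: "y \<in> slice \<omega> n Int N"
 obtains z where "!!i. z i \<in> slice \<omega> (m i) Int N" "(%i. F (z i)) \<longlonglongrightarrow> F y"
proof -
 have "\<exists>z\<in>slice \<omega> (m i) Int N. \<forall>x\<in>slice \<omega> (m i) Int N. dist (F z) (F y) <= dist (F x) (F y)" for i
 proof (rule continuous_attains_inf)
  show "compact (slice \<omega> (m i) Int N)" by (rule section_nbhd_compact[OF sn md])
  have "slice \<omega> (m i) Int N \<in> components (slice \<omega> (m i))" using sn md unfolding section_nbhd_def by blast
  then show "slice \<omega> (m i) Int N ~= {}" by (rule in_components_nonempty)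
  show "continuous_on (slice \<omega> (m i) Int N) (%z. dist (F z) (F y))" by (intro continuous_intros)
 qed
 then obtain z where z: "!!i. z i \<in> slice \<omega> (m i) Int N"
  "!!i x. x \<in> slice \<omega> (m i) Int N ==> dist (F (z i)) (F y) <= dist (F x) (F y)" by metis
 have "(%i. F (z i)) \<longlonglongrightarrow> F y"
 proof (rule tendstoI)
  fix eps :: real assume e: "eps > 0"
  let ?V = "N Int F -` ball (F y) eps"
  have "open ?V" using sn by (intro open_Int open_vimage F_cont) (auto simp: section_nbhd_def)
  moreover have "y \<in> ?V" using y e by auto
  ultimately have "\<forall>\<^sub>F n' in nhds n. ?V Int slice \<omega> n' ~= {}"
   using sn n y unfolding section_nbhd_def by blast
  then have "\<forall>\<^sub>F i in sequentially. ?V Int slice \<omega> (m i) ~= {}"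
   using m unfolding filterlim_iff by blast
  then show "\<forall>\<^sub>F i in sequentially. dist (F (z i)) (F y) < eps"
  proof (rule eventually_mono)
   fix i assume "?V Int slice \<omega> (m i) ~= {}"
   then obtain x where "x \<in> ?V Int slice \<omega> (m i)" by blast
   then have "x \<in> slice \<omega> (m i) Int N" "dist (F y) (F x) < eps" by auto
   then show "dist (F (z i)) (F y) < eps" using le_less_trans[OF z(2)[of x i]] by (simp add: dist_commute)
  qed
 qed
 then show thesis using that z(1) by blast
qed

lemma centred_limit:
 assumes sn: "section_nbhd \<omega> e N K dl" and n: "norm (n - e) < dl" and m: "m \<longlonglongrightarrow> n"
  and md: "!!i. norm (m i - e) < dl"
  and c: "!!i. centred (slice \<omega> (m i) Int N) (c i)" "c \<longlonglongrightarrow> d"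
 shows "centred (slice \<omega> n Int N) d"
 unfolding centred_def
proof
 fix p assume "p \<in> F ` (slice \<omega> n Int N)"
 then obtain y where y: "y \<in> slice \<omega> n Int N" "p = F y" by blast
 obtain z where z: "!!i. z i \<in> slice \<omega> (m i) Int N" "(%i. F (z i)) \<longlonglongrightarrow> F y"
  by (rule section_points_limit[OF sn n m md y(1)]) (rule that)
 have "\<exists>x. x \<in> slice \<omega> (m i) Int N & F x = 2 *\<^sub>R c i - F (z i)" for i
  using c(1)[of i] z(1)[of i] unfolding centred_def by force
 then obtain x where x: "!!i. x i \<in> slice \<omega> (m i) Int N" "!!i. F (x i) = 2 *\<^sub>R c i - F (z i)" by metis
 have "x i \<in> K" for i using x(1)[of i] sn md[of i] unfolding section_nbhd_def by blast
 then obtain l ph where l: "l \<in> K" "strict_mono ph" "(%i. x (ph i)) \<longlonglongrightarrow> l"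
  using compact_subseq[of K x] sn unfolding section_nbhd_def by blast
 have m': "(%i. m (ph i)) \<longlonglongrightarrow> n" using LIMSEQ_subseq_LIMSEQ[OF m l(2)] by (simp add: o_def)
 have "l \<in> slice \<omega> n" by (rule slice_limit[OF _ m' l(3)]) (use x in blast)
 moreover have "l \<in> N" using l(1) sn unfolding section_nbhd_def by blast
 moreover have "F l = 2 *\<^sub>R d - p"
 proof (rule LIMSEQ_unique)
  show "(%i. F (x (ph i))) \<longlonglongrightarrow> F l" by (rule F_tendsto[OF l(3)])
  have "(%i. 2 *\<^sub>R c i - F (z i)) \<longlonglongrightarrow> 2 *\<^sub>R d - F y" by (intro tendsto_intros c z)
  from LIMSEQ_subseq_LIMSEQ[OF this l(2)]
  show "(%i. F (x (ph i))) \<longlonglongrightarrow> 2 *\<^sub>R d - p" by (simp add: x(2) y(2) o_def)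
 qed
 ultimately show "2 *\<^sub>R d - p \<in> F ` (slice \<omega> n Int N)" by (metis IntI imageI)
qed

lemma centres_bounded:
 assumes sn: "section_nbhd \<omega> e N K dl"
 obtains R where "!!n c. norm (n - e) < dl ==> centred (slice \<omega> n Int N) c ==> norm c <= R"
proof -
 have "compact (F ` K)" using sn by (intro compact_continuous_image continuous_on_subset[OF F_cont]) (auto simp: section_nbhd_def)
 then have "bounded (F ` K)" by (rule compact_imp_bounded)
 then obtain R where R: "!!x. x \<in> K ==> norm (F x) <= R" unfolding bounded_iff by blast
 show thesis
 proof (rule that[of R])
  fix n c assume n: "norm (n - e) < dl" and c: "centred (slice \<omega> n Int N) c"
  have sub: "slice \<omega> n Int N <= K" and "slice \<omega> n Int N \<in> components (slice \<omega> n)"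
   using sn n unfolding section_nbhd_def by blast+
  then obtain y where y: "y \<in> slice \<omega> n Int N" using in_components_nonempty by blast
  then obtain z where z: "z \<in> slice \<omega> n Int N" "2 *\<^sub>R c - F y = F z" using c unfolding centred_def by blast
  have "2 *\<^sub>R c = F y + F z" using z(2) by (simp add: algebra_simps)
  then have "norm (2 *\<^sub>R c) <= norm (F y) + norm (F z)" by (simp add: norm_triangle_ineq)
  also have "\<dots> <= R + R" using R y z(1) sub by (intro add_mono) blast+
  finally show "norm c <= R" by simp
 qed
qed

text \<open>Otherwise a sequence of centres, bounded by the previous lemma, would accumulate at another
 centre of the limiting section, which has only one.\<close>

lemma centres_converge:
 assumes sn: "section_nbhd \<omega> e N K dl" and c: "centred (slice \<omega> e Int N) c" and eps: "eps > 0"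
 obtains d where "0 < d" "d <= dl"
  "!!n c'. norm (n - e) < d ==> centred (slice \<omega> n Int N) c' ==> norm (c' - c) < eps"
proof (rule ccontr)
 assume neg: "\<not> thesis"
 have dl: "dl > 0" using sn by (simp add: section_nbhd_def)
 have "\<exists>n c'. norm (n - e) < min dl (inverse (real (Suc i))) & centred (slice \<omega> n Int N) c' & \<not> norm (c' - c) < eps" for i
 proof (rule ccontr)
  assume "\<nexists>n c'. norm (n - e) < min dl (inverse (real (Suc i))) & centred (slice \<omega> n Int N) c' & \<not> norm (c' - c) < eps"
  then have thesis using dl by (intro that[of "min dl (inverse (real (Suc i)))"]) auto
  then show False using neg by blast
 qed
 then obtain m b where m: "!!i. norm (m i - e) < min dl (inverse (real (Suc i)))"
  "!!i. centred (slice \<omega> (m i) Int N) (b i)" "!!i. \<not> norm (b i - c) < eps" by metis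
 obtain R where R: "!!n c. norm (n - e) < dl ==> centred (slice \<omega> n Int N) c ==> norm c <= R"
  using centres_bounded[OF sn] by blast
 have md: "norm (m i - e) < dl" for i using m(1)[of i] by simp
 have "b i \<in> cball 0 R" for i using R[OF md m(2)] by simp
 then obtain l ph where l: "strict_mono ph" "(b \<circ> ph) \<longlonglongrightarrow> l"
  using compact_cball[of 0 R] unfolding compact_def by metis
 have "m \<longlonglongrightarrow> e"
 proof (rule LIM_zero_cancel, rule Lim_null_comparison)
  show "\<forall>\<^sub>F i in sequentially. norm (m i - e) <= inverse (real (Suc i))" using m(1) by (auto simp: less_imp_le)
  show "(%i. inverse (real (Suc i))) \<longlonglongrightarrow> 0" by (rule LIMSEQ_inverse_real_of_nat)
 qed
 from LIMSEQ_subseq_LIMSEQ[OF this l(1)] have m': "(m \<circ> ph) \<longlonglongrightarrow> e" .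
 have "centred (slice \<omega> e Int N) l"
  by (rule centred_limit[OF sn _ m' _ _ l(2)]) (use dl md m(2) in auto)
 moreover have "bounded (F ` (slice \<omega> e Int N))"
  using section_nbhd_compact[OF sn, of e] dl
  by (intro compact_imp_bounded compact_continuous_image continuous_on_subset[OF F_cont]) auto
 moreover obtain y where "y \<in> slice \<omega> e Int N"
  using sn dl in_components_nonempty[of "slice \<omega> e Int N" "slice \<omega> e"] unfolding section_nbhd_def by fastforce
 ultimately have "l = c"
  using symmetric_bounded_center_unique[of "F ` (slice \<omega> e Int N)" "F y" l c] c unfolding centred_def by blast
 have "(%i. norm ((b \<circ> ph) i - c)) \<longlonglongrightarrow> norm (l - c)" by (intro tendsto_intros l)
 moreover have "eps <= norm ((b \<circ> ph) i - c)" for i using m(3)[of "ph i"] by simp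
 ultimately have "eps <= norm (l - c)" by (intro LIMSEQ_le_const) auto
 then show False using \<open>l = c\<close> eps by simp
qed

end

context immersed_surface
begin

lemma section_nbhd_shrink:
 "section_nbhd \<omega> e N K dl ==> 0 < dl' ==> dl' <= dl ==> section_nbhd \<omega> e N K dl'"
 unfolding section_nbhd_def by (meson less_le_trans)

text \<open>Near the double point \<open>c\<close> a section consists of an arc on each of two transversal sheets. If
 the section has a centre \<open>c'\<close> near \<open>c\<close>, the reflection cannot map a piece of one arc to the
 other one, as their directions differ. So it maps the arc on the first sheet to itself, and
 the point of this arc that has the coordinate of \<open>c'\<close> is \<open>c'\<close>.\<close>

lemma centre_on_sheet:
 assumes N: "slice \<omega> n Int B1 <= N"
  and bij: "bij_betw (%y. d \<bullet> (F y - F x1)) (slice \<omega> n Int B1) {-r<..<r}"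
  and lip: "!!y z. y \<in> B1 ==> z \<in> B1 ==>
   norm (F y - F z) <= L * (\<bar>d \<bullet> (F y - F z)\<bar> + \<bar>e \<bullet> (F y - F z)\<bar>)"
  and L: "L > 0" "L * norm (n - e) <= 1 / 2"
  and cen: "centred (slice \<omega> n Int N) c'" and lc: "\<bar>d \<bullet> (c' - F x1)\<bar> < r" and et: "et > 0"
  and near: "!!a z. a \<in> slice \<omega> n Int B1 ==> \<bar>d \<bullet> (F a - c')\<bar> < et ==> z \<in> slice \<omega> n Int N ==>
   F z = 2 *\<^sub>R c' - F a ==> z \<in> B1 \<or> z \<in> B2"
  and tr: "!!a a' z z'. a \<in> slice \<omega> n Int B1 ==> a' \<in> slice \<omega> n Int B1 ==> z \<in> slice \<omega> n Int B2 ==>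
   z' \<in> slice \<omega> n Int B2 ==> F a - F a' = F z' - F z ==> F a = F a'"
 shows "c' \<in> F ` (slice \<omega> n Int B1)"
proof -
 let ?f = "%y. d \<bullet> (F y - F x1)"
 define s where "s = inv_into (slice \<omega> n Int B1) ?f"
 have s: "s l \<in> slice \<omega> n Int B1" "d \<bullet> (F (s l) - F x1) = l" if "l \<in> {-r<..<r}" for l
  using bij_betw_inv_into_right[OF bij that] bij_betwE[OF bij_betw_inv_into[OF bij]] that
  by (auto simp: s_def)
 have s_eq: "y = s l" if "y \<in> slice \<omega> n Int B1" "d \<bullet> (F y - F x1) = l" for y l
  using bij_betw_inv_into_left[OF bij that(1)] that(2) by (simp add: s_def)
 have sl: "norm (F (s l) - F (s m)) <= 2 * L * \<bar>l - m\<bar>" if "l \<in> {-r<..<r}" "m \<in> {-r<..<r}" for l m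
 proof -
  let ?w = "F (s l) - F (s m)"
  have "F (s l) - F (s m) = (F (s l) - F x1) - (F (s m) - F x1)" by simp
  then have 1: "d \<bullet> ?w = l - m" using s(2)[OF that(1)] s(2)[OF that(2)] by (simp add: inner_diff_right)
  have "n \<bullet> ?w = n \<bullet> (F (s l) - \<omega>) - n \<bullet> (F (s m) - \<omega>)" by (simp add: inner_diff_right)
  then have "n \<bullet> ?w = 0" using s(1)[OF that(1)] s(1)[OF that(2)] by (simp add: slice_def)
  then have "\<bar>e \<bullet> ?w\<bar> = \<bar>(n - e) \<bullet> ?w\<bar>" by (simp add: inner_diff_left)
  also have "\<dots> <= norm (n - e) * norm ?w" by (rule Cauchy_Schwarz_ineq2)
  finally have "L * \<bar>e \<bullet> ?w\<bar> <= L * (norm (n - e) * norm ?w)" using L(1) by simp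
  also have "\<dots> <= 1 / 2 * norm ?w" using mult_right_mono[OF L(2), of "norm ?w"] by (simp add: mult.assoc)
  finally have 2: "L * \<bar>e \<bullet> ?w\<bar> <= 1 / 2 * norm ?w" .
  have "norm ?w <= L * (\<bar>d \<bullet> ?w\<bar> + \<bar>e \<bullet> ?w\<bar>)"
   using s(1)[OF that(1)] s(1)[OF that(2)] by (intro lip) auto
  then have "norm ?w <= L * \<bar>l - m\<bar> + 1 / 2 * norm ?w"
   using 2 unfolding 1 distrib_left by linarith
  then show ?thesis by simp
 qed
 define k where "k = d \<bullet> (c' - F x1)"
 have k: "k \<in> {-r<..<r}" using lc by (auto simp: k_def)
 have "\<exists>z. l \<in> {-r<..<r} --> z \<in> slice \<omega> n Int N & F z = 2 *\<^sub>R c' - F (s l)" for l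
 proof (cases "l \<in> {-r<..<r}")
  case True
  then have "F (s l) \<in> F ` (slice \<omega> n Int N)" using s(1)[OF True] N by blast
  then have "2 *\<^sub>R c' - F (s l) \<in> F ` (slice \<omega> n Int N)" using cen unfolding centred_def by blast
  then obtain z where "z \<in> slice \<omega> n Int N" "2 *\<^sub>R c' - F (s l) = F z" by blast
  then show ?thesis by metis
 qed blast
 then obtain z where z: "!!l. l \<in> {-r<..<r} ==> z l \<in> slice \<omega> n Int N"
  "!!l. l \<in> {-r<..<r} ==> F (z l) = 2 *\<^sub>R c' - F (s l)" by metis
 have fz: "d \<bullet> (F (z l) - F x1) = 2 * k - l" if "l \<in> {-r<..<r}" for l
 proof -
  have "F (z l) - F x1 = (c' - F x1) + (c' - F x1) - (F (s l) - F x1)"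
   unfolding z(2)[OF that] by (simp add: scaleR_2)
  then have "d \<bullet> (F (z l) - F x1) = d \<bullet> (c' - F x1) + d \<bullet> (c' - F x1) - d \<bullet> (F (s l) - F x1)"
   by (simp only: inner_diff_right[of d "(c' - F x1) + (c' - F x1)"] inner_add_right)
  then show ?thesis using s(2)[OF that] by (simp add: k_def)
 qed
 have zB: "z l \<in> B1 \<or> z l \<in> B2" if "l \<in> {-r<..<r}" "\<bar>l - k\<bar> < et" for l
 proof (rule near[OF s(1)[OF that(1)] _ z[OF that(1)]])
  have "F (s l) - c' = (F (s l) - F x1) - (c' - F x1)" by simp
  then have "d \<bullet> (F (s l) - c') = l - k" using s(2)[OF that(1)] by (simp only: inner_diff_right k_def)
  then show "\<bar>d \<bullet> (F (s l) - c')\<bar> < et" using that(2) by simp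
 qed
 have "F (s k) = c'"
 proof (cases "z k \<in> B1")
  case True
  then have "z k = s k" using s_eq[of "z k" k] z(1)[OF k] fz[OF k] by auto
  then have "2 *\<^sub>R F (s k) = 2 *\<^sub>R c'" using z(2)[OF k] by (simp add: scaleR_2 algebra_simps)
  then show ?thesis by simp
 next
  case False
  then have zk: "z k \<in> slice \<omega> n Int B2" using zB[OF k] z(1)[OF k] et by auto
  define \<mu> where "\<mu> = min et (r - \<bar>k\<bar>)"
  have \<mu>: "\<mu> > 0" using k et by (auto simp: \<mu>_def)
  have small: "norm (F (s k) - c') <= 2 * L * t" if t: "0 < t" "t < \<mu>" for t
  proof -
   have I: "k + t \<in> {-r<..<r}" "k - t \<in> {-r<..<r}" using t by (auto simp: \<mu>_def)
   have "\<not> z (k + t) \<in> B2"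
   proof
    assume "z (k + t) \<in> B2"
    then have "z (k + t) \<in> slice \<omega> n Int B2" using z(1)[OF I(1)] by blast
    moreover have "F (s (k + t)) - F (s k) = F (z k) - F (z (k + t))"
     unfolding z(2)[OF k] z(2)[OF I(1)] by simp
    ultimately have "F (s (k + t)) = F (s k)" using tr[OF s(1)[OF I(1)] s(1)[OF k] _ zk] by blast
    then show False using s(2)[OF I(1)] s(2)[OF k] t by simp
   qed
   then have "z (k + t) \<in> slice \<omega> n Int B1" using zB[OF I(1)] z(1)[OF I(1)] t by (auto simp: \<mu>_def)
   then have "z (k + t) = s (k - t)" using s_eq[of "z (k + t)" "k - t"] fz[OF I(1)] by simp
   then have sum: "F (s (k - t)) + F (s (k + t)) = 2 *\<^sub>R c'" using z(2)[OF I(1)] by simp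
   have "2 *\<^sub>R (F (s k) - c') = (F (s k) - F (s (k - t))) + (F (s k) - F (s (k + t)))"
    using sum by (simp add: scaleR_2 algebra_simps)
   then have "norm (2 *\<^sub>R (F (s k) - c')) <= norm (F (s k) - F (s (k - t))) + norm (F (s k) - F (s (k + t)))"
    by (simp only: norm_triangle_ineq)
   also have "\<dots> <= 2 * L * \<bar>k - (k - t)\<bar> + 2 * L * \<bar>k - (k + t)\<bar>"
    by (intro add_mono sl k I)
   finally show ?thesis using t by simp
  qed
  have "norm (F (s k) - c') <= 0 + eps" if e: "eps > 0" for eps
  proof -
   let ?t = "min (\<mu> / 2) (eps / (2 * L))"
   have "norm (F (s k) - c') <= 2 * L * ?t" using \<mu> e L(1) by (intro small) auto
   also have "\<dots> <= 2 * L * (eps / (2 * L))" using L(1) by (intro mult_left_mono) auto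
   finally show ?thesis using L(1) by simp
  qed
  then have "norm (F (s k) - c') <= 0" by (rule field_le_epsilon)
  then show ?thesis by simp
 qed
 then show ?thesis using s(1)[OF k] by blast
qed

lemma centres_on_sheet:
 assumes sn: "section_nbhd \<omega> e N K dl" and cen: "centred (slice \<omega> e Int N) c"
  and x1: "x1 \<in> slice \<omega> e Int N" "F x1 = c" and B: "open B1" "open B2" "B1 <= N" "x1 \<in> B1"
  and pre: "!!x. x \<in> slice \<omega> e Int N ==> F x = c ==> x \<in> B1 \<or> x \<in> B2"
  and bij: "!!n. norm (n - e) < dl1 ==> bij_betw (%y. d \<bullet> (F y - F x1)) (slice \<omega> n Int B1) {-r<..<r}"
  and lip: "!!y z. y \<in> B1 ==> z \<in> B1 ==>
   norm (F y - F z) <= L * (\<bar>d \<bullet> (F y - F z)\<bar> + \<bar>e \<bullet> (F y - F z)\<bar>)"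
  and pos: "L > 0" "dl1 > 0" "r > 0" "C > 0"
  and tr: "!!a a' z z'. a \<in> B1 ==> a' \<in> B1 ==> z \<in> B2 ==> z' \<in> B2 ==> F a - F a' = F z' - F z ==>
   norm (F a - F a') <= C * \<bar>e \<bullet> (F a - F a')\<bar>"
 obtains \<kappa> where "\<kappa> > 0" "!!n c'. norm (n - e) < \<kappa> ==> centred (slice \<omega> n Int N) c' ==> c' \<in> F ` (slice \<omega> n Int B1)"
proof -
 have snd: "open N" "compact K" "K <= N" "dl > 0" using sn by (auto simp: section_nbhd_def)
 have sK: "slice \<omega> n Int N <= K" if "norm (n - e) < dl" for n using sn that unfolding section_nbhd_def by blast
 let ?C0 = "K - (B1 \<union> B2)"
 have ec: "e \<bullet> (c - \<omega>) = 1" using x1 by (auto simp: slice_def)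
 have cF: "closed (F ` ?C0)"
  by (intro compact_imp_closed compact_continuous_image continuous_on_subset[OF F_cont] compact_diff snd open_Un B) auto
 have "c \<notin> F ` ?C0"
 proof
  assume "c \<in> F ` ?C0"
  then obtain y where y: "y \<in> K" "y \<notin> B1" "y \<notin> B2" "F y = c" by blast
  then have "y \<in> slice \<omega> e Int N" using ec snd(3) by (auto simp: slice_def)
  then show False using pre y by blast
 qed
 then obtain rh0 where rh0: "rh0 > 0" "ball c rh0 <= - F ` ?C0"
  using openE[of "- F ` ?C0" c] cF by (auto simp: open_Compl)
 have "compact ((%y. F y - \<omega>) ` K)" by (intro compact_continuous_image continuous_intros snd)
 then have "bounded ((%y. F y - \<omega>) ` K)" by (rule compact_imp_bounded)
 then obtain R where R: "R > 0" "!!y. y \<in> K ==> norm (F y - \<omega>) <= R"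
  unfolding bounded_pos by blast
 define D where "D = norm d + 1"
 have D: "D > 0" "norm d <= D" by (auto simp: D_def add_nonneg_pos)
 define rh where "rh = min (rh0 / 8) (min (rh0 / (8 * L * D)) (r / D))"
 have rh: "rh > 0" using rh0 pos D by (simp add: rh_def)
 obtain \<kappa>1 where \<kappa>1: "0 < \<kappa>1" "\<kappa>1 <= dl"
  "!!n c'. norm (n - e) < \<kappa>1 ==> centred (slice \<omega> n Int N) c' ==> norm (c' - c) < rh"
  using centres_converge[OF sn cen rh] by blast
 define \<kappa> where "\<kappa> = min (min \<kappa>1 dl1) (min (rh0 / (8 * L * R)) (min (1 / (2 * L)) (1 / (2 * C))))"
 have \<kappa>: "\<kappa> > 0" using \<kappa>1 pos rh0 R by (simp add: \<kappa>_def)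
 show thesis
 proof (rule that[OF \<kappa>])
  fix n c' assume n: "norm (n - e) < \<kappa>" and c': "centred (slice \<omega> n Int N) c'"
  have n1: "norm (n - e) < \<kappa>1" "norm (n - e) < dl1" "norm (n - e) < dl" "norm (n - e) <= rh0 / (8 * L * R)"
   "norm (n - e) <= 1 / (2 * L)" "norm (n - e) <= 1 / (2 * C)"
   using n \<kappa>1(2) by (auto simp: \<kappa>_def)
  have c'c: "norm (c' - c) < rh" by (rule \<kappa>1(3)[OF n1(1) c'])
  have dc: "\<bar>d \<bullet> (c' - c)\<bar> <= D * norm (c' - c)"
   using Cauchy_Schwarz_ineq2[of d "c' - c"] mult_right_mono[OF D(2) norm_ge_zero, of "c' - c"] by linarith
  have "D * norm (c' - c) < D * rh" using c'c D(1) by (rule mult_strict_left_mono)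
  then have dc1: "\<bar>d \<bullet> (c' - c)\<bar> < D * rh" using dc by linarith
  have Drh: "D * rh <= r" "D * rh <= rh0 / (8 * L)"
  proof -
   have "D * rh <= D * (r / D)" using D(1) by (intro mult_left_mono) (auto simp: rh_def)
   then show "D * rh <= r" using D(1) by simp
   have "D * rh <= D * (rh0 / (8 * L * D))" using D(1) by (intro mult_left_mono) (auto simp: rh_def)
   then show "D * rh <= rh0 / (8 * L)" using D(1) by simp
  qed
  show "c' \<in> F ` (slice \<omega> n Int B1)"
  proof (rule centre_on_sheet[where N = N and d = d and ?x1.0 = x1 and r = r and L = L and e = e and ?B2.0 = B2])
   show "slice \<omega> n Int B1 <= N" using B by blast
   show "bij_betw (%y. d \<bullet> (F y - F x1)) (slice \<omega> n Int B1) {- r<..<r}" by (rule bij[OF n1(2)])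
   show "L * norm (n - e) <= 1 / 2" using mult_left_mono[OF n1(5), of L] pos(1) by simp
   show "\<bar>d \<bullet> (c' - F x1)\<bar> < r" using dc1 Drh(1) x1(2) by simp
   show "rh0 / (8 * L) > 0" using rh0 pos by simp
  next
   fix a z assume a: "a \<in> slice \<omega> n Int B1" "\<bar>d \<bullet> (F a - c')\<bar> < rh0 / (8 * L)"
    and z: "z \<in> slice \<omega> n Int N" "F z = 2 *\<^sub>R c' - F a"
   have aK: "a \<in> K" "z \<in> K" using sK[OF n1(3)] a(1) z(1) B(3) by blast+
   have "d \<bullet> (F a - F x1) = d \<bullet> (F a - c') + d \<bullet> (c' - c)" using x1(2) by (simp add: inner_diff_right)
   then have 1: "\<bar>d \<bullet> (F a - F x1)\<bar> <= rh0 / (8 * L) + rh0 / (8 * L)" using a(2) dc1 Drh(2) by linarith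
   have "e \<bullet> (F a - F x1) = e \<bullet> (F a - \<omega>) - e \<bullet> (F x1 - \<omega>)" by (simp add: inner_diff_right)
   then have "e \<bullet> (F a - F x1) = - ((n - e) \<bullet> (F a - \<omega>))" using a(1) x1(1) by (simp add: slice_def inner_diff_left)
   then have "\<bar>e \<bullet> (F a - F x1)\<bar> <= norm (n - e) * norm (F a - \<omega>)" by (simp add: Cauchy_Schwarz_ineq2)
   also have "\<dots> <= rh0 / (8 * L * R) * R" using n1(4) R aK rh0 pos by (intro mult_mono) auto
   also have "\<dots> = rh0 / (8 * L)" using R(1) by simp
   finally have 2: "\<bar>e \<bullet> (F a - F x1)\<bar> <= rh0 / (8 * L)" .
   have "norm (F a - F x1) <= L * (\<bar>d \<bullet> (F a - F x1)\<bar> + \<bar>e \<bullet> (F a - F x1)\<bar>)"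
    using a(1) B(4) by (intro lip) auto
   also have "\<dots> <= L * (3 * (rh0 / (8 * L)))" using 1 2 pos(1) by (intro mult_left_mono) auto
   also have "\<dots> = 3 * rh0 / 8" using pos(1) by simp
   finally have 3: "norm (F a - c) <= 3 * rh0 / 8" using x1(2) by simp
   have "F z - c = 2 *\<^sub>R (c' - c) - (F a - c)" using z(2) by (simp add: scaleR_2)
   then have "norm (F z - c) <= norm (2 *\<^sub>R (c' - c)) + norm (F a - c)" by (simp only: norm_triangle_ineq4)
   moreover have "norm (2 *\<^sub>R (c' - c)) <= 2 * (rh0 / 8)" using c'c by (simp add: rh_def)
   ultimately have "norm (F z - c) < rh0" using 3 rh0(1) by linarith
   then have "F z \<in> ball c rh0" by (simp add: dist_norm norm_minus_commute)
   then have "F z \<notin> F ` ?C0" using rh0(2) by blast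
   then show "z \<in> B1 \<or> z \<in> B2" using aK by blast
  next
   fix a a' z z' assume a: "a \<in> slice \<omega> n Int B1" "a' \<in> slice \<omega> n Int B1"
    "z \<in> slice \<omega> n Int B2" "z' \<in> slice \<omega> n Int B2" and eq: "F a - F a' = F z' - F z"
   let ?w = "F a - F a'"
   have "n \<bullet> ?w = n \<bullet> (F a - \<omega>) - n \<bullet> (F a' - \<omega>)" by (simp add: inner_diff_right)
   then have "n \<bullet> ?w = 0" using a by (simp add: slice_def)
   then have "\<bar>e \<bullet> ?w\<bar> = \<bar>(n - e) \<bullet> ?w\<bar>" by (simp add: inner_diff_left)
   also have "\<dots> <= norm (n - e) * norm ?w" by (rule Cauchy_Schwarz_ineq2)
   finally have "C * \<bar>e \<bullet> ?w\<bar> <= C * (norm (n - e) * norm ?w)" using pos by simp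
   also have "\<dots> <= C * (1 / (2 * C) * norm ?w)" using n1(6) pos by (intro mult_left_mono mult_right_mono) auto
   also have "\<dots> = norm ?w / 2" using pos by simp
   finally have "C * \<bar>e \<bullet> ?w\<bar> <= norm ?w / 2" .
   moreover have "norm ?w <= C * \<bar>e \<bullet> ?w\<bar>" using a by (intro tr[OF _ _ _ _ eq]) auto
   ultimately have "norm ?w <= 0" by linarith
   then show "F a = F a'" by simp
  qed (use lip pos c' in auto)
 qed
qed

end

context immersed_surface
begin

text \<open>The cross-cut \<open>\<Gamma>\<close> of the plane given by \<open>e\<close> is transversal, isolated from the rest of the section, centred at
 \<open>c\<close>, and \<open>c\<close> is a double point of it. The set \<open>N0\<close> replaces the statement that \<open>\<Gamma>\<close> is a component; this form is
 stable under moving the loop along a ruling.\<close>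

definition centred_loop :: "real^3 => real^3 => 'm set => real^3 => 'm => 'm => bool" where
 "centred_loop \<omega> e \<Gamma> c x1 x2 \<longleftrightarrow> compact \<Gamma> & connected \<Gamma> & (\<exists>N0. open N0 & slice \<omega> e Int N0 = \<Gamma>) &
  (\<forall>x\<in>\<Gamma>. cross3 (nu x) e ~= 0) &
  (\<forall>x\<in>\<Gamma>. \<forall>y\<in>\<Gamma>. x ~= y --> F x = F y --> indep3 (nu x) (nu y) e) &
  x1 ~= x2 & {x\<in>\<Gamma>. F x = c} = {x1, x2} & centred \<Gamma> c"

text \<open>The two sheets at \<open>c\<close> meet in a double curve \<open>Q\<close>, on which the height over the plane is a coordinate with Lipschitz
 inverse. The symmetric sections form a dense set, and limits of their centres are centres of the limiting sections, so
 all nearby sections are symmetric. Their centres are close to \<open>c\<close>, and lie on both sheets, hence on \<open>Q\<close>.\<close>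

lemma centres_are_crossings:
 assumes loop: "centred_loop \<omega> e \<Gamma> c x1 x2"
  and dense: "!!m r. r > 0 ==> \<exists>n. norm (n - m) < r &
   (\<forall>C\<in>components (slice \<omega> n). compact C --> (\<exists>c. centred C c))"
 obtains N K dl Q C where "section_nbhd \<omega> e N K dl" "slice \<omega> e Int N = \<Gamma>" "C > 0" "Q <= F ` K" "c \<in> Q"
  "!!q q'. q \<in> Q ==> q' \<in> Q ==> norm (q - q') <= C * \<bar>e \<bullet> (q - q')\<bar>"
  "!!n q q'. norm (n - e) < dl ==> q \<in> Q ==> q' \<in> Q ==> n \<bullet> (q - q') = 0 ==> q = q'"
  "!!n. norm (n - e) < dl ==> \<exists>q\<in>Q. n \<bullet> (q - \<omega>) = 1 & centred (slice \<omega> n Int N) q"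
proof -
 have \<Gamma>: "compact \<Gamma>" "connected \<Gamma>" and tr: "!!x. x \<in> \<Gamma> ==> cross3 (nu x) e ~= 0"
  and ind: "!!x y. x \<in> \<Gamma> ==> y \<in> \<Gamma> ==> x ~= y ==> F x = F y ==> indep3 (nu x) (nu y) e"
  and x12: "x1 ~= x2" "{x\<in>\<Gamma>. F x = c} = {x1, x2}" and cen: "centred \<Gamma> c"
  using loop unfolding centred_loop_def by blast+
 obtain N0 where N0: "open N0" "slice \<omega> e Int N0 = \<Gamma>" using loop unfolding centred_loop_def by blast
 have x: "x1 \<in> \<Gamma>" "x2 \<in> \<Gamma>" "F x1 = c" "F x2 = c" using x12(2) by blast+
 obtain N K dl0 where N: "open N" "\<Gamma> <= N" "N <= N0" "compact K" "K <= N" "dl0 > 0"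
  "!!n. norm (n - e) < dl0 ==> slice \<omega> n Int N <= K"
  "!!n. norm (n - e) < dl0 ==> slice \<omega> n Int N \<in> components (slice \<omega> n)"
  "!!n y V. norm (n - e) < dl0 ==> y \<in> slice \<omega> n Int N ==> open V ==> y \<in> V ==>
    \<forall>\<^sub>F n' in nhds n. V Int slice \<omega> n' ~= {}"
  by (rule nearby_sections[OF \<Gamma> _ N0 tr]) (use x(1) in blast)+
 have sn: "section_nbhd \<omega> e N K dl0" unfolding section_nbhd_def
  by (intro conjI allI impI N; assumption)
 have sN: "slice \<omega> e Int N = \<Gamma>" using N0(2) N(2,3) by blast
 have \<Gamma>K: "\<Gamma> <= K" using N(7)[of e] N(6) sN by simp
 obtain B where B: "B > 0" "!!w. B * norm w <= \<bar>nu x1 \<bullet> w\<bar> + \<bar>nu x2 \<bullet> w\<bar> + \<bar>e \<bullet> w\<bar>"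
  using indep3_coercive[OF ind[OF x(1,2) x12(1)]] x(3,4) by auto
 obtain U1 where U1: "open U1" "x1 \<in> U1"
  "!!y z. y \<in> U1 ==> z \<in> U1 ==> \<bar>nu x1 \<bullet> (F y - F z)\<bar> <= B / 4 * norm (F y - F z)"
  using secant[of "B / 4" x1] B(1) by auto
 obtain U2 where U2: "open U2" "x2 \<in> U2"
  "!!y z. y \<in> U2 ==> z \<in> U2 ==> \<bar>nu x2 \<bullet> (F y - F z)\<bar> <= B / 4 * norm (F y - F z)"
  using secant[of "B / 4" x2] B(1) by auto
 define C where "C = 2 / B"
 have C: "C > 0" using B by (simp add: C_def)
 have T: "norm (F a - F a') <= C * \<bar>e \<bullet> (F a - F a')\<bar>"
  if "a \<in> U1" "a' \<in> U1" "z \<in> U2" "z' \<in> U2" "F a - F a' = F z' - F z" for a a' z z'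
 proof -
  let ?w = "F a - F a'"
  have "\<bar>nu x1 \<bullet> ?w\<bar> <= B / 4 * norm ?w" by (rule U1(3)[OF that(1,2)])
  moreover have "\<bar>nu x2 \<bullet> ?w\<bar> <= B / 4 * norm ?w" unfolding that(5) by (rule U2(3)[OF that(4,3)])
  ultimately have "B / 2 * norm ?w <= \<bar>e \<bullet> ?w\<bar>" using B(2)[of ?w] by linarith
  then have "2 / B * (B / 2 * norm ?w) <= 2 / B * \<bar>e \<bullet> ?w\<bar>" using B(1) by (intro mult_left_mono) auto
  then show ?thesis using B(1) by (simp add: C_def)
 qed
 obtain V1 K1 where V1: "open V1" "compact K1" "x1 \<in> V1" "V1 <= K1" "K1 <= U1 Int N"
  using compact_neighbourhood[of "U1 Int N" x1] U1(1,2) N(1,2) x(1) by blast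
 obtain V2 K2 where V2: "open V2" "compact K2" "x2 \<in> V2" "V2 <= K2" "K2 <= U2 Int N"
  using compact_neighbourhood[of "U2 Int N" x2] U2(1,2) N(1,2) x(2) by blast
 have xs: "x1 \<in> slice \<omega> e" "x2 \<in> slice \<omega> e" using x(1,2) sN by blast+
 obtain B1 dl1 r1 L1 where B1: "open B1" "x1 \<in> B1" "B1 <= V1" "dl1 > 0" "r1 > 0" "L1 > 0"
  "!!y z. y \<in> B1 ==> z \<in> B1 ==>
   norm (F y - F z) <= L1 * (\<bar>cross3 (nu x1) e \<bullet> (F y - F z)\<bar> + \<bar>e \<bullet> (F y - F z)\<bar>)"
  "!!n. norm (n - e) < dl1 ==> bij_betw (%y. cross3 (nu x1) e \<bullet> (F y - F x1)) (slice \<omega> n Int B1) {-r1<..<r1}"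
  by (rule section_box[OF xs(1) tr[OF x(1)] V1(1,3)]) (rule that)
 obtain B2 dl2 r2 L2 where B2: "open B2" "x2 \<in> B2" "B2 <= V2" "dl2 > 0" "r2 > 0" "L2 > 0"
  "!!y z. y \<in> B2 ==> z \<in> B2 ==>
   norm (F y - F z) <= L2 * (\<bar>cross3 (nu x2) e \<bullet> (F y - F z)\<bar> + \<bar>e \<bullet> (F y - F z)\<bar>)"
  "!!n. norm (n - e) < dl2 ==> bij_betw (%y. cross3 (nu x2) e \<bullet> (F y - F x2)) (slice \<omega> n Int B2) {-r2<..<r2}"
  by (rule section_box[OF xs(2) tr[OF x(2)] V2(1,3)]) (rule that)
 have sub: "B1 <= U1" "B1 <= N" "B1 <= K1" "B2 <= U2" "B2 <= N" "B2 <= K2" using V1 V2 B1(3) B2(3) by blast+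
 have cen': "centred (slice \<omega> e Int N) c" using cen sN by simp
 have pre: "y = x1 \<or> y = x2" if "y \<in> slice \<omega> e Int N" "F y = c" for y using that sN x12(2) by blast
 obtain \<kappa>1 where \<kappa>1: "\<kappa>1 > 0" "!!n c'. norm (n - e) < \<kappa>1 ==> centred (slice \<omega> n Int N) c' ==> c' \<in> F ` (slice \<omega> n Int B1)"
 proof (rule centres_on_sheet[OF sn cen' _ x(3) B1(1) B2(1) sub(2) B1(2) _ B1(8) B1(7) B1(6,4,5) C])
  show "x1 \<in> slice \<omega> e Int N" using x(1) sN by blast
  show "y \<in> B1 \<or> y \<in> B2" if "y \<in> slice \<omega> e Int N" "F y = c" for y using pre[OF that] B1(2) B2(2) by blast
  show "norm (F a - F a') <= C * \<bar>e \<bullet> (F a - F a')\<bar>"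
   if "a \<in> B1" "a' \<in> B1" "z \<in> B2" "z' \<in> B2" "F a - F a' = F z' - F z" for a a' z z'
   by (rule T[OF _ _ _ _ that(5)]) (use that sub in blast)+
 qed (assumption | rule that)+
 obtain \<kappa>2 where \<kappa>2: "\<kappa>2 > 0" "!!n c'. norm (n - e) < \<kappa>2 ==> centred (slice \<omega> n Int N) c' ==> c' \<in> F ` (slice \<omega> n Int B2)"
 proof (rule centres_on_sheet[OF sn cen' _ x(4) B2(1) B1(1) sub(5) B2(2) _ B2(8) B2(7) B2(6,4,5) C])
  show "x2 \<in> slice \<omega> e Int N" using x(2) sN by blast
  show "y \<in> B2 \<or> y \<in> B1" if "y \<in> slice \<omega> e Int N" "F y = c" for y using pre[OF that] B1(2) B2(2) by blast
  show "norm (F a - F a') <= C * \<bar>e \<bullet> (F a - F a')\<bar>"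
   if "a \<in> B2" "a' \<in> B2" "z \<in> B1" "z' \<in> B1" and eq: "F a - F a' = F z' - F z" for a a' z z'
  proof -
   have "norm (F z' - F z) <= C * \<bar>e \<bullet> (F z' - F z)\<bar>"
    by (rule T[of z' z a' a]) (use that sub in auto)
   then show ?thesis unfolding eq .
  qed
 qed (assumption | rule that)+
 define dl where "dl = min (min dl0 (1 / (2 * C))) (min \<kappa>1 \<kappa>2)"
 have dl: "dl > 0" "dl <= dl0" using N(6) \<kappa>1(1) \<kappa>2(1) C by (auto simp: dl_def)
 define Q where "Q = F ` K1 Int F ` K2 Int F ` K"
 have QC: "norm (q - q') <= C * \<bar>e \<bullet> (q - q')\<bar>" if qq: "q \<in> Q" "q' \<in> Q" for q q'
 proof -
  obtain a a' z z' where az: "a \<in> K1" "a' \<in> K1" "z \<in> K2" "z' \<in> K2" "q = F a" "q' = F a'" "q = F z" "q' = F z'"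
   using qq unfolding Q_def by blast
  have "norm (F a - F a') <= C * \<bar>e \<bullet> (F a - F a')\<bar>"
   by (rule T[of a a' z' z]) (use az V1(5) V2(5) in auto)
  then show ?thesis using az by simp
 qed
 have Qu: "q = q'" if n: "norm (n - e) < dl" and qq: "q \<in> Q" "q' \<in> Q" "n \<bullet> (q - q') = 0" for n q q'
 proof -
  let ?w = "q - q'"
  have "\<bar>e \<bullet> ?w\<bar> = \<bar>(n - e) \<bullet> ?w\<bar>" using qq(3) by (simp add: inner_diff_left)
  also have "\<dots> <= norm (n - e) * norm ?w" by (rule Cauchy_Schwarz_ineq2)
  also have "\<dots> <= 1 / (2 * C) * norm ?w" using n by (intro mult_right_mono) (auto simp: dl_def)
  finally have "C * \<bar>e \<bullet> ?w\<bar> <= C * (1 / (2 * C) * norm ?w)" using C by (intro mult_left_mono) auto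
  also have "\<dots> = norm ?w / 2" using C by simp
  finally have "norm ?w <= 0" using QC[OF qq(1,2)] by linarith
  then show ?thesis by simp
 qed
 have ex: "\<exists>q\<in>Q. n \<bullet> (q - \<omega>) = 1 & centred (slice \<omega> n Int N) q" if n: "norm (n - e) < dl" for n
 proof -
  have "\<exists>m c. norm (m - n) < min (inverse (real (Suc i))) (dl - norm (n - e)) & centred (slice \<omega> m Int N) c" for i
  proof -
   have "min (inverse (real (Suc i))) (dl - norm (n - e)) > 0" using n by simp
   from dense[OF this] obtain m where mm: "norm (m - n) < min (inverse (real (Suc i))) (dl - norm (n - e)) &
    (\<forall>C\<in>components (slice \<omega> m). compact C --> (\<exists>c. centred C c))" by (rule exE)
   note m = conjunct1[OF mm] conjunct2[OF mm]
   have "norm (m - e) <= norm (m - n) + norm (n - e)" using norm_triangle_ineq[of "m - n" "n - e"] by simp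
   then have me: "norm (m - e) < dl0" using m(1) dl(2) by simp
   have "\<exists>c. centred (slice \<omega> m Int N) c" 
    by (rule m(2)[THEN bspec, OF N(8)[OF me], THEN mp, OF section_nbhd_compact[OF sn me]])
   then obtain c where "centred (slice \<omega> m Int N) c" by (rule exE)
   then show ?thesis using m(1) by (intro exI conjI)
  qed
  then obtain m ci where m: "!!i. norm (m i - n) < min (inverse (real (Suc i))) (dl - norm (n - e))"
   "!!i. centred (slice \<omega> (m i) Int N) (ci i)" by metis
  have me: "norm (m i - e) < dl" for i
  proof -
   have "norm (m i - e) <= norm (m i - n) + norm (n - e)" using norm_triangle_ineq[of "m i - n" "n - e"] by simp
   then show ?thesis using m(1)[of i] by simp
  qed
  have ml: "m \<longlonglongrightarrow> n"
  proof (rule LIM_zero_cancel, rule Lim_null_comparison)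
   show "\<forall>\<^sub>F i in sequentially. norm (m i - n) <= inverse (real (Suc i))" using m(1) by (auto simp: less_imp_le)
   show "(%i. inverse (real (Suc i))) \<longlonglongrightarrow> 0" by (rule LIMSEQ_inverse_real_of_nat)
  qed
  have "\<exists>b. b \<in> slice \<omega> (m i) Int B1 & F b = ci i" for i
   using \<kappa>1(2)[OF _ m(2)[of i]] me[of i] unfolding dl_def by auto
  then obtain b where b: "!!i. b i \<in> slice \<omega> (m i) Int B1" "!!i. F (b i) = ci i" by metis
  have "\<exists>b. b \<in> slice \<omega> (m i) Int B2 & F b = ci i" for i
   using \<kappa>2(2)[OF _ m(2)[of i]] me[of i] unfolding dl_def by auto
  then obtain d where d: "!!i. d i \<in> slice \<omega> (m i) Int B2" "!!i. F (d i) = ci i" by metis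
  have bK: "b i \<in> K1" and dK: "d i \<in> K2" for i using b(1)[of i] d(1)[of i] sub by blast+
  obtain l ph where l: "l \<in> K1" "strict_mono ph" "(%i. b (ph i)) \<longlonglongrightarrow> l"
   by (rule compact_subseq[OF V1(2) bK])
  obtain l' \<psi> where l': "l' \<in> K2" "strict_mono \<psi>" "(%i. d (ph (\<psi> i))) \<longlonglongrightarrow> l'"
   by (rule compact_subseq[OF V2(2) dK[of "ph _"]])
  let ?\<sigma> = "%i. ph (\<psi> i)"
  have sm: "strict_mono ?\<sigma>" using strict_mono_compose[OF l(2) l'(2)] .
  have bl: "(%i. b (?\<sigma> i)) \<longlonglongrightarrow> l" using LIMSEQ_subseq_LIMSEQ[OF l(3) l'(2)] by (simp add: o_def)
  have cl: "(%i. ci (?\<sigma> i)) \<longlonglongrightarrow> F l" using F_tendsto[OF bl] by (simp add: b(2))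
  have "(%i. ci (?\<sigma> i)) \<longlonglongrightarrow> F l'" using F_tendsto[OF l'(3)] by (simp add: d(2))
  then have ll: "F l = F l'" using cl LIMSEQ_unique by blast
  have ml': "(%i. m (?\<sigma> i)) \<longlonglongrightarrow> n" using LIMSEQ_subseq_LIMSEQ[OF ml sm] by (simp add: o_def)
  have ls: "l \<in> slice \<omega> n" by (rule slice_limit[OF _ ml' bl]) (use b in blast)
  have "l \<in> N" using l(1) V1(5) by blast
  moreover have n0: "norm (n - e) < dl0" using n dl(2) by simp
  ultimately have "l \<in> K" using N(7)[OF n0] ls by blast
  have "F l \<in> F ` K1" using l(1) by (rule imageI)
  moreover have "F l \<in> F ` K2" unfolding ll using l'(1) by (rule imageI)
  moreover have "F l \<in> F ` K" using \<open>l \<in> K\<close> by (rule imageI)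
  ultimately have "F l \<in> Q" by (simp add: Q_def)
  moreover have "centred (slice \<omega> n Int N) (F l)"
  proof (rule centred_limit[where m = "%i. m (ph (\<psi> i))" and c = "%i. ci (ph (\<psi> i))", OF sn n0 ml' _ _ cl])
   show "norm (m (ph (\<psi> i)) - e) < dl0" for i using me[of "ph (\<psi> i)"] dl(2) by simp
   show "centred (slice \<omega> (m (ph (\<psi> i))) Int N) (ci (ph (\<psi> i)))" for i by (rule m(2))
  qed
  moreover have "n \<bullet> (F l - \<omega>) = 1" using ls by (simp add: slice_def)
  ultimately show ?thesis by blast
 qed
 have "x1 \<in> K1" "x2 \<in> K2" "x1 \<in> K" using x V1(3,4) V2(3,4) \<Gamma>K by blast+
 then have "c \<in> F ` K1" "c \<in> F ` K2" "c \<in> F ` K" using x(3,4) by (auto intro: rev_image_eqI)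
 then have cQ: "c \<in> Q" by (simp add: Q_def)
 have QK: "Q <= F ` K" by (auto simp: Q_def)
 show thesis
  by (rule that[OF section_nbhd_shrink[OF sn dl] sN C QK cQ QC Qu ex])
qed

end

section \<open>The translation direction\<close>

lemma midpoint_affine_nonpos:
 fixes f :: "real => real"
 assumes b: "b > 0" and c: "continuous_on {-b..b} f"
  and mid: "!!x y. x \<in> {-b..b} ==> y \<in> {-b..b} ==> f x + f y = 2 * f ((x + y) / 2)"
  and z: "f b = 0" "f (-b) = 0" and x: "x \<in> {-b..b}"
 shows "f x <= 0"
proof -
 have "\<exists>m\<in>{-b..b}. \<forall>y\<in>{-b..b}. f y <= f m"
  by (rule continuous_attains_sup) (use b c in auto)
 then obtain m where m: "m \<in> {-b..b}" "!!y. y \<in> {-b..b} ==> f y <= f m" by blast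
 \<comment> \<open>the maximal value is a mean of values, one of them at an end point\<close>
 have "f m <= 0"
 proof (cases "m \<ge> 0")
  case True
  have "f (2 * m - b) + f b = 2 * f ((2 * m - b + b) / 2)" by (rule mid) (use True m(1) b in auto)
  moreover have "f (2 * m - b) <= f m" by (rule m(2)) (use True m(1) b in auto)
  ultimately show ?thesis using z by simp
 next
  case False
  have "f (2 * m + b) + f (-b) = 2 * f ((2 * m + b + -b) / 2)" by (rule mid) (use False m(1) b in auto)
  moreover have "f (2 * m + b) <= f m" by (rule m(2)) (use False m(1) b in auto)
  ultimately show ?thesis using z by simp
 qed
 then show ?thesis using m(2)[OF x] by simp
qed

lemma midpoint_affine_on_interval:
 fixes q :: "real => 'a::real_inner"
 assumes b: "b > 0" and c: "continuous_on {-b..b} q"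
  and mid: "!!x y. x \<in> {-b..b} ==> y \<in> {-b..b} ==> q x + q y = 2 *\<^sub>R q ((x + y) / 2)"
 obtains v where "!!x. x \<in> {-b..b} ==> q x = q 0 + x *\<^sub>R v"
proof -
 define v where "v = (1 / b) *\<^sub>R (q b - q 0)"
 define D where "D x = q x - q 0 - x *\<^sub>R v" for x
 have "q b + q (-b) = 2 *\<^sub>R q 0" using mid[of b "-b"] b by simp
 then have q2: "q (-b) - q 0 = - (q b - q 0)" by (simp add: algebra_simps scaleR_2)
 have D0: "D b = 0" "D (-b) = 0" using b q2 by (simp_all add: D_def v_def)
 have cD: "continuous_on {-b..b} D" unfolding D_def by (intro continuous_intros c)
 have Dm: "D x + D y = 2 *\<^sub>R D ((x + y) / 2)" if "x \<in> {-b..b}" "y \<in> {-b..b}" for x y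
 proof -
  have "D x + D y = (q x + q y) - 2 *\<^sub>R q 0 - (x + y) *\<^sub>R v"
   by (simp add: D_def algebra_simps scaleR_2)
  also have "\<dots> = 2 *\<^sub>R D ((x + y) / 2)" unfolding mid[OF that] by (simp add: D_def scaleR_right_diff_distrib)
  finally show ?thesis .
 qed
 have D_zero: "D x = 0" if x: "x \<in> {-b..b}" for x
 proof -
  have le: "u \<bullet> D x <= 0" for u
  proof (rule midpoint_affine_nonpos[OF b, of "%x. u \<bullet> D x"])
   show "continuous_on {- b..b} (%x. u \<bullet> D x)" by (intro continuous_intros cD)
   show "u \<bullet> D x + u \<bullet> D y = 2 * (u \<bullet> D ((x + y) / 2))" if "x \<in> {- b..b}" "y \<in> {- b..b}" for x y
    using arg_cong[OF Dm[OF that], of "%p. u \<bullet> p"] by (simp add: inner_add_right)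
  qed (use D0 x in auto)
  have "D x \<bullet> D x = 0" using le[of "D x"] inner_ge_zero[of "D x"] by linarith
  then show ?thesis by simp
 qed
 show thesis
 proof (rule that[of v])
  fix x assume "x \<in> {-b..b}"
  from D_zero[OF this] have "q x - (q 0 + x *\<^sub>R v) = 0" unfolding D_def by (simp only: diff_diff_eq)
  then show "q x = q 0 + x *\<^sub>R v" by (rule iffD1[OF right_minus_eq])
 qed
qed

text \<open>Scaling \<open>m\<close> moves the plane that it defines in parallel; a small scaling makes it pass through a prescribed
 point near the plane of \<open>e\<close>.\<close>

lemma plane_through_point:
 fixes e :: "'a::real_inner"
 assumes dl: "dl > 0" and R: "R \<ge> 0"
 obtains eps where "eps > 0"
  "!!m p. norm (m - e) <= eps ==> norm p <= R ==> \<bar>e \<bullet> p - 1\<bar> <= eps ==>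
   \<exists>\<mu>. norm (\<mu> *\<^sub>R m - e) < dl & (\<mu> *\<^sub>R m) \<bullet> p = 1"
proof -
 define A where "A = 1 + norm e * (1 + R)"
 have A: "A \<ge> 1" using R by (simp add: A_def)
 define eps where "eps = min (1 / (2 * (1 + R))) (dl / (4 * A))"
 have eps: "eps > 0" using dl A R by (auto simp: eps_def)
 have e1: "eps * (1 + R) <= 1 / 2"
 proof -
  have "eps * (1 + R) <= 1 / (2 * (1 + R)) * (1 + R)" using R by (intro mult_right_mono) (auto simp: eps_def)
  also have "\<dots> = 1 / 2" using R by (simp add: field_simps)
  finally show ?thesis .
 qed
 have e2: "2 * eps * A < dl"
 proof -
  have "2 * eps * A <= 2 * (dl / (4 * A)) * A" using A by (intro mult_right_mono mult_left_mono) (auto simp: eps_def)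
  also have "\<dots> = dl / 2" using A by simp
  finally show ?thesis using dl by simp
 qed
 show thesis
 proof (rule that[OF eps])
  fix m p assume m: "norm (m - e) <= eps" and p: "norm p <= R" "\<bar>e \<bullet> p - 1\<bar> <= eps"
  define t where "t = m \<bullet> p"
  have "t - 1 = (m - e) \<bullet> p + (e \<bullet> p - 1)" by (simp add: t_def inner_diff_left)
  moreover have "\<bar>(m - e) \<bullet> p\<bar> <= eps * R"
   using Cauchy_Schwarz_ineq2[of "m - e" p] mult_mono[OF m p(1)] eps by simp
  ultimately have t1: "\<bar>t - 1\<bar> <= eps * (1 + R)" using p(2) unfolding distrib_left by linarith
  then have t: "t \<ge> 1 / 2" using e1 by linarith
  have "(1 / t) *\<^sub>R m - e = (1 / t) *\<^sub>R ((m - e) + (1 - t) *\<^sub>R e)"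
   using t by (simp add: scaleR_left_diff_distrib scaleR_right_diff_distrib scaleR_right_distrib)
  then have "norm ((1 / t) *\<^sub>R m - e) = (1 / t) * norm ((m - e) + (1 - t) *\<^sub>R e)" using t by simp
  also have "\<dots> <= 2 * norm ((m - e) + (1 - t) *\<^sub>R e)" using t by (intro mult_right_mono) (auto simp: field_simps)
  also have "\<dots> <= 2 * (norm (m - e) + norm ((1 - t) *\<^sub>R e))"
   by (intro mult_left_mono norm_triangle_ineq) simp
  also have "\<dots> <= 2 * (eps + eps * (1 + R) * norm e)"
   using m mult_right_mono[OF t1, of "norm e"] by (simp add: abs_minus_commute)
  also have "\<dots> = 2 * eps * A" by (simp add: A_def algebra_simps)
  finally have "norm ((1 / t) *\<^sub>R m - e) < dl" using e2 by simp
  moreover have "((1 / t) *\<^sub>R m) \<bullet> p = 1" using t by (simp add: t_def)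
  ultimately show "\<exists>\<mu>. norm (\<mu> *\<^sub>R m - e) < dl & (\<mu> *\<^sub>R m) \<bullet> p = 1" by blast
 qed
qed

lemma norm_le_norm_add_scaleR:
 fixes x w :: "'a::real_inner"
 assumes "x \<bullet> w \<ge> 0" "t \<ge> 0"
 shows "norm x <= norm (x + t *\<^sub>R w)"
proof -
 have "x \<bullet> x <= (x + t *\<^sub>R w) \<bullet> (x + t *\<^sub>R w)"
  using assms by (simp add: inner_add_left inner_add_right inner_commute[of w x] add_nonneg_nonneg)
 then show ?thesis by (simp add: norm_le)
qed

lemma abs_mean_less:
 fixes a b h :: real
 assumes "\<bar>a\<bar> < h" "\<bar>b\<bar> < h"
 shows "\<bar>(a + b) / 2\<bar> < h"
 using abs_triangle_ineq[of a b] assms by simp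

context immersed_surface
begin

text \<open>All sections by planes near the given one and through a point \<open>q\<close> of the double curve have the
 centre \<open>q\<close>, and these planes cover a neighbourhood of the section except near \<open>q\<close> itself. So the surface
 is symmetric about \<open>q\<close>. Two such symmetries, about points \<open>q k\<close> at half height and \<open>q b\<close> at full height,
 translate a point from height \<open>a\<close> to height \<open>b\<close>. Going up and back down translates a bounded section by
 the second difference of \<open>q\<close>, which therefore vanishes: the double curve is straight, and
 the translations are translations in its direction.\<close>

lemma local_translation:
 assumes loop: "centred_loop \<omega> e \<Gamma> c x1 x2"
  and dense: "!!m r. r > 0 ==> \<exists>n. norm (n - m) < r &
   (\<forall>C\<in>components (slice \<omega> n). compact C --> (\<exists>c. centred C c))"
  and big: "\<exists>x\<in>\<Gamma>. F x ~= c"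
 obtains N K h v where "open N" "slice \<omega> e Int N = \<Gamma>" "compact K" "K <= N" "h > 0" "e \<bullet> v = 1"
  "!!a y. \<bar>a\<bar> < h ==> y \<in> N ==> e \<bullet> (F y - \<omega>) = 1 + a ==> y \<in> K"
  "!!a b p. \<bar>a\<bar> < h ==> \<bar>b\<bar> < h ==> p \<in> F ` {y\<in>N. e \<bullet> (F y - \<omega>) = 1 + a} ==>
   p + (b - a) *\<^sub>R v \<in> F ` {y\<in>N. e \<bullet> (F y - \<omega>) = 1 + b}"
proof -
 obtain N K dl Q C where sn: "section_nbhd \<omega> e N K dl" and sN: "slice \<omega> e Int N = \<Gamma>" and C: "C > 0"
  and QK: "Q <= F ` K" and cQ: "c \<in> Q"
  and QC: "!!q q'. q \<in> Q ==> q' \<in> Q ==> norm (q - q') <= C * \<bar>e \<bullet> (q - q')\<bar>"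
  and Qu: "!!n q q'. norm (n - e) < dl ==> q \<in> Q ==> q' \<in> Q ==> n \<bullet> (q - q') = 0 ==> q = q'"
  and Qex: "!!n. norm (n - e) < dl ==> \<exists>q\<in>Q. n \<bullet> (q - \<omega>) = 1 & centred (slice \<omega> n Int N) q"
  by (rule centres_are_crossings[OF loop dense]) (assumption | rule that)+
 have N: "open N" "compact K" "K <= N" "dl > 0" using sn unfolding section_nbhd_def by blast+
 have sK: "slice \<omega> n Int N <= K" if "norm (n - e) < dl" for n using sn that unfolding section_nbhd_def by blast
 have pers: "\<forall>\<^sub>F n' in nhds e. V Int slice \<omega> n' ~= {}" if "y \<in> slice \<omega> e Int N" "open V" "y \<in> V" for y V
 proof -
  have "norm (e - e) < dl" using N(4) by simp
  then show ?thesis using sn that unfolding section_nbhd_def by blast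
 qed
 define H where "H a = {y\<in>N. e \<bullet> (F y - \<omega>) = 1 + a}" for a
 define lev where "lev a = (1 / (1 + a)) *\<^sub>R e" for a
 define h0 where "h0 = min (1 / 2) (dl / (2 * norm e + 1))"
 have ne: "2 * norm e + 1 > 0" by (simp add: add_nonneg_pos)
 have h0: "h0 > 0" "h0 <= 1 / 2" using N(4) ne unfolding h0_def by (simp, intro min.cobounded1)
 have lev: "norm (lev a - e) < dl" if a: "\<bar>a\<bar> < h0" for a
 proof -
  have a2: "1 + a > 1 / 2" using a h0(2) by linarith
  have "lev a - e = (- a / (1 + a)) *\<^sub>R e"
  proof -
   have "1 / (1 + a) - 1 = - a / (1 + a)" using a2 by (simp add: field_simps)
   then show ?thesis unfolding lev_def by (metis scaleR_left_diff_distrib scaleR_one)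
  qed
  then have "norm (lev a - e) = \<bar>a\<bar> / (1 + a) * norm e" using a2 by simp
  also have "\<dots> <= (2 * \<bar>a\<bar>) * norm e"
  proof (rule mult_right_mono)
   have "\<bar>a\<bar> * 1 <= \<bar>a\<bar> * (2 * (1 + a))" using a2 by (intro mult_left_mono) auto
   then show "\<bar>a\<bar> / (1 + a) <= 2 * \<bar>a\<bar>" using a2 by (simp add: pos_divide_le_eq mult_ac)
  qed simp
  also have "\<dots> = (2 * norm e) * \<bar>a\<bar>" by simp
  also have "\<dots> <= (2 * norm e + 1) * \<bar>a\<bar>" by (intro mult_right_mono) auto
  also have "\<dots> < (2 * norm e + 1) * h0" using a ne by (intro mult_strict_left_mono) auto
  also have "\<dots> <= (2 * norm e + 1) * (dl / (2 * norm e + 1))" using ne by (intro mult_left_mono) (auto simp: h0_def)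
  also have "\<dots> = dl" using ne by simp
  finally show ?thesis .
 qed
 have lev_eq: "lev a \<bullet> p = 1 \<longleftrightarrow> e \<bullet> p = 1 + a" if a: "\<bar>a\<bar> < h0" for a and p :: "real^3"
 proof -
  have "1 + a ~= 0" using a h0(2) by linarith
  then show ?thesis by (auto simp: lev_def field_simps)
 qed
 have H_eq: "H a = slice \<omega> (lev a) Int N" if "\<bar>a\<bar> < h0" for a
  unfolding H_def slice_def using lev_eq[OF that] by auto
 have HK: "H a <= K" if "\<bar>a\<bar> < h0" for a unfolding H_eq[OF that] by (rule sK[OF lev[OF that]])
 have "\<exists>q. \<bar>a\<bar> < h0 --> q \<in> Q & e \<bullet> (q - \<omega>) = 1 + a & centred (H a) q" for a
  using Qex[OF lev[of a]] H_eq[of a] lev_eq[of a] by (cases "\<bar>a\<bar> < h0") auto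
 then obtain q where q: "!!a. \<bar>a\<bar> < h0 ==> q a \<in> Q" "!!a. \<bar>a\<bar> < h0 ==> e \<bullet> (q a - \<omega>) = 1 + a"
  "!!a. \<bar>a\<bar> < h0 ==> centred (H a) (q a)" by metis
 have qL: "norm (q a - q b) <= C * \<bar>a - b\<bar>" if "\<bar>a\<bar> < h0" "\<bar>b\<bar> < h0" for a b
 proof -
  have "e \<bullet> (q a - q b) = e \<bullet> (q a - \<omega>) - e \<bullet> (q b - \<omega>)" by (simp add: inner_diff_right)
  then have "e \<bullet> (q a - q b) = a - b" using q(2) that by simp
  then show ?thesis using QC[OF q(1) q(1)] that by metis
 qed
 have qH: "q a \<in> F ` H a" if a: "\<bar>a\<bar> < h0" for a
 proof -
  obtain y where "y \<in> K" "q a = F y" using q(1)[OF a] QK by blast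
  then have "y \<in> H a" using q(2)[OF a] N(3) by (auto simp: H_def)
  then show ?thesis using \<open>q a = F y\<close> by blast
 qed
 have q0: "q 0 = c"
 proof -
  obtain x where "x \<in> \<Gamma>" "F x = c" using loop unfolding centred_loop_def by blast
  then have "e \<bullet> (c - \<omega>) = 1" using sN by (auto simp: slice_def)
  moreover have "e \<bullet> (q 0 - \<omega>) = 1" using q(2)[of 0] h0 by simp
  ultimately have "e \<bullet> (q 0 - c) = 0" by (simp add: inner_diff_right)
  then show ?thesis using QC[OF q(1)[of 0] cQ] h0 by simp
 qed
 have "compact ((%y. F y - \<omega>) ` K)" by (intro compact_continuous_image continuous_intros N)
 then have "bounded ((%y. F y - \<omega>) ` K)" by (rule compact_imp_bounded)
 then obtain R where R: "R > 0" "!!y. y \<in> K ==> norm (F y - \<omega>) <= R"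
  unfolding bounded_pos by blast
 obtain eps where eps: "eps > 0" "!!m p. norm (m - e) <= eps ==> norm p <= R ==> \<bar>e \<bullet> p - 1\<bar> <= eps ==>
   \<exists>\<mu>. norm (\<mu> *\<^sub>R m - e) < dl & (\<mu> *\<^sub>R m) \<bullet> p = 1"
  by (rule plane_through_point[where e = e, OF N(4) less_imp_le[OF R(1)]]) (assumption | rule that)+
 define h1 where "h1 = min h0 eps"
 have h1: "h1 > 0" "h1 <= h0" "h1 <= eps" using h0 eps by (auto simp: h1_def)
 \<comment> \<open>symmetry of the surface about the points of the double curve\<close>
 have refl: "2 *\<^sub>R q k - p \<in> F ` H (2 * k - a)"
  if k: "\<bar>k\<bar> < h1" and p: "p \<in> F ` H a" and slope: "\<bar>a - k\<bar> <= eps * norm (p - q k)" for a k p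
 proof -
  obtain y where y: "y \<in> N" "e \<bullet> (F y - \<omega>) = 1 + a" "p = F y" using p by (auto simp: H_def)
  have k0: "\<bar>k\<bar> < h0" using k h1 by simp
  let ?w = "p - q k"
  have "e \<bullet> ?w = e \<bullet> (p - \<omega>) - e \<bullet> (q k - \<omega>)" by (simp add: inner_diff_right)
  then have ew: "e \<bullet> ?w = a - k" using y q(2)[OF k0] by simp
  define m where "m = e - ((a - k) / (norm ?w)\<^sup>2) *\<^sub>R ?w"
  have mw: "m \<bullet> ?w = 0"
  proof (cases "?w = 0")
   case False
   then show ?thesis unfolding m_def inner_diff_left[of e] ew inner_scaleR_left power2_norm_eq_inner[symmetric] by simp
  qed (simp only: inner_zero_right)
  have me: "norm (m - e) <= eps"
  proof (cases "?w = 0")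
   case True
   then show ?thesis using eps(1) by (simp add: m_def)
  next
   case False
   then have "norm (m - e) = \<bar>a - k\<bar> / norm ?w" unfolding m_def by (simp add: power2_eq_square)
   then show ?thesis using slope False by (simp add: pos_divide_le_eq)
  qed
  obtain x where x: "x \<in> K" "q k = F x" using q(1)[OF k0] QK by blast
  have "\<bar>e \<bullet> (q k - \<omega>) - 1\<bar> <= eps" using q(2)[OF k0] k h1(3) by simp
  from eps(2)[OF me _ this] R(2)[OF x(1)] x(2)
  obtain \<mu> where \<mu>: "norm (\<mu> *\<^sub>R m - e) < dl" "(\<mu> *\<^sub>R m) \<bullet> (q k - \<omega>) = 1" by auto
  let ?n = "\<mu> *\<^sub>R m"
  obtain q' where q': "q' \<in> Q" "?n \<bullet> (q' - \<omega>) = 1" "centred (slice \<omega> ?n Int N) q'" using Qex[OF \<mu>(1)] by blast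
  have "?n \<bullet> (q' - q k) = ?n \<bullet> (q' - \<omega>) - ?n \<bullet> (q k - \<omega>)" by (simp add: inner_diff_right algebra_simps)
  also have "\<dots> = 0" unfolding q'(2) \<mu>(2) by simp
  finally have "q' = q k" by (rule Qu[OF \<mu>(1) q'(1) q(1)[OF k0]])
  then have cen: "centred (slice \<omega> ?n Int N) (q k)" using q'(3) by simp
  have "p - \<omega> = ?w + (q k - \<omega>)" by simp
  then have "?n \<bullet> (p - \<omega>) = ?n \<bullet> (?w + (q k - \<omega>))" by (rule arg_cong)
  then have "?n \<bullet> (p - \<omega>) = \<mu> * (m \<bullet> ?w) + ?n \<bullet> (q k - \<omega>)"
   by (simp only: inner_add_right[of ?n ?w] inner_scaleR_left[of \<mu> m ?w])
  then have "?n \<bullet> (p - \<omega>) = 1" unfolding mw \<mu>(2) by simp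
  then have "y \<in> slice \<omega> ?n Int N" using y by (simp add: slice_def)
  then have "2 *\<^sub>R q k - p \<in> F ` (slice \<omega> ?n Int N)" using cen y(3) unfolding centred_def by blast
  then obtain z where z: "z \<in> N" "2 *\<^sub>R q k - p = F z" by blast
  have "F z - \<omega> = (q k - \<omega>) + (q k - \<omega>) - (p - \<omega>)" unfolding z(2)[symmetric] by (simp add: scaleR_2)
  then have "e \<bullet> (F z - \<omega>) = e \<bullet> (q k - \<omega>) + e \<bullet> (q k - \<omega>) - e \<bullet> (p - \<omega>)"
   by (simp only: inner_diff_right[of e "(q k - \<omega>) + (q k - \<omega>)"] inner_add_right)
  then have "e \<bullet> (F z - \<omega>) = 1 + (2 * k - a)" using y q(2)[OF k0] by simp
  then have "z \<in> H (2 * k - a)" using z(1) by (simp add: H_def)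
  then show ?thesis unfolding z(2) by blast
 qed
 have trans: "p + 2 *\<^sub>R (q b - q ((a + b) / 2)) \<in> F ` H b"
  if ab: "\<bar>a\<bar> < h1" "\<bar>b\<bar> < h1" and p: "p \<in> F ` H a"
   and slope: "\<bar>b - a\<bar> <= 2 * eps * norm (p - q ((a + b) / 2))" for a b p
 proof -
  let ?k = "(a + b) / 2"
  have k: "\<bar>?k\<bar> < h1" by (rule abs_mean_less[OF ab])
  have "\<bar>a - ?k\<bar> = \<bar>b - a\<bar> / 2" by (simp add: field_simps abs_minus_commute)
  then have "2 *\<^sub>R q ?k - p \<in> F ` H (2 * ?k - a)" using slope by (intro refl[OF k p]) simp
  moreover have "2 * ?k - a = b" by (simp add: add_divide_distrib)
  ultimately have "2 *\<^sub>R q ?k - p \<in> F ` H b" by (simp only:)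
  moreover have "centred (H b) (q b)" using q(3) ab(2) h1(2) by simp
  ultimately have "2 *\<^sub>R q b - (2 *\<^sub>R q ?k - p) \<in> F ` H b" unfolding centred_def by blast
  moreover have "2 *\<^sub>R q b - (2 *\<^sub>R q ?k - p) = p + 2 *\<^sub>R (q b - q ?k)" by (simp add: scaleR_right_diff_distrib)
  ultimately show ?thesis by (simp only:)
 qed
 obtain x where x: "x \<in> \<Gamma>" "F x ~= c" using big by blast
 define rh where "rh = norm (F x - c) / 4"
 have rh: "rh > 0" using x(2) by (simp add: rh_def)
 have xN: "x \<in> slice \<omega> e Int N" using x(1) sN by simp
 let ?V = "N Int F -` ball (F x) rh"
 have "\<forall>\<^sub>F n' in nhds e. ?V Int slice \<omega> n' ~= {}"
  by (rule pers[OF xN]) (use xN rh N(1) open_vimage[OF open_ball F_cont] in auto)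
 then obtain d where d: "d > 0" "!!n. norm (n - e) < d ==> ?V Int slice \<omega> n ~= {}"
  unfolding eventually_nhds_metric dist_norm by blast
 have "isCont lev 0" unfolding lev_def by (intro continuous_intros) simp
 moreover have "lev 0 = e" by (simp add: lev_def)
 ultimately obtain d' where d': "d' > 0" "!!a. \<bar>a\<bar> < d' ==> norm (lev a - e) < d"
  using d(1) unfolding continuous_at_eps_delta dist_norm by auto
 define h2 where "h2 = min (min h1 d') (min (eps * rh) (rh / (8 * C)))"
 have h2: "h2 > 0" "h2 <= h1" "h2 <= d'" "h2 <= eps * rh" "h2 <= rh / (8 * C)"
  using h1 d' eps rh C by (auto simp: h2_def)
 have Ch2: "C * h2 <= rh / 8" using mult_left_mono[OF h2(5), of C] C by simp
 have qC: "norm (q a - q b) <= rh / 4" if "\<bar>a\<bar> < h2" "\<bar>b\<bar> < h2" for a b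
 proof -
  have "norm (q a - q b) <= C * \<bar>a - b\<bar>" using that h1 h2 by (intro qL) auto
  also have "\<dots> <= C * (2 * h2)" using that C by (intro mult_left_mono) auto
  finally show ?thesis using Ch2 by simp
 qed
 have far: "\<exists>p\<in>F ` H a. norm (p - q a) \<ge> 2 * rh" if a: "\<bar>a\<bar> < h2" for a
 proof -
  have "\<bar>a\<bar> < d'" "\<bar>a\<bar> < h0" using a h1 h2 by auto
  have "?V Int slice \<omega> (lev a) ~= {}" by (rule d(2)[OF d'(2)[OF \<open>\<bar>a\<bar> < d'\<close>]])
  then obtain y where "y \<in> ?V Int slice \<omega> (lev a)" by blast
  then have y: "y \<in> N" "dist (F x) (F y) < rh" "y \<in> slice \<omega> (lev a)" by auto
  have "F y \<in> F ` H a" unfolding H_eq[OF \<open>\<bar>a\<bar> < h0\<close>] using y by blast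
  moreover have "norm (F y - q a) \<ge> 2 * rh"
  proof -
   have "norm (F x - c) = norm ((F x - F y) + (F y - q a) + (q a - c))" by simp
   then have "norm (F x - c) <= norm (F x - F y) + norm (F y - q a) + norm (q a - c)"
    using norm_triangle_ineq[of "(F x - F y) + (F y - q a)" "q a - c"] norm_triangle_ineq[of "F x - F y" "F y - q a"]
    by linarith
   moreover have "norm (q a - c) <= rh / 4" using qC[OF a, of 0] h2(1) q0 by simp
   ultimately show ?thesis using y(2) norm_ge_zero[of "F x - c"] unfolding dist_norm rh_def by linarith
  qed
  ultimately show ?thesis by blast
 qed
 have mid: "q a + q b = 2 *\<^sub>R q ((a + b) / 2)" if ab: "\<bar>a\<bar> < h2" "\<bar>b\<bar> < h2" for a b
 proof (rule ccontr)
  let ?k = "(a + b) / 2"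
  assume neq: "q a + q b ~= 2 *\<^sub>R q ?k"
  define w where "w = q a + q b - 2 *\<^sub>R q ?k"
  have w: "norm w > 0" using neq by (simp add: w_def)
  have k: "\<bar>?k\<bar> < h2" by (rule abs_mean_less[OF ab])
  have ab1: "\<bar>a\<bar> < h1" "\<bar>b\<bar> < h1" "\<bar>a\<bar> < h0" using ab h1(2) h2(2) by auto
  have step: "\<bar>b - a\<bar> <= 2 * eps * rh" "\<bar>a - b\<bar> <= 2 * eps * rh" using ab h2(4) by auto
  have slope: "2 * eps * rh <= 2 * eps * s" if "s \<ge> rh" for s using that eps(1) by simp
  obtain p where p: "p \<in> F ` H a" "norm (p - q a) \<ge> 2 * rh" "(p - q a) \<bullet> w \<ge> 0"
  proof -
   obtain p where p: "p \<in> F ` H a" "norm (p - q a) \<ge> 2 * rh" using far[OF ab(1)] by blast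
   show thesis
   proof (cases "(p - q a) \<bullet> w \<ge> 0")
    case True then show thesis using that p by blast
   next
    case False
    let ?p = "2 *\<^sub>R q a - p"
    have eq: "?p - q a = - (p - q a)" by (simp add: scaleR_2)
    have "?p \<in> F ` H a" using q(3)[OF ab1(3)] p(1) unfolding centred_def by blast
    moreover have "norm (?p - q a) \<ge> 2 * rh" unfolding eq norm_minus_cancel by (rule p(2))
    moreover have "(?p - q a) \<bullet> w \<ge> 0" unfolding eq inner_minus_left using False by simp
    ultimately show thesis by (rule that)
   qed
  qed
  have it: "p + real j *\<^sub>R (2 *\<^sub>R w) \<in> F ` H a" for j
  proof (induction j)
   case (Suc j)
   let ?p = "p + real j *\<^sub>R (2 *\<^sub>R w)"
   have "norm (p - q a) <= norm ((p - q a) + (2 * real j) *\<^sub>R w)" by (rule norm_le_norm_add_scaleR[OF p(3)]) simp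
   also have "(p - q a) + (2 * real j) *\<^sub>R w = ?p - q a" by simp
   finally have far1: "norm (?p - q a) \<ge> 2 * rh" using p(2) by linarith
   have far2: "norm (?p - q ?k) \<ge> rh"
   proof -
    have "?p - q a = (?p - q ?k) + (q ?k - q a)" by simp
    then have "norm (?p - q a) <= norm (?p - q ?k) + norm (q ?k - q a)" by (simp only: norm_triangle_ineq)
    then show ?thesis using far1 qC[OF k ab(1)] rh by linarith
   qed
   let ?p' = "?p + 2 *\<^sub>R (q b - q ?k)"
   have p': "?p' \<in> F ` H b"
    by (rule trans[OF ab1(1,2) Suc]) (rule order_trans[OF step(1) slope[OF far2]])
   have far3: "norm (?p' - q ?k) \<ge> rh"
   proof -
    have "?p - q ?k = (?p' - q ?k) - 2 *\<^sub>R (q b - q ?k)" by simp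
    then have "norm (?p - q ?k) <= norm (?p' - q ?k) + norm (2 *\<^sub>R (q b - q ?k))" by (simp only: norm_triangle_ineq4)
    moreover have "norm (2 *\<^sub>R (q b - q ?k)) <= rh / 2" using qC[OF ab(2) k] by simp
    moreover have "norm (?p - q ?k) \<ge> 2 * rh - rh / 4"
    proof -
     have "?p - q a = (?p - q ?k) + (q ?k - q a)" by simp
     then have "norm (?p - q a) <= norm (?p - q ?k) + norm (q ?k - q a)" by (simp only: norm_triangle_ineq)
     then show ?thesis using far1 qC[OF k ab(1)] by linarith
    qed
    ultimately show ?thesis using rh by linarith
   qed
   have kk: "(b + a) / 2 = ?k" by (simp add: add.commute)
   have "?p' + 2 *\<^sub>R (q a - q ((b + a) / 2)) \<in> F ` H a"
    by (rule trans[OF ab1(2,1) p']) (unfold kk, rule order_trans[OF step(2) slope[OF far3]])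
   moreover have "?p' + 2 *\<^sub>R (q a - q ((b + a) / 2)) = p + real (Suc j) *\<^sub>R (2 *\<^sub>R w)"
    unfolding kk by (simp add: w_def algebra_simps)
   ultimately show ?case by (simp only:)
  qed (use p(1) in simp)
  have bnd: "norm (u - \<omega>) <= R" if "u \<in> F ` H a" for u
   using that HK[OF ab1(3)] R(2) by blast
  have w2: "norm (2 *\<^sub>R w) > 0" using w by simp
  obtain j :: nat where j: "real j * norm (2 *\<^sub>R w) > 2 * R" using reals_Archimedean3[OF w2] by blast
  have "real j *\<^sub>R (2 *\<^sub>R w) = ((p + real j *\<^sub>R (2 *\<^sub>R w)) - \<omega>) - (p - \<omega>)" by simp
  then have "norm (real j *\<^sub>R (2 *\<^sub>R w)) <= norm ((p + real j *\<^sub>R (2 *\<^sub>R w)) - \<omega>) + norm (p - \<omega>)"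
   using norm_triangle_ineq4[of "(p + real j *\<^sub>R (2 *\<^sub>R w)) - \<omega>" "p - \<omega>"] by simp
  also have "\<dots> <= R + R" by (intro add_mono bnd it p)
  finally show False using j by simp
 qed
 define h3 where "h3 = h2 / 2"
 have h3: "h3 > 0" "h3 < h2" using h2(1) by (auto simp: h3_def)
 have cq: "continuous_on {-h3..h3} q"
  unfolding continuous_on_iff dist_norm
 proof (intro ballI allI impI)
  fix a et :: real assume a: "a \<in> {-h3..h3}" and et: "et > 0"
  have "norm (q b - q a) < et" if "b \<in> {-h3..h3}" "norm (b - a) < et / C" for b
  proof -
   have "norm (q b - q a) <= C * \<bar>b - a\<bar>" using a that h3 h2(2) h1(2) by (intro qL) auto
   also have "\<dots> < C * (et / C)" using that(2) C by (intro mult_strict_left_mono) auto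
   finally show ?thesis using C by simp
  qed
  then show "\<exists>d>0. \<forall>x'\<in>{-h3..h3}. norm (x' - a) < d --> norm (q x' - q a) < et"
   using et C by (intro exI[of _ "et / C"]) auto
 qed
 obtain v where v: "!!a. a \<in> {-h3..h3} ==> q a = q 0 + a *\<^sub>R v"
 proof (rule midpoint_affine_on_interval[OF h3(1) cq])
  show "q x + q y = 2 *\<^sub>R q ((x + y) / 2)" if "x \<in> {-h3..h3}" "y \<in> {-h3..h3}" for x y
   using that h3 by (intro mid) auto
 qed (rule that)
 have ev: "e \<bullet> v = 1"
 proof -
  have h: "\<bar>h3\<bar> < h0" "\<bar>0\<bar> < h0" using h3 h2(2) h1 by auto
  have eq: "q h3 - \<omega> = (q 0 - \<omega>) + h3 *\<^sub>R v" using v[of h3] h3(1) by simp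
  have "e \<bullet> (q h3 - \<omega>) = e \<bullet> (q 0 - \<omega>) + h3 * (e \<bullet> v)"
   unfolding eq inner_add_right inner_scaleR_right ..
  then have "h3 * (e \<bullet> v) = h3" using q(2)[OF h(1)] q(2)[OF h(2)] by simp
  then show ?thesis using h3(1) by simp
 qed
 have small: "p + (b - a) *\<^sub>R v \<in> F ` H b"
  if ab: "\<bar>a\<bar> < h3" "\<bar>b\<bar> < h3" and p: "p \<in> F ` H a"
   and st: "\<bar>b - a\<bar> * (1 + eps * norm v) <= 2 * eps * norm (p - q a)" for a b p
 proof -
  let ?k = "(a + b) / 2"
  have k: "?k \<in> {-h3..h3}" "b \<in> {-h3..h3}" "a \<in> {-h3..h3}" using ab by auto
  have 1: "2 *\<^sub>R (q b - q ?k) = (b - a) *\<^sub>R v"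
  proof -
   have "2 *\<^sub>R (q b - q ?k) = (2 * b - 2 * ?k) *\<^sub>R v" unfolding v[OF k(1)] v[OF k(2)]
    by (simp only: scaleR_left_diff_distrib scaleR_right_diff_distrib scaleR_right_distrib scaleR_scaleR add_diff_cancel_left)
   moreover have "2 * b - 2 * ?k = b - a" by (simp add: add_divide_distrib)
   ultimately show ?thesis by (simp only:)
  qed
  have 2: "q a - q ?k = ((a - b) / 2) *\<^sub>R v"
   unfolding v[OF k(1)] v[OF k(3)] by (simp flip: scaleR_left_diff_distrib add: field_simps)
  have "p - q a = (p - q ?k) - (q a - q ?k)" by simp
  then have "norm (p - q a) <= norm (p - q ?k) + norm (q a - q ?k)" by (simp only: norm_triangle_ineq4)
  also have "norm (q a - q ?k) = \<bar>b - a\<bar> / 2 * norm v" unfolding 2 by (simp add: abs_minus_commute)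
  finally have "2 * eps * norm (p - q a) <= 2 * eps * (norm (p - q ?k) + \<bar>b - a\<bar> / 2 * norm v)"
   using eps(1) by simp
  then have "\<bar>b - a\<bar> <= 2 * eps * norm (p - q ?k)" using st by (simp add: algebra_simps)
  then show ?thesis using trans[of a b p] ab p h3 h2(2) unfolding 1 by simp
 qed
 have final: "p + (b - a) *\<^sub>R v \<in> F ` H b" if ab: "\<bar>a\<bar> < h3" "\<bar>b\<bar> < h3" and p: "p \<in> F ` H a" for a b p
 proof (cases "p = q a")
  case True
  have I: "a \<in> {-h3..h3}" "b \<in> {-h3..h3}" using ab by auto
  have "p + (b - a) *\<^sub>R v = q b" unfolding True v[OF I(1)] v[OF I(2)] by (simp add: algebra_simps)
  moreover have "q b \<in> F ` H b" using ab h3 h2(2) h1(2) by (intro qH) auto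
  ultimately show ?thesis by simp
 next
  case False
  \<comment> \<open>near the double curve only short translations are available, but they can be iterated\<close>
  have pos: "2 * eps * norm (p - q a) > 0" using False eps(1) by simp
  obtain n0 :: nat where n0: "real n0 * (2 * eps * norm (p - q a)) > \<bar>b - a\<bar> * (1 + eps * norm v)"
   using reals_Archimedean3[OF pos] by blast
  define n where "n = Suc n0"
  have "real n * (2 * eps * norm (p - q a)) \<ge> real n0 * (2 * eps * norm (p - q a))"
   unfolding n_def using pos by (intro mult_right_mono) auto
  then have n: "\<bar>b - a\<bar> * (1 + eps * norm v) <= real n * (2 * eps * norm (p - q a))" using n0 by linarith
  define s where "s = (b - a) / real n"
  have ns: "real n * s = b - a" by (simp add: s_def n_def)
  have inI: "\<bar>a + real j * s\<bar> < h3" if "j <= n" for j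
  proof -
   define t where "t = real j / real n"
   have t: "0 <= t" "t <= 1" using that by (auto simp: t_def n_def)
   have "real j * s = t * (b - a)" by (simp add: t_def s_def)
   then have "a + real j * s = (1 - t) * a + t * b" by (simp add: algebra_simps)
   then have "\<bar>a + real j * s\<bar> <= (1 - t) * \<bar>a\<bar> + t * \<bar>b\<bar>"
    using abs_triangle_ineq[of "(1 - t) * a" "t * b"] t by (simp add: abs_mult)
   also have "\<dots> <= (1 - t) * max \<bar>a\<bar> \<bar>b\<bar> + t * max \<bar>a\<bar> \<bar>b\<bar>" using t by (intro add_mono mult_left_mono) auto
   also have "\<dots> = max \<bar>a\<bar> \<bar>b\<bar>" by (simp add: algebra_simps)
   finally show ?thesis using ab by simp
  qed
  have "j <= n ==> p + (real j * s) *\<^sub>R v \<in> F ` H (a + real j * s)" for j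
  proof (induction j)
   case (Suc j)
   let ?p = "p + (real j * s) *\<^sub>R v" and ?a = "a + real j * s"
   have j: "j <= n" using Suc.prems by simp
   have e1: "a + real (Suc j) * s - ?a = s" by (simp add: algebra_simps)
   have eq: "?p - q ?a = p - q a"
   proof -
    have I: "?a \<in> {-h3..h3}" "a \<in> {-h3..h3}" using inI[OF j] ab by auto
    show ?thesis unfolding v[OF I(1)] v[OF I(2)] by (simp add: scaleR_left_distrib)
   qed
   have "\<bar>s\<bar> * (1 + eps * norm v) = \<bar>b - a\<bar> * (1 + eps * norm v) / real n" by (simp add: s_def)
   also have "\<dots> <= 2 * eps * norm (p - q a)"
    using n by (subst pos_divide_le_eq) (simp_all add: n_def mult.commute)
   finally have "\<bar>s\<bar> * (1 + eps * norm v) <= 2 * eps * norm (?p - q ?a)" unfolding eq .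
   then have "?p + (a + real (Suc j) * s - ?a) *\<^sub>R v \<in> F ` H (a + real (Suc j) * s)"
    by (intro small[OF inI[OF j] inI[OF Suc.prems] Suc.IH[OF j]]) (simp only: e1)
   moreover have "?p + (a + real (Suc j) * s - ?a) *\<^sub>R v = p + (real (Suc j) * s) *\<^sub>R v"
    unfolding e1 by (simp add: algebra_simps)
   ultimately show ?case by (simp only:)
  qed (use p in simp)
  from this[of n] show ?thesis unfolding ns by simp
 qed
 show thesis
 proof (rule that[OF N(1) sN N(2,3) h3(1) ev])
  fix a y assume "\<bar>a\<bar> < h3" "y \<in> N" "e \<bullet> (F y - \<omega>) = 1 + a"
  moreover then have "\<bar>a\<bar> < h0" using h3 h2(2) h1(2) by simp
  ultimately show "y \<in> K" using HK[of a] unfolding H_def by blast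
 qed (use final in \<open>simp add: H_def\<close>)
qed

end

section \<open>Rulings of the surface\<close>

text \<open>The global hypotheses on the immersion, in the form in which they enter: sections by a dense set of planes are symmetric, sheets
 cross transversally, and (completeness) lifts of bounded line segments accumulate at their ends.\<close>

locale central_surface = immersed_surface F nu
 for F :: "'m::{t2_space,second_countable_topology} => real^3" and nu +
 assumes nu_nonzero: "nu x ~= 0"
  and central_dense: "r > 0 ==> \<exists>n. norm (n - m) < r &
   (\<forall>C\<in>components (slice \<omega> n). compact C --> (\<exists>c. centred C c))"
  and normals_independent: "x ~= y ==> F x = F y ==> cross3 (nu x) (nu y) ~= 0"
  and line_limit: "a < b ==> continuous_on {a<..<b} g ==> (!!h. h \<in> {a<..<b} ==> F (g h) = p + h *\<^sub>R v) ==>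
   \<exists>s y. (\<forall>i::nat. s i \<in> {a<..<b}) & s \<longlonglongrightarrow> b & (%i. g (s i)) \<longlonglongrightarrow> y"

lemma cross3_vanishing_parallel:
 assumes "d ~= 0" "cross3 d v = 0" "cross3 d w = 0"
 shows "cross3 v w = 0"
proof -
 have par: "u = ((d \<bullet> u) / (d \<bullet> d)) *\<^sub>R d" if "cross3 d u = 0" for u
 proof -
  have "cross3 d (cross3 d u) = (d \<bullet> u) *\<^sub>R d - (d \<bullet> d) *\<^sub>R u" by (rule Lagrange)
  then have "(d \<bullet> d) *\<^sub>R u = (d \<bullet> u) *\<^sub>R d" using that by simp
  then have "inverse (d \<bullet> d) *\<^sub>R ((d \<bullet> d) *\<^sub>R u) = inverse (d \<bullet> d) *\<^sub>R ((d \<bullet> u) *\<^sub>R d)" by simp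
  then show ?thesis using assms(1) by (simp add: divide_inverse_commute)
 qed
 show ?thesis by (subst par[OF assms(2)], subst par[OF assms(3)]) (simp add: cross_mult_left cross_mult_right)
qed

context immersed_surface
begin

text \<open>The set where two lifts agree is closed, and it is open because \<open>F\<close> is locally injective.\<close>

lemma lift_unique:
 assumes J: "connected J" and g: "continuous_on J g1" "continuous_on J g2"
  and eq: "!!h. h \<in> J ==> F (g1 h) = F (g2 h)" and h: "h0 \<in> J" "g1 h0 = g2 h0" "h \<in> (J :: real set)"
 shows "g1 h = g2 h"
proof (rule connected_induction_simple[OF J h(1) h(3), of "%h. g1 h = g2 h"])
 show "g1 h0 = g2 h0" by (rule h)
 fix a assume a: "a \<in> J"
 have pre: "openin (top_of_set J) (J Int g1 -` U Int (J Int g2 -` V))" if "open U" "open V" for U V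
  using g that by (intro openin_Int continuous_openin_preimage_gen) auto
 show "\<exists>T. openin (top_of_set J) T & a \<in> T & (\<forall>x\<in>T. \<forall>y\<in>T. g1 x = g2 x --> g1 y = g2 y)"
 proof (cases "g1 a = g2 a")
  case True
  obtain U where U: "open U" "g1 a \<in> U" "inj_on F U" using secant[of 1 "g1 a"] by auto
  let ?T = "J Int g1 -` U Int (J Int g2 -` U)"
  have "g1 y = g2 y" if "y \<in> ?T" for y
   by (rule inj_onD[OF U(3) eq]) (use that in auto)
  moreover have "a \<in> ?T" using a True U(2) by simp
  ultimately show ?thesis using pre[OF U(1) U(1)] by (intro exI[of _ ?T]) simp
 next
  case False
  obtain U V where UV: "open U" "open V" "g1 a \<in> U" "g2 a \<in> V" "U Int V = {}" using hausdorff[OF False] by blast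
  let ?T = "J Int g1 -` U Int (J Int g2 -` V)"
  have "g1 x ~= g2 x" if "x \<in> ?T" for x using that UV(5) by auto
  moreover have "a \<in> ?T" using a UV by simp
  ultimately show ?thesis using pre[OF UV(1,2)] by (intro exI[of _ ?T]) simp
 qed
qed

text \<open>The points \<open>g (s i)\<close> have secants in the direction \<open>v\<close>, and secants near \<open>y\<close> are nearly
 orthogonal to the normal at \<open>y\<close>.\<close>

lemma tangent_of_limit:
 assumes s: "s \<longlonglongrightarrow> (b::real)" "!!i. s i ~= b" and g: "(%i. g (s i)) \<longlonglongrightarrow> y"
  and F: "!!i. F (g (s i)) = p + s i *\<^sub>R v"
 shows "nu y \<bullet> v = 0"
proof -
 have "(%i. p + s i *\<^sub>R v) \<longlonglongrightarrow> p + b *\<^sub>R v" by (intro tendsto_intros s)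
 moreover have "(%i. p + s i *\<^sub>R v) \<longlonglongrightarrow> F y" using F_tendsto[OF g] by (simp add: F)
 ultimately have Fy: "F y = p + b *\<^sub>R v" using LIMSEQ_unique by blast
 have "\<bar>nu y \<bullet> v\<bar> <= 0 + eps" if e: "eps > 0" for eps
 proof -
  define eps' where "eps' = eps / (norm v + 1)"
  have v1: "norm v + 1 > 0" by (simp add: add_nonneg_pos)
  have e': "eps' > 0" using e v1 by (simp add: eps'_def)
  obtain U where U: "open U" "y \<in> U" "!!u z. u \<in> U ==> z \<in> U ==> \<bar>nu y \<bullet> (F u - F z)\<bar> <= eps' * norm (F u - F z)"
   using secant[OF e', of y] by auto
  have "\<forall>\<^sub>F i in sequentially. g (s i) \<in> U" using topological_tendstoD[OF g U(1,2)] .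
  then obtain i where i: "g (s i) \<in> U" using eventually_happens'[OF sequentially_bot] by blast
  have "F (g (s i)) - F y = (s i - b) *\<^sub>R v" unfolding F Fy by (simp add: scaleR_left_diff_distrib)
  then have "\<bar>s i - b\<bar> * \<bar>nu y \<bullet> v\<bar> <= eps' * (\<bar>s i - b\<bar> * norm v)"
   using U(3)[OF i U(2)] by (simp add: abs_mult)
  then have "\<bar>s i - b\<bar> * \<bar>nu y \<bullet> v\<bar> <= \<bar>s i - b\<bar> * (eps' * norm v)" by (simp add: mult_ac)
  then have "\<bar>nu y \<bullet> v\<bar> <= eps' * norm v" using s(2)[of i] by (simp add: mult_le_cancel_left)
  also have "\<dots> <= eps' * (norm v + 1)" using e' by (intro mult_left_mono) auto
  also have "\<dots> = eps" using v1 by (simp add: eps'_def)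
  finally show ?thesis by simp
 qed
 then have "\<bar>nu y \<bullet> v\<bar> <= 0" by (rule field_le_epsilon)
 then show ?thesis by simp
qed

end

context central_surface
begin

text \<open>Around a point whose tangent plane contains \<open>v\<close> there are coordinates in which lines in the direction
 \<open>v\<close> are vertical.\<close>

lemma ruled_box:
 assumes y: "nu y \<bullet> v = 0" and e: "e \<bullet> v = 1" and W: "open W" "y \<in> W"
 obtains U r k l where "open U" "y \<in> U" "U <= W" "r > 0" "inj_on F U" "l \<bullet> v = 0"
  "homeomorphism U ({-r<..<r} \<times> {-r<..<r}) (%z. (l \<bullet> (F z - F y), e \<bullet> (F z - F y))) k"
proof -
 define l where "l = cross3 v (nu y)"
 have ind: "indep3 l e (nu y)" unfolding indep3_def
 proof safe
  fix w assume w: "l \<bullet> w = 0" "e \<bullet> w = 0" "nu y \<bullet> w = 0"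
  have 1: "cross3 (nu y) (cross3 v w) = 0" unfolding Lagrange using w y by (simp add: inner_commute)
  have "nu y \<bullet> cross3 v w = - (l \<bullet> w)" unfolding l_def
   by (simp add: cross3_simps)
  then have "nu y \<bullet> cross3 v w = 0" using w by simp
  then have "cross3 v w = 0" using norm_and_cross_eq_0[of "nu y" "cross3 v w"] 1 nu_nonzero by auto
  then have "cross3 e (cross3 v w) = 0" by simp
  then show "w = 0" unfolding Lagrange using w(2) e by simp
 qed
 obtain U r L k where B: "open U" "y \<in> U" "U <= W" "r > 0" "L > 0" "inj_on F U"
  "homeomorphism U ({-r<..<r} \<times> {-r<..<r}) (%z. (l \<bullet> (F z - F y), e \<bullet> (F z - F y))) k"
  "!!u z. u \<in> U ==> z \<in> U ==> norm (F u - F z) <= L * (\<bar>l \<bullet> (F u - F z)\<bar> + \<bar>e \<bullet> (F u - F z)\<bar>)"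
  by (rule coordinate_box[OF ind W]) (rule that)
 have "l \<bullet> v = 0" by (simp add: l_def inner_commute dot_cross_self)
 then show thesis by (rule that[OF B(1-4,6) _ B(7)])
qed

text \<open>A lift of such a line cannot leave the box before its height does.\<close>

lemma lift_stays_in_box:
 assumes hom: "homeomorphism U ({-r<..<r} \<times> {-r<..<r}) (%z. (l \<bullet> (F z - F y), e \<bullet> (F z - F y))) k"
  and U: "open U" and l: "l \<bullet> v = 0"
  and J: "connected J" and g: "continuous_on J g" and F: "!!h. h \<in> J ==> F (g h) = p + h *\<^sub>R v"
  and h0: "h0 \<in> J" "g h0 \<in> U" and range: "!!h. h \<in> J ==> e \<bullet> (p + h *\<^sub>R v - F y) \<in> {-r<..<r}"
  and h: "h \<in> (J :: real set)"
 shows "g h \<in> U" "g h = k (l \<bullet> (p - F y), e \<bullet> (p + h *\<^sub>R v - F y))"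
proof -
 let ?k = "%h. k (l \<bullet> (p - F y), e \<bullet> (p + h *\<^sub>R v - F y))"
 have lF: "l \<bullet> (F (g h) - F y) = l \<bullet> (p - F y)" if "h \<in> J" for h
  unfolding F[OF that] using l by (simp add: inner_diff_right inner_add_right)
 have form: "g h = ?k h" if "h \<in> J" "g h \<in> U" for h
  using homeomorphism_apply1[OF hom that(2), unfolded lF[OF that(1)], unfolded F[OF that(1)]] by simp
 have lr: "l \<bullet> (p - F y) \<in> {-r<..<r}"
 proof -
  have "(%z. (l \<bullet> (F z - F y), e \<bullet> (F z - F y))) ` U = {-r<..<r} \<times> {-r<..<r}" using hom by (simp add: homeomorphism_def)
  then have "(l \<bullet> (F (g h0) - F y), e \<bullet> (F (g h0) - F y)) \<in> {-r<..<r} \<times> {-r<..<r}" using h0(2) by blast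
  then show ?thesis using lF[OF h0(1)] by simp
 qed
 have ck: "continuous_on ({-r<..<r} \<times> {-r<..<r}) k" using hom by (simp add: homeomorphism_def)
 have ck': "continuous_on J ?k"
  by (rule continuous_on_compose2[OF ck]) (use lr range in \<open>auto intro!: continuous_intros\<close>)
 have kU: "?k h \<in> U" if "h \<in> J" for h
 proof -
  have "k ` ({-r<..<r} \<times> {-r<..<r}) = U" using hom by (simp add: homeomorphism_def)
  then show ?thesis using lr range[OF that] by blast
 qed
 show inU: "g h \<in> U"
 proof (rule connected_induction_simple[OF J h0(1) h, of "%h. g h \<in> U"])
  show "g h0 \<in> U" by (rule h0)
  fix a assume a: "a \<in> J"
  show "\<exists>T. openin (top_of_set J) T & a \<in> T & (\<forall>x\<in>T. \<forall>y\<in>T. g x \<in> U --> g y \<in> U)"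
  proof (cases "g a \<in> U")
   case True
   have "openin (top_of_set J) (J Int g -` U)" using g U by (intro continuous_openin_preimage_gen)
   then show ?thesis using a True by (intro exI[of _ "J Int g -` U"]) simp
  next
   case False
   then have "g a ~= ?k a" using kU[OF a] by auto
   from hausdorff[OF this] obtain V W where VW: "open V" "open W" "g a \<in> V" "?k a \<in> W" "V Int W = {}"
    by (elim exE conjE)
   let ?T = "J Int g -` V Int (J Int ?k -` W)"
   have "openin (top_of_set J) ?T" using g ck' VW by (intro openin_Int continuous_openin_preimage_gen)
   moreover have "g x \<notin> U" if x: "x \<in> ?T" for x
   proof
    assume "g x \<in> U"
    then have "g x = ?k x" using form x by simp
    then have "g x \<in> V Int W" using x by simp
    then show False using VW(5) by simp
   qed
   ultimately show ?thesis using a VW by (intro exI[of _ ?T]) simp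
  qed
 qed
 show "g h = ?k h" by (rule form[OF h inU])
qed

end

lemma continuous_on_locally:
 fixes f :: "'a::t2_space => 'b::topological_space"
 assumes "!!p. p \<in> S ==> \<exists>O'. open O' & p \<in> O' & continuous_on (S Int O') f"
 shows "continuous_on S f"
 unfolding continuous_on_eq_continuous_within
proof
 fix p assume p: "p \<in> S"
 from assms[OF p] obtain W where W: "open W" "p \<in> W" "continuous_on (S Int W) f" by (elim exE conjE)
 have "continuous (at p within (S Int W)) f"
  using W(3) p W(2) unfolding continuous_on_eq_continuous_within by simp
 moreover have "at p within (S Int W) = at p within S"
  by (rule at_within_nhd[OF W(2,1)]) auto
 ultimately show "continuous (at p within S) f" by simp
qed

context immersed_surface
begin

text \<open>The lines in the direction \<open>v\<close> through the points of \<open>F ` \<Gamma>\<close> are lifted to the surface, over the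
 parameters in \<open>I\<close>, and the lifts depend continuously on the starting point.\<close>

definition ruling :: "'m set => real^3 => real set => ('m => real => 'm) => bool" where
 "ruling \<Gamma> v I \<Psi> \<longleftrightarrow> continuous_on (\<Gamma> \<times> I) (%p. \<Psi> (fst p) (snd p)) & (\<forall>x\<in>\<Gamma>. \<Psi> x 0 = x) &
  (\<forall>x\<in>\<Gamma>. \<forall>h\<in>I. F (\<Psi> x h) = F x + h *\<^sub>R v)"

lemma rulingD:
 assumes "ruling \<Gamma> v I \<Psi>"
 shows "continuous_on (\<Gamma> \<times> I) (%p. \<Psi> (fst p) (snd p))" "x \<in> \<Gamma> ==> \<Psi> x 0 = x"
  "x \<in> \<Gamma> ==> h \<in> I ==> F (\<Psi> x h) = F x + h *\<^sub>R v"
 using assms by (auto simp: ruling_def)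

lemma ruling_line:
 assumes "ruling \<Gamma> v I \<Psi>" "x \<in> \<Gamma>" "J <= I"
 shows "continuous_on J (%h. \<Psi> x h)"
proof -
 have "continuous_on J (%h. (%p. \<Psi> (fst p) (snd p)) (x, h))"
  by (rule continuous_on_compose2[OF rulingD(1)[OF assms(1)]]) (use assms in \<open>auto intro!: continuous_intros\<close>)
 then show ?thesis by simp
qed

lemma ruling_section:
 assumes "ruling \<Gamma> v I \<Psi>" "h \<in> I"
 shows "continuous_on \<Gamma> (%x. \<Psi> x h)"
proof -
 have "continuous_on \<Gamma> (%x. (%p. \<Psi> (fst p) (snd p)) (x, h))"
  by (rule continuous_on_compose2[OF rulingD(1)[OF assms(1)]]) (use assms in \<open>auto intro!: continuous_intros\<close>)
 then show ?thesis by simp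
qed

lemma ruling_subset: "ruling \<Gamma> v I \<Psi> ==> \<Gamma>' <= \<Gamma> ==> I' <= I ==> ruling \<Gamma>' v I' \<Psi>"
 unfolding ruling_def by (meson Sigma_mono continuous_on_subset subsetD)

lemma ruling_unique:
 assumes r: "ruling \<Gamma>1 v I1 \<Psi>1" "ruling \<Gamma>2 v I2 \<Psi>2" and I: "is_interval I1" "is_interval I2" "0 \<in> I1" "0 \<in> I2"
  and x: "x \<in> \<Gamma>1" "x \<in> \<Gamma>2" and h: "h \<in> I1" "h \<in> I2"
 shows "\<Psi>1 x h = \<Psi>2 x h"
proof (rule lift_unique[where J = "I1 Int I2" and ?h0.0 = 0])
 show "connected (I1 Int I2)" using I by (simp add: is_interval_connected is_interval_Int)
 show "continuous_on (I1 Int I2) (%h. \<Psi>1 x h)" by (rule ruling_line[OF r(1) x(1)]) simp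
 show "continuous_on (I1 Int I2) (%h. \<Psi>2 x h)" by (rule ruling_line[OF r(2) x(2)]) simp
 show "F (\<Psi>1 x t) = F (\<Psi>2 x t)" if "t \<in> I1 Int I2" for t
  using rulingD(3)[OF r(1) x(1)] rulingD(3)[OF r(2) x(2)] that by simp
 show "\<Psi>1 x 0 = \<Psi>2 x 0" using rulingD(2)[OF r(1) x(1)] rulingD(2)[OF r(2) x(2)] by simp
qed (use I h in auto)

text \<open>Local lifts agree where they overlap because lifts of a line are unique.\<close>

lemma rulings_glue:
 assumes loc: "!!x h. x \<in> \<Gamma> ==> h \<in> J ==> \<exists>W I ph. open W & x \<in> W & open I & is_interval I & 0 \<in> I & h \<in> I & ruling (\<Gamma> Int W) v I ph"
  and J: "0 \<in> J"
 obtains \<Psi> where "ruling \<Gamma> v J \<Psi>"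
proof -
 define ok where "ok W I ph x h \<longleftrightarrow> open W & x \<in> W & open I & is_interval I & 0 \<in> I & h \<in> I & ruling (\<Gamma> Int W) v I ph" for W I ph x h
 define \<Psi> where "\<Psi> x h = (SOME z. \<exists>W I ph. ok W I ph x h & z = ph x h)" for x h
 have eq: "\<Psi> x h = ph x h" if x: "x \<in> \<Gamma>" and o: "ok W I ph x h" for x h W I ph
  unfolding \<Psi>_def
 proof (rule some_equality)
  show "\<exists>W I ph'. ok W I ph' x h & ph x h = ph' x h" using o by (intro exI conjI) auto
  fix z assume "\<exists>W I ph'. ok W I ph' x h & z = ph' x h"
  then obtain W' I' ph' where o': "ok W' I' ph' x h" and z: "z = ph' x h" by (elim exE conjE)
  have "ph' x h = ph x h"
   by (rule ruling_unique[of "\<Gamma> Int W'" v I' ph' "\<Gamma> Int W" I ph]) (use o o' x in \<open>auto simp: ok_def\<close>)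
  then show "z = ph x h" using z by simp
 qed
 have ex: "\<exists>W I ph. ok W I ph x h" if "x \<in> \<Gamma>" "h \<in> J" for x h
  using loc[OF that] unfolding ok_def .
 have "continuous_on (\<Gamma> \<times> J) (%p. \<Psi> (fst p) (snd p))"
 proof (rule continuous_on_locally)
  fix p assume p: "p \<in> \<Gamma> \<times> J"
  obtain x h where xh: "p = (x, h)" "x \<in> \<Gamma>" "h \<in> J" using p by auto
  obtain W I ph where o: "ok W I ph x h" using ex[OF xh(2,3)] by (elim exE)
  have o': "open W" "x \<in> W" "open I" "h \<in> I" and r: "ruling (\<Gamma> Int W) v I ph" using o by (auto simp: ok_def)
  have "continuous_on ((\<Gamma> \<times> J) Int (W \<times> I)) (%p. ph (fst p) (snd p))"
   by (rule continuous_on_subset[OF rulingD(1)[OF r]]) auto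
  moreover have "\<Psi> (fst p) (snd p) = ph (fst p) (snd p)" if "p \<in> (\<Gamma> \<times> J) Int (W \<times> I)" for p
   by (rule eq) (use that o in \<open>auto simp: ok_def\<close>)
  ultimately have "continuous_on ((\<Gamma> \<times> J) Int (W \<times> I)) (%p. \<Psi> (fst p) (snd p))"
   using continuous_on_cong[of "(\<Gamma> \<times> J) Int (W \<times> I)" _ "%p. \<Psi> (fst p) (snd p)" "%p. ph (fst p) (snd p)"] by blast
  then show "\<exists>O'. open O' & p \<in> O' & continuous_on ((\<Gamma> \<times> J) Int O') (%p. \<Psi> (fst p) (snd p))"
   using o' xh by (intro exI[of _ "W \<times> I"]) (auto intro: open_Times)
 qed
 moreover have "\<Psi> x 0 = x" if x: "x \<in> \<Gamma>" for x
 proof -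
  obtain W I ph where o: "ok W I ph x 0" using ex[OF x J] by (elim exE)
  then show ?thesis using eq[OF x o] rulingD(2)[of "\<Gamma> Int W" v I ph x] x by (simp add: ok_def)
 qed
 moreover have "F (\<Psi> x h) = F x + h *\<^sub>R v" if x: "x \<in> \<Gamma>" and h: "h \<in> J" for x h
 proof -
  obtain W I ph where o: "ok W I ph x h" using ex[OF x h] by (elim exE)
  then show ?thesis using eq[OF x o] rulingD(3)[of "\<Gamma> Int W" v I ph x h] x by (simp add: ok_def)
 qed
 ultimately have "ruling \<Gamma> v J \<Psi>" by (simp add: ruling_def)
 then show thesis by (rule that)
qed

lemma finite_fibre:
 assumes "compact \<Gamma>"
 shows "finite {y\<in>\<Gamma>. F y = p}"
proof -
 let ?Y = "{y\<in>\<Gamma>. F y = p}"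
 have "closed {y. F y = p}" by (intro closed_Collect_eq continuous_intros)
 moreover have "?Y = \<Gamma> Int {y. F y = p}" by auto
 ultimately have cY: "compact ?Y" using assms by (simp add: compact_Int_closed)
 have "\<exists>U. open U & y \<in> U & inj_on F U" for y using secant[of 1 y] by auto
 then obtain U where U: "!!y. open (U y)" "!!y. y \<in> U y" "!!y. inj_on F (U y)" by metis
 have op: "!!y. y \<in> ?Y ==> open (U y)" by (rule U(1))
 have "?Y <= (\<Union>y\<in>?Y. U y)" using U(2) by blast
 from compactE_image[OF cY op this]
 obtain T where T: "T <= ?Y" "finite T" "?Y <= (\<Union>y\<in>T. U y)" .
 have "?Y <= T"
 proof
  fix y assume y: "y \<in> ?Y"
  then obtain t where t: "t \<in> T" "y \<in> U t" using T(3) by blast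
  have "y = t" by (rule inj_onD[OF U(3) _ t(2) U(2)]) (use y t(1) T(1) in auto)
  then show "y \<in> T" using t by simp
 qed
 then show ?thesis using T(2) by (rule finite_subset)
qed

text \<open>The points of a section are not isolated: a coordinate box contains a curve of points of the same
 height.\<close>

lemma nearby_point_same_height:
 assumes hom: "homeomorphism U ({-r<..<r} \<times> {-r<..<r}) (%z. (a \<bullet> (F z - F y), e \<bullet> (F z - F y))) k"
  and p: "p \<in> U"
 obtains z where "!!t. a \<bullet> (F p - F y) + t \<in> {-r<..<r} ==> z t \<in> U & e \<bullet> (F (z t) - F p) = 0 & a \<bullet> (F (z t) - F p) = t"
  "(z \<longlongrightarrow> p) (at (0::real))" "\<forall>\<^sub>F t in at (0::real). a \<bullet> (F p - F y) + t \<in> {-r<..<r}"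
proof -
 let ?a = "a \<bullet> (F p - F y)" and ?e = "e \<bullet> (F p - F y)"
 let ?I = "{-r<..<r}"
 have img: "(%z. (a \<bullet> (F z - F y), e \<bullet> (F z - F y))) ` U = ?I \<times> ?I" "k ` (?I \<times> ?I) = U"
  using hom by (auto simp: homeomorphism_def)
 have "(?a, ?e) \<in> ?I \<times> ?I" unfolding img(1)[symmetric] using p by (rule imageI)
 then have pI: "?a \<in> ?I" "?e \<in> ?I" by auto
 have ck: "continuous_on (?I \<times> ?I) k" using hom by (simp add: homeomorphism_def)
 have kp: "k (?a, ?e) = p" by (rule homeomorphism_apply1[OF hom p])
 define z where "z t = k (?a + t, ?e)" for t
 show thesis
 proof (rule that[of z])
  fix t assume t: "?a + t \<in> ?I"
  have "(?a + t, ?e) \<in> ?I \<times> ?I" using t pI by simp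
  then have zU: "z t \<in> U" and co: "(a \<bullet> (F (z t) - F y), e \<bullet> (F (z t) - F y)) = (?a + t, ?e)"
   using img(2) homeomorphism_apply2[OF hom] unfolding z_def by blast+
  then show "z t \<in> U & e \<bullet> (F (z t) - F p) = 0 & a \<bullet> (F (z t) - F p) = t"
   by (simp add: inner_diff_right)
 next
  have "isCont k (?a, ?e)"
   using ck pI by (simp add: continuous_on_eq_continuous_at open_Times)
  moreover have "((%t. (?a + t, ?e)) \<longlongrightarrow> (?a + 0, ?e)) (at 0)" by (intro tendsto_intros)
  ultimately have "((%t. k (?a + t, ?e)) \<longlongrightarrow> k (?a, ?e)) (at 0)"
   using isCont_tendsto_compose[of "(?a, ?e)" k "%t. (?a + t, ?e)" "at 0"] by simp
  then show "(z \<longlongrightarrow> p) (at 0)" unfolding z_def kp .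
 next
  have "((%t. ?a + t) \<longlongrightarrow> ?a + 0) (at 0)" by (intro tendsto_intros)
  then show "\<forall>\<^sub>F t in at 0. ?a + t \<in> ?I" using topological_tendstoD[of _ "?a + 0" _ ?I] pI(1) by simp
 qed
qed

end

lemma finite_common_bound:
 assumes "finite Y" "!!y. y \<in> Y ==> \<exists>b>0. \<forall>eps. 0 < eps --> eps <= b --> P y eps"
 obtains eps :: real where "eps > 0" "!!y. y \<in> Y ==> P y eps"
proof -
 obtain b where b: "!!y. y \<in> Y ==> b y > 0" "!!y eps. y \<in> Y ==> 0 < eps ==> eps <= b y ==> P y eps"
  using assms(2) by metis
 let ?m = "Min (insert 1 (b ` Y))"
 have "?m > 0" using assms(1) b(1) by auto
 moreover have "?m <= b y" if "y \<in> Y" for y using assms(1) that by auto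
 ultimately show thesis using that[of ?m] b(2) by blast
qed

context central_surface
begin

text \<open>The translations of sections are lifted to the surface. Near a double point of the section the
 translated point might jump to the other sheet. Then on the way, by connectedness, it would be a crossing
 of the two sheets, and translating back it would become a crossing of the given section, which has
 no other crossings nearby.\<close>

lemma local_ruling_at:
 assumes N: "open N" "compact K" "K <= N" and h: "h > 0" and ev: "e \<bullet> v = 1"
  and \<Gamma>: "compact \<Gamma>" "slice \<omega> e Int N = \<Gamma>"
  and tr: "!!x. x \<in> \<Gamma> ==> cross3 (nu x) e ~= 0"
  and ind: "!!x y. x \<in> \<Gamma> ==> y \<in> \<Gamma> ==> x ~= y ==> F x = F y ==> indep3 (nu x) (nu y) e"
  and hK: "!!a y. \<bar>a\<bar> < h ==> y \<in> N ==> e \<bullet> (F y - \<omega>) = 1 + a ==> y \<in> K"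
  and T: "!!a b p. \<bar>a\<bar> < h ==> \<bar>b\<bar> < h ==> p \<in> F ` {y\<in>N. e \<bullet> (F y - \<omega>) = 1 + a} ==>
   p + (b - a) *\<^sub>R v \<in> F ` {y\<in>N. e \<bullet> (F y - \<omega>) = 1 + b}"
  and x0: "x0 \<in> \<Gamma>"
 obtains W et ph where "open W" "x0 \<in> W" "et > 0" "ruling (\<Gamma> Int W) v {-et<..<et} ph"
proof -
 define H where "H a = {y\<in>N. e \<bullet> (F y - \<omega>) = 1 + a}" for a
 have H0: "H 0 = \<Gamma>" using \<Gamma>(2) by (auto simp: H_def slice_def)
 have HK: "H a <= K" if "\<bar>a\<bar> < h" for a using hK[OF that] by (auto simp: H_def)
 have \<Gamma>K: "\<Gamma> <= K" using HK[of 0] H0 h by simp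
 have TH: "p + (b - a) *\<^sub>R v \<in> F ` H b" if "\<bar>a\<bar> < h" "\<bar>b\<bar> < h" "p \<in> F ` H a" for a b p
  using T[OF that(1,2)] that(3) by (simp add: H_def)
 have height: "e \<bullet> (F x - \<omega>) = 1" "x \<in> N" if "x \<in> \<Gamma>" for x using that \<Gamma>(2) by (auto simp: slice_def)
 define d0 where "d0 = F x0"
 define Y where "Y = {y\<in>\<Gamma>. F y = d0}"
 have fY: "finite Y" unfolding Y_def by (rule finite_fibre[OF \<Gamma>(1)])
 have Y: "y \<in> \<Gamma>" "F y = d0" if "y \<in> Y" for y using that by (auto simp: Y_def)
 have x0Y: "x0 \<in> Y" using x0 by (simp add: Y_def d0_def)
 define sep where "sep y eps \<longleftrightarrow> (\<forall>w. \<bar>nu x0 \<bullet> w\<bar> <= eps * norm w --> \<bar>nu y \<bullet> w\<bar> <= eps * norm w -->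
   e \<bullet> w = 0 --> w = 0)" for y eps
 have ex: "\<exists>b>0. \<forall>eps. 0 < eps --> eps <= b --> sep y eps" if y: "y \<in> Y - {x0}" for y
 proof -
  have i3: "indep3 (nu x0) (nu y) e" by (rule ind) (use y Y[of y] x0 in \<open>auto simp: d0_def\<close>)
  obtain b where b: "b > 0"
   "!!w. \<bar>nu x0 \<bullet> w\<bar> <= b * norm w ==> \<bar>nu y \<bullet> w\<bar> <= b * norm w ==> \<bar>e \<bullet> w\<bar> <= b * norm w ==> w = 0"
   by (rule indep3_nearly_orthogonal[OF i3]) (rule that)
  have "w = 0" if "0 < eps" "eps <= b" "\<bar>nu x0 \<bullet> w\<bar> <= eps * norm w" "\<bar>nu y \<bullet> w\<bar> <= eps * norm w" "e \<bullet> w = 0" for eps w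
  proof -
   have "eps * norm w <= b * norm w" using that(2) by (rule mult_right_mono) simp
   then show ?thesis using that by (intro b(2)) auto
  qed
  then show ?thesis using b(1) unfolding sep_def by (intro exI[of _ b]) simp
 qed
 have fY': "finite (Y - {x0})" using fY by simp
 obtain eps where eps: "eps > 0" and sep: "!!y. y \<in> Y - {x0} ==> sep y eps"
  by (rule finite_common_bound[OF fY' ex]) (assumption | rule that)+
 have E: "w = 0" if "y \<in> Y - {x0}" "\<bar>nu x0 \<bullet> w\<bar> <= eps * norm w" "\<bar>nu y \<bullet> w\<bar> <= eps * norm w" "e \<bullet> w = 0" for y w
  using sep[OF that(1)] that(2-) unfolding sep_def by simp
 define P where "P y U r k V D \<longleftrightarrow> open U & y \<in> U & U <= N & inj_on F U &
   homeomorphism U ({-r<..<r} \<times> {-r<..<r}) (%z. (cross3 (nu y) e \<bullet> (F z - F y), e \<bullet> (F z - F y))) k &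
   (\<forall>u\<in>U. \<forall>z\<in>U. \<bar>nu y \<bullet> (F u - F z)\<bar> <= eps * norm (F u - F z)) &
   open V & compact D & y \<in> V & V <= D & D <= U" for y U and r :: real and k V D
 have "\<exists>U r k V D. P y U r k V D" if y: "y \<in> Y" for y
 proof -
  obtain U1 where U1: "open U1" "y \<in> U1"
   "\<forall>u\<in>U1. \<forall>z\<in>U1. \<bar>nu y \<bullet> (F u - F z)\<bar> <= eps * norm (F u - F z)"
   using secant[OF eps, of y] by auto
  have o: "open (U1 Int N)" "y \<in> U1 Int N" using U1 N(1) height(2)[OF Y(1)[OF y]] by auto
  obtain U r L k where U: "open U" "y \<in> U" "U <= U1 Int N" "r > 0" "L > 0" "inj_on F U"
   "homeomorphism U ({-r<..<r} \<times> {-r<..<r}) (%z. (cross3 (nu y) e \<bullet> (F z - F y), e \<bullet> (F z - F y))) k"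
   "!!u z. u \<in> U ==> z \<in> U ==> norm (F u - F z) <= L * (\<bar>cross3 (nu y) e \<bullet> (F u - F z)\<bar> + \<bar>e \<bullet> (F u - F z)\<bar>)"
   by (rule coordinate_box[OF indep3_cross[OF tr[OF Y(1)[OF y]]] o]) (rule that)
  obtain V D where V: "open V" "compact D" "y \<in> V" "V <= D" "D <= U"
   by (rule compact_neighbourhood[OF U(1,2)]) (rule that)
  have "U <= N" and se: "\<forall>u\<in>U. \<forall>z\<in>U. \<bar>nu y \<bullet> (F u - F z)\<bar> <= eps * norm (F u - F z)"
   using U(3) U1(3) by blast+
  then have "P y U r k V D" unfolding P_def by (intro conjI U V)
  then show ?thesis by (intro exI)
 qed
 then obtain U r k V D where PY: "!!y. y \<in> Y ==> P y (U y) (r y) (k y) (V y) (D y)" by metis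
 have Q: "open (U y)" "y \<in> U y" "U y <= N" "inj_on F (U y)"
  "homeomorphism (U y) ({-r y<..<r y} \<times> {-r y<..<r y}) (%z. (cross3 (nu y) e \<bullet> (F z - F y), e \<bullet> (F z - F y))) (k y)"
  "\<forall>u\<in>U y. \<forall>z\<in>U y. \<bar>nu y \<bullet> (F u - F z)\<bar> <= eps * norm (F u - F z)"
  "open (V y)" "compact (D y)" "y \<in> V y" "V y <= D y" "D y <= U y" if "y \<in> Y" for y
  using PY[OF that, unfolded P_def] by - (elim conjE, assumption)+
 \<comment> \<open>two sheets have no common direction along the plane\<close>
 have apart: "F u = F u'" if "y \<in> Y - {x0}" "u \<in> U x0" "u' \<in> U x0" "z \<in> U y" "z' \<in> U y"
  "F u - F u' = F z - F z'" "e \<bullet> (F u - F u') = 0" for y u u' z z'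
 proof -
  have "\<bar>nu x0 \<bullet> (F u - F u')\<bar> <= eps * norm (F u - F u')" using Q(6)[OF x0Y] that(2,3) by blast
  moreover have "\<bar>nu y \<bullet> (F u - F u')\<bar> <= eps * norm (F u - F u')" unfolding that(6) using Q(6)[of y] that(1,4,5) by blast
  ultimately have "F u - F u' = 0" using E[OF that(1)] that(7) by blast
  then show ?thesis by simp
 qed
 let ?C = "K - (\<Union>y\<in>Y. V y)"
 have oV: "open (\<Union>y\<in>Y. V y)" using Q(7) by blast
 have cC: "closed (F ` ?C)"
  by (intro compact_imp_closed compact_continuous_image continuous_on_subset[OF F_cont] compact_diff N oV) auto
 have "d0 \<notin> F ` ?C"
 proof
  assume "d0 \<in> F ` ?C"
  then obtain u where u: "u \<in> K" "u \<notin> (\<Union>y\<in>Y. V y)" "F u = d0" by blast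
  have "u \<in> slice \<omega> e Int N" using u N(3) height(1)[OF x0] by (auto simp: slice_def d0_def)
  then have "u \<in> Y" using u(3) \<Gamma>(2) by (simp add: Y_def)
  then show False using u(2) Q(9)[of u] by blast
 qed
 then obtain rh where rh: "rh > 0" "ball d0 rh <= - F ` ?C"
  using openE[of "- F ` ?C" d0] cC by (auto simp: open_Compl)
 have near: "\<exists>y\<in>Y. u \<in> V y" if "u \<in> K" "dist d0 (F u) < rh" for u
 proof -
  have "F u \<notin> F ` ?C" using rh(2) that(2) by auto
  then show ?thesis using that(1) by blast
 qed
 define et where "et = min h (rh / (2 * (norm v + 1)))"
 have v1: "norm v + 1 > 0" by (simp add: add_nonneg_pos)
 have et: "et > 0" "et <= h" using h rh(1) v1 by (auto simp: et_def)
 define W where "W = V x0 Int F -` ball d0 (rh / 2)"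
 have W: "open W" "x0 \<in> W" "W <= V x0"
  using Q(7,9)[OF x0Y] rh(1) open_vimage[OF open_ball F_cont] by (auto simp: W_def d0_def)
 have dW: "dist d0 (F x + t *\<^sub>R v) < rh" if "x \<in> W" "t \<in> {-et<..<et}" for x t
 proof -
  have "norm (t *\<^sub>R v) = \<bar>t\<bar> * norm v" by simp
  also have "\<dots> <= (rh / (2 * (norm v + 1))) * (norm v + 1)"
   using that(2) v1 by (intro mult_mono) (auto simp: et_def)
  also have "\<dots> = rh / 2" using v1 by (simp add: field_simps)
  finally have "norm (t *\<^sub>R v) <= rh / 2" .
  moreover have "dist d0 (F x) < rh / 2" using that(1) by (simp add: W_def)
  moreover have "dist d0 (F x + t *\<^sub>R v) <= dist d0 (F x) + norm (t *\<^sub>R v)"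
   using dist_triangle[of d0 "F x + t *\<^sub>R v" "F x"] by (simp add: dist_norm)
  ultimately show ?thesis by linarith
 qed
 \<comment> \<open>near \<open>x0\<close> the other sheets do not meet the sheet of \<open>x0\<close> in the plane of the section\<close>
 have simple: "F u ~= F x" if x: "x \<in> \<Gamma> Int W" "x ~= x0" and y: "y \<in> Y - {x0}" and u: "u \<in> V y" for x y u
 proof
  assume eq: "F u = F x"
  have "F x = F x0"
  proof (rule apart[OF y])
   show "x \<in> U x0" "x0 \<in> U x0" using x(1) W(2,3) Q(10,11)[OF x0Y] by blast+
   show "u \<in> U y" "y \<in> U y" using u y Q(2,10,11)[of y] by blast+
   show "F x - F x0 = F u - F y" using eq Y(2)[of y] y by (simp add: d0_def)
   have "e \<bullet> (F x - F x0) = e \<bullet> (F x - \<omega>) - e \<bullet> (F x0 - \<omega>)" by (simp add: inner_diff_right)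
   then show "e \<bullet> (F x - F x0) = 0" using height(1) x(1) x0 by simp
  qed
  then have "x = x0" using inj_onD[OF Q(4)[OF x0Y], of x x0] x(1) W(2,3) Q(10,11)[OF x0Y] by blast
  then show False using x(2) by simp
 qed
 have lift1: "F x + t *\<^sub>R v \<in> F ` D x0" if x: "x \<in> \<Gamma> Int W" "x ~= x0" and t: "t \<in> {-et<..<et}" for x t
 proof (rule ccontr)
  assume no: "F x + t *\<^sub>R v \<notin> F ` D x0"
  let ?I = "{-et<..<et}"
  let ?g = "%t. F x + t *\<^sub>R v"
  let ?R = "\<Union>y\<in>Y - {x0}. D y"
  have cR: "compact ?R" using fY Q(8) by (intro compact_UN) auto
  have cl: "closed (?g -` F ` A)" if "compact A" for A
   by (intro closed_vimage compact_imp_closed compact_continuous_image continuous_on_subset[OF F_cont] that continuous_intros) auto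
  have inH: "?g s \<in> F ` H s" if "s \<in> ?I" for s
  proof -
   have "\<bar>0\<bar> < h" "\<bar>s\<bar> < h" using that et(2) h by (auto simp: abs_less_iff)
   moreover have "F x \<in> F ` H 0" unfolding H0 using x(1) by blast
   ultimately have "F x + (s - 0) *\<^sub>R v \<in> F ` H s" by (rule TH)
   then show ?thesis by simp
  qed
  have cover: "s \<in> ?g -` F ` D x0 \<or> s \<in> ?g -` F ` ?R" if s: "s \<in> ?I" for s
  proof -
   obtain u where u: "u \<in> H s" "?g s = F u" using inH[OF s] by blast
   have "\<bar>s\<bar> < h" using s et(2) by (auto simp: abs_less_iff)
   then have "u \<in> K" using u(1) HK by blast
   moreover have "dist d0 (F u) < rh" unfolding u(2)[symmetric] using x(1) s by (intro dW) auto
   ultimately obtain y where y: "y \<in> Y" "u \<in> V y" using near by blast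
   then have "u \<in> D y" using Q(10) by blast
   then show ?thesis using y(1) u(2) by (cases "y = x0") auto
  qed
  have "\<exists>s\<in>?I. s \<in> ?g -` F ` D x0 & s \<in> ?g -` F ` ?R"
  proof (rule ccontr)
   assume dis: "\<not> (\<exists>s\<in>?I. s \<in> ?g -` F ` D x0 & s \<in> ?g -` F ` ?R)"
   have "?g -` F ` D x0 Int ?I = {} \<or> ?g -` F ` ?R Int ?I = {}"
   proof (rule connected_closedD)
    show "connected ?I" by simp
    show "?g -` F ` D x0 Int ?g -` F ` ?R Int ?I = {}" using dis by blast
    show "?I <= ?g -` F ` D x0 \<union> ?g -` F ` ?R" using cover by blast
   qed (intro cl Q(8) x0Y cR)+
   moreover have "0 \<in> ?g -` F ` D x0 Int ?I" using x(1) W(3) Q(10)[OF x0Y] et(1) by auto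
   moreover have "t \<in> ?g -` F ` ?R Int ?I" using cover[OF t] no t by simp
   ultimately show False by blast
  qed
  then obtain s p p' y where s: "s \<in> ?I" and p: "p \<in> D x0" "F p = ?g s" and p': "p' \<in> D y" "F p' = ?g s" and y: "y \<in> Y - {x0}"
   by force
  have p'U: "p' \<in> U y" "p' \<in> N" using p'(1) Q(3,11)[of y] y by blast+
  have eg: "e \<bullet> (?g s - \<omega>) = 1 + s"
  proof -
   have "?g s - \<omega> = (F x - \<omega>) + s *\<^sub>R v" by simp
   then have "e \<bullet> (?g s - \<omega>) = e \<bullet> (F x - \<omega>) + s * (e \<bullet> v)" by (simp only: inner_add_right inner_scaleR_right)
   then show ?thesis using height(1) x(1) ev by simp
  qed
  \<comment> \<open>points of the section near \<open>x\<close> lie on the sheet of \<open>x0\<close> only\<close>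
  have "closed (F ` (\<Gamma> - V x0))"
   by (intro compact_imp_closed compact_continuous_image continuous_on_subset[OF F_cont] compact_diff \<Gamma> Q(7) x0Y) auto
  moreover have "F x \<notin> F ` (\<Gamma> - V x0)"
  proof
   assume "F x \<in> F ` (\<Gamma> - V x0)"
   then obtain u where u: "u \<in> \<Gamma>" "u \<notin> V x0" "F u = F x" by force
   have "dist d0 (F u) < rh" using dW[of x 0] x(1) et(1) u(3) by simp
   then obtain y where "y \<in> Y" "u \<in> V y" using near[of u] u(1) \<Gamma>K by blast
   moreover then have "y ~= x0" using u(2) by auto
   ultimately show False using simple[OF x, of y u] u(3) by simp
  qed
  ultimately obtain r' where r': "r' > 0" "ball (F x) r' <= - F ` (\<Gamma> - V x0)"
   using openE[of "- F ` (\<Gamma> - V x0)" "F x"] by (auto simp: open_Compl)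
  have yY: "y \<in> Y" using y by simp
  obtain z where z: "!!t. cross3 (nu y) e \<bullet> (F p' - F y) + t \<in> {-r y<..<r y} ==>
    z t \<in> U y & e \<bullet> (F (z t) - F p') = 0 & cross3 (nu y) e \<bullet> (F (z t) - F p') = t"
   and zl: "(z \<longlongrightarrow> p') (at (0::real))"
   and zr: "\<forall>\<^sub>F t in at (0::real). cross3 (nu y) e \<bullet> (F p' - F y) + t \<in> {-r y<..<r y}"
   by (rule nearby_point_same_height[OF Q(5)[OF yY] p'U(1)]) (rule that)
  have "\<forall>\<^sub>F t in at 0. dist (F (z t)) (F p') < r'" by (rule tendstoD[OF F_tendsto[OF zl] r'(1)])
  then have "\<forall>\<^sub>F t in at (0::real). dist (F (z t)) (F p') < r' &
    cross3 (nu y) e \<bullet> (F p' - F y) + t \<in> {-r y<..<r y} & t ~= 0"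
   using zr eventually_neq_at_within[of "0::real" 0 UNIV] by (intro eventually_conj)
  then obtain \<tau> where \<tau>: "dist (F (z \<tau>)) (F p') < r'" "cross3 (nu y) e \<bullet> (F p' - F y) + \<tau> \<in> {-r y<..<r y}" "\<tau> ~= 0"
   using eventually_happens'[OF at_neq_bot] by blast
  note zz = z[OF \<tau>(2)]
  have "F (z \<tau>) - \<omega> = (F (z \<tau>) - F p') + (?g s - \<omega>)" unfolding p'(2) by simp
  then have "e \<bullet> (F (z \<tau>) - \<omega>) = e \<bullet> (F (z \<tau>) - F p') + e \<bullet> (?g s - \<omega>)" by (simp only: inner_add_right)
  then have "e \<bullet> (F (z \<tau>) - \<omega>) = 1 + s" unfolding eg using zz by simp
  then have "z \<tau> \<in> H s" using zz Q(3)[OF yY] by (auto simp: H_def)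
  then have "F (z \<tau>) + (0 - s) *\<^sub>R v \<in> F ` H 0" using s et(2) h by (intro TH) auto
  then obtain u where u: "u \<in> \<Gamma>" "F u = F (z \<tau>) - s *\<^sub>R v" unfolding H0 by force
  have ux: "F u - F x = F (z \<tau>) - F p'" unfolding u(2) p'(2) by simp
  then have "dist (F x) (F u) < r'" using \<tau>(1) by (simp add: dist_norm norm_minus_commute)
  then have "F u \<notin> F ` (\<Gamma> - V x0)" using r'(2) by auto
  then have "u \<in> V x0" using u(1) by blast
  have "F u = F x"
  proof (rule apart[OF y _ _ _ p'U(1) ux])
   show "u \<in> U x0" "x \<in> U x0" using \<open>u \<in> V x0\<close> x(1) W(3) Q(10,11)[OF x0Y] by blast+
   show "z \<tau> \<in> U y" using zz by simp
   show "e \<bullet> (F u - F x) = 0" unfolding ux using zz by simp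
  qed
  then have "F (z \<tau>) - F p' = 0" using ux by simp
  then have "cross3 (nu y) e \<bullet> (F (z \<tau>) - F p') = 0" by (simp only: inner_zero_right)
  then show False using zz \<tau>(3) by simp
 qed
 have lift: "F x + t *\<^sub>R v \<in> F ` D x0" if x: "x \<in> \<Gamma> Int W" and t: "t \<in> {-et<..<et}" for x t
 proof (cases "x = x0")
  case True
  obtain z where z: "!!t. cross3 (nu x0) e \<bullet> (F x0 - F x0) + t \<in> {-r x0<..<r x0} ==>
    z t \<in> U x0 & e \<bullet> (F (z t) - F x0) = 0 & cross3 (nu x0) e \<bullet> (F (z t) - F x0) = t"
   and zl: "(z \<longlongrightarrow> x0) (at (0::real))"
   and zr: "\<forall>\<^sub>F t in at (0::real). cross3 (nu x0) e \<bullet> (F x0 - F x0) + t \<in> {-r x0<..<r x0}"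
   by (rule nearby_point_same_height[OF Q(5)[OF x0Y] Q(2)[OF x0Y]]) (rule that)
  have "\<forall>\<^sub>F s in at (0::real). z s \<in> W" by (rule topological_tendstoD[OF zl W(1,2)])
  then have evD: "\<forall>\<^sub>F s in at (0::real). F (z s) + t *\<^sub>R v \<in> F ` D x0"
  proof (rule eventually_elim2[OF _ eventually_conj[OF zr eventually_neq_at_within[of "0::real" 0 UNIV]]])
   fix s assume s: "z s \<in> W" "cross3 (nu x0) e \<bullet> (F x0 - F x0) + s \<in> {-r x0<..<r x0} & s ~= 0"
   note zz = z[OF conjunct1[OF s(2)]]
   have "F (z s) - \<omega> = (F (z s) - F x0) + (F x0 - \<omega>)" by simp
   then have "e \<bullet> (F (z s) - \<omega>) = e \<bullet> (F (z s) - F x0) + e \<bullet> (F x0 - \<omega>)" by (simp only: inner_add_right)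
   then have "z s \<in> slice \<omega> e Int N" using zz height(1)[OF x0] Q(3)[OF x0Y] by (auto simp: slice_def)
   then have "z s \<in> \<Gamma> Int W" using \<Gamma>(2) s(1) by simp
   moreover have "z s ~= x0" using zz s(2) by auto
   ultimately show "F (z s) + t *\<^sub>R v \<in> F ` D x0" using lift1 t by blast
  qed
  have limD: "((%s. F (z s) + t *\<^sub>R v) \<longlongrightarrow> F x0 + t *\<^sub>R v) (at 0)" by (intro tendsto_intros F_tendsto zl)
  have "closed (F ` D x0)"
   by (intro compact_imp_closed compact_continuous_image continuous_on_subset[OF F_cont] Q(8) x0Y) auto
  then have "F x0 + t *\<^sub>R v \<in> F ` D x0" by (rule Lim_in_closed_set[OF _ evD at_neq_bot limD])
  then show ?thesis using True by simp
 qed (use lift1 x t in blast)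
 let ?a = "cross3 (nu x0) e"
 let ?J = "{-r x0<..<r x0}"
 note hom = Q(5)[OF x0Y]
 define ph where "ph x t = k x0 (?a \<bullet> (F x + t *\<^sub>R v - F x0), e \<bullet> (F x + t *\<^sub>R v - F x0))" for x t
 have ph: "(?a \<bullet> (F x + t *\<^sub>R v - F x0), e \<bullet> (F x + t *\<^sub>R v - F x0)) \<in> ?J \<times> ?J & F (ph x t) = F x + t *\<^sub>R v &
   ph x t \<in> U x0"
  if x: "x \<in> \<Gamma> Int W" and t: "t \<in> {-et<..<et}" for x t
 proof -
  obtain u where u: "u \<in> U x0" "F x + t *\<^sub>R v = F u" using lift[OF x t] Q(11)[OF x0Y] by blast
  have img: "(%z. (?a \<bullet> (F z - F x0), e \<bullet> (F z - F x0))) ` U x0 = ?J \<times> ?J" using hom by (simp add: homeomorphism_def)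
  have "ph x t = u" unfolding ph_def u(2) by (rule homeomorphism_apply1[OF hom u(1)])
  moreover have "(?a \<bullet> (F u - F x0), e \<bullet> (F u - F x0)) \<in> ?J \<times> ?J" unfolding img[symmetric] using u(1) by (rule imageI)
  ultimately show ?thesis using u by simp
 qed
 have "continuous_on ((\<Gamma> Int W) \<times> {-et<..<et}) (%p. ph (fst p) (snd p))"
 proof -
  have ck: "continuous_on (?J \<times> ?J) (k x0)" using hom by (simp add: homeomorphism_def)
  show ?thesis unfolding ph_def
  proof (rule continuous_on_compose2[OF ck])
   show "continuous_on ((\<Gamma> Int W) \<times> {- et<..<et})
    (%p. (?a \<bullet> (F (fst p) + snd p *\<^sub>R v - F x0), e \<bullet> (F (fst p) + snd p *\<^sub>R v - F x0)))"
    by (intro continuous_intros)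
   show "(%p. (?a \<bullet> (F (fst p) + snd p *\<^sub>R v - F x0), e \<bullet> (F (fst p) + snd p *\<^sub>R v - F x0))) `
    ((\<Gamma> Int W) \<times> {- et<..<et}) <= ?J \<times> ?J"
   proof (rule image_subsetI)
    fix p assume "p \<in> (\<Gamma> Int W) \<times> {- et<..<et}"
    then show "(?a \<bullet> (F (fst p) + snd p *\<^sub>R v - F x0), e \<bullet> (F (fst p) + snd p *\<^sub>R v - F x0)) \<in> ?J \<times> ?J"
     using ph[of "fst p" "snd p"] by (simp only: mem_Times_iff)
   qed
  qed
 qed
 moreover have "ph x 0 = x" if x: "x \<in> \<Gamma> Int W" for x
 proof -
  have "F (ph x 0) = F x" "ph x 0 \<in> U x0" using ph[OF x, of 0] et(1) by auto
  moreover have "x \<in> U x0" using x W(3) Q(10,11)[OF x0Y] by blast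
  ultimately show ?thesis using inj_onD[OF Q(4)[OF x0Y]] by blast
 qed
 ultimately have "ruling (\<Gamma> Int W) v {-et<..<et} ph" unfolding ruling_def using ph by simp
 then show thesis by (rule that[OF W(1,2) et(1)])
qed

end

lemma connected_third_point:
 fixes x1 x2 :: "'a::t2_space"
 assumes "connected \<Gamma>" "x1 \<in> \<Gamma>" "x2 \<in> \<Gamma>" "x1 ~= x2"
 shows "\<exists>x\<in>\<Gamma>. x ~= x1 & x ~= x2"
proof (rule ccontr)
 assume "\<not> ?thesis"
 then have G: "\<Gamma> = {x1, x2}" using assms by blast
 from hausdorff[OF assms(4)] obtain U V where UV: "open U" "open V" "x1 \<in> U" "x2 \<in> V" "U Int V = {}"
  by (elim exE conjE)
 have "U Int \<Gamma> = {} \<or> V Int \<Gamma> = {}"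
  by (rule connectedD[OF assms(1) UV(1,2)]) (use UV G in auto)
 then show False using UV G by auto
qed

context central_surface
begin

lemma centred_loopD:
 assumes "centred_loop \<omega> e \<Gamma> c x1 x2"
 shows "compact \<Gamma>" "connected \<Gamma>" "\<Gamma> <= slice \<omega> e" "x \<in> \<Gamma> ==> cross3 (nu x) e ~= 0"
  "x \<in> \<Gamma> ==> y \<in> \<Gamma> ==> x ~= y ==> F x = F y ==> indep3 (nu x) (nu y) e"
  "x1 ~= x2" "x1 \<in> \<Gamma>" "x2 \<in> \<Gamma>" "F x1 = c" "F x2 = c" "x \<in> \<Gamma> ==> F x = c ==> x = x1 \<or> x = x2" "centred \<Gamma> c"
proof -
 note a = assms[unfolded centred_loop_def]
 show "compact \<Gamma>" "connected \<Gamma>" "x1 ~= x2" "centred \<Gamma> c" using a by simp_all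
 have f: "{x\<in>\<Gamma>. F x = c} = {x1, x2}" using a by simp
 show "x1 \<in> \<Gamma>" "x2 \<in> \<Gamma>" "F x1 = c" "F x2 = c" using f by blast+
 show "x \<in> \<Gamma> ==> F x = c ==> x = x1 \<or> x = x2" using f by blast
 show "x \<in> \<Gamma> ==> cross3 (nu x) e ~= 0" using a by simp
 show "x \<in> \<Gamma> ==> y \<in> \<Gamma> ==> x ~= y ==> F x = F y ==> indep3 (nu x) (nu y) e" using a by simp
 obtain N0 where "slice \<omega> e Int N0 = \<Gamma>" using a by auto
 then show "\<Gamma> <= slice \<omega> e" by blast
qed

lemma centred_loop_height:
 assumes "centred_loop \<omega> e \<Gamma> c x1 x2" "x \<in> \<Gamma>"
 shows "e \<bullet> (F x - \<omega>) = 1"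
 using centred_loopD(3)[OF assms(1)] assms(2) by (auto simp: slice_def)

text \<open>A compact loop is covered by finitely many pieces on which the local rulings exist for a common time.\<close>

lemma local_ruling:
 assumes loop: "centred_loop \<omega> e \<Gamma> c x1 x2"
 obtains v h \<Psi> where "h > 0" "e \<bullet> v = 1" "ruling \<Gamma> v {-h<..<h} \<Psi>"
proof -
 note L = centred_loopD[OF loop]
 have big: "\<exists>x\<in>\<Gamma>. F x ~= c" using connected_third_point[OF L(2,7,8,6)] L(11) by blast
 obtain N K h v where N: "open N" and sN: "slice \<omega> e Int N = \<Gamma>" and K: "compact K" "K <= N" and h: "h > 0" and ev: "e \<bullet> v = 1"
  and hK: "!!a y. \<bar>a\<bar> < h ==> y \<in> N ==> e \<bullet> (F y - \<omega>) = 1 + a ==> y \<in> K"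
  and T: "!!a b p. \<bar>a\<bar> < h ==> \<bar>b\<bar> < h ==> p \<in> F ` {y\<in>N. e \<bullet> (F y - \<omega>) = 1 + a} ==>
   p + (b - a) *\<^sub>R v \<in> F ` {y\<in>N. e \<bullet> (F y - \<omega>) = 1 + b}"
  by (rule local_translation[OF loop central_dense big]) (assumption | rule that)+
 have "\<exists>W et ph. open W & x \<in> W & et > 0 & ruling (\<Gamma> Int W) v {-et<..<et} ph" if x: "x \<in> \<Gamma>" for x
 proof -
  obtain W et ph where "open W" "x \<in> W" "et > 0" "ruling (\<Gamma> Int W) v {-et<..<et} ph"
   by (rule local_ruling_at[OF N K h ev L(1) sN L(4) L(5) hK T x]) (assumption | rule that)+
  then show ?thesis by (intro exI conjI)
 qed
 then obtain W et ph where W: "!!x. x \<in> \<Gamma> ==> open (W x) & x \<in> W x & et x > 0 & ruling (\<Gamma> Int W x) v {-et x<..<et x} (ph x)"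
  by metis
 have op: "!!x. x \<in> \<Gamma> ==> open (W x)" using W by blast
 have "\<Gamma> <= (\<Union>x\<in>\<Gamma>. W x)" using W by blast
 from compactE_image[OF L(1) op this] obtain T where T: "T <= \<Gamma>" "finite T" "\<Gamma> <= (\<Union>x\<in>T. W x)" .
 define h1 where "h1 = Min (insert 1 (et ` T))"
 have h1: "h1 > 0" "!!x. x \<in> T ==> h1 <= et x" using T(1,2) W by (auto simp: h1_def)
 obtain \<Psi> where "ruling \<Gamma> v {-h1<..<h1} \<Psi>"
 proof (rule rulings_glue)
  fix x t assume x: "x \<in> \<Gamma>" and t: "t \<in> {-h1<..<h1}"
  obtain y where y: "y \<in> T" "x \<in> W y" using T(3) x by blast
  have Wy: "open (W y)" "ruling (\<Gamma> Int W y) v {-et y<..<et y} (ph y)" using W y(1) T(1) by blast+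
  have "t \<in> {-et y<..<et y}" "0 \<in> {-et y<..<et y}" using t h1(2)[OF y(1)] h1(1) by auto
  then show "\<exists>W I ph. open W & x \<in> W & open I & is_interval I & 0 \<in> I & t \<in> I & ruling (\<Gamma> Int W) v I ph"
   using y(2) Wy by (intro exI[of _ "W y"] exI[of _ "{-et y<..<et y}"] exI[of _ "ph y"]) simp
 qed (use h1(1) in simp, rule that)
 then show thesis by (rule that[OF h1(1) ev])
qed

text \<open>The line of the ruling through the point provides secants in the direction \<open>v\<close>.\<close>

lemma ruling_tangent:
 assumes r: "ruling \<Gamma> v I \<Psi>" and I: "is_interval I" "b \<in> I" "a \<in> I" "a ~= b" and x: "x \<in> \<Gamma>"
 shows "nu (\<Psi> x b) \<bullet> v = 0"
proof -
 define s where "s i = b + inverse (real (Suc i)) * (a - b)" for i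
 have sI: "s i \<in> I" for i
 proof -
  have u: "0 <= inverse (real (Suc i))" "inverse (real (Suc i)) <= 1" by (auto simp: inverse_le_1_iff)
  have "convex I" using I(1) by (rule is_interval_convex)
  then have "(1 - inverse (real (Suc i))) *\<^sub>R b + inverse (real (Suc i)) *\<^sub>R a \<in> I"
   using u I by (intro convexD_alt) auto
  then show ?thesis by (simp add: s_def algebra_simps)
 qed
 have sl: "s \<longlonglongrightarrow> b"
 proof -
  have "(%i. b + inverse (real (Suc i)) * (a - b)) \<longlonglongrightarrow> b + 0 * (a - b)"
   by (intro tendsto_intros LIMSEQ_inverse_real_of_nat)
  then show ?thesis by (simp add: s_def[abs_def])
 qed
 have sb: "s i ~= b" for i using I(4) by (simp add: s_def)
 have "(%i. \<Psi> x (s i)) \<longlonglongrightarrow> \<Psi> x b"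
  by (rule continuous_on_tendsto_compose[OF ruling_line[OF r x order_refl] sl I(2)]) (use sI in simp)
 then show ?thesis
  by (rule tangent_of_limit[where g = "\<Psi> x" and p = "F x", OF sl sb]) (rule rulingD(3)[OF r x sI])
qed

lemma tangent_imp_transversal:
 assumes "nu y \<bullet> v = 0" "e \<bullet> v = 1"
 shows "cross3 (nu y) e ~= 0"
proof
 assume "cross3 (nu y) e = 0"
 then have "cross3 v (cross3 (nu y) e) = 0" by simp
 then have "nu y = 0" unfolding Lagrange using assms by (simp add: inner_commute)
 then show False using nu_nonzero by blast
qed

lemma tangent_imp_indep3:
 assumes t: "nu y \<bullet> v = 0" "nu z \<bullet> v = 0" "e \<bullet> v = 1" and yz: "y ~= z" "F y = F z"
 shows "indep3 (nu y) (nu z) e"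
 unfolding indep3_def
proof safe
 fix w assume w: "nu y \<bullet> w = 0" "nu z \<bullet> w = 0" "e \<bullet> w = 0"
 let ?d = "cross3 (nu y) (nu z)"
 have par: "cross3 ?d u = 0" if "nu y \<bullet> u = 0" "nu z \<bullet> u = 0" for u
 proof -
  have "cross3 u ?d = 0" unfolding Lagrange using that by (simp add: inner_commute)
  then show ?thesis using cross_skew[of ?d u] by simp
 qed
 have "cross3 v w = 0"
  by (rule cross3_vanishing_parallel[OF normals_independent[OF yz] par[OF t(1,2)] par[OF w(1,2)]])
 then have "cross3 e (cross3 v w) = 0" by simp
 then show "w = 0" unfolding Lagrange using w(3) t(3) by simp
qed

text \<open>Translating \<open>\<Gamma>\<close> along the ruling gives a cross-cut by the parallel plane. Transversality is
 automatic, since \<open>v\<close> is tangent to the surface and transversal to the planes, and no further double points at the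
 centre appear because lifts are unique.\<close>

lemma ruling_loop:
 assumes loop: "centred_loop \<omega> e \<Gamma> c x1 x2" and ev: "e \<bullet> v = 1" and r: "ruling \<Gamma> v I \<Psi>"
  and I: "is_interval I" "0 \<in> I" "b \<in> I" "a1 \<in> I" "a2 \<in> I" "a1 ~= a2"
 shows "centred_loop (\<omega> + b *\<^sub>R v) e ((%x. \<Psi> x b) ` \<Gamma>) (c + b *\<^sub>R v) (\<Psi> x1 b) (\<Psi> x2 b)"
proof -
 note L = centred_loopD[OF loop]
 let ?G = "%h. (%x. \<Psi> x h) ` \<Gamma>"
 have FP: "F (\<Psi> x h) = F x + h *\<^sub>R v" if "x \<in> \<Gamma>" "h \<in> I" for x h by (rule rulingD(3)[OF r that])
 have tan: "nu (\<Psi> x h) \<bullet> v = 0" if "x \<in> \<Gamma>" "h \<in> I" for x h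
 proof -
  obtain a where "a \<in> I" "a ~= h" using I(4-6) by blast
  then show ?thesis using ruling_tangent[OF r I(1) that(2)] that(1) by blast
 qed
 have slice_eq: "z \<in> slice (\<omega> + h *\<^sub>R v) e \<longleftrightarrow> e \<bullet> (F z - \<omega>) = 1 + h" for z h
 proof -
  have "F z - (\<omega> + h *\<^sub>R v) = (F z - \<omega>) - h *\<^sub>R v" by simp
  then have "e \<bullet> (F z - (\<omega> + h *\<^sub>R v)) = e \<bullet> (F z - \<omega>) - h * (e \<bullet> v)" by (simp only: inner_diff_right[of e "F z - \<omega>"] inner_scaleR_right)
  then show ?thesis using ev by (auto simp: slice_def)
 qed
 have height: "e \<bullet> (F (\<Psi> x h) - \<omega>) = 1 + h" if "x \<in> \<Gamma>" "h \<in> I" for x h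
 proof -
  have "F (\<Psi> x h) - \<omega> = (F x - \<omega>) + h *\<^sub>R v" unfolding FP[OF that] by simp
  then have "e \<bullet> (F (\<Psi> x h) - \<omega>) = e \<bullet> (F x - \<omega>) + h * (e \<bullet> v)" by (simp only: inner_add_right inner_scaleR_right)
  then show ?thesis using centred_loop_height[OF loop that(1)] ev by simp
 qed
 have inj: "x = x'" if "x \<in> \<Gamma>" "x' \<in> \<Gamma>" "\<Psi> x b = \<Psi> x' b" for x x'
 proof -
  have F: "F x = F x'" using FP[OF that(1) I(3)] FP[OF that(2) I(3)] that(3) by simp
  have "\<Psi> x 0 = \<Psi> x' 0"
   by (rule lift_unique[OF is_interval_connected[OF I(1)] ruling_line[OF r that(1) order_refl] ruling_line[OF r that(2) order_refl] _ I(3) that(3) I(2)])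
    (simp add: FP that F)
  then show ?thesis using rulingD(2)[OF r that(1)] rulingD(2)[OF r that(2)] by simp
 qed
 \<comment> \<open>being relatively open in the section propagates along every line, box by box\<close>
 have open_along: "\<exists>U. open U & \<Psi> x h \<in> U & slice (\<omega> + h *\<^sub>R v) e Int U <= ?G h" if x: "x \<in> \<Gamma>" and h: "h \<in> I" for x h
 proof (rule connected_induction_simple[OF is_interval_connected[OF I(1)] I(2) h,
    of "%h. \<exists>U. open U & \<Psi> x h \<in> U & slice (\<omega> + h *\<^sub>R v) e Int U <= ?G h"])
  obtain N0 where N0: "open N0" "slice \<omega> e Int N0 = \<Gamma>" using loop unfolding centred_loop_def by blast
  have "?G 0 = \<Gamma>" using rulingD(2)[OF r] by force
  then show "\<exists>U. open U & \<Psi> x 0 \<in> U & slice (\<omega> + 0 *\<^sub>R v) e Int U <= ?G 0"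
   using N0 x rulingD(2)[OF r x] by (intro exI[of _ N0]) auto
 next
  fix h0 assume h0: "h0 \<in> I"
  let ?y = "\<Psi> x h0"
  obtain U r0 k l where U: "open U" "?y \<in> U" "U <= UNIV" "r0 > 0" "inj_on F U" "l \<bullet> v = 0"
   "homeomorphism U ({-r0<..<r0} \<times> {-r0<..<r0}) (%z. (l \<bullet> (F z - F ?y), e \<bullet> (F z - F ?y))) k"
   by (rule ruled_box[OF tan[OF x h0] ev open_UNIV UNIV_I]) (rule that)
  let ?Q = "{-r0<..<r0}"
  define J where "J = I Int {h0 - r0<..<h0 + r0}"
  have J: "connected J" "J <= I" "h0 \<in> J" "openin (top_of_set I) J"
   using I(1) h0 U(4) by (auto simp: J_def is_interval_Int intro!: is_interval_connected openin_open_Int)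
  have img: "(%z. (l \<bullet> (F z - F ?y), e \<bullet> (F z - F ?y))) ` U = ?Q \<times> ?Q" "k ` (?Q \<times> ?Q) = U" and ck: "continuous_on (?Q \<times> ?Q) k"
   using U(7) by (auto simp: homeomorphism_def)
  have ey: "e \<bullet> (F x' + t *\<^sub>R v - F ?y) = t - h0" if "x' \<in> \<Gamma>" for x' t
  proof -
   have "F x' + t *\<^sub>R v - F ?y = (F x' - \<omega>) - (F x - \<omega>) + (t - h0) *\<^sub>R v" unfolding FP[OF x h0] by (simp add: algebra_simps)
   then have "e \<bullet> (F x' + t *\<^sub>R v - F ?y) = e \<bullet> (F x' - \<omega>) - e \<bullet> (F x - \<omega>) + (t - h0) * (e \<bullet> v)"
    by (simp only: inner_add_right[of e "(F x' - \<omega>) - (F x - \<omega>)"] inner_diff_right[of e "F x' - \<omega>" "F x - \<omega>"] inner_scaleR_right)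
   then show ?thesis using centred_loop_height[OF loop that] centred_loop_height[OF loop x] ev by simp
  qed
  have stay: "\<Psi> x' t \<in> U" "\<Psi> x' t = k (l \<bullet> (F x' - F ?y), t - h0)"
   if "x' \<in> \<Gamma>" "t' \<in> J" "\<Psi> x' t' \<in> U" "t \<in> J" for x' t t'
  proof -
   have rg: "e \<bullet> (F x' + s *\<^sub>R v - F ?y) \<in> ?Q" if "s \<in> J" for s
    unfolding ey[OF \<open>x' \<in> \<Gamma>\<close>] using that by (auto simp: J_def)
   have FF: "F (\<Psi> x' s) = F x' + s *\<^sub>R v" if "s \<in> J" for s using FP[OF \<open>x' \<in> \<Gamma>\<close>] that J(2) by blast
   note st = lift_stays_in_box[OF U(7,1,6) J(1) ruling_line[OF r that(1) J(2)] FF that(2,3) rg that(4)]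
   show "\<Psi> x' t \<in> U" by (rule st(1))
   show "\<Psi> x' t = k (l \<bullet> (F x' - F ?y), t - h0)" using st(2) unfolding ey[OF that(1)] by simp
  qed
  have xU: "\<Psi> x t \<in> U" if "t \<in> J" for t by (rule stay(1)[OF x J(3) U(2) that])
  have step: "\<exists>U'. open U' & \<Psi> x h' \<in> U' & slice (\<omega> + h' *\<^sub>R v) e Int U' <= ?G h'"
   if hh: "h \<in> J" "h' \<in> J" and ex: "\<exists>U'. open U' & \<Psi> x h \<in> U' & slice (\<omega> + h *\<^sub>R v) e Int U' <= ?G h" for h h'
  proof -
   obtain U1 where U1: "open U1" "\<Psi> x h \<in> U1" "slice (\<omega> + h *\<^sub>R v) e Int U1 <= ?G h" using ex by (elim exE conjE)
   let ?p = "%z. k (l \<bullet> (F z - F ?y), h - h0)"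
   have hQ: "h - h0 \<in> ?Q" "h' - h0 \<in> ?Q" using hh by (auto simp: J_def)
   have lz: "l \<bullet> (F z - F ?y) \<in> ?Q" "e \<bullet> (F z - F ?y) \<in> ?Q" if "z \<in> U" for z
   proof -
    have "(l \<bullet> (F z - F ?y), e \<bullet> (F z - F ?y)) \<in> ?Q \<times> ?Q" unfolding img(1)[symmetric] using that by (rule imageI)
    then show "l \<bullet> (F z - F ?y) \<in> ?Q" "e \<bullet> (F z - F ?y) \<in> ?Q" by (simp_all only: mem_Times_iff fst_conv snd_conv)
   qed
   have cp: "continuous_on U ?p"
    by (rule continuous_on_compose2[OF ck]) (use lz hQ in \<open>auto intro!: continuous_intros\<close>)
   define U2 where "U2 = ?p -` U1 Int U"
   have oU2: "open U2" unfolding U2_def using cp U1(1) U(1) by (simp add: continuous_on_open_vimage)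
   have lv: "l \<bullet> (F (\<Psi> x t) - F ?y) = l \<bullet> (F x - F ?y)" if "t \<in> J" for t
    using FP[OF x, of t] that J(2) U(6) by (auto simp: inner_diff_right inner_add_right)
   have "?p (\<Psi> x h') = \<Psi> x h" unfolding lv[OF hh(2)] using stay(2)[OF x J(3) U(2) hh(1)] by simp
   then have x2: "\<Psi> x h' \<in> U2" using U1(2) xU[OF hh(2)] by (simp add: U2_def)
   have "z \<in> ?G h'" if z: "z \<in> slice (\<omega> + h' *\<^sub>R v) e Int U2" for z
   proof -
    have zU: "z \<in> U" and pU: "?p z \<in> U1" using z by (auto simp: U2_def)
    have ez: "e \<bullet> (F z - F ?y) = h' - h0"
    proof -
     have "F z - F ?y = (F z - \<omega>) - (F ?y - \<omega>)" by simp
     then have "e \<bullet> (F z - F ?y) = e \<bullet> (F z - \<omega>) - e \<bullet> (F ?y - \<omega>)" by (simp only: inner_diff_right[of e "F z - \<omega>" "F ?y - \<omega>"])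
     then show ?thesis using z height[OF x h0] by (simp add: slice_eq)
    qed
    have kz: "z = k (l \<bullet> (F z - F ?y), h' - h0)" using homeomorphism_apply1[OF U(7) zU] unfolding ez by simp
    have pr: "(l \<bullet> (F z - F ?y), h - h0) \<in> ?Q \<times> ?Q" using lz(1)[OF zU] hQ(1) by simp
    have pUU: "?p z \<in> U" using img(2) pr by blast
    have pc: "l \<bullet> (F (?p z) - F ?y) = l \<bullet> (F z - F ?y)" "e \<bullet> (F (?p z) - F ?y) = h - h0"
     using homeomorphism_apply2[OF U(7) pr] by simp_all
    have "F (?p z) - \<omega> = (F (?p z) - F ?y) + (F ?y - \<omega>)" by simp
    then have "e \<bullet> (F (?p z) - \<omega>) = e \<bullet> (F (?p z) - F ?y) + e \<bullet> (F ?y - \<omega>)" by (simp only: inner_add_right)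
    then have "?p z \<in> slice (\<omega> + h *\<^sub>R v) e" unfolding slice_eq pc(2) height[OF x h0] by simp
    then obtain x' where x': "x' \<in> \<Gamma>" "?p z = \<Psi> x' h" using U1(3) pU by blast
    have "\<Psi> x' h \<in> U" using pUU x'(2) by simp
    then have "\<Psi> x' h' = k (l \<bullet> (F x' - F ?y), h' - h0)" by (rule stay(2)[OF x'(1) hh(1) _ hh(2)])
    moreover have "l \<bullet> (F x' - F ?y) = l \<bullet> (F (\<Psi> x' h) - F ?y)"
     using FP[OF x'(1), of h] hh(1) J(2) U(6) by (auto simp: inner_diff_right inner_add_right)
    ultimately have "\<Psi> x' h' = z" using pc(1) kz unfolding x'(2) by simp
    then show ?thesis using x'(1) by blast
   qed
   then show ?thesis using oU2 x2 by (intro exI[of _ U2]) blast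
  qed
  show "\<exists>T. openin (top_of_set I) T & h0 \<in> T & (\<forall>h\<in>T. \<forall>h'\<in>T.
    (\<exists>U. open U & \<Psi> x h \<in> U & slice (\<omega> + h *\<^sub>R v) e Int U <= ?G h) -->
    (\<exists>U. open U & \<Psi> x h' \<in> U & slice (\<omega> + h' *\<^sub>R v) e Int U <= ?G h'))"
   by (intro exI[of _ J] conjI ballI impI J(3,4)) (rule step)
 qed
 define N1 where "N1 = \<Union>{U. open U & slice (\<omega> + b *\<^sub>R v) e Int U <= ?G b}"
 have "open N1" unfolding N1_def by (rule open_Union) blast
 moreover have "slice (\<omega> + b *\<^sub>R v) e Int N1 = ?G b"
 proof (rule antisym)
  show "slice (\<omega> + b *\<^sub>R v) e Int N1 <= ?G b" unfolding N1_def by blast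
  show "?G b <= slice (\<omega> + b *\<^sub>R v) e Int N1"
  proof
   fix y assume "y \<in> ?G b"
   then obtain x where x: "x \<in> \<Gamma>" "y = \<Psi> x b" by blast
   have "y \<in> slice (\<omega> + b *\<^sub>R v) e" unfolding slice_eq x(2) by (rule height[OF x(1) I(3)])
   moreover have "y \<in> N1" using open_along[OF x(1) I(3)] unfolding N1_def x(2) by blast
   ultimately show "y \<in> slice (\<omega> + b *\<^sub>R v) e Int N1" by simp
  qed
 qed
 ultimately have 1: "\<exists>N0. open N0 & slice (\<omega> + b *\<^sub>R v) e Int N0 = ?G b" by (intro exI conjI)
 have 2: "compact (?G b)" "connected (?G b)"
  using ruling_section[OF r I(3)] L(1,2) by (auto intro: compact_continuous_image connected_continuous_image)
 have 3: "\<forall>y\<in>?G b. cross3 (nu y) e ~= 0"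
  using tangent_imp_transversal[OF tan[OF _ I(3)] ev] by blast
 have 4: "\<forall>y\<in>?G b. \<forall>z\<in>?G b. y ~= z --> F y = F z --> indep3 (nu y) (nu z) e"
  using tangent_imp_indep3[OF tan[OF _ I(3)] tan[OF _ I(3)] ev] by blast
 have 5: "\<Psi> x1 b ~= \<Psi> x2 b" using inj[OF L(7,8)] L(6) by blast
 have 6: "{y\<in>?G b. F y = c + b *\<^sub>R v} = {\<Psi> x1 b, \<Psi> x2 b}"
 proof (rule antisym)
  show "{y\<in>?G b. F y = c + b *\<^sub>R v} <= {\<Psi> x1 b, \<Psi> x2 b}"
  proof
   fix y assume "y \<in> {y\<in>?G b. F y = c + b *\<^sub>R v}"
   then obtain x where x: "x \<in> \<Gamma>" "y = \<Psi> x b" "F y = c + b *\<^sub>R v" by blast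
   then have "F x = c" using FP[OF x(1) I(3)] by simp
   then show "y \<in> {\<Psi> x1 b, \<Psi> x2 b}" using L(11)[OF x(1)] x(2) by auto
  qed
  show "{\<Psi> x1 b, \<Psi> x2 b} <= {y\<in>?G b. F y = c + b *\<^sub>R v}"
   using L(7-10) FP[OF L(7) I(3)] FP[OF L(8) I(3)] by auto
 qed
 have 7: "centred (?G b) (c + b *\<^sub>R v)" unfolding centred_def
 proof
  fix p assume "p \<in> F ` ?G b"
  then obtain x where x: "x \<in> \<Gamma>" "p = F x + b *\<^sub>R v" using FP I(3) by auto
  have "F x \<in> F ` \<Gamma>" using x(1) by (rule imageI)
  then have "2 *\<^sub>R c - F x \<in> F ` \<Gamma>" using L(12) unfolding centred_def by blast
  then obtain x' where x': "x' \<in> \<Gamma>" "2 *\<^sub>R c - F x = F x'" by blast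
  have "2 *\<^sub>R (c + b *\<^sub>R v) - p = F (\<Psi> x' b)" unfolding x(2) FP[OF x'(1) I(3)] x'(2)[symmetric]
   by (simp add: scaleR_2)
  then show "2 *\<^sub>R (c + b *\<^sub>R v) - p \<in> F ` ?G b" using x'(1) by blast
 qed
 show ?thesis unfolding centred_loop_def using 1 2 3 4 5 6 7 by (intro conjI)
qed

end

context central_surface
begin

text \<open>Completeness provides the end points of the lines of a ruling; in a box around such an end point
 the nearby lines are vertical, so that the end points depend continuously on the line.\<close>

lemma ruling_extends_to_endpoint:
 assumes r: "ruling \<Gamma> v {a<..<b} \<Psi>" and ab: "a < 0" "0 < b" and ev: "e \<bullet> v = 1"
  and flat: "!!x x'. x \<in> \<Gamma> ==> x' \<in> \<Gamma> ==> e \<bullet> (F x - F x') = 0"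
 obtains \<Psi>' where "ruling \<Gamma> v {a<..b} \<Psi>'" "!!x h. h \<in> {a<..<b} ==> \<Psi>' x h = \<Psi> x h"
proof -
 have FP: "F (\<Psi> x h) = F x + h *\<^sub>R v" if "x \<in> \<Gamma>" "h \<in> {a<..<b}" for x h by (rule rulingD(3)[OF r that])
 have lim: "\<exists>s y. (\<forall>i::nat. s i \<in> {a<..<b}) & s \<longlonglongrightarrow> b & (%i. \<Psi> x (s i)) \<longlonglongrightarrow> y" if x: "x \<in> \<Gamma>" for x
  by (rule line_limit[OF _ ruling_line[OF r x order_refl] FP[OF x]]) (use ab in auto)
 then obtain s Y where s: "!!x i. x \<in> \<Gamma> ==> s x i \<in> {a<..<b}" "!!x. x \<in> \<Gamma> ==> s x \<longlonglongrightarrow> b"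
  and Y: "!!x. x \<in> \<Gamma> ==> (%i::nat. \<Psi> x (s x i)) \<longlonglongrightarrow> Y x" by metis
 have FY: "F (Y x) = F x + b *\<^sub>R v" if x: "x \<in> \<Gamma>" for x
 proof (rule LIMSEQ_unique)
  show "(%i. F (\<Psi> x (s x i))) \<longlonglongrightarrow> F (Y x)" by (rule F_tendsto[OF Y[OF x]])
  have "(%i. F x + s x i *\<^sub>R v) \<longlonglongrightarrow> F x + b *\<^sub>R v" by (intro tendsto_intros s(2) x)
  then show "(%i. F (\<Psi> x (s x i))) \<longlonglongrightarrow> F x + b *\<^sub>R v" using FP[OF x s(1)[OF x]] by simp
 qed
 define \<Psi>' where "\<Psi>' x h = (if h < b then \<Psi> x h else Y x)" for x h
 have "continuous_on (\<Gamma> \<times> {a<..b}) (%p. \<Psi>' (fst p) (snd p))"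
 proof (rule continuous_on_locally)
  fix p assume "p \<in> \<Gamma> \<times> {a<..b}"
  then obtain x h where p: "p = (x, h)" "x \<in> \<Gamma>" "a < h" "h <= b" by auto
  show "\<exists>O'. open O' & p \<in> O' & continuous_on (\<Gamma> \<times> {a<..b} Int O') (%p. \<Psi>' (fst p) (snd p))"
  proof (cases "h < b")
   case True
   let ?O = "(UNIV :: 'm set) \<times> {..<b}"
   have "continuous_on (\<Gamma> \<times> {a<..b} Int ?O) (%p. \<Psi> (fst p) (snd p))"
    by (rule continuous_on_subset[OF rulingD(1)[OF r]]) auto
   then have "continuous_on (\<Gamma> \<times> {a<..b} Int ?O) (%p. \<Psi>' (fst p) (snd p))"
    by (rule continuous_on_eq) (auto simp: \<Psi>'_def)
   moreover have "open ?O" by (intro open_Times) auto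
   ultimately show ?thesis using p True by (intro exI[of _ ?O]) simp
  next
   case False
   then have h: "h = b" using p by simp
   let ?y = "Y x"
   have sb: "s x i ~= b" for i using s(1)[OF p(2), of i] by simp
   have tan: "nu ?y \<bullet> v = 0"
    by (rule tangent_of_limit[where g = "\<Psi> x" and p = "F x", OF s(2)[OF p(2)] sb Y[OF p(2)]]) (rule FP[OF p(2) s(1)[OF p(2)]])
   obtain U r0 k l where U: "open U" "?y \<in> U" "U <= UNIV" "r0 > 0" "inj_on F U" "l \<bullet> v = 0"
    "homeomorphism U ({-r0<..<r0} \<times> {-r0<..<r0}) (%z. (l \<bullet> (F z - F ?y), e \<bullet> (F z - F ?y))) k"
    by (rule ruled_box[OF tan ev open_UNIV UNIV_I]) (rule that)
   let ?Q = "{-r0<..<r0}"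
   define a' where "a' = max a (b - r0)"
   have a': "a <= a'" "a' < b" "b - r0 <= a'" using ab U(4) by (auto simp: a'_def)
   have ck: "continuous_on (?Q \<times> ?Q) k" using U(7) by (simp add: homeomorphism_def)
   have "\<forall>\<^sub>F i in sequentially. \<Psi> x (s x i) \<in> U & s x i > a'"
    by (intro eventually_conj topological_tendstoD[OF Y[OF p(2)] U(1,2)] order_tendstoD(1)[OF s(2)[OF p(2)] a'(2)])
   then obtain i where i: "\<Psi> x (s x i) \<in> U" "s x i > a'" using eventually_happens'[OF sequentially_bot] by blast
   define h' where "h' = s x i"
   have h': "h' \<in> {a<..<b}" "h' \<in> {a'<..<b}" "\<Psi> x h' \<in> U" using i s(1)[OF p(2), of i] by (auto simp: h'_def)
   have "openin (top_of_set \<Gamma>) (\<Gamma> Int (%x. \<Psi> x h') -` U)"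
    by (rule continuous_openin_preimage_gen[OF ruling_section[OF r h'(1)] U(1)])
   then obtain W where W: "open W" "\<Gamma> Int (%x. \<Psi> x h') -` U = \<Gamma> Int W" unfolding openin_open by blast
   have WU: "\<Psi> x' h' \<in> U" if "x' \<in> \<Gamma> Int W" for x' using W(2) that by blast
   have xW: "x \<in> W" using W(2) p(2) h'(3) by blast
   define \<kappa> where "\<kappa> q = k (l \<bullet> (F (fst q) - F ?y), snd q - b)" for q
   have ey: "e \<bullet> (F x' + t *\<^sub>R v - F ?y) = t - b" if "x' \<in> \<Gamma>" for x' t
   proof -
    have "F x' + t *\<^sub>R v - F ?y = (F x' - F x) + (t - b) *\<^sub>R v" unfolding FY[OF p(2)] by (simp add: algebra_simps)
    then have "e \<bullet> (F x' + t *\<^sub>R v - F ?y) = e \<bullet> (F x' - F x) + (t - b) * (e \<bullet> v)"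
     by (simp only: inner_add_right[of e "F x' - F x"] inner_scaleR_right)
    then show ?thesis using flat[OF that p(2)] ev by simp
   qed
   have lQ: "l \<bullet> (F x' - F ?y) \<in> ?Q" if x': "x' \<in> \<Gamma> Int W" for x'
   proof -
    have "(%z. (l \<bullet> (F z - F ?y), e \<bullet> (F z - F ?y))) ` U = ?Q \<times> ?Q" using U(7) by (simp add: homeomorphism_def)
    then have "(l \<bullet> (F (\<Psi> x' h') - F ?y), e \<bullet> (F (\<Psi> x' h') - F ?y)) \<in> ?Q \<times> ?Q" using WU[OF x'] by blast
    then have "l \<bullet> (F (\<Psi> x' h') - F ?y) \<in> ?Q" by simp
    moreover have "F (\<Psi> x' h') = F x' + h' *\<^sub>R v" using FP h'(1) x' by blast
    ultimately show ?thesis using U(6) by (simp add: inner_diff_right inner_add_right)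
   qed
   have inner: "\<Psi> x' t = \<kappa> (x', t)" if x': "x' \<in> \<Gamma> Int W" and t: "t \<in> {a'<..<b}" for x' t
   proof -
    have x'G: "x' \<in> \<Gamma>" using x' by simp
    have sub: "{a'<..<b} <= {a<..<b}" using a' by auto
    have FF: "F (\<Psi> x' t) = F x' + t *\<^sub>R v" if "t \<in> {a'<..<b}" for t using FP[OF x'G] that sub by blast
    have rg: "e \<bullet> (F x' + t *\<^sub>R v - F ?y) \<in> ?Q" if "t \<in> {a'<..<b}" for t
     unfolding ey[OF x'G] using that a' U(4) by auto
    have cJ: "connected {a'<..<b}" by simp
    note st = lift_stays_in_box(2)[OF U(7,1,6) cJ ruling_line[OF r x'G sub] FF h'(2) WU[OF x'] rg t]
    then show ?thesis unfolding ey[OF x'G] \<kappa>_def by simp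
   qed
   have c\<kappa>: "continuous_on ((\<Gamma> Int W) \<times> {a'<..b}) \<kappa>" unfolding \<kappa>_def
   proof (rule continuous_on_compose2[OF ck])
    show "continuous_on ((\<Gamma> Int W) \<times> {a'<..b}) (%q. (l \<bullet> (F (fst q) - F ?y), snd q - b))" by (intro continuous_intros)
    show "(%q. (l \<bullet> (F (fst q) - F ?y), snd q - b)) ` ((\<Gamma> Int W) \<times> {a'<..b}) <= ?Q \<times> ?Q"
    proof (rule image_subsetI)
     fix q assume q: "q \<in> (\<Gamma> Int W) \<times> {a'<..b}"
     then have "l \<bullet> (F (fst q) - F ?y) \<in> ?Q" using lQ[of "fst q"] by (simp only: mem_Times_iff)
     moreover have "snd q - b \<in> ?Q" using q a' U(4) by auto
     ultimately show "(l \<bullet> (F (fst q) - F ?y), snd q - b) \<in> ?Q \<times> ?Q" by (simp only: mem_Times_iff fst_conv snd_conv)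
    qed
   qed
   have edge: "Y x' = \<kappa> (x', b)" if x': "x' \<in> \<Gamma> Int W" for x'
   proof -
    have x'G: "x' \<in> \<Gamma>" using x' by simp
    have ev': "\<forall>\<^sub>F i in sequentially. s x' i > a'" by (rule order_tendstoD(1)[OF s(2)[OF x'G] a'(2)])
    have "continuous_on {a'<..b} (%t. \<kappa> (x', t))"
     by (rule continuous_on_compose2[OF c\<kappa>]) (use x' in \<open>auto intro!: continuous_intros\<close>)
    then have "(%i. \<kappa> (x', s x' i)) \<longlonglongrightarrow> \<kappa> (x', b)"
    proof (rule continuous_on_tendsto_compose[OF _ s(2)[OF x'G]])
     show "b \<in> {a'<..b}" using a' by simp
     show "\<forall>\<^sub>F i in sequentially. s x' i \<in> {a'<..b}"
     proof (rule eventually_mono[OF ev'])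
      show "s x' i \<in> {a'<..b}" if "s x' i > a'" for i using s(1)[OF x'G, of i] that by simp
     qed
    qed
    moreover have "\<forall>\<^sub>F i in sequentially. \<kappa> (x', s x' i) = \<Psi> x' (s x' i)"
     using ev'
    proof (rule eventually_mono)
     fix i assume "s x' i > a'"
     then have "s x' i \<in> {a'<..<b}" using s(1)[OF x'G, of i] by simp
     then show "\<kappa> (x', s x' i) = \<Psi> x' (s x' i)" using inner[OF x'] by simp
    qed
    ultimately have "(%i. \<Psi> x' (s x' i)) \<longlonglongrightarrow> \<kappa> (x', b)" by (rule Lim_transform_eventually)
    then show ?thesis using Y[OF x'G] LIMSEQ_unique by blast
   qed
   let ?O = "W \<times> {a'<..}"
   have sub: "\<Gamma> \<times> {a<..b} Int ?O <= (\<Gamma> Int W) \<times> {a'<..b}" by auto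
   have "continuous_on (\<Gamma> \<times> {a<..b} Int ?O) (%p. \<Psi>' (fst p) (snd p))"
   proof (rule continuous_on_eq[OF continuous_on_subset[OF c\<kappa> sub]])
    fix q assume "q \<in> \<Gamma> \<times> {a<..b} Int ?O"
    then have q: "fst q \<in> \<Gamma> Int W" "snd q \<in> {a'<..b}" using sub by auto
    show "\<kappa> q = \<Psi>' (fst q) (snd q)"
    proof (cases "snd q < b")
     case True
     then show ?thesis using inner[OF q(1), of "snd q"] q(2) by (simp add: \<Psi>'_def)
    next
     case False
     then have "snd q = b" using q(2) by simp
     then show ?thesis using edge[OF q(1)] by (metis \<Psi>'_def less_irrefl prod.collapse)
    qed
   qed
   moreover have "open ?O" by (intro open_Times W) auto
   ultimately show ?thesis using p h xW a' by (intro exI[of _ ?O]) simp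
  qed
 qed
 moreover have "\<Psi>' x 0 = x" if "x \<in> \<Gamma>" for x using rulingD(2)[OF r that] ab by (simp add: \<Psi>'_def)
 moreover have "F (\<Psi>' x h) = F x + h *\<^sub>R v" if "x \<in> \<Gamma>" "h \<in> {a<..b}" for x h
  using FP[OF that(1)] FY[OF that(1)] that(2) by (cases "h < b") (auto simp: \<Psi>'_def)
 ultimately have "ruling \<Gamma> v {a<..b} \<Psi>'" by (simp add: ruling_def)
 moreover have "\<Psi>' x h = \<Psi> x h" if "h \<in> {a<..<b}" for x h using that by (simp add: \<Psi>'_def)
 ultimately show thesis by (rule that)
qed

text \<open>The loop at the end of the ruling is again a centred loop, so it has a ruling of its own. Both rulings have the
 same direction, because both directions are tangent to the two sheets at the centre.\<close>

lemma ruling_extends_beyond: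
 assumes loop: "centred_loop \<omega> e \<Gamma> c x1 x2" and ev: "e \<bullet> v = 1"
  and r: "ruling \<Gamma> v {a<..<b} \<Psi>" and ab: "a < 0" "0 < b"
 obtains b' \<Phi> where "b' > b" "ruling \<Gamma> v {a<..<b'} \<Phi>"
proof -
 note L = centred_loopD[OF loop]
 have flat: "e \<bullet> (F x - F x') = 0" if "x \<in> \<Gamma>" "x' \<in> \<Gamma>" for x x'
 proof -
  have "F x - F x' = (F x - \<omega>) - (F x' - \<omega>)" by simp
  then have "e \<bullet> (F x - F x') = e \<bullet> (F x - \<omega>) - e \<bullet> (F x' - \<omega>)" by (simp only: inner_diff_right[of e "F x - \<omega>" "F x' - \<omega>"])
  then show ?thesis using centred_loop_height[OF loop] that by simp
 qed
 obtain \<Psi>' where r': "ruling \<Gamma> v {a<..b} \<Psi>'" by (rule ruling_extends_to_endpoint[OF r ab ev flat])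
 have I: "is_interval {a<..b}" "0 \<in> {a<..b}" "b \<in> {a<..b}" "(0::real) ~= b" using ab by (auto simp: is_interval_oc)
 let ?G = "(%x. \<Psi>' x b) ` \<Gamma>"
 have loop': "centred_loop (\<omega> + b *\<^sub>R v) e ?G (c + b *\<^sub>R v) (\<Psi>' x1 b) (\<Psi>' x2 b)"
  by (rule ruling_loop[OF loop ev r' I(1,2,3) I(2,3,4)])
 note L' = centred_loopD[OF loop']
 obtain v' h \<Phi> where h: "h > 0" and ev': "e \<bullet> v' = 1" and \<Phi>: "ruling ?G v' {-h<..<h} \<Phi>"
  by (rule local_ruling[OF loop'])
 \<comment> \<open>the direction of the new ruling is the old one, as both are tangent to both sheets at the centre\<close>
 have t: "nu (\<Psi>' x b) \<bullet> v = 0" if "x \<in> \<Gamma>" for x by (rule ruling_tangent[OF r' I(1,3,2,4) that])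
 have t': "nu y \<bullet> v' = 0" if "y \<in> ?G" for y
 proof -
  have J: "is_interval {-h<..<h}" "0 \<in> {-h<..<h}" "h/2 \<in> {-h<..<h}" "h/2 ~= 0" using h by (auto simp: is_interval_oo)
  show ?thesis using ruling_tangent[OF \<Phi> J that] rulingD(2)[OF \<Phi> that] by simp
 qed
 have "indep3 (nu (\<Psi>' x1 b)) (nu (\<Psi>' x2 b)) e" by (rule L'(5)[OF L'(7,8,6)]) (simp add: L'(9,10))
 moreover have "nu (\<Psi>' x1 b) \<bullet> (v - v') = 0" "nu (\<Psi>' x2 b) \<bullet> (v - v') = 0" "e \<bullet> (v - v') = 0"
  using t[OF L(7)] t[OF L(8)] t'[OF L'(7)] t'[OF L'(8)] ev ev' by (simp_all add: inner_diff_right)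
 ultimately have "v - v' = 0" unfolding indep3_def by blast
 then have v: "v' = v" by simp
 define \<Theta> where "\<Theta> x t = (if t <= b then \<Psi>' x t else \<Phi> (\<Psi>' x b) (t - b))" for x t
 have "continuous_on (\<Gamma> \<times> {a<..<b+h}) (%p. \<Theta> (fst p) (snd p))" unfolding \<Theta>_def
 proof (rule continuous_on_cases_le)
  show "continuous_on {p \<in> \<Gamma> \<times> {a<..<b+h}. snd p <= b} (%p. \<Psi>' (fst p) (snd p))"
   by (rule continuous_on_subset[OF rulingD(1)[OF r']]) auto
  have "continuous_on {p \<in> \<Gamma> \<times> {a<..<b+h}. b <= snd p} (%p. (%q. \<Phi> (fst q) (snd q)) (\<Psi>' (fst p) b, snd p - b))"
  proof (rule continuous_on_compose2[OF rulingD(1)[OF \<Phi>]])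
   show "continuous_on {p \<in> \<Gamma> \<times> {a<..<b+h}. b <= snd p} (%p. (\<Psi>' (fst p) b, snd p - b))"
    by (intro continuous_intros continuous_on_compose2[OF ruling_section[OF r' I(3)]]) auto
  qed (use h in auto)
  then show "continuous_on {p \<in> \<Gamma> \<times> {a<..<b+h}. b <= snd p} (%p. \<Phi> (\<Psi>' (fst p) b) (snd p - b))" by simp
  show "continuous_on (\<Gamma> \<times> {a<..<b+h}) snd" by (intro continuous_intros)
  show "\<Psi>' (fst p) (snd p) = \<Phi> (\<Psi>' (fst p) b) (snd p - b)" if "p \<in> \<Gamma> \<times> {a<..<b+h}" "snd p = b" for p
   using that rulingD(2)[OF \<Phi>, of "\<Psi>' (fst p) b"] by auto
 qed
 moreover have "\<Theta> x 0 = x" if "x \<in> \<Gamma>" for x using rulingD(2)[OF r' that] ab by (simp add: \<Theta>_def)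
 moreover have "F (\<Theta> x t) = F x + t *\<^sub>R v" if x: "x \<in> \<Gamma>" and t: "t \<in> {a<..<b+h}" for x t
 proof (cases "t <= b")
  case True
  then show ?thesis using rulingD(3)[OF r' x, of t] t by (simp add: \<Theta>_def)
 next
  case False
  have "\<Psi>' x b \<in> ?G" using x by (rule imageI)
  then have "F (\<Phi> (\<Psi>' x b) (t - b)) = F (\<Psi>' x b) + (t - b) *\<^sub>R v'" by (rule rulingD(3)[OF \<Phi>]) (use False t h in auto)
  then show ?thesis using False rulingD(3)[OF r' x I(3)] by (simp add: \<Theta>_def v scaleR_left_diff_distrib)
 qed
 ultimately have "ruling \<Gamma> v {a<..<b+h} \<Theta>" by (simp add: ruling_def)
 then show thesis using h by (intro that[of "b + h"]) auto
qed

text \<open>Otherwise the supremum of the admissible end points would be admissible and could be exceeded.\<close>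

lemma ruling_upwards:
 assumes loop: "centred_loop \<omega> e \<Gamma> c x1 x2" and ev: "e \<bullet> v = 1"
  and r: "ruling \<Gamma> v {-h<..<h} \<Psi>" and h: "h > 0"
 shows "\<exists>\<Phi>. ruling \<Gamma> v {-h<..<b} \<Phi>"
proof -
 define S where "S = {b. \<exists>\<Phi>. ruling \<Gamma> v {-h<..<b} \<Phi>}"
 have hS: "h \<in> S" using r by (auto simp: S_def)
 have down: "b \<in> S" if bb: "b' \<in> S" "b <= b'" for b b'
 proof -
  obtain \<Phi> where "ruling \<Gamma> v {-h<..<b'} \<Phi>" using bb(1) by (auto simp: S_def)
  then have "ruling \<Gamma> v {-h<..<b} \<Phi>" by (rule ruling_subset) (use bb in auto)
  then show ?thesis by (auto simp: S_def)
 qed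
 have "\<not> bdd_above S"
 proof
  assume bdd: "bdd_above S"
  let ?s = "Sup S"
  have s: "h <= ?s" by (rule cSup_upper[OF hS bdd])
  obtain \<Phi> where \<Phi>: "ruling \<Gamma> v {-h<..<?s} \<Phi>"
  proof (rule rulings_glue)
   fix x t assume t: "t \<in> {-h<..<?s}"
   then obtain b where b: "b \<in> S" "max t 0 < b" using less_cSup_iff[of S "max t 0"] hS bdd s h by auto
   obtain ph where ph: "ruling \<Gamma> v {-h<..<b} ph" using b(1) by (auto simp: S_def)
   show "\<exists>W I ph. open W & x \<in> W & open I & is_interval I & 0 \<in> I & t \<in> I & ruling (\<Gamma> Int W) v I ph"
    using t b(2) h ph by (intro exI[of _ UNIV] exI[of _ "{-h<..<b}"] exI[of _ ph]) (simp add: is_interval_oo)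
  next
   show "0 \<in> {-h<..<?s}" using h s by simp
  qed (rule that)
  obtain b' \<Phi>' where b': "b' > ?s" "ruling \<Gamma> v {-h<..<b'} \<Phi>'"
   by (rule ruling_extends_beyond[OF loop ev \<Phi>]) (use h s in auto)
  then have "b' \<in> S" by (auto simp: S_def)
  then show False using cSup_upper[OF _ bdd] b'(1) by fastforce
 qed
 then obtain b' where "b' \<in> S" "b <= b'" unfolding bdd_above_def by (meson linear)
 then have "b \<in> S" by (rule down)
 then show ?thesis by (simp add: S_def)
qed

lemma ruling_flip:
 assumes "ruling \<Gamma> v I \<Psi>"
 shows "ruling \<Gamma> (- v) (uminus ` I) (%x t. \<Psi> x (- t))"
proof -
 have "continuous_on (\<Gamma> \<times> uminus ` I) (%p. (%q. \<Psi> (fst q) (snd q)) (fst p, - snd p))"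
  by (rule continuous_on_compose2[OF rulingD(1)[OF assms]]) (auto intro!: continuous_intros)
 then show ?thesis using assms by (auto simp: ruling_def)
qed

text \<open>Reversing the sign of \<open>e\<close> turns upward rulings into downward ones; moving the base point \<open>\<omega>\<close> to the
 other side of the plane keeps the plane in the form \<open>{p. e \<bullet> (p - \<omega>) = 1}\<close>.\<close>

lemma centred_loop_flip:
 assumes loop: "centred_loop \<omega> e \<Gamma> c x1 x2" and ev: "e \<bullet> v = 1"
 shows "centred_loop (\<omega> + 2 *\<^sub>R v) (- e) \<Gamma> c x1 x2"
proof -
 have "slice (\<omega> + 2 *\<^sub>R v) (- e) = slice \<omega> e"
 proof -
  have "- e \<bullet> (F z - (\<omega> + 2 *\<^sub>R v)) = 2 - e \<bullet> (F z - \<omega>)" for z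
   using ev by (simp add: inner_diff_right inner_add_right)
  then show ?thesis unfolding slice_def by auto
 qed
 moreover have "indep3 a b (- e) \<longleftrightarrow> indep3 a b e" for a b by (simp add: indep3_def)
 moreover have "cross3 a (- e) ~= 0 \<longleftrightarrow> cross3 a e ~= 0" for a by (simp add: cross_minus_right)
 ultimately show ?thesis using loop unfolding centred_loop_def by simp
qed

text \<open>The local ruling is extended upwards, and downwards by reversing the direction; the rulings over
 all bounded intervals are then glued.\<close>

theorem global_ruling:
 assumes loop: "centred_loop \<omega> e \<Gamma> c x1 x2"
 obtains v \<Psi> where "e \<bullet> v = 1" "ruling \<Gamma> v UNIV \<Psi>"
proof -
 obtain v h \<Psi> where h: "h > 0" and ev: "e \<bullet> v = 1" and r: "ruling \<Gamma> v {-h<..<h} \<Psi>"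
  by (rule local_ruling[OF loop])
 have up: "\<exists>\<Phi>. ruling \<Gamma> v {-h<..<b} \<Phi>" for b by (rule ruling_upwards[OF loop ev r h])
 have img: "uminus ` {-h<..<b} = {-b<..<h}" for b :: real by (auto simp: image_iff)
 have ev': "- e \<bullet> - v = 1" using ev by simp
 have r': "ruling \<Gamma> (- v) {-h<..<h} (%x t. \<Psi> x (- t))" using ruling_flip[OF r] unfolding img .
 have down: "\<exists>\<Phi>. ruling \<Gamma> v {-b<..<h} \<Phi>" for b
 proof -
  obtain \<Phi> where "ruling \<Gamma> (- v) {-h<..<b} \<Phi>"
   using ruling_upwards[OF centred_loop_flip[OF loop ev] ev' r' h] by blast
  from ruling_flip[OF this] have "ruling \<Gamma> v {-b<..<h} (%x t. \<Phi> x (- t))" unfolding img by simp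
  then show ?thesis by blast
 qed
 obtain \<Theta> where "ruling \<Gamma> v UNIV \<Theta>"
 proof (rule rulings_glue[where J = UNIV and \<Gamma> = \<Gamma> and v = v])
  fix x and t :: real
  obtain \<Phi>1 where 1: "ruling \<Gamma> v {-h<..<\<bar>t\<bar>+1} \<Phi>1" using up by blast
  obtain \<Phi>2 where 2: "ruling \<Gamma> v {-(\<bar>t\<bar>+1)<..<h} \<Phi>2" using down by blast
  show "\<exists>W I ph. open W & x \<in> W & open I & is_interval I & 0 \<in> I & t \<in> I & ruling (\<Gamma> Int W) v I ph"
  proof (cases "t \<ge> 0")
   case True
   then show ?thesis using 1 h
    by (intro exI[of _ UNIV] exI[of _ "{-h<..<\<bar>t\<bar>+1}"] exI[of _ \<Phi>1]) (simp add: is_interval_oo)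
  next
   case False
   then show ?thesis using 2 h
    by (intro exI[of _ UNIV] exI[of _ "{-(\<bar>t\<bar>+1)<..<h}"] exI[of _ \<Phi>2]) (simp add: is_interval_oo)
  qed
 qed (simp, rule that)
 then show thesis using that ev by blast
qed

text \<open>The ruled part of the surface is open, since the boxes are filled by lines of the ruling, and closed, since
 the section is compact.\<close>

theorem ruling_surjective:
 assumes loop: "centred_loop \<omega> e \<Gamma> c x1 x2" and ev: "e \<bullet> v = 1"
  and r: "ruling \<Gamma> v UNIV \<Psi>" and conn: "connected (UNIV :: 'm set)"
 shows "\<exists>x\<in>\<Gamma>. \<exists>h. z = \<Psi> x h"
proof -
 note L = centred_loopD[OF loop]
 let ?S = "{z. \<exists>x\<in>\<Gamma>. \<exists>h. z = \<Psi> x h}"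
 have FP: "F (\<Psi> x h) = F x + h *\<^sub>R v" if "x \<in> \<Gamma>" for x h by (rule rulingD(3)[OF r that UNIV_I])
 have height: "e \<bullet> (F (\<Psi> x h) - \<omega>) = 1 + h" if "x \<in> \<Gamma>" for x h
 proof -
  have "F (\<Psi> x h) - \<omega> = (F x - \<omega>) + h *\<^sub>R v" unfolding FP[OF that] by simp
  then have "e \<bullet> (F (\<Psi> x h) - \<omega>) = e \<bullet> (F x - \<omega>) + h * (e \<bullet> v)" by (simp only: inner_add_right inner_scaleR_right)
  then show ?thesis using centred_loop_height[OF loop that] ev by simp
 qed
 have "open ?S"
 proof (subst open_subopen, intro ballI)
  fix y assume "y \<in> ?S"
  then obtain x b where x: "x \<in> \<Gamma>" "y = \<Psi> x b" by blast
  have Iu: "is_interval (UNIV :: real set)" by (rule is_interval_univ)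
  have loop': "centred_loop (\<omega> + b *\<^sub>R v) e ((%x. \<Psi> x b) ` \<Gamma>) (c + b *\<^sub>R v) (\<Psi> x1 b) (\<Psi> x2 b)"
   by (rule ruling_loop[OF loop ev r Iu UNIV_I UNIV_I UNIV_I UNIV_I zero_neq_one])
  obtain N0 where N0: "open N0" "slice (\<omega> + b *\<^sub>R v) e Int N0 = (%x. \<Psi> x b) ` \<Gamma>"
   using loop' unfolding centred_loop_def by blast
  have yG: "y \<in> (%x. \<Psi> x b) ` \<Gamma>" using x by blast
  then have yN: "y \<in> N0" using N0(2) by blast
  have tan: "nu y \<bullet> v = 0" unfolding x(2) by (rule ruling_tangent[OF r Iu UNIV_I UNIV_I _ x(1), where a = "b + 1"]) simp
  obtain U r0 k l where U: "open U" "y \<in> U" "U <= N0" "r0 > 0" "inj_on F U" "l \<bullet> v = 0"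
   "homeomorphism U ({-r0<..<r0} \<times> {-r0<..<r0}) (%z. (l \<bullet> (F z - F y), e \<bullet> (F z - F y))) k"
   by (rule ruled_box[OF tan ev N0(1) yN]) (rule that)
  let ?Q = "{-r0<..<r0}"
  have "U <= ?S"
  proof
   fix z assume z: "z \<in> U"
   let ?l = "l \<bullet> (F z - F y)" and ?t = "e \<bullet> (F z - F y)"
   have "(%z. (l \<bullet> (F z - F y), e \<bullet> (F z - F y))) ` U = ?Q \<times> ?Q" "k ` (?Q \<times> ?Q) = U"
    using U(7) by (auto simp: homeomorphism_def)
   then have img: "(%z. (l \<bullet> (F z - F y), e \<bullet> (F z - F y))) ` U = ?Q \<times> ?Q" "k ` (?Q \<times> ?Q) = U" by simp_all
   have lt: "(?l, ?t) \<in> ?Q \<times> ?Q" unfolding img(1)[symmetric] using z by (rule imageI)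
   then have l0: "(?l, 0) \<in> ?Q \<times> ?Q" using U(4) by simp
   define p where "p = k (?l, 0)"
   have pU: "p \<in> U" unfolding p_def using img(2) l0 by blast
   have pc: "l \<bullet> (F p - F y) = ?l" "e \<bullet> (F p - F y) = 0"
    using homeomorphism_apply2[OF U(7) l0] unfolding p_def by simp_all
   have "F p - (\<omega> + b *\<^sub>R v) = (F p - F y) + ((F y - \<omega>) - b *\<^sub>R v)" by simp
   then have "e \<bullet> (F p - (\<omega> + b *\<^sub>R v)) = e \<bullet> (F p - F y) + (e \<bullet> (F y - \<omega>) - b * (e \<bullet> v))"
    by (simp only: inner_add_right inner_diff_right[of e "F y - \<omega>"] inner_scaleR_right)
   then have "p \<in> slice (\<omega> + b *\<^sub>R v) e" using pc(2) height[OF x(1), of b] ev x(2) by (simp add: slice_def)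
   then have "p \<in> (%x. \<Psi> x b) ` \<Gamma>" using N0(2) pU U(3) by blast
   then obtain x' where x': "x' \<in> \<Gamma>" "p = \<Psi> x' b" by blast
   have ey: "e \<bullet> (F x' + h *\<^sub>R v - F y) = h - b" for h
   proof -
    have "F x' + h *\<^sub>R v - F y = (F p - F y) + (h - b) *\<^sub>R v" unfolding x'(2) FP[OF x'(1)] by (simp add: algebra_simps)
    then have "e \<bullet> (F x' + h *\<^sub>R v - F y) = e \<bullet> (F p - F y) + (h - b) * (e \<bullet> v)"
     by (simp only: inner_add_right inner_scaleR_right)
    then show ?thesis using pc(2) ev by simp
   qed
   let ?J = "{b - r0<..<b + r0}"
   have J: "connected ?J" "b \<in> ?J" "b + ?t \<in> ?J" using lt U(4) by auto
   have rg: "e \<bullet> (F x' + h *\<^sub>R v - F y) \<in> ?Q" if "h \<in> ?J" for h unfolding ey using that by auto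
   have pU': "\<Psi> x' b \<in> U" using pU x'(2) by simp
   have "\<Psi> x' (b + ?t) = k (l \<bullet> (F x' - F y), e \<bullet> (F x' + (b + ?t) *\<^sub>R v - F y))"
    by (rule lift_stays_in_box(2)[OF U(7,1,6) J(1) ruling_line[OF r x'(1) subset_UNIV] FP[OF x'(1)] J(2) pU' rg J(3)])
   moreover have "l \<bullet> (F x' - F y) = ?l"
    using pc(1) U(6) unfolding x'(2) FP[OF x'(1)] by (simp add: inner_diff_right inner_add_right)
   ultimately have "\<Psi> x' (b + ?t) = k (?l, ?t)" unfolding ey by simp
   also have "\<dots> = z" by (rule homeomorphism_apply1[OF U(7) z])
   finally have "z = \<Psi> x' (b + ?t)" by (rule sym)
   then show "z \<in> ?S" using x'(1) by blast
  qed
  then show "\<exists>T. open T & y \<in> T & T <= ?S" using U(1,2) by (intro exI[of _ U] conjI)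
 qed
 moreover have "closed ?S" unfolding closed_sequential_limits
 proof (intro allI impI, elim conjE)
  fix zs z assume zs: "\<forall>n. zs n \<in> ?S" and lim: "zs \<longlonglongrightarrow> z"
  have "\<forall>n. \<exists>p. fst p \<in> \<Gamma> & zs n = \<Psi> (fst p) (snd p)"
  proof
   fix n
   obtain x h where "x \<in> \<Gamma>" "zs n = \<Psi> x h" using zs[rule_format, of n] by blast
   then show "\<exists>p. fst p \<in> \<Gamma> & zs n = \<Psi> (fst p) (snd p)" by (intro exI[of _ "(x, h)"]) simp
  qed
  from choice[OF this] obtain p where p: "\<forall>n. fst (p n) \<in> \<Gamma> & zs n = \<Psi> (fst (p n)) (snd (p n))" by (rule exE)
  define x where "x = (%n. fst (p n))"
  define h where "h = (%n. snd (p n))"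
  have xh: "x n \<in> \<Gamma>" "zs n = \<Psi> (x n) (h n)" for n using p unfolding x_def h_def by auto
  obtain x0 ph where x0: "x0 \<in> \<Gamma>" "strict_mono ph" "(%n. x (ph n)) \<longlonglongrightarrow> x0"
   by (rule compact_subseq[OF L(1) xh(1)])
  have hn: "h n = e \<bullet> (F (zs n) - \<omega>) - 1" for n unfolding xh(2)[of n] using height[OF xh(1)[of n]] by simp
  have "(%n. e \<bullet> (F (zs n) - \<omega>) - 1) \<longlonglongrightarrow> e \<bullet> (F z - \<omega>) - 1" by (intro tendsto_intros F_tendsto lim)
  moreover have "h = (%n. e \<bullet> (F (zs n) - \<omega>) - 1)" by (rule ext) (rule hn)
  ultimately have "h \<longlonglongrightarrow> e \<bullet> (F z - \<omega>) - 1" by (simp only:)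
  from LIMSEQ_subseq_LIMSEQ[OF this x0(2)] have hl: "(%n. h (ph n)) \<longlonglongrightarrow> e \<bullet> (F z - \<omega>) - 1" by (simp add: o_def)
  let ?h = "e \<bullet> (F z - \<omega>) - 1"
  have "(%n. (x (ph n), h (ph n))) \<longlonglongrightarrow> (x0, ?h)" by (intro tendsto_intros x0 hl)
  then have "(%n. (%p. \<Psi> (fst p) (snd p)) (x (ph n), h (ph n))) \<longlonglongrightarrow> (%p. \<Psi> (fst p) (snd p)) (x0, ?h)"
   by (rule continuous_on_tendsto_compose[OF rulingD(1)[OF r]]) (use x0 xh in auto)
  then have "(%n. zs (ph n)) \<longlonglongrightarrow> \<Psi> x0 ?h" by (simp add: xh(2))
  moreover have "(%n. zs (ph n)) \<longlonglongrightarrow> z" using LIMSEQ_subseq_LIMSEQ[OF lim x0(2)] by (simp add: o_def)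
  ultimately have "z = \<Psi> x0 ?h" using LIMSEQ_unique by blast
  then show "z \<in> ?S" using x0(1) by blast
 qed
 moreover have "?S ~= {}" using L(7) by blast
 moreover have "\<forall>T :: 'm set. open T & closed T --> T = {} \<or> T = UNIV" using conn by (simp add: connected_clopen)
 then have "open ?S & closed ?S --> ?S = {} \<or> ?S = UNIV" by (rule spec)
 ultimately have "?S = UNIV" by (simp only: simp_thms)
 then show ?thesis by blast
qed

end

section \<open>Secants and normals of an immersion in charts\<close>

lemma real2_basis: "(w :: real^2) = w $ 1 *\<^sub>R axis 1 1 + w $ 2 *\<^sub>R axis 2 1"
 by (simp add: vec_eq_iff forall_2 axis_def)

lemma linear_bound_on_basis:
 fixes L :: "real^2 => 'b::real_normed_vector"
 assumes "linear L"
 shows "norm (L w) <= (norm (L (axis 1 1)) + norm (L (axis 2 1))) * norm w"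
proof -
 have "L w = L (w $ 1 *\<^sub>R axis 1 1 + w $ 2 *\<^sub>R axis 2 1)" by (rule arg_cong[OF real2_basis])
 then have "L w = w $ 1 *\<^sub>R L (axis 1 1) + w $ 2 *\<^sub>R L (axis 2 1)"
  unfolding linear_add[OF assms] linear_scale[OF assms] .
 then have "norm (L w) <= \<bar>w $ 1\<bar> * norm (L (axis 1 1)) + \<bar>w $ 2\<bar> * norm (L (axis 2 1))"
  using norm_triangle_ineq[of "w $ 1 *\<^sub>R L (axis 1 1)" "w $ 2 *\<^sub>R L (axis 2 1)"] by simp
 also have "\<dots> <= norm w * norm (L (axis 1 1)) + norm w * norm (L (axis 2 1))"
  by (intro add_mono mult_right_mono component_le_norm_cart norm_ge_zero)
 finally show ?thesis by (simp add: algebra_simps)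
qed

text \<open>This is the strict form of differentiability that continuity of the derivative provides: it
 controls secants between any two points near \<open>z0\<close>, not only those through \<open>z0\<close>.\<close>

lemma C1_linearization:
 fixes f :: "real^2 => 'b::real_normed_vector"
 assumes S: "open S" "z0 \<in> S" and d: "!!z. z \<in> S ==> (f has_derivative D z) (at z)"
  and c: "!!v. continuous_on S (%z. D z v)" and et: "et > 0"
 obtains dl where "dl > 0" "ball z0 dl <= S"
  "!!z z'. z \<in> ball z0 dl ==> z' \<in> ball z0 dl ==> norm (f z - f z' - D z0 (z - z')) <= et * norm (z - z')"
proof -
 have lin: "linear (D z)" if "z \<in> S" for z using d[OF that] has_derivative_linear by blast
 have cont: "\<forall>\<^sub>F z in nhds z0. dist (D z v) (D z0 v) < et / 2" for v
 proof -
  have "isCont (%z. D z v) z0" using c[of v] S by (simp add: continuous_on_eq_continuous_at)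
  then have "((%z. D z v) \<longlongrightarrow> D z0 v) (nhds z0)" by (simp add: tendsto_nhds_iff isCont_def)
  then show ?thesis using et by (intro tendstoD) simp_all
 qed
 have "\<forall>\<^sub>F z in nhds z0. z \<in> S & dist (D z (axis 1 1)) (D z0 (axis 1 1)) < et / 2 & dist (D z (axis 2 1)) (D z0 (axis 2 1)) < et / 2"
  by (intro eventually_conj cont eventually_nhds_in_open S)
 then obtain dl where dl: "dl > 0" and near: "!!z. dist z z0 < dl ==> z \<in> S & dist (D z (axis 1 1)) (D z0 (axis 1 1)) < et / 2 &
   dist (D z (axis 2 1)) (D z0 (axis 2 1)) < et / 2"
  unfolding eventually_nhds_metric by blast
 have sub: "ball z0 dl <= S" using near by (auto simp: dist_commute)
 have on: "onorm (%h. D z h - D z0 h) <= et" if z: "z \<in> ball z0 dl" for z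
 proof (rule onorm_le)
  fix w
  have zS: "z \<in> S" using z sub by blast
  have l: "linear (%h. D z h - D z0 h)" using lin[OF zS] lin[OF S(2)] by (rule linear_compose_sub)
  have "dist z z0 < dl" using z by (simp add: dist_commute)
  from near[OF this] have "norm (D z (axis 1 1) - D z0 (axis 1 1)) + norm (D z (axis 2 1) - D z0 (axis 2 1)) <= et"
   by (simp add: dist_norm)
  from order_trans[OF linear_bound_on_basis[OF l, of w] mult_right_mono[OF this norm_ge_zero[of w]]]
  show "norm (D z w - D z0 w) <= et * norm w" by simp
 qed
 show thesis
 proof (rule that[OF dl sub])
  fix z z' assume z: "z \<in> ball z0 dl" "z' \<in> ball z0 dl"
  have "norm (f z - f z' - D z0 (z - z')) <= norm (z - z') * et"
  proof (rule differentiable_bound_linearization[where S = "ball z0 dl"])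
   show "z' + t *\<^sub>R (z - z') \<in> ball z0 dl" if "t \<in> {0..1}" for t
    using convexD_alt[OF convex_ball z(2,1), of t] that by (simp add: algebra_simps)
   show "(f has_derivative D x) (at x within ball z0 dl)" if "x \<in> ball z0 dl" for x
    using d[of x] sub that by (blast intro: has_derivative_at_withinI)
   show "onorm (D x - D z0) <= et" if "x \<in> ball z0 dl" for x using on[OF that] by (simp add: fun_diff_def)
  qed (use dl in simp)
  then show "norm (f z - f z' - D z0 (z - z')) <= et * norm (z - z')" by (simp add: mult.commute)
 qed
qed

text \<open>Injectivity of the derivative bounds \<open>norm (z - z')\<close> by the length of the secant, so the error of the linearization is
 small relative to the secant itself.\<close>

lemma C1_immersion_secant:
 fixes f :: "real^2 => 'b::euclidean_space"
 assumes S: "open S" "z0 \<in> S" and d: "!!z. z \<in> S ==> (f has_derivative D z) (at z)"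
  and c: "!!v. continuous_on S (%z. D z v)" and inj: "inj (D z0)" and eps: "eps > 0"
 obtains dl B where "dl > 0" "B > 0" "ball z0 dl <= S"
  "!!z z'. z \<in> ball z0 dl ==> z' \<in> ball z0 dl ==> norm (z - z') <= B * norm (f z - f z')"
  "!!z z'. z \<in> ball z0 dl ==> z' \<in> ball z0 dl ==> norm (f z - f z' - D z0 (z - z')) <= eps * norm (f z - f z')"
proof -
 have lin: "linear (D z0)" using d[OF S(2)] has_derivative_linear by blast
 obtain m where m: "m > 0" "!!w. m * norm w <= norm (D z0 w)" by (rule linear_inj_bounded_below_pos[OF lin inj]) (rule that)
 define et where "et = min (m / 2) (eps * m / 2)"
 have et: "et > 0" "et <= m / 2" "et <= eps * m / 2" using m eps by (auto simp: et_def)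
 obtain dl where dl: "dl > 0" "ball z0 dl <= S"
  "!!z z'. z \<in> ball z0 dl ==> z' \<in> ball z0 dl ==> norm (f z - f z' - D z0 (z - z')) <= et * norm (z - z')"
  by (rule C1_linearization[OF S d c et(1)]) (assumption | rule that)+
 have low: "norm (z - z') <= 2 / m * norm (f z - f z')" if z: "z \<in> ball z0 dl" "z' \<in> ball z0 dl" for z z'
 proof -
  have "norm (D z0 (z - z')) - norm (f z - f z') <= norm (f z - f z' - D z0 (z - z'))"
   using norm_triangle_ineq3[of "f z - f z'" "D z0 (z - z')"] by linarith
  then have "m * norm (z - z') - norm (f z - f z') <= et * norm (z - z')" using m(2)[of "z - z'"] dl(3)[OF z] by linarith
  moreover have "et * norm (z - z') <= m / 2 * norm (z - z')" using et(2) by (rule mult_right_mono) simp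
  ultimately have "m / 2 * norm (z - z') <= norm (f z - f z')" by linarith
  then have "2 / m * (m / 2 * norm (z - z')) <= 2 / m * norm (f z - f z')" using m(1) by (intro mult_left_mono) auto
  then show ?thesis using m(1) by simp
 qed
 show thesis
 proof (rule that[OF dl(1) _ dl(2) low])
  show "2 / m > 0" using m by simp
  fix z z' assume z: "z \<in> ball z0 dl" "z' \<in> ball z0 dl"
  have "norm (f z - f z' - D z0 (z - z')) <= et * norm (z - z')" by (rule dl(3)[OF z])
  also have "\<dots> <= (eps * m / 2) * (2 / m * norm (f z - f z'))" using et low[OF z] by (intro mult_mono) auto
  also have "\<dots> = eps * norm (f z - f z')" using m(1) by simp
  finally show "norm (f z - f z' - D z0 (z - z')) <= eps * norm (f z - f z')" .
 qed
qed

lemma chart_coordinates: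
 assumes "is_chart (U, ph)"
 shows "open U" "open (ph ` U)" "homeomorphism U (ph ` U) ph (inv_into U ph)" "inj_on ph U"
proof -
 obtain \<psi> where \<psi>: "homeomorphism U (ph ` U) ph \<psi>" and o: "open U" "open (ph ` U)"
  using assms by (auto simp: is_chart_def)
 show "open U" "open (ph ` U)" by (rule o)+
 show inj: "inj_on ph U" by (rule inj_on_inverseI[of _ \<psi>]) (rule homeomorphism_apply1[OF \<psi>])
 have "inv_into U ph z = \<psi> z" if "z \<in> ph ` U" for z
  using that inj homeomorphism_apply1[OF \<psi>] by (auto simp: inv_into_f_f)
 then show "homeomorphism U (ph ` U) ph (inv_into U ph)"
  by (intro homeomorphism_cong[OF \<psi>] refl)
qed

lemma cross3_multiple:
 assumes "cross3 u w ~= 0" "\<nu> \<bullet> u = 0" "\<nu> \<bullet> w = 0"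
 shows "\<nu> = ((\<nu> \<bullet> cross3 u w) / (cross3 u w \<bullet> cross3 u w)) *\<^sub>R cross3 u w"
proof -
 let ?d = "cross3 u w"
 have "cross3 \<nu> ?d = 0" unfolding Lagrange using assms by simp
 then have "cross3 ?d (cross3 \<nu> ?d) = 0" by simp
 then have *: "(?d \<bullet> ?d) *\<^sub>R \<nu> = (?d \<bullet> \<nu>) *\<^sub>R ?d" unfolding Lagrange[of ?d \<nu> ?d] by simp
 have "?d \<bullet> ?d ~= 0" using assms(1) by simp
 then have "\<nu> = inverse (?d \<bullet> ?d) *\<^sub>R ((?d \<bullet> ?d) *\<^sub>R \<nu>)" by simp
 then show ?thesis unfolding * by (simp add: divide_inverse_commute inner_commute)
qed

locale surface_immersion =
 fixes A :: "'m::{t2_space, second_countable_topology} chart set" and F :: "'m => real^3"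
 assumes atlas: "smooth_surface A" and immersed: "C2_immersion A F"
begin

lemma chart_at: obtains U ph where "(U, ph) \<in> A" "x \<in> U"
proof -
 have "x \<in> (\<Union>(U, ph)\<in>A. U)" using atlas unfolding smooth_surface_def by simp
 then show thesis using that by auto
qed

lemma charts: "(U, ph) \<in> A ==> is_chart (U, ph)"
 using atlas unfolding smooth_surface_def by blast

lemma chart_derivative:
 assumes c: "(U, ph) \<in> A" and z: "z \<in> ph ` U"
 shows "((F \<circ> inv_into U ph) has_derivative frechet_derivative (F \<circ> inv_into U ph) (at z)) (at z)"
  "inj (frechet_derivative (F \<circ> inv_into U ph) (at z))"
  "continuous_on (ph ` U) (%z. frechet_derivative (F \<circ> inv_into U ph) (at z) v)"
  "(%z. frechet_derivative (F \<circ> inv_into U ph) (at z) v) differentiable (at z)"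
proof -
 have C: "Ck_on 2 (ph ` U) (F \<circ> inv_into U ph)" "\<forall>z\<in>ph ` U. inj (frechet_derivative (F \<circ> inv_into U ph) (at z))"
  using immersed c unfolding C2_immersion_def by blast+
 show "inj (frechet_derivative (F \<circ> inv_into U ph) (at z))" using C(2) z by blast
 have 1: "\<forall>x\<in>ph ` U. (F \<circ> inv_into U ph) differentiable (at x)"
  and 2: "\<forall>x\<in>ph ` U. (%z. frechet_derivative (F \<circ> inv_into U ph) (at z) v) differentiable (at x)"
  using C(1) unfolding numeral_2_eq_2 Ck_on.simps by blast+
 show "((F \<circ> inv_into U ph) has_derivative frechet_derivative (F \<circ> inv_into U ph) (at z)) (at z)"
  using 1 z frechet_derivative_works by blast
 show "(%z. frechet_derivative (F \<circ> inv_into U ph) (at z) v) differentiable (at z)" using 2 z by blast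
 show "continuous_on (ph ` U) (%z. frechet_derivative (F \<circ> inv_into U ph) (at z) v)"
  by (intro continuous_at_imp_continuous_on ballI differentiable_imp_continuous_within 2[rule_format])
qed

lemma chart_position:
 assumes "(U, ph) \<in> A" "y \<in> U"
 shows "(F \<circ> inv_into U ph) (ph y) = F y"
 using chart_coordinates(4)[OF charts[OF assms(1)]] assms(2) by simp

text \<open>By the chain rule, a transition map carries one parametrization of the tangent plane to the other.\<close>

lemma tangent_range_subset:
 assumes c: "(U, ph) \<in> A" "x \<in> U" and d: "(V, \<psi>) \<in> A" "x \<in> V"
 shows "range (frechet_derivative (F \<circ> inv_into U ph) (at (ph x))) <= range (frechet_derivative (F \<circ> inv_into V \<psi>) (at (\<psi> x)))"
proof -
 let ?T = "\<psi> \<circ> inv_into U ph" and ?f = "F \<circ> inv_into U ph" and ?g = "F \<circ> inv_into V \<psi>"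
 note cU = chart_coordinates[OF charts[OF c(1)]] and cV = chart_coordinates[OF charts[OF d(1)]]
 have "openin (top_of_set U) (U Int V)" using cU(1) cV(1) by (simp add: openin_open_eq open_Int)
 from homeomorphism_imp_open_map[OF cU(3) this] have o: "open (ph ` (U Int V))" using cU(2) openin_open_trans by blast
 have "smoothly_compatible (U, ph) (V, \<psi>)" using atlas c d unfolding smooth_surface_def by blast
 then have "Ck_on 1 (ph ` (U Int V)) ?T" unfolding smoothly_compatible_def by blast
 then have "?T differentiable (at (ph x))" using c(2) d(2) unfolding One_nat_def Ck_on.simps by blast
 then have dT: "(?T has_derivative frechet_derivative ?T (at (ph x))) (at (ph x))" using frechet_derivative_works by blast
 have Tx: "?T (ph x) = \<psi> x" using cU(4) c(2) by simp
 have "(?g has_derivative frechet_derivative ?g (at (\<psi> x))) (at (?T (ph x)))"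
  unfolding Tx by (rule chart_derivative(1)[OF d(1)]) (use d(2) in blast)
 from diff_chain_at[OF dT this]
 have "((?g \<circ> ?T) has_derivative (frechet_derivative ?g (at (\<psi> x)) \<circ> frechet_derivative ?T (at (ph x)))) (at (ph x))" .
 then have "(?f has_derivative (frechet_derivative ?g (at (\<psi> x)) \<circ> frechet_derivative ?T (at (ph x)))) (at (ph x))"
 proof (rule has_derivative_transform_within_open[OF _ o])
  show "ph x \<in> ph ` (U Int V)" using c(2) d(2) by blast
  fix z assume "z \<in> ph ` (U Int V)"
  then obtain y where "y \<in> U Int V" "z = ph y" by blast
  then show "(?g \<circ> ?T) z = ?f z" using cU(4) cV(4) by simp
 qed
 then have "frechet_derivative ?f (at (ph x)) = frechet_derivative ?g (at (\<psi> x)) \<circ> frechet_derivative ?T (at (ph x))"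
  by (rule frechet_derivative_at[symmetric])
 then show ?thesis by auto
qed

lemma tangent_plane_chart:
 assumes "(U, ph) \<in> A" "x \<in> U"
 shows "tangent_plane A F x = range (frechet_derivative (F \<circ> inv_into U ph) (at (ph x)))"
proof (rule antisym)
 show "tangent_plane A F x <= range (frechet_derivative (F \<circ> inv_into U ph) (at (ph x)))"
 proof
  fix w assume "w \<in> tangent_plane A F x"
  then obtain V \<psi> where "(V, \<psi>) \<in> A" "x \<in> V" "w \<in> range (frechet_derivative (F \<circ> inv_into V \<psi>) (at (\<psi> x)))"
   unfolding tangent_plane_def by auto
  then show "w \<in> range (frechet_derivative (F \<circ> inv_into U ph) (at (ph x)))"
   using tangent_range_subset[OF _ _ assms] by blast
 qed
 show "range (frechet_derivative (F \<circ> inv_into U ph) (at (ph x))) <= tangent_plane A F x"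
  unfolding tangent_plane_def using assms by auto
qed

definition chart_normal :: "'m set => ('m => real^2) => real^2 => real^3" where
 "chart_normal U ph z = cross3 (frechet_derivative (F \<circ> inv_into U ph) (at z) (axis 1 1))
  (frechet_derivative (F \<circ> inv_into U ph) (at z) (axis 2 1))"

lemma chart_normal_nonzero:
 assumes "(U, ph) \<in> A" "z \<in> ph ` U"
 shows "chart_normal U ph z ~= 0"
proof
 let ?D = "frechet_derivative (F \<circ> inv_into U ph) (at z)"
 have lin: "linear ?D" using chart_derivative(1)[OF assms] has_derivative_linear by blast
 have inj: "inj ?D" by (rule chart_derivative(2)[OF assms])
 let ?u = "?D (axis 1 1)" and ?w = "?D (axis 2 1)"
 assume "chart_normal U ph z = 0"
 then have c: "cross3 ?u ?w = 0" by (simp add: chart_normal_def)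
 have "cross3 ?u (cross3 ?u ?w) = (?u \<bullet> ?w) *\<^sub>R ?u - (?u \<bullet> ?u) *\<^sub>R ?w" by (rule Lagrange)
 then have "?D ((?u \<bullet> ?w) *\<^sub>R axis 1 1 - (?u \<bullet> ?u) *\<^sub>R axis 2 1) = ?D 0"
  unfolding linear_diff[OF lin] linear_scale[OF lin] linear_0[OF lin] c by simp
 from injD[OF inj this] have "(?u \<bullet> ?w) *\<^sub>R axis 1 1 - (?u \<bullet> ?u) *\<^sub>R axis 2 1 = (0 :: real^2)" .
 then have "?u \<bullet> ?u = 0" by (auto simp: vec_eq_iff forall_2 axis_def)
 then have "?D (axis 1 1) = ?D 0" using linear_0[OF lin] by simp
 from injD[OF inj this] have "axis 1 1 = (0 :: real^2)" .
 then show False by (simp add: axis_eq_0_iff)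
qed

lemma unit_normals_multiple:
 assumes "(U, ph) \<in> A" "x \<in> U" "\<nu> \<in> unit_normals A F x"
 shows "\<exists>s. s ~= 0 & \<nu> = s *\<^sub>R chart_normal U ph (ph x)"
proof -
 have z: "ph x \<in> ph ` U" using assms(2) by blast
 have \<nu>: "norm \<nu> = 1" "!!v. \<nu> \<bullet> frechet_derivative (F \<circ> inv_into U ph) (at (ph x)) v = 0"
  using assms(3) tangent_plane_chart[OF assms(1,2)] unfolding unit_normals_def by auto
 have eq: "\<nu> = ((\<nu> \<bullet> chart_normal U ph (ph x)) / (chart_normal U ph (ph x) \<bullet> chart_normal U ph (ph x))) *\<^sub>R chart_normal U ph (ph x)"
  unfolding chart_normal_def
  by (rule cross3_multiple) (use chart_normal_nonzero[OF assms(1) z] \<nu>(2) in \<open>simp_all add: chart_normal_def\<close>)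
 have "\<nu> ~= 0" using \<nu>(1) by auto
 then have "(\<nu> \<bullet> chart_normal U ph (ph x)) / (chart_normal U ph (ph x) \<bullet> chart_normal U ph (ph x)) ~= 0" using eq by force
 then show ?thesis using eq by blast
qed

lemma unit_normals_nonempty: "unit_normals A F x ~= {}"
proof -
 obtain U ph where c: "(U, ph) \<in> A" "x \<in> U" by (rule chart_at)
 have z: "ph x \<in> ph ` U" using c(2) by blast
 let ?n = "chart_normal U ph (ph x)" and ?D = "frechet_derivative (F \<circ> inv_into U ph) (at (ph x))"
 have lin: "linear ?D" using chart_derivative(1)[OF c(1) z] has_derivative_linear by blast
 have "?n \<bullet> ?D v = 0" for v
 proof -
  have "?D v = ?D (v $ 1 *\<^sub>R axis 1 1 + v $ 2 *\<^sub>R axis 2 1)" by (rule arg_cong[OF real2_basis])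
  then have "?D v = v $ 1 *\<^sub>R ?D (axis 1 1) + v $ 2 *\<^sub>R ?D (axis 2 1)"
   unfolding linear_add[OF lin] linear_scale[OF lin] .
  then show ?thesis unfolding chart_normal_def by (simp add: inner_add_right inner_commute dot_cross_self)
 qed
 then have "sgn ?n \<in> unit_normals A F x"
  using chart_normal_nonzero[OF c(1) z] tangent_plane_chart[OF c] unfolding unit_normals_def
  by (auto simp: norm_sgn sgn_div_norm)
 then show ?thesis by blast
qed

definition normal :: "'m => real^3" where
 "normal x = (SOME \<nu>. \<nu> \<in> unit_normals A F x)"

lemma normal: "normal x \<in> unit_normals A F x"
 using unit_normals_nonempty[of x] unfolding normal_def by (rule some_in_eq[THEN iffD2])

lemma normal_nonzero: "normal x ~= 0"
 using normal[of x] by (auto simp: unit_normals_def)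

lemma unit_normals_multiple_normal:
 assumes "\<nu> \<in> unit_normals A F x"
 shows "\<exists>s. s ~= 0 & \<nu> = s *\<^sub>R normal x"
proof -
 obtain U ph where c: "(U, ph) \<in> A" "x \<in> U" by (rule chart_at)
 obtain s where s: "s ~= 0" "\<nu> = s *\<^sub>R chart_normal U ph (ph x)" using unit_normals_multiple[OF c assms] by blast
 obtain t where t: "t ~= 0" "normal x = t *\<^sub>R chart_normal U ph (ph x)" using unit_normals_multiple[OF c normal] by blast
 have "\<nu> = (s / t) *\<^sub>R normal x" unfolding s(2) t(2) using t(1) by simp
 then show ?thesis using s(1) t(1) by (intro exI[of _ "s / t"]) simp
qed

lemma immersion_continuous: "continuous_on UNIV F"
proof (rule continuous_at_imp_continuous_on, rule ballI)
 fix x :: 'm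
 obtain U ph where c: "(U, ph) \<in> A" "x \<in> U" by (rule chart_at)
 note cU = chart_coordinates[OF charts[OF c(1)]]
 have "continuous_on (ph ` U) (F \<circ> inv_into U ph)"
  by (intro continuous_at_imp_continuous_on ballI) (rule has_derivative_continuous[OF chart_derivative(1)[OF c(1)]])
 moreover have "continuous_on U ph" using cU(3) by (simp add: homeomorphism_def)
 ultimately have "continuous_on U (%y. (F \<circ> inv_into U ph) (ph y))" by (rule continuous_on_compose2) simp
 then have "continuous_on U F" by (rule continuous_on_eq) (rule chart_position[OF c(1)])
 then show "isCont F x" using cU(1) c(2) by (simp add: continuous_on_eq_continuous_at)
qed

text \<open>The linearization at \<open>x\<close> takes values in the tangent plane, to which the normal is orthogonal.\<close>

lemma immersion_secant:
 assumes "0 < eps"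
 shows "\<exists>U. open U & x \<in> U & inj_on F U & (\<forall>y\<in>U. \<forall>z\<in>U. \<bar>normal x \<bullet> (F y - F z)\<bar> <= eps * norm (F y - F z))"
proof -
 obtain U ph where c: "(U, ph) \<in> A" "x \<in> U" by (rule chart_at)
 note cU = chart_coordinates[OF charts[OF c(1)]]
 let ?f = "F \<circ> inv_into U ph" and ?D = "%z. frechet_derivative (F \<circ> inv_into U ph) (at z)"
 have z: "ph x \<in> ph ` U" using c(2) by blast
 obtain dl B where dl: "dl > 0" "B > 0" "ball (ph x) dl <= ph ` U"
  "!!z z'. z \<in> ball (ph x) dl ==> z' \<in> ball (ph x) dl ==> norm (z - z') <= B * norm (?f z - ?f z')"
  "!!z z'. z \<in> ball (ph x) dl ==> z' \<in> ball (ph x) dl ==> norm (?f z - ?f z' - ?D (ph x) (z - z')) <= eps * norm (?f z - ?f z')"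
  by (rule C1_immersion_secant[OF cU(2) z chart_derivative(1)[OF c(1)] chart_derivative(3)[OF c(1) z] chart_derivative(2)[OF c(1) z] assms])
   (assumption | rule that)+
 define V where "V = ph -` ball (ph x) dl Int U"
 have "open V" unfolding V_def using cU(1,3) by (simp add: continuous_on_open_vimage homeomorphism_def)
 moreover have "x \<in> V" using c(2) dl(1) by (simp add: V_def)
 moreover have "inj_on F V"
 proof (rule inj_onI)
  fix y y' assume y: "y \<in> V" "y' \<in> V" "F y = F y'"
  have "norm (ph y - ph y') <= B * norm (?f (ph y) - ?f (ph y'))" by (rule dl(4)) (use y in \<open>auto simp: V_def\<close>)
  moreover have "?f (ph y) = F y" "?f (ph y') = F y'" using chart_position[OF c(1)] y by (auto simp: V_def)
  ultimately have "ph y = ph y'" using y(3) by simp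
  then show "y = y'" using inj_onD[OF cU(4)] y by (auto simp: V_def)
 qed
 moreover have "\<bar>normal x \<bullet> (F y - F y')\<bar> <= eps * norm (F y - F y')" if y: "y \<in> V" "y' \<in> V" for y y'
 proof -
  have eq: "?f (ph y) = F y" "?f (ph y') = F y'" using chart_position[OF c(1)] y by (auto simp: V_def)
  have b: "norm (F y - F y' - ?D (ph x) (ph y - ph y')) <= eps * norm (F y - F y')"
   using dl(5)[of "ph y" "ph y'"] y unfolding eq by (auto simp: V_def)
  have n: "norm (normal x) = 1" "normal x \<bullet> ?D (ph x) (ph y - ph y') = 0"
   using normal[of x] tangent_plane_chart[OF c] by (auto simp: unit_normals_def)
  have "\<bar>normal x \<bullet> (F y - F y')\<bar> = \<bar>normal x \<bullet> (F y - F y' - ?D (ph x) (ph y - ph y'))\<bar>"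
   using n(2) by (simp only: inner_diff_right[of _ "F y - F y'"] diff_zero)
  also have "\<dots> <= norm (normal x) * norm (F y - F y' - ?D (ph x) (ph y - ph y'))" by (rule Cauchy_Schwarz_ineq2)
  finally show ?thesis using b n(1) by simp
 qed
 ultimately show ?thesis by (intro exI[of _ V]) blast
qed

lemma immersed_surface_normal: "immersed_surface F normal"
proof
 show "continuous_on UNIV F" by (rule immersion_continuous)
 show "\<exists>U. open U & x \<in> U & inj_on F U & (\<forall>y\<in>U. \<forall>z\<in>U. \<bar>normal x \<bullet> (F y - F z)\<bar> <= eps * norm (F y - F z))"
  if "0 < eps" for eps x by (rule immersion_secant[OF that])
 show "\<exists>U ph (\<psi> :: real^2 => 'm). open U & x \<in> U & open (ph ` U) & homeomorphism U (ph ` U) ph \<psi>" for x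
 proof -
  obtain U ph where c: "(U, ph) \<in> A" "x \<in> U" by (rule chart_at)
  then show ?thesis using chart_coordinates[OF charts[OF c(1)]] by blast
 qed
qed

end

section \<open>Exterior products of vectors in space\<close>

lemma wedge_nil: "wedge ([] :: (real^'n) list) ~= (%_. 0)"
proof
 assume "wedge ([] :: (real^'n) list) = (%_. 0)"
 then have "wedge ([] :: (real^'n) list) [] = 0" by (rule fun_cong)
 then show False by (simp add: wedge_def)
qed

lemma wedge_single: "v ~= 0 ==> wedge [v] ~= (%_. 0)"
proof
 assume v: "v ~= 0" and w: "wedge [v] = (%_. 0)"
 have one: "{..<length [v]} = {0}" by auto
 have "wedge [v] [i] = v $ i" for i unfolding wedge_def one permutes_sing by simp
 then have "v $ i = 0" for i using w by simp
 then show False using v by (simp add: vec_eq_iff)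
qed

lemma wedge_pair_component: "wedge [a, b] [i, j] = a $ i * b $ j - b $ i * a $ j"
proof -
 have two: "{..<length [a, b]} = insert 0 {1::nat}" by auto
 have f: "finite {1::nat}" "0 \<notin> {1::nat}" by auto
 show ?thesis unfolding wedge_def two sum_over_permutations_insert[OF f] permutes_sing
  by (simp add: sign_swap_id sign_id Transposition.transpose_def)
qed

lemma wedge_triple_component:
 "wedge [a, b, c] [i, j, k] = a $ i * (b $ j * c $ k - c $ j * b $ k)
   + b $ i * (c $ j * a $ k - a $ j * c $ k) + c $ i * (a $ j * b $ k - b $ j * a $ k)"
proof -
 have three: "{..<length [a, b, c]} = insert 0 (insert 1 {2::nat})" by auto
 have f: "finite {2::nat}" "1 \<notin> {2::nat}" "finite (insert 1 {2::nat})" "0 \<notin> insert 1 {2::nat}" by auto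
 show ?thesis
  unfolding wedge_def three sum_over_permutations_insert[OF f(3,4)] sum_over_permutations_insert[OF f(1,2)] permutes_sing
  by (simp add: sign_swap_id permutation_swap_id sign_compose sign_id Transposition.transpose_def algebra_simps)
qed

lemma cross3_components:
 "cross3 a b = vector [a $ 2 * b $ 3 - a $ 3 * b $ 2, a $ 3 * b $ 1 - a $ 1 * b $ 3, a $ 1 * b $ 2 - a $ 2 * b $ 1]"
 by (simp add: cross3_def)

lemma wedge_pair: "wedge [a, b :: real^3] ~= (%_. 0) \<longleftrightarrow> cross3 a b ~= 0"
proof -
 have "wedge [a, b] = (%_. 0) \<longleftrightarrow> (\<forall>i j. a $ i * b $ j - b $ i * a $ j = 0)"
 proof
  assume "wedge [a, b] = (%_. 0)"
  then show "\<forall>i j. a $ i * b $ j - b $ i * a $ j = 0" by (simp flip: wedge_pair_component)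
 next
  assume *: "\<forall>i j. a $ i * b $ j - b $ i * a $ j = 0"
  show "wedge [a, b] = (%_. 0)"
  proof
   fix js show "wedge [a, b] js = 0"
   proof (cases "length js = 2")
    case True
    then obtain i j where "js = [i, j]" by (auto simp: numeral_2_eq_2 length_Suc_conv)
    then show ?thesis using * by (simp only: wedge_pair_component)
   qed (simp add: wedge_def)
  qed
 qed
 moreover have "(\<forall>i j. a $ i * b $ j - b $ i * a $ j = 0) \<longleftrightarrow> cross3 a b = 0"
  by (auto simp: cross3_components vec_eq_iff forall_3 vector_3 algebra_simps)
 ultimately show ?thesis by simp
qed

lemma wedge_triple: "wedge [a, b, c :: real^3] ~= (%_. 0) \<longleftrightarrow> cross3 a b \<bullet> c ~= 0"
proof -
 have t: "cross3 a b \<bullet> c = wedge [a, b, c] [1, 2, 3]"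
  by (simp add: cross3_components inner_vec_def sum_3 vector_3 wedge_triple_component algebra_simps)
 have z: "wedge [a, b, c] [i, j, k] = 0" if "wedge [a, b, c] [1, 2, 3] = 0" for i j k
  using that exhaust_3[of i] exhaust_3[of j] exhaust_3[of k] unfolding wedge_triple_component
  by (elim disjE) (simp_all add: algebra_simps)
 then have "wedge [a, b, c] is = 0" if "wedge [a, b, c] [1, 2, 3] = 0" for "is"
 proof (cases "length is = 3")
  case True
  then obtain i j k where "is = [i, j, k]" by (auto simp: numeral_3_eq_3 length_Suc_conv)
  then show ?thesis using z[OF that] by simp
 qed (simp add: wedge_def)
 then show ?thesis unfolding t by (auto simp: fun_eq_iff)
qed

text \<open>Two of the indices coincide by the pigeonhole principle, so composing each permutation with their transposition changes the
 sign of its term and preserves the product.\<close>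

lemma wedge_overlong:
 fixes vs :: "(real^'n::finite) list"
 assumes "length vs > CARD('n)"
 shows "wedge vs = (%_. 0)"
proof
 fix "is" :: "'n list"
 show "wedge vs is = 0"
 proof (cases "length is = length vs")
  case True
  have "\<not> distinct is"
  proof
   assume "distinct is"
   then have "length is = card (set is)" by (simp add: distinct_card)
   also have "\<dots> <= CARD('n)" by (rule card_mono) auto
   finally show False using assms True by simp
  qed
  then obtain i j where ij: "i < length vs" "j < length vs" "i ~= j" "is ! i = is ! j"
   unfolding distinct_conv_nth True by blast
  let ?S = "{..<length vs}" and ?q = "Transposition.transpose i j"
  let ?t = "%p. real_of_int (sign p) * (\<Prod>l<length vs. (vs ! p l) $ (is ! l))"
  have q: "?q permutes ?S" using ij by (intro permutes_swap_id) auto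
  have "?t (p \<circ> ?q) = - ?t p" if p: "p permutes ?S" for p
  proof -
   have "sign (p \<circ> ?q) = sign p * sign ?q"
    by (rule sign_compose) (use permutes_imp_permutation[OF _ p] permutation_swap_id in auto)
   moreover have "sign ?q = -1" using ij(3) by (simp add: sign_swap_id)
   ultimately have s: "sign (p \<circ> ?q) = - sign p" by simp
   have "(\<Prod>l<length vs. (vs ! p l) $ (is ! l)) = (\<Prod>l<length vs. ((%l. (vs ! p l) $ (is ! l)) \<circ> ?q) l)"
    by (rule prod.permute[OF q])
   also have "\<dots> = (\<Prod>l<length vs. (vs ! (p \<circ> ?q) l) $ (is ! l))"
   proof (rule prod.cong[OF refl])
    fix l
    have "is ! ?q l = is ! l" using ij(4) by (simp add: Transposition.transpose_def)
    then show "((%l. (vs ! p l) $ (is ! l)) \<circ> ?q) l = (vs ! (p \<circ> ?q) l) $ (is ! l)" by simp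
   qed
   finally show ?thesis unfolding s by simp
  qed
  then have "(\<Sum>p | p permutes ?S. ?t (p \<circ> ?q)) = (\<Sum>p | p permutes ?S. - ?t p)" by (intro sum.cong) auto
  moreover have "(\<Sum>p | p permutes ?S. ?t p) = (\<Sum>p | p permutes ?S. ?t (p \<circ> ?q))"
   by (rule sum_permutations_compose_right[OF q])
  ultimately have "(\<Sum>p | p permutes ?S. ?t p) = - (\<Sum>p | p permutes ?S. ?t p)" by (simp only: sum_negf)
  then show ?thesis using True by (simp add: wedge_def)
 qed (simp add: wedge_def)
qed

section \<open>General position in terms of normal vectors\<close>

text \<open>The exterior product is multilinear.\<close>

lemma wedge_scaled:
 assumes "length us = length vs" "!!i. i < length vs ==> us ! i = s i *\<^sub>R vs ! i"
 shows "wedge us is = (\<Prod>i<length vs. s i) * wedge vs is"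
proof -
 have "(\<Prod>i<length vs. (us ! p i) $ (is ! i)) = (\<Prod>i<length vs. s i) * (\<Prod>i<length vs. (vs ! p i) $ (is ! i))"
  if p: "p permutes {..<length vs}" for p
 proof -
  have "(\<Prod>i<length vs. (us ! p i) $ (is ! i)) = (\<Prod>i<length vs. s (p i) * (vs ! p i) $ (is ! i))"
   using assms(2) permutes_in_image[OF p] by (intro prod.cong) auto
  also have "\<dots> = (\<Prod>i<length vs. s (p i)) * (\<Prod>i<length vs. (vs ! p i) $ (is ! i))" by (rule prod.distrib)
  also have "(\<Prod>i<length vs. s (p i)) = (\<Prod>i<length vs. s i)" using prod.permute[OF p, of s] by (simp add: o_def)
  finally show ?thesis .
 qed
 then show ?thesis by (auto simp: wedge_def assms(1) sum_distrib_left intro!: sum.cong)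
qed

lemma wedge_scaled_nonzero:
 assumes "length us = length vs" "!!i. i < length vs ==> s i ~= 0 & us ! i = s i *\<^sub>R vs ! i"
 shows "wedge us ~= (%_. 0) \<longleftrightarrow> wedge vs ~= (%_. 0)"
proof -
 have "(\<Prod>i<length vs. s i) ~= 0" using assms(2) by simp
 moreover have "wedge us is = (\<Prod>i<length vs. s i) * wedge vs is" for "is"
  by (rule wedge_scaled) (use assms in auto)
 ultimately show ?thesis by (simp add: fun_eq_iff)
qed

lemma triple_nonzero_indep3: 
 assumes "cross3 a b \<bullet> c ~= 0" shows "indep3 a b c"
 unfolding indep3_def
proof safe
 fix w assume w: "a \<bullet> w = 0" "b \<bullet> w = 0" "c \<bullet> w = 0"
 have "cross3 a b ~= 0" using assms by auto
 from cross3_multiple[OF this, of w] obtain k where k: "w = k *\<^sub>R cross3 a b"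
  using w by (auto simp: inner_commute)
 have "k * (cross3 a b \<bullet> c) = 0" using w(3) unfolding k by (simp add: inner_commute)
 then show "w = 0" using assms k by simp
qed

lemma plane_unit_normal:
 assumes "n ~= 0" shows "sgn n \<in> plane_unit_normals {y. n \<bullet> (y - \<omega>) = 1}"
 using assms unfolding plane_unit_normals_def by (auto simp: norm_sgn sgn_div_norm inner_diff_right)

lemma plane_unit_normal_multiple:
 assumes n: "n ~= 0" and \<nu>: "\<nu> \<in> plane_unit_normals {y. n \<bullet> (y - \<omega>) = 1}"
 shows "\<exists>s. s ~= 0 & \<nu> = s *\<^sub>R n"
proof -
 define s where "s = (\<nu> \<bullet> n) / (n \<bullet> n)"
 define v where "v = \<nu> - s *\<^sub>R n"
 have nn: "n \<bullet> n ~= 0" using n by simp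
 have nv: "n \<bullet> v = 0" unfolding v_def s_def using nn by (simp add: inner_diff_right inner_commute)
 define p where "p = \<omega> + (1 / (n \<bullet> n)) *\<^sub>R n"
 have "p \<in> {y. n \<bullet> (y - \<omega>) = 1}" "p + v \<in> {y. n \<bullet> (y - \<omega>) = 1}"
  unfolding p_def using nn nv by (auto simp: inner_add_right inner_diff_right)
 then have "\<nu> \<bullet> (p + v - p) = 0" using \<nu> unfolding plane_unit_normals_def by blast
 then have "\<nu> \<bullet> v = 0" by simp
 then have "v \<bullet> v = 0" using nv unfolding v_def by (simp add: inner_diff_left)
 then have eq: "\<nu> = s *\<^sub>R n" by (simp add: v_def)
 moreover have "s ~= 0"
 proof
  assume "s = 0"
  then have "norm \<nu> = 0" using eq by simp
  then show False using \<nu> by (simp add: plane_unit_normals_def)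
 qed
 ultimately show ?thesis by blast
qed

context surface_immersion begin

text \<open>General position of the immersion itself, for one choice of the normals: double points are
 transversal, triple points have independent normals, and there are no quadruple points.\<close>

definition normal_crossings :: bool where
 "normal_crossings \<longleftrightarrow> (\<forall>x y. x ~= y & F x = F y --> cross3 (normal x) (normal y) ~= 0) &
  (\<forall>x y z. distinct [x, y, z] & F x = F y & F y = F z --> cross3 (normal x) (normal y) \<bullet> normal z ~= 0) &
  (\<forall>x y z w. distinct [x, y, z, w] --> \<not> (F x = F y & F y = F z & F z = F w))"

text \<open>The conditions that general position puts on the plane \<open>{p. n \<bullet> (p - \<omega>) = 1}\<close>: it is tangent to no
 sheet, transversal to the double curves, and avoids the triple points.\<close>

definition generic :: "real^3 => real^3 => bool" where
 "generic \<omega> n \<longleftrightarrow> (\<forall>x. n \<bullet> (F x - \<omega>) = 1 --> cross3 (normal x) n ~= 0) &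
  (\<forall>x y. x ~= y & F x = F y & n \<bullet> (F x - \<omega>) = 1 --> cross3 (normal x) (normal y) \<bullet> n ~= 0) &
  (\<forall>x y z. distinct [x, y, z] & F x = F y & F y = F z --> n \<bullet> (F x - \<omega>) ~= 1)"

lemma normals_at:
 assumes "n ~= 0" "\<nu> \<in> case_sum (unit_normals A F) (%p. plane_unit_normals {y. n \<bullet> (y - \<omega>) = 1}) z"
 shows "\<exists>s. s ~= 0 & \<nu> = s *\<^sub>R case_sum normal (%_. n) z"
 using assms(2) unit_normals_multiple_normal plane_unit_normal_multiple[OF assms(1)] by (cases z) simp_all

text \<open>Unit normals are nonzero multiples of the chosen normals, and nonzero factors do not affect
 whether an exterior product vanishes.\<close>

lemma in_general_position_wedge:
 fixes \<omega> :: "real^3"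
 assumes n: "n ~= 0"
 defines "Q \<equiv> {y. n \<bullet> (y - \<omega>) = 1}"
 shows "in_general_position A F Q \<longleftrightarrow> (\<forall>y zs. distinct zs & set zs <= {z \<in> UNIV <+> Q. case_sum F (%p. p) z = y}
  --> wedge (map (case_sum normal (%_. n)) zs) ~= (%_. 0))" (is "?L \<longleftrightarrow> ?R")
proof
 let ?N = "case_sum (unit_normals A F) (%p. plane_unit_normals Q)"
 assume L: ?L
 show ?R
 proof (intro allI impI, elim conjE)
  fix y zs assume zs: "distinct zs" "set zs <= {z \<in> UNIV <+> Q. case_sum F (%p. p) z = y}"
  let ?\<nu>s = "map (case_sum normal (%_. sgn n)) zs"
  have c: "normals_condition (length zs) (UNIV <+> Q) (case_sum F (%p. p)) ?N"
   using L unfolding in_general_position_def extension_condition_def by blast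
  have "\<forall>i<length zs. ?\<nu>s ! i \<in> ?N (zs ! i)"
  proof (intro allI impI)
   fix i assume "i < length zs"
   then show "?\<nu>s ! i \<in> ?N (zs ! i)"
    using normal plane_unit_normal[OF n] by (cases "zs ! i") (simp_all add: Q_def)
  qed
  then have "wedge ?\<nu>s ~= (%_. 0)"
   using c[unfolded normals_condition_def, rule_format, of zs ?\<nu>s y] zs by simp
  moreover have "wedge ?\<nu>s ~= (%_. 0) \<longleftrightarrow> wedge (map (case_sum normal (%_. n)) zs) ~= (%_. 0)"
  proof (rule wedge_scaled_nonzero)
   fix i assume "i < length (map (case_sum normal (%_. n)) zs)"
   then show "case_sum (%_. 1) (%_. inverse (norm n)) (zs ! i) ~= 0 &
     ?\<nu>s ! i = case_sum (%_. 1) (%_. inverse (norm n)) (zs ! i) *\<^sub>R map (case_sum normal (%_. n)) zs ! i"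
    using n by (cases "zs ! i") (simp_all add: sgn_div_norm)
  qed simp
  ultimately show "wedge (map (case_sum normal (%_. n)) zs) ~= (%_. 0)" by blast
 qed
next
 let ?N = "case_sum (unit_normals A F) (%p. plane_unit_normals Q)"
 assume R: ?R
 show ?L unfolding in_general_position_def extension_condition_def normals_condition_def
 proof (intro allI impI, elim conjE)
  fix k y zs \<nu>s
  assume h: "length zs = k" "length \<nu>s = k" "distinct zs" "set zs <= {z \<in> UNIV <+> Q. case_sum F (%p. p) z = y}"
   and N: "\<forall>i<k. \<nu>s ! i \<in> ?N (zs ! i)"
  have "\<exists>s. s ~= 0 & \<nu>s ! i = s *\<^sub>R case_sum normal (%_. n) (zs ! i)" if "i < k" for i
   using normals_at[OF n] N that unfolding Q_def by blast
  then have *: "\<forall>i. \<exists>s. i < k --> s ~= 0 & \<nu>s ! i = s *\<^sub>R case_sum normal (%_. n) (zs ! i)" by blast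
  from choice[OF *] obtain s where
   s: "\<forall>i. i < k --> s i ~= 0 & \<nu>s ! i = s i *\<^sub>R case_sum normal (%_. n) (zs ! i)" ..
  have "wedge \<nu>s ~= (%_. 0) \<longleftrightarrow> wedge (map (case_sum normal (%_. n)) zs) ~= (%_. 0)"
   by (rule wedge_scaled_nonzero[where s = s]) (use s h in auto)
  then show "wedge \<nu>s ~= (%_. 0)" using R[rule_format, of zs y] h by blast
 qed
qed

lemma general_position_crossings:
 assumes "n ~= 0" "in_general_position A F {y. n \<bullet> (y - \<omega>) = 1}"
 shows "normal_crossings" "generic \<omega> n"
proof -
 let ?W = "%zs. wedge (map (case_sum normal (%_ :: real^3. n)) zs) ~= (%_. 0)"
 have W: "?W zs" if "distinct zs" "set zs <= {z \<in> UNIV <+> {y. n \<bullet> (y - \<omega>) = 1}. case_sum F (%p. p) z = q}" for zs q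
  by (rule assms(2)[unfolded in_general_position_wedge[OF assms(1)], rule_format, OF conjI]) (rule that)+
 show "normal_crossings" unfolding normal_crossings_def
 proof (intro conjI allI impI; (elim conjE)?)
  fix x y assume "x ~= y" "F x = F y"
  then have "?W [Inl x, Inl y]" by (intro W[of "[Inl x, Inl y]" "F y"]) auto
  then show "cross3 (normal x) (normal y) ~= 0" by (simp add: wedge_pair)
 next
  fix x y z assume "distinct [x, y, z]" "F x = F y" "F y = F z"
  then have "?W [Inl x, Inl y, Inl z]" by (intro W[of "[Inl x, Inl y, Inl z]" "F z"]) auto
  then show "cross3 (normal x) (normal y) \<bullet> normal z ~= 0" by (simp add: wedge_triple)
 next
  fix x y z w :: 'm assume d: "distinct [x, y, z, w]"
  show "\<not> (F x = F y & F y = F z & F z = F w)"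
  proof
   assume "F x = F y & F y = F z & F z = F w"
   then have "?W [Inl x, Inl y, Inl z, Inl w]" using d by (intro W[of "[Inl x, Inl y, Inl z, Inl w]" "F w"]) auto
   then show False by (simp add: wedge_overlong)
  qed
 qed
 show "generic \<omega> n" unfolding generic_def
 proof (intro conjI allI impI; (elim conjE)?)
  fix x assume "n \<bullet> (F x - \<omega>) = 1"
  then have "?W [Inl x, Inr (F x)]" by (intro W[of "[Inl x, Inr (F x)]" "F x"]) auto
  then show "cross3 (normal x) n ~= 0" by (simp add: wedge_pair)
 next
  fix x y assume "x ~= y" "F x = F y" "n \<bullet> (F x - \<omega>) = 1"
  then have "?W [Inl x, Inl y, Inr (F y)]" by (intro W[of "[Inl x, Inl y, Inr (F y)]" "F y"]) auto
  then show "cross3 (normal x) (normal y) \<bullet> n ~= 0" by (simp add: wedge_triple)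
 next
  fix x y z assume d: "distinct [x, y, z]" "F x = F y" "F y = F z"
  show "n \<bullet> (F x - \<omega>) ~= 1"
  proof
   assume "n \<bullet> (F x - \<omega>) = 1"
   then have "?W [Inl x, Inl y, Inl z, Inr (F z)]" using d by (intro W[of "[Inl x, Inl y, Inl z, Inr (F z)]" "F z"]) auto
   then show False by (simp add: wedge_overlong)
  qed
 qed
qed

lemma crossings_general_position:
 assumes n: "n ~= 0" and c: "normal_crossings" and g: "generic \<omega> n"
 shows "in_general_position A F {y. n \<bullet> (y - \<omega>) = 1}"
 unfolding in_general_position_wedge[OF n]
proof (intro allI impI, elim conjE)
 fix y zs
 assume d: "distinct zs" and sub: "set zs <= {z \<in> UNIV <+> {y. n \<bullet> (y - \<omega>) = 1}. case_sum F (%p. p) z = y}"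
 let ?N = "case_sum normal (%_. n)"
 have pt: "(\<exists>x. z = Inl x & F x = y) \<or> z = Inr y & n \<bullet> (y - \<omega>) = 1" if "z \<in> set zs" for z
  using subsetD[OF sub that] by (auto elim!: PlusE)
 have c2: "cross3 (normal x) (normal x') ~= 0" if "x ~= x'" "F x = F x'" for x x'
  using c that unfolding normal_crossings_def by blast
 have c3: "cross3 (normal x) (normal x') \<bullet> normal x'' ~= 0" if "distinct [x, x', x'']" "F x = F x'" "F x' = F x''" for x x' x''
  using c that unfolding normal_crossings_def by blast
 have c4: False if "x ~= x'" "x ~= x''" "x ~= x'''" "x' ~= x''" "x' ~= x'''" "x'' ~= x'''"
  "F x = y" "F x' = y" "F x'' = y" "F x''' = y" for x x' x'' x'''
  using c[unfolded normal_crossings_def, THEN conjunct2, THEN conjunct2, rule_format, of x x' x'' x'''] that by simp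
 have g1: "cross3 (normal x) n ~= 0" if "n \<bullet> (F x - \<omega>) = 1" for x
  using g that unfolding generic_def by blast
 have g2: "cross3 (normal x) (normal x') \<bullet> n ~= 0" if "x ~= x'" "F x = F x'" "n \<bullet> (F x' - \<omega>) = 1" for x x'
  using g[unfolded generic_def, THEN conjunct2, THEN conjunct1, rule_format, of x x'] that by simp
 have g3: False if "x ~= x'" "x ~= x''" "x' ~= x''" "F x = y" "F x' = y" "F x'' = y" "n \<bullet> (y - \<omega>) = 1" for x x' x''
  using g[unfolded generic_def, THEN conjunct2, THEN conjunct2, rule_format, of x x' x''] that by simp
 have g1': "cross3 n (normal x) ~= 0" if "n \<bullet> (F x - \<omega>) = 1" for x
  using g1[OF that] cross_skew[of n "normal x"] by auto
 have rot: "cross3 a b \<bullet> d = cross3 d a \<bullet> b" "cross3 a b \<bullet> d = cross3 b d \<bullet> a" for a b d :: "real^3"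
  by (simp_all add: cross3_components inner_vec_def sum_3 vector_3 algebra_simps)
 have g2': "cross3 n (normal x) \<bullet> normal x' ~= 0" "cross3 (normal x) n \<bullet> normal x' ~= 0"
  if "x ~= x'" "F x = F x'" "n \<bullet> (F x' - \<omega>) = 1" for x x'
  using g2[OF that] g2[of x' x] that rot(2)[of n "normal x" "normal x'"] rot(1)[of "normal x" n "normal x'"] by simp_all
 consider "zs = []" | z where "zs = [z]" | z z' where "zs = [z, z']" | z z' z'' where "zs = [z, z', z'']"
  | z z' z'' z''' r where "zs = z # z' # z'' # z''' # r"
 proof (cases zs)
  case (Cons a as) note 1 = this
  show thesis
  proof (cases as)
   case (Cons b bs) note 2 = this
   show thesis
   proof (cases bs)
    case (Cons k ks) note 3 = this
    show thesis using that 1 2 3 by (cases ks) auto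
   qed (use that 1 2 in simp)
  qed (use that 1 in simp)
 qed (use that in simp)
 then show "wedge (map ?N zs) ~= (%_. 0)"
 proof cases
  case 1 then show ?thesis by (simp add: wedge_nil)
 next
  case (2 z) then show ?thesis using normal_nonzero n by (cases z) (simp_all add: wedge_single)
 next
  case (3 z z')
  have "cross3 (?N z) (?N z') ~= 0"
   using pt[of z, unfolded 3, simplified] pt[of z', unfolded 3, simplified] d unfolding 3 by (elim disjE exE conjE; simp add: c2 g1 g1')
  then show ?thesis unfolding 3 by (simp add: wedge_pair)
 next
  case (4 z z' z'')
  have "cross3 (?N z) (?N z') \<bullet> ?N z'' ~= 0"
   using pt[of z, unfolded 4, simplified] pt[of z', unfolded 4, simplified] pt[of z'', unfolded 4, simplified] d unfolding 4
   by (elim disjE exE conjE) (simp_all add: c3 g2 g2')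
  then show ?thesis unfolding 4 by (simp add: wedge_triple)
 next
  case (5 z z' z'' z''' r)
  have False
   using pt[of z, unfolded 5, simplified] pt[of z', unfolded 5, simplified] pt[of z'', unfolded 5, simplified] 
    pt[of z''', unfolded 5, simplified] d unfolding 5
   by (elim disjE exE conjE) (simp_all, (elim conjE, ((rule c4; assumption) | (rule g3; assumption)))+)
  then show ?thesis by blast
 qed
qed

end

section \<open>Almost every plane is in general position\<close>

text \<open>By the Lindeloef property countably many of the neighbourhoods suffice.\<close>

lemma negligible_locally:
 fixes X :: "'a::second_countable_topology set" and B :: "'a => 'b::euclidean_space set"
 assumes loc: "!!x. x \<in> X ==> \<exists>U. open U & x \<in> U & negligible (\<Union>y\<in>U Int X. B y)"
 shows "negligible (\<Union>x\<in>X. B x)"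
proof -
 define W where "W = {U. open U & negligible (\<Union>y\<in>U Int X. B y)}"
 obtain W' where W': "W' <= W" "countable W'" "\<Union>W' = \<Union>W"
  by (rule Lindelof[of W]) (simp add: W_def, rule that)
 have "negligible (\<Union>((%U. \<Union>y\<in>U Int X. B y) ` W'))"
  using W'(1,2) by (intro negligible_countable_Union) (auto simp: W_def)
 moreover have "(\<Union>x\<in>X. B x) <= (\<Union>((%U. \<Union>y\<in>U Int X. B y) ` W'))"
 proof
  fix n assume "n \<in> (\<Union>x\<in>X. B x)"
  then obtain x where x: "x \<in> X" "n \<in> B x" by blast
  obtain U where U: "open U" "x \<in> U" "negligible (\<Union>y\<in>U Int X. B y)" using loc[OF x(1)] by blast
  then have "x \<in> \<Union>W'" unfolding W'(3) W_def by blast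
  then obtain V where "V \<in> W'" "x \<in> V" by blast
  then show "n \<in> (\<Union>((%U. \<Union>y\<in>U Int X. B y) ` W'))" using x by blast
 qed
 ultimately show ?thesis by (rule negligible_subset)
qed

lemma differentiable_bilinear:
 assumes "bounded_bilinear h" "f differentiable (at x)" "g differentiable (at x)"
 shows "(%x. h (f x) (g x)) differentiable (at x)"
proof -
 obtain f' g' where "(f has_derivative f') (at x)" "(g has_derivative g') (at x)"
  using assms(2,3) unfolding differentiable_def by blast
 from bounded_bilinear.FDERIV[OF assms(1) this] show ?thesis unfolding differentiable_def by blast
qed

lemmas differentiable_cross3 = differentiable_bilinear[OF bilinear_cross[unfolded bilinear_conv_bounded_bilinear]]

lemma differentiable_pointwise_Lipschitz:
 fixes G :: "'a::real_normed_vector => 'b::real_normed_vector"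
 assumes "G differentiable (at p)"
 obtains dl K where "dl > 0" "K \<ge> 0" "!!q. norm (q - p) < dl ==> norm (G q - G p) <= K * norm (q - p)"
proof -
 obtain G' where G': "(G has_derivative G') (at p)" using assms unfolding differentiable_def by blast
 then have bl: "bounded_linear G'" by (rule has_derivative_bounded_linear)
 obtain dl where dl: "dl > 0" "\<forall>q. norm (q - p) < dl --> norm (G q - G p - G' (q - p)) <= 1 * norm (q - p)"
  using G' unfolding has_derivative_at_alt by (blast intro: zero_less_one)
 show thesis
 proof (rule that[OF dl(1)])
  show "0 <= onorm G' + 1" using onorm_pos_le[OF bl] by simp
  fix q assume "norm (q - p) < dl"
  then have "norm (G q - G p - G' (q - p)) <= norm (q - p)" using dl(2) by simp
  moreover have "norm (G' (q - p)) <= onorm G' * norm (q - p)" by (rule onorm[OF bl])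
  moreover have "norm (G q - G p) <= norm (G q - G p - G' (q - p)) + norm (G' (q - p))"
   using norm_triangle_ineq[of "G q - G p - G' (q - p)" "G' (q - p)"] by simp
  ultimately show "norm (G q - G p) <= (onorm G' + 1) * norm (q - p)" by (simp add: distrib_right)
 qed
qed

text \<open>The solutions \<open>n\<close> of the two linear equations form a line in the direction \<open>p \<times> d\<close>; the first summand is its
 point nearest to the origin.\<close>

lemma solve_two_planes:
 assumes n: "n \<bullet> p = 1" "n \<bullet> d = 0" and d: "d ~= 0"
 defines "e \<equiv> cross3 p d"
 shows "e ~= 0" "\<exists>l. n = inverse (e \<bullet> e) *\<^sub>R cross3 d e + l *\<^sub>R e"
proof -
 show e: "e ~= 0"
 proof
  assume "e = 0"
  then have "cross3 d (cross3 p d) = 0" by (simp add: e_def)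
  then have "(d \<bullet> d) *\<^sub>R p = (d \<bullet> p) *\<^sub>R d" unfolding Lagrange by simp
  then have "n \<bullet> ((d \<bullet> d) *\<^sub>R p) = n \<bullet> ((d \<bullet> p) *\<^sub>R d)" by simp
  then show False using n d by simp
 qed
 define m where "m = n - inverse (e \<bullet> e) *\<^sub>R cross3 d e"
 have "cross3 d e \<bullet> p = e \<bullet> e" "cross3 d e \<bullet> d = 0"
  unfolding e_def by (simp_all add: cross3_components inner_vec_def sum_3 vector_3 algebra_simps)
 then have "m \<bullet> p = 0" "m \<bullet> d = 0" using n e unfolding m_def by (simp_all add: inner_diff_left)
 from cross3_multiple[OF e[unfolded e_def] this] obtain l where "m = l *\<^sub>R e" unfolding e_def by blast
 then show "\<exists>l. n = inverse (e \<bullet> e) *\<^sub>R cross3 d e + l *\<^sub>R e" by (intro exI[of _ l]) (simp add: m_def algebra_simps)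
qed

context surface_immersion begin

lemma chart_normal_differentiable:
 assumes "(U, ph) \<in> A" "z \<in> ph ` U"
 shows "chart_normal U ph differentiable (at z)"
 unfolding chart_normal_def by (intro differentiable_cross3 chart_derivative(4)[OF assms])

lemma chart_differentiable:
 assumes "(U, ph) \<in> A" "z \<in> ph ` U"
 shows "(F \<circ> inv_into U ph) differentiable (at z)"
 using chart_derivative(1)[OF assms] unfolding differentiable_def by blast

lemma normal_chart_normal:
 assumes "(U, ph) \<in> A" "x \<in> U"
 shows "\<exists>s. s ~= 0 & normal x = s *\<^sub>R chart_normal U ph (ph x)"
 by (rule unit_normals_multiple[OF assms normal])

text \<open>The vector of the tangent plane at a point of a chart is a differentiable function of the two coordinates of
 the point, so these vectors form the image of a set of smaller dimension.\<close>

lemma tangent_planes_negligible: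
 "negligible (\<Union>x. {n. n \<bullet> (F x - \<omega>) = 1 & cross3 (normal x) n = 0})"
proof (rule negligible_locally)
 fix x :: 'm
 obtain U ph where c: "(U, ph) \<in> A" "x \<in> U" by (rule chart_at)
 let ?f = "F \<circ> inv_into U ph" and ?N = "chart_normal U ph"
 let ?S = "{z \<in> ph ` U. ?N z \<bullet> (?f z - \<omega>) ~= 0}"
 let ?g = "%z. inverse (?N z \<bullet> (?f z - \<omega>)) *\<^sub>R ?N z"
 have "?g differentiable (at z)" if z: "z \<in> ?S" for z
 proof -
  have zU: "z \<in> ph ` U" and nz: "?N z \<bullet> (?f z - \<omega>) ~= 0" using z by simp_all
  show ?thesis
   by (intro differentiable_bilinear[OF bounded_bilinear_scaleR] differentiable_bilinear[OF bounded_bilinear_inner]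
    differentiable_inverse differentiable_diff differentiable_const chart_normal_differentiable[OF c(1) zU] chart_differentiable[OF c(1) zU] nz)
 qed
 then have "?g differentiable_on ?S" unfolding differentiable_on_def by (blast intro: differentiable_at_withinI)
 then have neg: "negligible (?g ` ?S)" by (rule negligible_differentiable_image_lowdim[rotated]) simp
 have "(\<Union>y\<in>U Int UNIV. {n. n \<bullet> (F y - \<omega>) = 1 & cross3 (normal y) n = 0}) <= ?g ` ?S"
 proof
  fix n assume "n \<in> (\<Union>y\<in>U Int UNIV. {n. n \<bullet> (F y - \<omega>) = 1 & cross3 (normal y) n = 0})"
  then obtain y where y: "y \<in> U" and n: "n \<bullet> (F y - \<omega>) = 1" "cross3 (normal y) n = 0" by blast
  obtain s where s: "s ~= 0" "normal y = s *\<^sub>R ?N (ph y)" using normal_chart_normal[OF c(1) y] by blast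
  let ?m = "?N (ph y)" and ?p = "F y - \<omega>"
  have m0: "?m ~= 0" using chart_normal_nonzero[OF c(1)] y by blast
  have "cross3 ?m n = 0" using n(2) s by (simp add: cross_mult_left)
  then have "cross3 ?m (cross3 ?m n) = 0" by simp
  then have L: "(?m \<bullet> n) *\<^sub>R ?m = (?m \<bullet> ?m) *\<^sub>R n" unfolding Lagrange by simp
  then have "((?m \<bullet> n) *\<^sub>R ?m) \<bullet> ?p = ((?m \<bullet> ?m) *\<^sub>R n) \<bullet> ?p" by simp
  then have k: "(?m \<bullet> n) * (?m \<bullet> ?p) = ?m \<bullet> ?m" using n(1) by simp
  then have ne: "?m \<bullet> ?p ~= 0" using m0 by auto
  have "n = inverse (?m \<bullet> ?m) *\<^sub>R ((?m \<bullet> ?m) *\<^sub>R n)" using m0 by simp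
  also have "\<dots> = (inverse (?m \<bullet> ?m) * (?m \<bullet> n)) *\<^sub>R ?m" unfolding L[symmetric] by simp
  also have "inverse (?m \<bullet> ?m) * (?m \<bullet> n) = inverse (?m \<bullet> ?p)" using k ne m0 by (simp add: field_simps)
  finally have "n = inverse (?m \<bullet> ?p) *\<^sub>R ?m" .
  moreover have f: "?f (ph y) = F y" by (rule chart_position[OF c(1) y])
  ultimately have "n = ?g (ph y)" by (simp only:)
  moreover have "ph y \<in> ?S" using y ne unfolding mem_Collect_eq f by blast
  ultimately show "n \<in> ?g ` ?S" by (rule image_eqI)
 qed
 then show "\<exists>U. open U & x \<in> U & negligible (\<Union>y\<in>U Int UNIV. {n. n \<bullet> (F y - \<omega>) = 1 & cross3 (normal y) n = 0})"
  using chart_coordinates(1)[OF charts[OF c(1)]] c(2) negligible_subset[OF neg] by blast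
qed

lemma chart_bilipschitz:
 assumes c: "(U, ph) \<in> A" "x \<in> U" and eps: "eps > 0"
 obtains V B where "open V" "x \<in> V" "V <= U" "B > 0"
  "!!y z. y \<in> V ==> z \<in> V ==> norm (ph y - ph z) <= B * norm (F y - F z)"
  "!!y z. y \<in> V ==> z \<in> V ==> \<bar>normal x \<bullet> (F y - F z)\<bar> <= eps * norm (F y - F z)"
proof -
 note cU = chart_coordinates[OF charts[OF c(1)]]
 let ?f = "F \<circ> inv_into U ph"
 have z: "ph x \<in> ph ` U" using c(2) by blast
 obtain dl B where dl: "dl > 0" "B > 0" "ball (ph x) dl <= ph ` U"
  "!!z z'. z \<in> ball (ph x) dl ==> z' \<in> ball (ph x) dl ==> norm (z - z') <= B * norm (?f z - ?f z')"
  "!!z z'. z \<in> ball (ph x) dl ==> z' \<in> ball (ph x) dl ==>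
   norm (?f z - ?f z' - frechet_derivative ?f (at (ph x)) (z - z')) <= 1 * norm (?f z - ?f z')"
  by (rule C1_immersion_secant[OF cU(2) z chart_derivative(1)[OF c(1)] chart_derivative(3)[OF c(1) z] chart_derivative(2)[OF c(1) z] zero_less_one])
   (assumption | rule that)+
 obtain W where W: "open W" "x \<in> W" "\<forall>y\<in>W. \<forall>z\<in>W. \<bar>normal x \<bullet> (F y - F z)\<bar> <= eps * norm (F y - F z)"
  using immersion_secant[OF eps, of x] by blast
 define V where "V = ph -` ball (ph x) dl Int U Int W"
 show thesis
 proof (rule that[of V B])
  show "open V" unfolding V_def using cU(1,3) W(1) by (simp add: continuous_on_open_vimage homeomorphism_def open_Int)
  show "x \<in> V" using c(2) dl(1) W(2) by (simp add: V_def)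
  show "V <= U" by (auto simp: V_def)
  show "B > 0" by (rule dl(2))
  fix y z assume y: "y \<in> V" "z \<in> V"
  then have "norm (ph y - ph z) <= B * norm (?f (ph y) - ?f (ph z))" by (intro dl(4)) (auto simp: V_def)
  moreover have "?f (ph y) = F y" "?f (ph z) = F z" using y by (auto simp: V_def intro!: chart_position[OF c(1)] simp del: o_apply)
  ultimately show "norm (ph y - ph z) <= B * norm (F y - F z)" by (simp only:)
  show "\<bar>normal x \<bullet> (F y - F z)\<bar> <= eps * norm (F y - F z)" using W(3) y by (auto simp: V_def)
 qed
qed

text \<open>A secant \<open>w\<close> of the double set is nearly orthogonal to both normals, so it is nearly parallel to
 \<open>d\<close>. Hence the linear form \<open>d\<close> is a coordinate on the double set with Lipschitz inverse, which serves as a substitute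
 for the fact that the double set is a curve.\<close>

lemma double_curve_parameter:
 assumes c: "(U, ph) \<in> A" "x \<in> U" and c': "(V, \<psi>) \<in> A" "y \<in> V" and ind: "cross3 (normal x) (normal y) ~= 0"
 obtains U' V' C d where "open U'" "x \<in> U'" "U' <= U" "open V'" "y \<in> V'" "V' <= V" "C > 0"
  "!!x1 x2 y1 y2. x1 \<in> U' ==> x2 \<in> U' ==> y1 \<in> V' ==> y2 \<in> V' ==> F x1 = F y1 ==> F x2 = F y2 ==>
   norm (ph x1 - ph x2) <= C * \<bar>d \<bullet> F x1 - d \<bullet> F x2\<bar> & norm (\<psi> y1 - \<psi> y2) <= C * \<bar>d \<bullet> F x1 - d \<bullet> F x2\<bar>"
proof -
 define d where "d = cross3 (normal x) (normal y)"
 have "indep3 d (normal y) (normal x)" unfolding d_def by (rule indep3_cross[OF ind])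
 then obtain B where B: "B > 0" "!!w. B * norm w <= \<bar>d \<bullet> w\<bar> + \<bar>normal y \<bullet> w\<bar> + \<bar>normal x \<bullet> w\<bar>"
  by (rule indep3_coercive) (rule that)
 have B4: "B / 4 > 0" using B(1) by simp
 obtain U' B1 where U': "open U'" "x \<in> U'" "U' <= U" "B1 > 0"
  "!!y z. y \<in> U' ==> z \<in> U' ==> norm (ph y - ph z) <= B1 * norm (F y - F z)"
  "!!y z. y \<in> U' ==> z \<in> U' ==> \<bar>normal x \<bullet> (F y - F z)\<bar> <= B / 4 * norm (F y - F z)"
  by (rule chart_bilipschitz[OF c B4]) (rule that)
 obtain V' B2 where V': "open V'" "y \<in> V'" "V' <= V" "B2 > 0"
  "!!y z. y \<in> V' ==> z \<in> V' ==> norm (\<psi> y - \<psi> z) <= B2 * norm (F y - F z)"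
  "!!z w. z \<in> V' ==> w \<in> V' ==> \<bar>normal y \<bullet> (F z - F w)\<bar> <= B / 4 * norm (F z - F w)"
  by (rule chart_bilipschitz[OF c' B4]) (rule that)
 define C where "C = (B1 + B2) * (2 / B)"
 show thesis
 proof (rule that[OF U'(1-3) V'(1-3), of C d])
  show "C > 0" using U'(4) V'(4) B(1) by (simp add: C_def)
  fix x1 x2 y1 y2 assume h: "x1 \<in> U'" "x2 \<in> U'" "y1 \<in> V'" "y2 \<in> V'" "F x1 = F y1" "F x2 = F y2"
  let ?w = "F x1 - F x2"
  have "\<bar>normal x \<bullet> ?w\<bar> <= B / 4 * norm ?w" "\<bar>normal y \<bullet> ?w\<bar> <= B / 4 * norm ?w"
   using U'(6)[OF h(1,2)] V'(6)[OF h(3,4)] unfolding h(5,6) by blast+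
  then have "B * norm ?w <= 2 * \<bar>d \<bullet> ?w\<bar>" using B(2)[of ?w] by linarith
  then have "2 / B * (B * norm ?w) <= 2 / B * (2 * \<bar>d \<bullet> ?w\<bar>)" using B(1) by (intro mult_left_mono) auto
  then have w: "norm ?w <= 2 / B * \<bar>d \<bullet> F x1 - d \<bullet> F x2\<bar>" using B(1) by (simp add: inner_diff_right)
  have 1: "B1 * norm ?w <= (B1 + B2) * (2 / B * \<bar>d \<bullet> F x1 - d \<bullet> F x2\<bar>)"
   using w U'(4) V'(4) B(1) by (intro mult_mono) auto
  have 2: "B2 * norm ?w <= (B1 + B2) * (2 / B * \<bar>d \<bullet> F x1 - d \<bullet> F x2\<bar>)"
   using w U'(4) V'(4) B(1) by (intro mult_mono) auto
  have eq: "(B1 + B2) * (2 / B * \<bar>d \<bullet> F x1 - d \<bullet> F x2\<bar>) = C * \<bar>d \<bullet> F x1 - d \<bullet> F x2\<bar>" by (simp add: C_def)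
  have "norm (ph x1 - ph x2) <= B1 * norm ?w" by (rule U'(5)[OF h(1,2)])
  moreover have "norm (\<psi> y1 - \<psi> y2) <= B2 * norm ?w" using V'(5)[OF h(3,4)] unfolding h(5,6) .
  ultimately show "norm (ph x1 - ph x2) <= C * \<bar>d \<bullet> F x1 - d \<bullet> F x2\<bar> & norm (\<psi> y1 - \<psi> y2) <= C * \<bar>d \<bullet> F x1 - d \<bullet> F x2\<bar>"
   using 1 2 unfolding eq by linarith
 qed
qed

text \<open>A vector \<open>n\<close> of the set is determined by a point of the double curve and one further parameter: it lies on the line
 given by \<open>solve_two_planes\<close>. The coordinate \<open>\<tau>\<close> along the double curve is only known to have a Lipschitz inverse on some set of
 real numbers, so the parameters \<open>(\<tau>, l)\<close> are placed in a plane of three-dimensional space, and the map to \<open>n\<close> is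
 pointwise Lipschitz there.\<close>

lemma double_planes_negligible:
 assumes cr: "!!x y. x ~= y ==> F x = F y ==> cross3 (normal x) (normal y) ~= 0"
 shows "negligible (\<Union>q\<in>{q. fst q ~= snd q & F (fst q) = F (snd q)}.
  {n. n \<bullet> (F (fst q) - \<omega>) = 1 & cross3 (normal (fst q)) (normal (snd q)) \<bullet> n = 0})" (is "negligible (\<Union>q\<in>?X. ?B q)")
proof (rule negligible_locally)
 fix q assume "q \<in> ?X"
 obtain x y where q: "q = (x, y)" by (rule prod.exhaust)
 have xy: "x ~= y" "F x = F y" using \<open>q \<in> ?X\<close> unfolding q by simp_all
 obtain U ph where c: "(U, ph) \<in> A" "x \<in> U" by (rule chart_at)
 obtain V \<psi> where c': "(V, \<psi>) \<in> A" "y \<in> V" by (rule chart_at)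
 obtain U' V' C d where UV: "open U'" "x \<in> U'" "U' <= U" "open V'" "y \<in> V'" "V' <= V" "C > 0" and
  par: "!!x1 x2 y1 y2. x1 \<in> U' ==> x2 \<in> U' ==> y1 \<in> V' ==> y2 \<in> V' ==> F x1 = F y1 ==> F x2 = F y2 ==>
   norm (ph x1 - ph x2) <= C * \<bar>d \<bullet> F x1 - d \<bullet> F x2\<bar> & norm (\<psi> y1 - \<psi> y2) <= C * \<bar>d \<bullet> F x1 - d \<bullet> F x2\<bar>"
  by (rule double_curve_parameter[OF c c' cr[OF xy]]) (rule that)
 let ?f = "F \<circ> inv_into U ph" and ?M = "chart_normal U ph" and ?N = "chart_normal V \<psi>"
 define P where "P = (%p :: (real^2) \<times> (real^2) \<times> real. ?f (fst p) - \<omega>)"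
 define D where "D = (%p :: (real^2) \<times> (real^2) \<times> real. cross3 (?M (fst p)) (?N (fst (snd p))))"
 define E where "E = (%p. cross3 (P p) (D p))"
 define G where "G = (%p. inverse (E p \<bullet> E p) *\<^sub>R cross3 (D p) (E p) + snd (snd p) *\<^sub>R E p)"
 define R where "R = {r \<in> U' \<times> V'. fst r ~= snd r & F (fst r) = F (snd r)}"
 define \<xi> where "\<xi> = (%\<tau>. SOME r. r \<in> R & d \<bullet> F (fst r) = \<tau>)"
 define H where "H = (%v :: real \<times> real \<times> real. (ph (fst (\<xi> (fst v))), \<psi> (snd (\<xi> (fst v))), fst (snd v)))"
 define T where "T = {v :: real \<times> real \<times> real. snd (snd v) = 0 & fst v \<in> (%r. d \<bullet> F (fst r)) ` R & E (H v) ~= 0}"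
 have \<xi>: "\<xi> \<tau> \<in> R" "d \<bullet> F (fst (\<xi> \<tau>)) = \<tau>" if "\<tau> \<in> (%r. d \<bullet> F (fst r)) ` R" for \<tau>
 proof -
  have "\<exists>r. r \<in> R & d \<bullet> F (fst r) = \<tau>" using that by blast
  from someI_ex[OF this] show "\<xi> \<tau> \<in> R" "d \<bullet> F (fst (\<xi> \<tau>)) = \<tau>" unfolding \<xi>_def by blast+
 qed
 have parR: "norm (ph (fst r) - ph (fst r')) <= C * \<bar>d \<bullet> F (fst r) - d \<bullet> F (fst r')\<bar>"
  "norm (\<psi> (snd r) - \<psi> (snd r')) <= C * \<bar>d \<bullet> F (fst r) - d \<bullet> F (fst r')\<bar>" if "r \<in> R" "r' \<in> R" for r r'
  using par[of "fst r" "fst r'" "snd r" "snd r'"] that by (auto simp: R_def)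
 have negT: "negligible T"
 proof (rule negligible_subset)
  show "negligible {v :: real \<times> real \<times> real. (0, 0, 1) \<bullet> v = 0}" by (rule negligible_hyperplane) (simp add: zero_prod_def)
  show "T <= {v. (0, 0, 1) \<bullet> v = 0}" by (auto simp: T_def inner_prod_def)
 qed
 have lip: "norm (H v - H v0) <= (2 * C + 1) * norm (v - v0)" if "v \<in> T" "v0 \<in> T" for v v0
 proof -
  have r: "\<xi> (fst v) \<in> R" "d \<bullet> F (fst (\<xi> (fst v))) = fst v" "\<xi> (fst v0) \<in> R" "d \<bullet> F (fst (\<xi> (fst v0))) = fst v0"
   using \<xi> that by (simp_all add: T_def)
  have n1: "\<bar>fst v - fst v0\<bar> <= norm (v - v0)" using norm_fst_le[of "fst (v - v0)" "snd (v - v0)"] unfolding prod.collapse by (simp add: fst_diff)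
  have n2: "\<bar>fst (snd v) - fst (snd v0)\<bar> <= norm (v - v0)"
   using norm_fst_le[of "fst (snd (v - v0))" "snd (snd (v - v0))"] norm_snd_le[of "snd (v - v0)" "fst (v - v0)"]
   unfolding prod.collapse by (simp add: fst_diff snd_diff)
  have Cn: "C * \<bar>fst v - fst v0\<bar> <= C * norm (v - v0)" using n1 UV(7) by (intro mult_left_mono) auto
  have a: "norm (ph (fst (\<xi> (fst v))) - ph (fst (\<xi> (fst v0)))) <= C * norm (v - v0)"
   using parR(1)[OF r(1,3)] Cn unfolding r(2,4) by linarith
  have b: "norm (\<psi> (snd (\<xi> (fst v))) - \<psi> (snd (\<xi> (fst v0)))) <= C * norm (v - v0)"
   using parR(2)[OF r(1,3)] Cn unfolding r(2,4) by linarith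
  have "norm (H v - H v0) <= norm (ph (fst (\<xi> (fst v))) - ph (fst (\<xi> (fst v0)))) +
   (norm (\<psi> (snd (\<xi> (fst v))) - \<psi> (snd (\<xi> (fst v0)))) + norm (fst (snd v) - fst (snd v0)))"
   unfolding H_def by (simp add: norm_Pair_le[THEN order_trans] norm_Pair_le)
  then show ?thesis using a b n2 by (simp add: algebra_simps)
 qed
 have diffG: "G differentiable (at (H v))" if v: "v \<in> T" for v
 proof -
  have r: "\<xi> (fst v) \<in> R" using \<xi> v by (simp add: T_def)
  have in1: "fst (H v) \<in> ph ` U" "fst (snd (H v)) \<in> \<psi> ` V" using r UV unfolding H_def R_def by auto
  have f1: "(%p :: (real^2) \<times> (real^2) \<times> real. fst p) differentiable (at (H v))"
   by (rule bounded_linear_imp_differentiable[OF bounded_linear_fst])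
  have f2: "(%p :: (real^2) \<times> (real^2) \<times> real. fst (snd p)) differentiable (at (H v))"
   by (rule bounded_linear_imp_differentiable[OF bounded_linear_compose[OF bounded_linear_fst bounded_linear_snd]])
  have f3: "(%p :: (real^2) \<times> (real^2) \<times> real. snd (snd p)) differentiable (at (H v))"
   by (rule bounded_linear_imp_differentiable[OF bounded_linear_compose[OF bounded_linear_snd bounded_linear_snd]])
  have dM: "(%p :: (real^2) \<times> (real^2) \<times> real. ?M (fst p)) differentiable (at (H v))"
   using differentiable_chain_at[OF f1 chart_normal_differentiable[OF c(1) in1(1)]] unfolding o_def .
  have dN: "(%p :: (real^2) \<times> (real^2) \<times> real. ?N (fst (snd p))) differentiable (at (H v))"
   using differentiable_chain_at[OF f2 chart_normal_differentiable[OF c'(1) in1(2)]] unfolding o_def .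
  have df: "(%p :: (real^2) \<times> (real^2) \<times> real. ?f (fst p)) differentiable (at (H v))"
   using differentiable_chain_at[OF f1 chart_differentiable[OF c(1) in1(1)]] unfolding o_def .
  have dP: "P differentiable (at (H v))" unfolding P_def by (intro differentiable_diff df differentiable_const)
  have dD: "D differentiable (at (H v))" unfolding D_def by (intro differentiable_cross3 dM dN)
  have dE: "E differentiable (at (H v))" unfolding E_def by (intro differentiable_cross3 dP dD)
  have nz: "E (H v) \<bullet> E (H v) ~= 0" using v by (simp add: T_def)
  show ?thesis unfolding G_def
   by (intro differentiable_add differentiable_bilinear[OF bounded_bilinear_scaleR] differentiable_inverse
    differentiable_bilinear[OF bounded_bilinear_inner] differentiable_cross3 dD dE f3 nz)
 qed
 have neg: "negligible ((%v. G (H v)) ` T)"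
 proof (rule negligible_locally_Lipschitz_image[OF _ negT])
  show "DIM(real \<times> real \<times> real) <= DIM(real^3)" by simp
  fix v0 assume v0: "v0 \<in> T"
  obtain dl K where dl: "dl > 0" "K \<ge> 0" "!!p. norm (p - H v0) < dl ==> norm (G p - G (H v0)) <= K * norm (p - H v0)"
   by (rule differentiable_pointwise_Lipschitz[OF diffG[OF v0]]) (rule that)
  let ?L = "2 * C + 1"
  have L: "?L > 0" using UV(7) by simp
  show "\<exists>W B. open W & v0 \<in> W & (\<forall>v\<in>T Int W. norm (G (H v) - G (H v0)) <= B * norm (v - v0))"
  proof (intro exI conjI ballI)
   show "open (ball v0 (dl / ?L))" by simp
   show "v0 \<in> ball v0 (dl / ?L)" using dl(1) L by simp
   fix v assume v: "v \<in> T Int ball v0 (dl / ?L)"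
   have l: "norm (H v - H v0) <= ?L * norm (v - v0)" using lip v v0 by blast
   have "norm (v - v0) < dl / ?L" using v by (simp add: dist_norm norm_minus_commute)
   then have "?L * norm (v - v0) < dl" using L by (simp add: pos_less_divide_eq mult.commute)
   with l have "norm (H v - H v0) < dl" by linarith
   then have "norm (G (H v) - G (H v0)) <= K * norm (H v - H v0)" by (rule dl(3))
   also have "\<dots> <= K * (?L * norm (v - v0))" using l dl(2) by (rule mult_left_mono)
   finally show "norm (G (H v) - G (H v0)) <= (K * ?L) * norm (v - v0)" by (simp only: mult.assoc)
  qed
 qed
 have "(\<Union>r\<in>(U' \<times> V') Int ?X. ?B r) <= (%v. G (H v)) ` T"
 proof
  fix n assume "n \<in> (\<Union>r\<in>(U' \<times> V') Int ?X. ?B r)"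
  then obtain r where r: "r \<in> R" and n: "n \<bullet> (F (fst r) - \<omega>) = 1" "cross3 (normal (fst r)) (normal (snd r)) \<bullet> n = 0"
   unfolding R_def by blast
  have rU: "fst r \<in> U" "snd r \<in> V" and rx: "fst r ~= snd r" "F (fst r) = F (snd r)" using r UV unfolding R_def by auto
  let ?\<tau> = "d \<bullet> F (fst r)"
  have t: "?\<tau> \<in> (%r. d \<bullet> F (fst r)) ` R" using r by blast
  have "norm (ph (fst r) - ph (fst (\<xi> ?\<tau>))) <= 0" "norm (\<psi> (snd r) - \<psi> (snd (\<xi> ?\<tau>))) <= 0"
   using parR[OF r \<xi>(1)[OF t]] unfolding \<xi>(2)[OF t] by simp_all
  then have same: "ph (fst (\<xi> ?\<tau>)) = ph (fst r)" "\<psi> (snd (\<xi> ?\<tau>)) = \<psi> (snd r)" by simp_all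
  have Hv: "H (?\<tau>, l, 0) = (ph (fst r), \<psi> (snd r), l)" for l by (simp add: H_def same)
  obtain s where s: "s ~= 0" "normal (fst r) = s *\<^sub>R ?M (ph (fst r))" using normal_chart_normal[OF c(1) rU(1)] by blast
  obtain t where t': "t ~= 0" "normal (snd r) = t *\<^sub>R ?N (\<psi> (snd r))" using normal_chart_normal[OF c'(1) rU(2)] by blast
  let ?d = "cross3 (?M (ph (fst r))) (?N (\<psi> (snd r)))"
  have dd: "cross3 (normal (fst r)) (normal (snd r)) = (s * t) *\<^sub>R ?d" unfolding s(2) t'(2) by (simp add: cross_mult_left cross_mult_right)
  have d0: "?d ~= 0" using cr[OF rx] unfolding dd by auto
  have nd: "n \<bullet> ?d = 0" using n(2) s(1) t'(1) unfolding dd by (simp add: inner_commute)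
  note sol = solve_two_planes[OF n(1) nd d0]
  from sol(2) obtain l where l: "n = inverse (cross3 (F (fst r) - \<omega>) ?d \<bullet> cross3 (F (fst r) - \<omega>) ?d) *\<^sub>R cross3 ?d (cross3 (F (fst r) - \<omega>) ?d)
   + l *\<^sub>R cross3 (F (fst r) - \<omega>) ?d" by blast
  have fr: "?f (ph (fst r)) = F (fst r)" by (rule chart_position[OF c(1) rU(1)])
  have PDE: "P (H (?\<tau>, l, 0)) = F (fst r) - \<omega>" "D (H (?\<tau>, l, 0)) = ?d" unfolding Hv P_def D_def fst_conv snd_conv fr by (rule refl)+
  then have E: "E (H (?\<tau>, l, 0)) = cross3 (F (fst r) - \<omega>) ?d" unfolding E_def by simp
  have "n = G (H (?\<tau>, l, 0))" unfolding G_def E PDE unfolding Hv snd_conv by (rule l)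
  moreover have "(?\<tau>, l, 0) \<in> T" unfolding T_def mem_Collect_eq E using t sol(1) by simp
  ultimately show "n \<in> (%v. G (H v)) ` T" by (rule image_eqI)
 qed
 then have "negligible (\<Union>r\<in>(U' \<times> V') Int ?X. ?B r)" by (rule negligible_subset[OF neg])
 moreover have "open (U' \<times> V')" "q \<in> U' \<times> V'" using UV unfolding q by (auto intro: open_Times)
 ultimately show "\<exists>W. open W & q \<in> W & negligible (\<Union>r\<in>W Int ?X. ?B r)" by blast
qed

text \<open>Triple points are isolated: a secant between two of them would be nearly orthogonal to three independent normals.
 Each triple point excludes a plane of vectors \<open>n\<close>.\<close>

lemma triple_planes_negligible:
 assumes cr: "!!x y z. x ~= y ==> x ~= z ==> y ~= z ==> F x = F y ==> F y = F z ==> cross3 (normal x) (normal y) \<bullet> normal z ~= 0"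
 shows "negligible (\<Union>q\<in>{(x, y, z). x ~= y & x ~= z & y ~= z & F x = F y & F y = F z}. {n. n \<bullet> (F (fst q) - \<omega>) = 1})"
  (is "negligible (\<Union>q\<in>?X. ?B q)")
proof (rule negligible_locally)
 fix q assume q: "q \<in> ?X"
 obtain x y z where xyz: "q = (x, y, z)" by (metis prod_cases3)
 have h: "x ~= y" "x ~= z" "y ~= z" "F x = F y" "F y = F z" using q unfolding xyz by auto
 obtain eps where eps: "eps > 0"
  "!!w. \<bar>normal x \<bullet> w\<bar> <= eps * norm w ==> \<bar>normal y \<bullet> w\<bar> <= eps * norm w ==> \<bar>normal z \<bullet> w\<bar> <= eps * norm w ==> w = 0"
  by (rule indep3_nearly_orthogonal[OF triple_nonzero_indep3[OF cr[OF h]]]) (rule that)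
 obtain U where U: "open U" "x \<in> U" "inj_on F U" "\<forall>p\<in>U. \<forall>q\<in>U. \<bar>normal x \<bullet> (F p - F q)\<bar> <= eps * norm (F p - F q)"
  using immersion_secant[OF eps(1), of x] by blast
 obtain V where V: "open V" "y \<in> V" "inj_on F V" "\<forall>p\<in>V. \<forall>q\<in>V. \<bar>normal y \<bullet> (F p - F q)\<bar> <= eps * norm (F p - F q)"
  using immersion_secant[OF eps(1), of y] by blast
 obtain W where W: "open W" "z \<in> W" "inj_on F W" "\<forall>p\<in>W. \<forall>q\<in>W. \<bar>normal z \<bullet> (F p - F q)\<bar> <= eps * norm (F p - F q)"
  using immersion_secant[OF eps(1), of z] by blast
 have one: "F (fst r) = F x" if r: "r \<in> (U \<times> V \<times> W) Int ?X" for r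
 proof -
  obtain x' y' z' where r': "r = (x', y', z')" by (metis prod_cases3)
  have h': "x' \<in> U" "y' \<in> V" "z' \<in> W" "F x' = F y'" "F y' = F z'" using r unfolding r' by auto
  have a: "\<bar>normal x \<bullet> (F x' - F x)\<bar> <= eps * norm (F x' - F x)" using U(2,4) h'(1) by blast
  have b: "\<bar>normal y \<bullet> (F x' - F x)\<bar> <= eps * norm (F x' - F x)" unfolding h(4) h'(4) using V(2,4) h'(2) by blast
  have d: "\<bar>normal z \<bullet> (F x' - F x)\<bar> <= eps * norm (F x' - F x)" unfolding h(4,5) h'(4,5) using W(2,4) h'(3) by blast
  from eps(2)[OF a b d] show ?thesis unfolding r' by simp
 qed
 have "negligible {n. (F x - \<omega>) \<bullet> n = 1}" by (rule negligible_hyperplane) simp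
 then have "negligible (\<Union>r\<in>(U \<times> V \<times> W) Int ?X. ?B r)"
  by (rule negligible_subset) (use one in \<open>auto simp: inner_commute\<close>)
 moreover have "open (U \<times> V \<times> W)" using U V W by (intro open_Times)
 moreover have "q \<in> U \<times> V \<times> W" using U V W unfolding xyz by blast
 ultimately show "\<exists>W. open W & q \<in> W & negligible (\<Union>r\<in>W Int ?X. ?B r)" by blast
qed

lemma generic_dense:
 assumes c: "normal_crossings" and r: "r > 0"
 obtains n where "norm (n - m) < r" "n ~= 0" "generic \<omega> n"
proof -
 have c2: "cross3 (normal x) (normal y) ~= 0" if "x ~= y" "F x = F y" for x y
  using c[unfolded normal_crossings_def, THEN conjunct1, rule_format, of x y] that by simp
 have c3: "cross3 (normal x) (normal y) \<bullet> normal z ~= 0" if "x ~= y" "x ~= z" "y ~= z" "F x = F y" "F y = F z" for x y z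
  using c[unfolded normal_crossings_def, THEN conjunct2, THEN conjunct1, rule_format, of x y z] that by simp
 have neg: "negligible ((\<Union>x. {n. n \<bullet> (F x - \<omega>) = 1 & cross3 (normal x) n = 0}) \<union>
  (\<Union>q\<in>{q. fst q ~= snd q & F (fst q) = F (snd q)}. {n. n \<bullet> (F (fst q) - \<omega>) = 1 & cross3 (normal (fst q)) (normal (snd q)) \<bullet> n = 0}) \<union>
  (\<Union>q\<in>{(x, y, z). x ~= y & x ~= z & y ~= z & F x = F y & F y = F z}. {n. n \<bullet> (F (fst q) - \<omega>) = 1}) \<union> {0})" (is "negligible ?N")
  by (intro negligible_Un tangent_planes_negligible double_planes_negligible triple_planes_negligible c2 c3 negligible_sing)
 have "\<not> ball m r <= ?N"
  using open_not_negligible[OF open_ball, of m r] negligible_subset[OF neg] r by auto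
 then obtain n where n: "n \<in> ball m r" "n \<notin> ?N" by blast
 show thesis
 proof (rule that[of n])
  show "norm (n - m) < r" using n(1) by (simp add: dist_norm norm_minus_commute)
  show "n ~= 0" using n(2) by blast
  show "generic \<omega> n" unfolding generic_def
  proof (intro conjI allI impI; (elim conjE)?)
   fix x assume "n \<bullet> (F x - \<omega>) = 1"
   then show "cross3 (normal x) n ~= 0" using n(2) by blast
  next
   fix x y assume h: "x ~= y" "F x = F y" "n \<bullet> (F x - \<omega>) = 1"
   show "cross3 (normal x) (normal y) \<bullet> n ~= 0"
   proof
    assume "cross3 (normal x) (normal y) \<bullet> n = 0"
    then have "n \<in> (\<Union>q\<in>{q. fst q ~= snd q & F (fst q) = F (snd q)}. {n. n \<bullet> (F (fst q) - \<omega>) = 1 & cross3 (normal (fst q)) (normal (snd q)) \<bullet> n = 0})"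
     using h by (intro UN_I[of "(x, y)"]) auto
    then show False using n(2) by blast
   qed
  next
   fix x y z assume h: "distinct [x, y, z]" "F x = F y" "F y = F z"
   show "n \<bullet> (F x - \<omega>) ~= 1"
   proof
    assume "n \<bullet> (F x - \<omega>) = 1"
    then have "n \<in> (\<Union>q\<in>{(x, y, z). x ~= y & x ~= z & y ~= z & F x = F y & F y = F z}. {n. n \<bullet> (F (fst q) - \<omega>) = 1})"
     using h by (intro UN_I[of "(x, y, z)"]) auto
    then show False using n(2) by blast
   qed
  qed
 qed
qed

end

section \<open>The induced distance\<close>

text \<open>Piecewise regular curves as an inductive predicate, in which the pieces are added at the end one at a time.\<close>

inductive regular_path :: "'m::topological_space chart set => (real => 'm) => real => real => bool" for A \<gamma> where
 piece: "a < b ==> C1_curve A a b \<gamma> ==> regular_path A \<gamma> a b"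
| append: "regular_path A \<gamma> a b ==> b < c ==> C1_curve A b c \<gamma> ==> regular_path A \<gamma> a c"

lemma regular_path_less: "regular_path A \<gamma> a b ==> a < b"
 by (induction rule: regular_path.induct) auto

lemma regular_path_concat:
 assumes "regular_path A \<gamma> b c" "regular_path A \<gamma> a b"
 shows "regular_path A \<gamma> a c"
 using assms
proof (induction rule: regular_path.induct)
 case (piece b c) show ?case by (rule regular_path.append[OF piece(3,1,2)])
next
 case (append b c d) show ?case by (rule regular_path.append[OF append(4)[OF append(5)] append(2,3)])
qed

lemma piecewise_C1_curve_regular_path: "piecewise_C1_curve A \<gamma> \<longleftrightarrow> regular_path A \<gamma> 0 1"
proof
 assume "piecewise_C1_curve A \<gamma>"
 then obtain n p where p: "p (0::nat) = 0" "p n = 1" "\<forall>i<n. p i < p (Suc i) & C1_curve A (p i) (p (Suc i)) \<gamma>"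
  unfolding piecewise_C1_curve_def by blast
 have "i <= n ==> i = 0 \<or> regular_path A \<gamma> 0 (p i)" for i
 proof (induction i)
  case (Suc i)
  then have s: "p i < p (Suc i)" "C1_curve A (p i) (p (Suc i)) \<gamma>" using p(3) by simp_all
  have "i = 0 \<or> regular_path A \<gamma> 0 (p i)" using Suc by simp
  then show ?case
  proof
   assume "i = 0"
   then show ?thesis using regular_path.piece[OF s] p(1) by simp
  next
   assume "regular_path A \<gamma> 0 (p i)"
   from regular_path.append[OF this s] show ?thesis by blast
  qed
 qed simp
 from this[of n] show "regular_path A \<gamma> 0 1" using p(1,2) by (cases "n = 0") simp_all
next
 have "\<exists>(n::nat) p. p 0 = a & p n = b & (\<forall>i<n. p i < p (Suc i) & C1_curve A (p i) (p (Suc i)) \<gamma>)"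
  if "regular_path A \<gamma> a b" for a b
  using that
 proof (induction rule: regular_path.induct)
  case (piece a b)
  then show ?case by (intro exI[of _ 1] exI[of _ "%i. if i = 0 then a else b"]) simp
 next
  case (append a b c)
  then obtain n p where p: "p (0::nat) = a" "p n = b" "\<forall>i<n. p i < p (Suc i) & C1_curve A (p i) (p (Suc i)) \<gamma>" by blast
  have "\<forall>i<Suc n. (p(Suc n := c)) i < (p(Suc n := c)) (Suc i) & C1_curve A ((p(Suc n := c)) i) ((p(Suc n := c)) (Suc i)) \<gamma>"
   using p append(2,3) by (auto simp: less_Suc_eq)
  then show ?case using p(1) by (intro exI[of _ "Suc n"] exI[of _ "p(Suc n := c)"]) simp
 qed
 from this[of 0 1] show "regular_path A \<gamma> 0 1 ==> piecewise_C1_curve A \<gamma>" unfolding piecewise_C1_curve_def by blast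
qed

lemma C1_curve_affine:
 assumes \<gamma>: "C1_curve A a b \<gamma>" and m: "!!t. t \<in> {u..v} ==> k * t + c \<in> {a..b}"
  and dl: "!!t. t \<in> {u..v} ==> dl t = \<gamma> (k * t + c)"
 shows "C1_curve A u v dl"
 unfolding C1_curve_def
proof (intro conjI ballI)
 let ?m = "%t. k * t + c"
 have cont\<gamma>: "continuous_on {a..b} \<gamma>" using \<gamma> by (simp add: C1_curve_def)
 have sub: "?m ` {u..v} <= {a..b}" using m by blast
 have "continuous_on {u..v} (%t. \<gamma> (?m t))" by (rule continuous_on_compose2[OF cont\<gamma> _ sub]) (intro continuous_intros)
 then show "continuous_on {u..v} dl" by (rule continuous_on_eq) (simp add: dl)
 fix ch assume ch: "ch \<in> A"
 obtain U ph where U: "ch = (U, ph)" by (cases ch)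
 obtain D where D: "continuous_on {t \<in> {a..b}. \<gamma> t \<in> U} D"
  "\<forall>t\<in>{a..b}. \<gamma> t \<in> U --> (ph \<circ> \<gamma> has_vector_derivative D t) (at t within {a..b})"
  using \<gamma> ch unfolding C1_curve_def U by blast
 have "\<exists>D. continuous_on {t \<in> {u..v}. dl t \<in> U} D &
   (\<forall>t\<in>{u..v}. dl t \<in> U --> (ph \<circ> dl has_vector_derivative D t) (at t within {u..v}))"
 proof (intro exI[of _ "%t. k *\<^sub>R D (?m t)"] conjI ballI impI)
  have "continuous_on {t \<in> {u..v}. dl t \<in> U} (%t. D (?m t))"
   by (rule continuous_on_compose2[OF D(1)]) (use m dl in \<open>auto intro!: continuous_intros\<close>)
  then show "continuous_on {t \<in> {u..v}. dl t \<in> U} (%t. k *\<^sub>R D (?m t))" by (intro continuous_intros)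
  fix t assume t: "t \<in> {u..v}" "dl t \<in> U"
  have "(ph \<circ> \<gamma> has_vector_derivative D (?m t)) (at (?m t) within {a..b})"
   using D(2) m[OF t(1)] t(2) dl[OF t(1)] by simp
  then have g: "(ph \<circ> \<gamma> has_vector_derivative D (?m t)) (at (?m t) within ?m ` {u..v})"
   by (rule has_vector_derivative_within_subset) (rule sub)
  have "(?m has_vector_derivative k) (at t within {u..v})" by (auto intro!: derivative_eq_intros)
  from vector_diff_chain_within[OF this g]
  have "((ph \<circ> \<gamma>) \<circ> ?m has_vector_derivative k *\<^sub>R D (?m t)) (at t within {u..v})" .
  then show "(ph \<circ> dl has_vector_derivative k *\<^sub>R D (?m t)) (at t within {u..v})"
   by (rule has_vector_derivative_transform_within[where d = 1]) (use t dl in simp_all)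
 qed
 then show "case ch of (U, ph) => \<exists>D. continuous_on {t \<in> {u..v}. dl t \<in> U} D &
   (\<forall>t\<in>{u..v}. dl t \<in> U --> (ph \<circ> dl has_vector_derivative D t) (at t within {u..v}))" unfolding U by simp
qed

lemma regular_path_cong:
 assumes "regular_path A \<gamma> a b" "!!t. t \<in> {a..b} ==> dl t = \<gamma> t"
 shows "regular_path A dl a b"
 using assms
proof (induction rule: regular_path.induct)
 case (piece a b)
 have "C1_curve A a b dl" by (rule C1_curve_affine[OF piece(2), where k = 1 and c = 0]) (use piece(3) in simp_all)
 then show ?case by (rule regular_path.piece[OF piece(1)])
next
 case (append a b c)
 have ab: "a < b" by (rule regular_path_less[OF append(1)])
 have "C1_curve A b c dl" by (rule C1_curve_affine[OF append(3), where k = 1 and c = 0]) (use append(5) ab in simp_all)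
 moreover have "regular_path A dl a b" by (rule append(4)) (use append(2,5) in simp)
 ultimately show ?case by (intro regular_path.append[OF _ append(2)])
qed

lemma regular_path_affine:
 assumes "regular_path A \<gamma> a b" "k > 0"
 shows "regular_path A (%t. \<gamma> (k * t + c)) ((a - c) / k) ((b - c) / k)"
 using assms(1)
proof (induction rule: regular_path.induct)
 case (piece a b)
 show ?case
 proof (rule regular_path.piece)
  show "(a - c) / k < (b - c) / k" using piece(1) assms(2) by (simp add: divide_strict_right_mono)
  show "C1_curve A ((a - c) / k) ((b - c) / k) (%t. \<gamma> (k * t + c))"
   by (rule C1_curve_affine[OF piece(2) _ refl]) (use assms(2) in \<open>simp add: field_simps\<close>)
 qed
next
 case (append a b d)
 show ?case
 proof (rule regular_path.append[OF append(4)])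
  show "(b - c) / k < (d - c) / k" using append(2) assms(2) by (simp add: divide_strict_right_mono)
  show "C1_curve A ((b - c) / k) ((d - c) / k) (%t. \<gamma> (k * t + c))"
   by (rule C1_curve_affine[OF append(3) _ refl]) (use assms(2) in \<open>simp add: field_simps\<close>)
 qed
qed

lemma regular_path_reverse:
 assumes "regular_path A \<gamma> a b"
 shows "regular_path A (%t. \<gamma> (- 1 * t + 1)) (1 - b) (1 - a)"
 using assms
proof (induction rule: regular_path.induct)
 case (piece a b)
 show ?case
  by (rule regular_path.piece) (use piece(1) in simp, rule C1_curve_affine[OF piece(2) _ refl], simp)
next
 case (append a b d)
 have "regular_path A (%t. \<gamma> (- 1 * t + 1)) (1 - d) (1 - b)"
  by (rule regular_path.piece) (use append(2) in simp, rule C1_curve_affine[OF append(3) _ refl], simp)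
 then show ?case by (rule regular_path_concat[OF append(4)])
qed

definition join :: "(real => 'a) => (real => 'a) => real => 'a" where
 "join \<gamma> dl t = (if t <= 1 / 2 then \<gamma> (2 * t + 0) else dl (2 * t + - 1))"

lemma regular_path_join:
 assumes "regular_path A \<gamma> 0 1" "regular_path A dl 0 1" "\<gamma> 1 = dl 0"
 shows "regular_path A (join \<gamma> dl) 0 1"
proof -
 have "regular_path A (join \<gamma> dl) ((0 - 0) / 2) ((1 - 0) / 2)"
  by (rule regular_path_cong[OF regular_path_affine[OF assms(1)]]) (auto simp: join_def)
 moreover have "regular_path A (join \<gamma> dl) ((0 - - 1) / 2) ((1 - - 1) / 2)"
 proof (rule regular_path_cong[OF regular_path_affine[OF assms(2)]])
  fix t :: real assume "t \<in> {(0 - - 1) / 2..(1 - - 1) / 2}"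
  then have ge: "t \<ge> 1 / 2" by simp
  show "join \<gamma> dl t = dl (2 * t + - 1)"
  proof (cases "t <= 1 / 2")
   case True
   with ge have t: "t = 1 / 2" by simp
   show ?thesis unfolding t by (simp add: join_def assms(3))
  qed (simp add: join_def)
 qed simp
 ultimately show ?thesis using regular_path_concat by fastforce
qed

lemma vector_derivative_cong_open:
 assumes "open S" "t \<in> S" "!!s. s \<in> S ==> f s = g s"
 shows "vector_derivative f (at t) = vector_derivative g (at t)"
 by (rule vector_derivative_cong_eq) (use assms eventually_nhds in blast)+

context surface_immersion begin

abbreviation speed :: "(real => 'm) => real => real" where
 "speed \<gamma> t \<equiv> norm (vector_derivative (F \<circ> \<gamma>) (at t))"

text \<open>The derivative is computed in a chart around each parameter. It does not depend on the chart, so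
 the local expressions give one continuous function.\<close>

lemma C1_curve_image:
 assumes \<gamma>: "C1_curve A a b \<gamma>" and ab: "a < b"
 obtains E where "continuous_on {a..b} E" "!!t. t \<in> {a..b} ==> (F \<circ> \<gamma> has_vector_derivative E t) (at t within {a..b})"
proof -
 define E where "E = (%t. vector_derivative (F \<circ> \<gamma>) (at t within {a..b}))"
 have cont: "continuous_on {a..b} \<gamma>" using \<gamma> by (simp add: C1_curve_def)
 have main: "(F \<circ> \<gamma> has_vector_derivative E t) (at t within {a..b}) & continuous (at t within {a..b}) E" if t: "t \<in> {a..b}" for t
 proof -
  obtain U ph where c: "(U, ph) \<in> A" "\<gamma> t \<in> U" by (rule chart_at)
  note cU = chart_coordinates[OF charts[OF c(1)]]
  let ?f = "F \<circ> inv_into U ph" and ?L = "%z. frechet_derivative (F \<circ> inv_into U ph) (at z)"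
  obtain D where D: "continuous_on {t \<in> {a..b}. \<gamma> t \<in> U} D"
   "\<forall>t\<in>{a..b}. \<gamma> t \<in> U --> (ph \<circ> \<gamma> has_vector_derivative D t) (at t within {a..b})"
   using \<gamma> c(1) unfolding C1_curve_def by blast
  obtain T where T: "open T" "T Int {a..b} = \<gamma> -` U Int {a..b}"
   using cont cU(1) unfolding continuous_on_open_invariant by blast
  have hd: "(F \<circ> \<gamma> has_vector_derivative ?L (ph (\<gamma> s)) (D s)) (at s within {a..b})" if s: "s \<in> {a..b}" "\<gamma> s \<in> U" for s
  proof -
   have "(?f has_derivative ?L (ph (\<gamma> s))) (at ((ph \<circ> \<gamma>) s) within (ph \<circ> \<gamma>) ` {a..b})"
    using chart_derivative(1)[OF c(1), of "ph (\<gamma> s)"] s(2) by (simp add: has_derivative_at_withinI)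
   from vector_derivative_diff_chain_within[OF D(2)[rule_format, OF s] this]
   have h: "(?f \<circ> (ph \<circ> \<gamma>) has_vector_derivative ?L (ph (\<gamma> s)) (D s)) (at s within {a..b})" .
   have "s \<in> T" using T(2) s by blast
   then obtain d where d: "d > 0" "ball s d <= T" using T(1) open_contains_ball by blast
   show ?thesis
   proof (rule has_vector_derivative_transform_within[OF h d(1) s(1)])
    fix s' assume "s' \<in> {a..b}" "dist s' s < d"
    then have "s' \<in> T Int {a..b}" using d(2) by (auto simp: dist_commute)
    then have "\<gamma> s' \<in> U" unfolding T(2) by simp
    then show "(?f \<circ> (ph \<circ> \<gamma>)) s' = (F \<circ> \<gamma>) s'" using chart_position[OF c(1), of "\<gamma> s'"] by simp
   qed
  qed
  have Eq: "E s = ?L (ph (\<gamma> s)) (D s)" if s: "s \<in> {a..b}" "\<gamma> s \<in> U" for s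
   unfolding E_def by (rule vector_derivative_within_closed_interval[OF ab s(1) hd[OF s]])
  have lin: "linear (?L (ph (\<gamma> s)))" if "\<gamma> s \<in> U" for s
   using chart_derivative(1)[OF c(1), of "ph (\<gamma> s)"] that has_derivative_linear by blast
  have exp: "?L (ph (\<gamma> s)) w = w $ 1 *\<^sub>R ?L (ph (\<gamma> s)) (axis 1 1) + w $ 2 *\<^sub>R ?L (ph (\<gamma> s)) (axis 2 1)" if "\<gamma> s \<in> U" for s w
  proof -
   have "?L (ph (\<gamma> s)) w = ?L (ph (\<gamma> s)) (w $ 1 *\<^sub>R axis 1 1 + w $ 2 *\<^sub>R axis 2 1)" by (rule arg_cong[OF real2_basis])
   then show ?thesis unfolding linear_add[OF lin[OF that]] linear_scale[OF lin[OF that]] .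
  qed
  let ?S = "{s \<in> {a..b}. \<gamma> s \<in> U}"
  have cph: "continuous_on ?S (%s. ph (\<gamma> s))"
   by (rule continuous_on_compose2[of U ph]) (use cU(3) cont in \<open>auto simp: homeomorphism_def intro: continuous_on_subset\<close>)
  have cL: "continuous_on ?S (%s. ?L (ph (\<gamma> s)) v)" for v
   by (rule continuous_on_compose2[OF chart_derivative(3)[OF c(1), of "ph (\<gamma> t)"] cph]) (use c(2) in auto)
  have cD: "continuous_on ?S (%s. D s $ i)" for i
   by (intro continuous_intros D(1))
  have "continuous_on ?S (%s. D s $ 1 *\<^sub>R ?L (ph (\<gamma> s)) (axis 1 1) + D s $ 2 *\<^sub>R ?L (ph (\<gamma> s)) (axis 2 1))"
   by (intro continuous_on_add continuous_on_scaleR cL cD)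
  then have "continuous_on ?S E"
  proof (rule continuous_on_eq)
   fix s assume "s \<in> ?S"
   then have s: "s \<in> {a..b}" "\<gamma> s \<in> U" by simp_all
   show "D s $ 1 *\<^sub>R ?L (ph (\<gamma> s)) (axis 1 1) + D s $ 2 *\<^sub>R ?L (ph (\<gamma> s)) (axis 2 1) = E s"
    unfolding Eq[OF s] by (rule exp[OF s(2), symmetric])
  qed
  then have "continuous (at t within ?S) E" using t c(2) by (simp add: continuous_on_eq_continuous_within)
  moreover have "at t within ?S = at t within {a..b}"
  proof (rule at_within_nhd[OF _ T(1)])
   have "t \<in> T Int {a..b}" unfolding T(2) using t c(2) by simp
   then show "t \<in> T" by blast
   have "s \<in> ?S \<longleftrightarrow> s \<in> {a..b}" if "s \<in> T" for s
    using that eqset_imp_iff[OF T(2), of s] by auto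
   then show "?S Int T - {t} = {a..b} Int T - {t}" by blast
  qed
  ultimately show ?thesis using hd[OF t c(2)] Eq[OF t c(2)] by simp
 qed
 show thesis
 proof (rule that[of E])
  show "continuous_on {a..b} E" using main by (simp add: continuous_on_eq_continuous_within)
 qed (use main in blast)
qed

lemma regular_path_regular:
 assumes "regular_path A \<gamma> a b"
 shows "continuous_on {a..b} \<gamma> & speed \<gamma> integrable_on {a..b} &
  (\<exists>S. finite S & (\<forall>t\<in>{a..b} - S. (F \<circ> \<gamma>) differentiable (at t)))"
 using assms
proof (induction rule: regular_path.induct)
 have pc: "continuous_on {a..b} \<gamma> & speed \<gamma> integrable_on {a..b} & (\<forall>t\<in>{a..b} - {a, b}. (F \<circ> \<gamma>) differentiable (at t))"
  if ab: "a < b" and g: "C1_curve A a b \<gamma>" for a b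
 proof -
  obtain E where E: "continuous_on {a..b} E" "!!t. t \<in> {a..b} ==> (F \<circ> \<gamma> has_vector_derivative E t) (at t within {a..b})"
   by (rule C1_curve_image[OF g ab]) (rule that)
  have hd: "(F \<circ> \<gamma> has_vector_derivative E t) (at t)" if t: "t \<in> {a..b} - {a, b}" for t
  proof -
   have "at t within {a..b} = at t" by (rule at_within_Icc_at) (use t in auto)
   then show ?thesis using E(2)[of t] t by simp
  qed
  have "(%t. norm (E t)) integrable_on {a..b}" by (intro integrable_continuous_real continuous_on_norm E(1))
  then have "speed \<gamma> integrable_on {a..b}"
   by (rule integrable_spike_finite[of "{a, b}", rotated 2]) (use vector_derivative_at[OF hd] in simp_all)
  moreover have "\<forall>t\<in>{a..b} - {a, b}. (F \<circ> \<gamma>) differentiable (at t)"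
   using hd differentiableI_vector by blast
  moreover have "continuous_on {a..b} \<gamma>" using g by (simp add: C1_curve_def)
  ultimately show ?thesis by blast
 qed
 case (piece a b)
 show ?case
  by (intro conjI exI[of _ "{a, b}"], rule pc[OF piece, THEN conjunct1], rule pc[OF piece, THEN conjunct2, THEN conjunct1], simp,
   rule pc[OF piece, THEN conjunct2, THEN conjunct2])
 case (append a b c)
 note ih = append(4) and p2 = pc[OF append(2,3)]
 have ab: "a < b" by (rule regular_path_less[OF append(1)])
 have un: "{a..c} = {a..b} \<union> {b..c}" using ab append(2) by auto
 have "continuous_on {a..c} \<gamma>" unfolding un by (rule continuous_on_closed_Un) (use ih p2 in auto)
 moreover have "speed \<gamma> integrable_on {a..c}"
  by (rule Henstock_Kurzweil_Integration.integrable_combine[OF less_imp_le[OF ab] less_imp_le[OF append(2)]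
   ih[THEN conjunct2, THEN conjunct1] p2[THEN conjunct2, THEN conjunct1]])
 moreover obtain S where "finite S" "\<forall>t\<in>{a..b} - S. (F \<circ> \<gamma>) differentiable (at t)" using ih by blast
 then have "finite (S \<union> {b, c})" "\<forall>t\<in>{a..c} - (S \<union> {b, c}). (F \<circ> \<gamma>) differentiable (at t)" using p2 unfolding un by auto
 ultimately show ?case by blast
qed

text \<open>The derivative of \<open>F \<circ> \<gamma>\<close> exists outside a finite set and integrates to the displacement.\<close>

lemma path_displacement:
 assumes g: "regular_path A \<gamma> 0 1" and t: "t \<in> {0..1}"
 shows "norm (F (\<gamma> t) - F (\<gamma> 0)) <= induced_length F \<gamma>"
proof -
 obtain S where S: "finite S" "\<forall>t\<in>{0..1} - S. (F \<circ> \<gamma>) differentiable (at t)"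
  and c: "continuous_on {0..1} \<gamma>" and i: "speed \<gamma> integrable_on {0..1}"
  using regular_path_regular[OF g] by blast
 have sub: "{0..t} <= {0..1}" using t by auto
 have "((%s. vector_derivative (F \<circ> \<gamma>) (at s)) has_integral (F \<circ> \<gamma>) t - (F \<circ> \<gamma>) 0) {0..t}"
 proof (rule fundamental_theorem_of_calculus_strong[OF S(1)])
  show "0 <= t" using t by simp
  show "(F \<circ> \<gamma> has_vector_derivative vector_derivative (F \<circ> \<gamma>) (at s)) (at s)" if "s \<in> {0..t} - S" for s
   using S(2) sub that vector_derivative_works by blast
  show "continuous_on {0..t} (F \<circ> \<gamma>)"
   by (rule continuous_on_compose) (use c sub immersion_continuous in \<open>auto intro: continuous_on_subset\<close>)
 qed
 then have I: "(%s. vector_derivative (F \<circ> \<gamma>) (at s)) integrable_on {0..t}"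
  "integral {0..t} (%s. vector_derivative (F \<circ> \<gamma>) (at s)) = F (\<gamma> t) - F (\<gamma> 0)"
  by (auto simp: integrable_on_def integral_unique)
 have it: "speed \<gamma> integrable_on {0..t}" by (rule integrable_on_subinterval[OF i sub])
 have "norm (F (\<gamma> t) - F (\<gamma> 0)) <= integral {0..t} (speed \<gamma>)"
  unfolding I(2)[symmetric] by (rule integral_norm_bound_integral[OF I(1) it]) simp
 also have "\<dots> <= integral {0..1} (speed \<gamma>)" by (rule integral_subset_le[OF sub it i]) simp
 finally show ?thesis by (simp add: induced_length_def)
qed

lemma speed_affine_integral:
 assumes g: "regular_path A \<gamma> a b" and k: "k ~= 0"
  and uv: "(%x. (1 / k) * x + - ((1 / k) * c)) ` {a..b} = {u..v}"
  and dl: "!!t. t \<in> {u<..<v} ==> dl t = \<gamma> (k * t + c)"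
 shows "(speed dl has_integral integral {a..b} (speed \<gamma>)) {u..v}"
proof -
 obtain S where S: "finite S" "\<forall>t\<in>{a..b} - S. (F \<circ> \<gamma>) differentiable (at t)" and i: "speed \<gamma> integrable_on {a..b}"
  using regular_path_regular[OF g] by blast
 let ?m = "%t. k * t + c"
 have "(speed \<gamma> has_integral integral {a..b} (speed \<gamma>)) (cbox a b)" using i by (simp add: integrable_integral)
 from has_integral_affinity[OF this k, of c]
 have "((%t. speed \<gamma> (?m t)) has_integral (1 / \<bar>k\<bar>) * integral {a..b} (speed \<gamma>)) {u..v}" using uv by simp
 from has_integral_mult_right[OF this, of "\<bar>k\<bar>"]
 have "((%t. \<bar>k\<bar> * speed \<gamma> (?m t)) has_integral integral {a..b} (speed \<gamma>)) {u..v}" using k by simp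
 then show ?thesis
 proof (rule has_integral_spike_finite[rotated 2])
  show "finite ({u, v} \<union> (%x. (1 / k) * x + - ((1 / k) * c)) ` S)" using S(1) by simp
  fix t assume t: "t \<in> {u..v} - ({u, v} \<union> (%x. (1 / k) * x + - ((1 / k) * c)) ` S)"
  have inv: "(1 / k) * ?m t + - ((1 / k) * c) = t" using k by (simp add: field_simps)
  have "?m t \<notin> S" using t inv by (metis DiffD2 UnI2 imageI)
  moreover have "?m t \<in> {a..b}"
  proof -
   have "t \<in> (%x. (1 / k) * x + - ((1 / k) * c)) ` {a..b}" using t uv by blast
   then obtain x where x: "x \<in> {a..b}" "t = (1 / k) * x + - ((1 / k) * c)" by blast
   have "?m t = x" unfolding x(2) using k by (simp add: field_simps)
   then show ?thesis using x(1) by simp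
  qed
  ultimately have "(F \<circ> \<gamma> has_vector_derivative vector_derivative (F \<circ> \<gamma>) (at (?m t))) (at (?m t))"
   using S(2) vector_derivative_works by blast
  moreover have "(?m has_vector_derivative k) (at t)" by (auto intro!: derivative_eq_intros)
  ultimately have "((F \<circ> \<gamma>) \<circ> ?m has_vector_derivative k *\<^sub>R vector_derivative (F \<circ> \<gamma>) (at (?m t))) (at t)"
   by (intro vector_diff_chain_at)
  then have "vector_derivative ((F \<circ> \<gamma>) \<circ> ?m) (at t) = k *\<^sub>R vector_derivative (F \<circ> \<gamma>) (at (?m t))" by (rule vector_derivative_at)
  moreover have "vector_derivative (F \<circ> dl) (at t) = vector_derivative ((F \<circ> \<gamma>) \<circ> ?m) (at t)"
   by (rule vector_derivative_cong_open[of "{u<..<v}"]) (use t dl in auto)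
  ultimately show "speed dl t = \<bar>k\<bar> * speed \<gamma> (?m t)" by simp
 qed
qed

lemma length_reverse:
 assumes "regular_path A \<gamma> 0 1"
 shows "induced_length F (%t. \<gamma> (- 1 * t + 1)) = induced_length F \<gamma>"
 using speed_affine_integral[OF assms, of "- 1" 1 0 1 "%t. \<gamma> (- 1 * t + 1)"]
 unfolding induced_length_def by (simp add: image_affinity_atLeastAtMost integral_unique)

lemma length_join:
 assumes "regular_path A \<gamma> 0 1" "regular_path A dl 0 1"
 shows "induced_length F (join \<gamma> dl) = induced_length F \<gamma> + induced_length F dl"
proof -
 have "(speed (join \<gamma> dl) has_integral integral {0..1} (speed \<gamma>)) {0..1 / 2}"
  by (rule speed_affine_integral[OF assms(1), of 2 0]) (simp_all add: image_affinity_atLeastAtMost join_def)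
 moreover have "(speed (join \<gamma> dl) has_integral integral {0..1} (speed dl)) {1 / 2..1}"
 proof (rule speed_affine_integral[OF assms(2), of 2 "- 1"])
  show "(%x. 1 / 2 * x + - (1 / 2 * - 1)) ` {0..1::real} = {1 / 2..1}" by (subst image_affinity_atLeastAtMost) simp
 qed (simp_all add: join_def)
 ultimately have "(speed (join \<gamma> dl) has_integral integral {0..1} (speed \<gamma>) + integral {0..1} (speed dl)) {0..1}"
  by (rule has_integral_combine[rotated 2]) simp_all
 then show ?thesis unfolding induced_length_def by (rule integral_unique)
qed

lemma chart_segment:
 assumes c: "(V, \<psi>) \<in> A" and seg: "!!t. t \<in> {0..1} ==> a + t *\<^sub>R (b - a) \<in> \<psi> ` V"
 shows "C1_curve A 0 1 (%t. inv_into V \<psi> (a + t *\<^sub>R (b - a)))"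
 unfolding C1_curve_def
proof (intro conjI ballI)
 note cV = chart_coordinates[OF charts[OF c]]
 let ?c = "%t. a + t *\<^sub>R (b - a)"
 show "continuous_on {0..1} (%t. inv_into V \<psi> (?c t))"
  by (rule continuous_on_compose2[of "\<psi> ` V" "inv_into V \<psi>"])
   (use cV(3) seg in \<open>auto simp: homeomorphism_def intro!: continuous_intros\<close>)
 fix ch assume ch: "ch \<in> A"
 obtain U ph where U: "ch = (U, ph)" by (cases ch)
 let ?T = "ph \<circ> inv_into V \<psi>"
 have "smoothly_compatible (V, \<psi>) (U, ph)" using atlas c ch unfolding smooth_surface_def U by blast
 then have "Ck_on 1 (\<psi> ` (V Int U)) ?T" unfolding smoothly_compatible_def by blast
 then have T: "\<forall>z\<in>\<psi> ` (V Int U). ?T differentiable (at z)" "\<forall>v. continuous_on (\<psi> ` (V Int U)) (%z. frechet_derivative ?T (at z) v)"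
  unfolding One_nat_def Ck_on.simps by blast+
 have inV: "?c t \<in> \<psi> ` (V Int U)" if "t \<in> {0..1}" "inv_into V \<psi> (?c t) \<in> U" for t
 proof -
  have "inv_into V \<psi> (?c t) \<in> V" "\<psi> (inv_into V \<psi> (?c t)) = ?c t"
   using seg[OF that(1)] by (auto intro: inv_into_into f_inv_into_f)
  then show ?thesis using that(2) by (metis IntI imageI)
 qed
 have "\<exists>D. continuous_on {t \<in> {0..1}. inv_into V \<psi> (?c t) \<in> U} D &
   (\<forall>t\<in>{0..1}. inv_into V \<psi> (?c t) \<in> U --> (ph \<circ> (%t. inv_into V \<psi> (?c t)) has_vector_derivative D t) (at t within {0..1}))"
 proof (intro exI[of _ "%t. frechet_derivative ?T (at (?c t)) (b - a)"] conjI ballI impI)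
  show "continuous_on {t \<in> {0..1}. inv_into V \<psi> (?c t) \<in> U} (%t. frechet_derivative ?T (at (?c t)) (b - a))"
   by (rule continuous_on_compose2[OF T(2)[rule_format]]) (use inV in \<open>auto intro!: continuous_intros simp del: image_Int\<close>)
  fix t :: real assume t: "t \<in> {0..1}" "inv_into V \<psi> (?c t) \<in> U"
  have h1: "(?T has_derivative frechet_derivative ?T (at (?c t))) (at (?c t) within ?c ` {0..1})"
   using T(1) inV[OF t] frechet_derivative_works has_derivative_at_withinI by blast
  have h2: "(?c has_vector_derivative (b - a)) (at t within {0..1})" by (auto intro!: derivative_eq_intros)
  from vector_derivative_diff_chain_within[OF h2 h1]
  have "(?T \<circ> ?c has_vector_derivative frechet_derivative ?T (at (?c t)) (b - a)) (at t within {0..1})" .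
  then show "(ph \<circ> (%t. inv_into V \<psi> (?c t)) has_vector_derivative frechet_derivative ?T (at (?c t)) (b - a)) (at t within {0..1})"
   by (simp add: o_def)
 qed
 then show "case ch of (U, ph) => \<exists>D. continuous_on {t \<in> {0..1}. inv_into V \<psi> (?c t) \<in> U} D &
   (\<forall>t\<in>{0..1}. inv_into V \<psi> (?c t) \<in> U --> (ph \<circ> (%t. inv_into V \<psi> (?c t)) has_vector_derivative D t) (at t within {0..1}))"
  unfolding U by simp
qed

text \<open>A chart ball contains straight segments between any two of its points. So the set of reachable points contains
 every such ball that it meets, and it is open and closed.\<close>

lemma paths_exist:
 assumes conn: "connected (UNIV :: 'm set)"
 obtains \<gamma> where "regular_path A \<gamma> 0 1" "\<gamma> 0 = x" "\<gamma> 1 = y"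
proof -
 define R where "R = {y. \<exists>\<gamma>. regular_path A \<gamma> 0 1 & \<gamma> 0 = x & \<gamma> 1 = y}"
 have const: "\<exists>W. open W & y \<in> W & (W Int R ~= {} --> W <= R) & (y = x --> y \<in> R)" for y
 proof -
  obtain V \<psi> where c: "(V, \<psi>) \<in> A" "y \<in> V" by (rule chart_at)
  note cV = chart_coordinates[OF charts[OF c(1)]]
  obtain d where d: "d > 0" "ball (\<psi> y) d <= \<psi> ` V" using cV(2) c(2) open_contains_ball by blast
  define W where "W = \<psi> -` ball (\<psi> y) d Int V"
  have W: "open W" "y \<in> W" using cV(1,3) c(2) d(1) unfolding W_def
   by (simp_all add: continuous_on_open_vimage homeomorphism_def)
  have seg: "\<exists>\<sigma>. regular_path A \<sigma> 0 1 & \<sigma> 0 = z & \<sigma> 1 = w" if zw: "z \<in> W" "w \<in> W" for z w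
  proof -
   let ?\<sigma> = "%t. inv_into V \<psi> (\<psi> z + t *\<^sub>R (\<psi> w - \<psi> z))"
   have "C1_curve A 0 1 ?\<sigma>"
   proof (rule chart_segment[OF c(1)])
    fix t :: real assume "t \<in> {0..1}"
    then have "\<psi> z + t *\<^sub>R (\<psi> w - \<psi> z) \<in> ball (\<psi> y) d"
     using convexD_alt[OF convex_ball, of "\<psi> z" "\<psi> y" d "\<psi> w" t] zw unfolding W_def by (simp add: algebra_simps)
    then show "\<psi> z + t *\<^sub>R (\<psi> w - \<psi> z) \<in> \<psi> ` V" using d(2) by blast
   qed
   then have "regular_path A ?\<sigma> 0 1" by (intro regular_path.piece) simp_all
   moreover have "?\<sigma> 0 = z" "?\<sigma> 1 = w" using zw cV(4) by (simp_all add: W_def)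
   ultimately show ?thesis by blast
  qed
  have "W <= R" if ne: "W Int R ~= {}"
  proof
   fix w assume w: "w \<in> W"
   obtain z where z0: "z \<in> W" "z \<in> R" using ne by blast
   then have "\<exists>\<gamma>. regular_path A \<gamma> 0 1 & \<gamma> 0 = x & \<gamma> 1 = z" by (simp add: R_def)
   then obtain \<gamma> where z: "z \<in> W" "regular_path A \<gamma> 0 1" "\<gamma> 0 = x" "\<gamma> 1 = z" using z0(1) by (elim exE conjE) 
   obtain \<sigma> where \<sigma>: "regular_path A \<sigma> 0 1" "\<sigma> 0 = z" "\<sigma> 1 = w" using seg[OF z(1) w] by blast
   have "regular_path A (join \<gamma> \<sigma>) 0 1" by (rule regular_path_join[OF z(2) \<sigma>(1)]) (simp add: z \<sigma>)
   moreover have "join \<gamma> \<sigma> 0 = x" "join \<gamma> \<sigma> 1 = w" by (simp_all add: join_def z \<sigma>)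
   ultimately show "w \<in> R" unfolding R_def by blast
  qed
  moreover have "y = x --> y \<in> R" using seg[OF W(2) W(2)] unfolding R_def by blast
  ultimately show ?thesis using W by blast
 qed
 have "\<exists>T. open T & y \<in> T & T <= R" if "y \<in> R" for y using const[of y] that by blast
 then have "open R" by (subst open_subopen) blast
 moreover have "\<exists>T. open T & y \<in> T & T <= - R" if "y \<in> - R" for y using const[of y] that by blast
 then have "open (- R)" by (subst open_subopen) blast
 moreover have "x \<in> R" using const[of x] by blast
 moreover have "\<forall>T :: 'm set. open T & closed T --> T = {} \<or> T = UNIV" using conn by (simp add: connected_clopen)
 ultimately have "R = UNIV" unfolding closed_def by blast
 then show thesis using that unfolding R_def by blast
qed

lemma induced_dist_paths: "induced_dist A F x y = Inf {induced_length F \<gamma> |\<gamma>. regular_path A \<gamma> 0 1 & \<gamma> 0 = x & \<gamma> 1 = y}"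
 unfolding induced_dist_def piecewise_C1_curve_regular_path by (rule refl)

lemma length_nonneg: "induced_length F \<gamma> \<ge> 0"
proof (cases "speed \<gamma> integrable_on {0..1}")
 case True then show ?thesis unfolding induced_length_def by (rule integral_nonneg) simp
qed (simp add: induced_length_def not_integrable_integral)

lemma induced_dist_le:
 assumes "regular_path A \<gamma> 0 1" "\<gamma> 0 = x" "\<gamma> 1 = y"
 shows "induced_dist A F x y <= induced_length F \<gamma>"
 unfolding induced_dist_paths
 by (rule cInf_lower) (use assms length_nonneg in \<open>auto intro!: bdd_belowI[of _ 0]\<close>)

lemma induced_dist_less:
 assumes "connected (UNIV :: 'm set)" "induced_dist A F x y < r"
 obtains \<gamma> where "regular_path A \<gamma> 0 1" "\<gamma> 0 = x" "\<gamma> 1 = y" "induced_length F \<gamma> < r"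
proof -
 let ?S = "{induced_length F \<gamma> |\<gamma>. regular_path A \<gamma> 0 1 & \<gamma> 0 = x & \<gamma> 1 = y}"
 obtain \<gamma> where "regular_path A \<gamma> 0 1" "\<gamma> 0 = x" "\<gamma> 1 = y" by (rule paths_exist[OF assms(1)])
 then have "?S ~= {}" by blast
 from cInf_lessD[OF this assms(2)[unfolded induced_dist_paths]] show thesis using that by blast
qed

text \<open>A curve from \<open>x\<close> to a point outside \<open>U\<close> crosses the boundary of a small chart ball around \<open>x\<close>. There its image
 has moved by at least \<open>rh / B\<close>, and its length is at least that displacement.\<close>

lemma small_induced_balls:
 assumes conn: "connected (UNIV :: 'm set)" and U: "open U" "x \<in> U"
 obtains r where "r > 0" "!!y. induced_dist A F x y < r ==> y \<in> U"
proof -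
 obtain V ph where c: "(V, ph) \<in> A" "x \<in> V" by (rule chart_at)
 note cV = chart_coordinates[OF charts[OF c(1)]]
 obtain W B where W: "open W" "x \<in> W" "W <= V" "B > 0"
  "!!y z. y \<in> W ==> z \<in> W ==> norm (ph y - ph z) <= B * norm (F y - F z)"
  "!!y z. y \<in> W ==> z \<in> W ==> \<bar>normal x \<bullet> (F y - F z)\<bar> <= 1 * norm (F y - F z)"
  by (rule chart_bilipschitz[OF c zero_less_one]) (rule that)
 have "openin (top_of_set V) (W Int U)" using W(1,3) U(1) cV(1) by (auto simp: openin_open_eq open_Int)
 from homeomorphism_imp_open_map[OF cV(3) this] have o: "open (ph ` (W Int U))" using cV(2) openin_open_trans by blast
 have "ph x \<in> ph ` (W Int U)" using W U by blast
 then obtain rh where rh: "rh > 0" "cball (ph x) rh <= ph ` (W Int U)" using o open_contains_cball by blast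
 define G where "G = ph -` ball (ph x) rh Int V"
 define K where "K = inv_into V ph ` cball (ph x) rh"
 have G: "open G" "x \<in> G" unfolding G_def using cV(1,3) c(2) rh(1) by (simp_all add: continuous_on_open_vimage homeomorphism_def)
 have sub: "cball (ph x) rh <= ph ` V" using rh(2) W(3) by blast
 have "continuous_on (cball (ph x) rh) (inv_into V ph)" using cV(3) sub by (auto simp: homeomorphism_def intro: continuous_on_subset)
 then have "compact K" unfolding K_def by (rule compact_continuous_image) simp
 then have clK: "closed K" by (rule compact_imp_closed)
 have Kmem: "z \<in> W & z \<in> U & z \<in> V & dist (ph x) (ph z) <= rh" if "z \<in> K" for z
 proof -
  obtain u where u: "u \<in> cball (ph x) rh" "z = inv_into V ph u" using \<open>z \<in> K\<close> unfolding K_def by blast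
  obtain w where w: "w \<in> W Int U" "u = ph w" using u(1) rh(2) by blast
  have "z = w" unfolding u(2) w(2) using cV(4) w(1) W(3) by (intro inv_into_f_f) auto
  then show ?thesis using w u(1) W(3) by auto
 qed
 show thesis
 proof (rule that[of "rh / B"])
  show "rh / B > 0" using rh(1) W(4) by simp
  fix y assume dy: "induced_dist A F x y < rh / B"
  obtain \<gamma> where \<gamma>: "regular_path A \<gamma> 0 1" "\<gamma> 0 = x" "\<gamma> 1 = y" "induced_length F \<gamma> < rh / B"
   by (rule induced_dist_less[OF conn dy])
  have cont: "continuous_on {0..1} \<gamma>" using regular_path_regular[OF \<gamma>(1)] by blast
  show "y \<in> U"
  proof (rule ccontr)
   assume "y \<notin> U"
   then have yK: "y \<notin> K" using Kmem by blast
   have "\<exists>t\<in>{0..1}. \<gamma> t \<in> K & \<gamma> t \<notin> G"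
   proof (rule ccontr)
    assume no: "\<not> (\<exists>t\<in>{0..1}. \<gamma> t \<in> K & \<gamma> t \<notin> G)"
    have GK: "G <= K"
    proof
     fix z assume "z \<in> G"
     then have z: "z \<in> V" "ph z \<in> cball (ph x) rh" by (auto simp: G_def)
     have "z = inv_into V ph (ph z)" using inv_into_f_f[OF cV(4) z(1)] by simp
     then show "z \<in> K" unfolding K_def using z(2) by (rule image_eqI)
    qed
    have cn: "connected (\<gamma> ` {0..1})" by (rule connected_continuous_image[OF cont]) simp
    have "\<gamma> ` {0..1} <= G \<union> - K" using no by blast
    moreover have "G Int - K Int \<gamma> ` {0..1} = {}" using GK by blast
    moreover have "G Int \<gamma> ` {0..1} ~= {}"
    proof -
     have "\<gamma> 0 \<in> \<gamma> ` {0..1}" by (rule imageI) simp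
     then show ?thesis using \<gamma>(2) G(2) by auto
    qed
    moreover have "- K Int \<gamma> ` {0..1} ~= {}"
    proof -
     have "\<gamma> 1 \<in> \<gamma> ` {0..1}" by (rule imageI) simp
     then show ?thesis using \<gamma>(3) yK by auto
    qed
    ultimately show False using connectedD[OF cn G(1), of "- K"] clK by (simp add: open_Compl)
   qed
   then obtain t where t: "t \<in> {0..1}" "\<gamma> t \<in> K" "\<gamma> t \<notin> G" by blast
   have "dist (ph x) (ph (\<gamma> t)) \<ge> rh" using t(3) Kmem[OF t(2)] unfolding G_def by auto
   then have "rh <= norm (ph (\<gamma> t) - ph x)" by (simp add: dist_norm norm_minus_commute)
   also have "\<dots> <= B * norm (F (\<gamma> t) - F x)" using W(5) Kmem[OF t(2)] W(2) by blast
   also have "\<dots> <= B * induced_length F \<gamma>" using path_displacement[OF \<gamma>(1) t(1)] \<gamma>(2) W(4) by (intro mult_left_mono) auto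
   also have "\<dots> < B * (rh / B)" using \<gamma>(4) W(4) by (intro mult_strict_left_mono)
   finally show False using W(4) by simp
  qed
 qed
qed

lemma Metric_space_induced_dist:
 assumes conn: "connected (UNIV :: 'm set)"
 shows "Metric_space UNIV (induced_dist A F)"
proof
 have le: "induced_dist A F y x <= induced_dist A F x y" for x y
 proof (rule dense_ge)
  fix r assume "induced_dist A F x y < r"
  then obtain \<gamma> where \<gamma>: "regular_path A \<gamma> 0 1" "\<gamma> 0 = x" "\<gamma> 1 = y" "induced_length F \<gamma> < r" by (rule induced_dist_less[OF conn])
  have "regular_path A (%t. \<gamma> (- 1 * t + 1)) 0 1" using regular_path_reverse[OF \<gamma>(1)] by simp
  then have "induced_dist A F y x <= induced_length F (%t. \<gamma> (- 1 * t + 1))" by (rule induced_dist_le) (simp_all add: \<gamma>)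
  then show "induced_dist A F y x <= r" using \<gamma>(4) unfolding length_reverse[OF \<gamma>(1)] by simp
 qed
 show nn: "0 <= induced_dist A F x y" for x y
 proof (rule dense_ge)
  fix r assume "induced_dist A F x y < r"
  then obtain \<gamma> where "induced_length F \<gamma> < r" by (rule induced_dist_less[OF conn])
  then show "0 <= r" using length_nonneg[of \<gamma>] by simp
 qed
 show "induced_dist A F x y = induced_dist A F y x" for x y using le by (intro antisym)
 show "induced_dist A F x y = 0 \<longleftrightarrow> x = y" for x y
 proof
  assume d: "induced_dist A F x y = 0"
  show "x = y"
  proof (rule ccontr)
   assume "x ~= y"
   then have "open (- {y})" "x \<in> - {y}" by (auto simp: open_Compl)
   then obtain r where "r > 0" "!!z. induced_dist A F x z < r ==> z \<in> - {y}" by (rule small_induced_balls[OF conn]) (rule that)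
   from this(2)[of y] this(1) d show False by simp
  qed
 next
  assume "x = y"
  obtain V \<psi> where c: "(V, \<psi>) \<in> A" "x \<in> V" by (rule chart_at)
  let ?\<sigma> = "%t. inv_into V \<psi> (\<psi> x + t *\<^sub>R (\<psi> x - \<psi> x))"
  have "C1_curve A 0 1 ?\<sigma>" by (rule chart_segment[OF c(1)]) (use c(2) in simp)
  then have "regular_path A ?\<sigma> 0 1" by (intro regular_path.piece) simp_all
  then have "induced_dist A F x x <= induced_length F ?\<sigma>"
   by (rule induced_dist_le) (use chart_coordinates(4)[OF charts[OF c(1)]] c(2) in simp_all)
  also have "induced_length F ?\<sigma> = 0" by (simp add: induced_length_def o_def vector_derivative_const_at)
  finally show "induced_dist A F x y = 0" using nn[of x x] \<open>x = y\<close> by simp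
 qed
 show "induced_dist A F x z <= induced_dist A F x y + induced_dist A F y z" for x y z
 proof (rule field_le_epsilon)
  fix e :: real assume e: "e > 0"
  have "induced_dist A F x y < induced_dist A F x y + e / 2" using e by simp
  then obtain \<gamma> where \<gamma>: "regular_path A \<gamma> 0 1" "\<gamma> 0 = x" "\<gamma> 1 = y" "induced_length F \<gamma> < induced_dist A F x y + e / 2"
   by (rule induced_dist_less[OF conn])
  have "induced_dist A F y z < induced_dist A F y z + e / 2" using e by simp
  then obtain dl where dl: "regular_path A dl 0 1" "dl 0 = y" "dl 1 = z" "induced_length F dl < induced_dist A F y z + e / 2"
   by (rule induced_dist_less[OF conn])
  have "regular_path A (join \<gamma> dl) 0 1" by (rule regular_path_join[OF \<gamma>(1) dl(1)]) (simp add: \<gamma> dl)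
  then have "induced_dist A F x z <= induced_length F (join \<gamma> dl)" by (rule induced_dist_le) (simp_all add: join_def \<gamma> dl)
  then show "induced_dist A F x z <= induced_dist A F x y + induced_dist A F y z + e"
   unfolding length_join[OF \<gamma>(1) dl(1)] using \<gamma>(4) dl(4) by simp
 qed
qed

text \<open>The local inverse of the chart expression of \<open>F\<close> need not be known to be differentiable. It suffices
 that \<open>F\<close> is bi-Lipschitz in the chart and that its derivative \<open>L\<close> has the left inverse \<open>Q\<close>, written out by Cramer's rule.\<close>

lemma line_lift_C1:
 assumes cont: "continuous_on {0..1} \<gamma>" and lift: "!!t. t \<in> {0..1} ==> F (\<gamma> t) = p + t *\<^sub>R w"
 shows "C1_curve A 0 1 \<gamma>"
 unfolding C1_curve_def
proof (intro conjI ballI)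
 show "continuous_on {0..1} \<gamma>" by (rule cont)
 fix ch assume ch: "ch \<in> A"
 obtain U ph where U: "ch = (U, ph)" by (cases ch)
 have c: "(U, ph) \<in> A" using ch U by simp
 note cU = chart_coordinates[OF charts[OF c]]
 let ?f = "F \<circ> inv_into U ph" and ?L = "%z. frechet_derivative (F \<circ> inv_into U ph) (at z)" and ?N = "chart_normal U ph"
 define Q where "Q = (%z v. ((cross3 v (?L z (axis 2 1)) \<bullet> ?N z) / (?N z \<bullet> ?N z)) *\<^sub>R axis 1 1
  + ((cross3 (?L z (axis 1 1)) v \<bullet> ?N z) / (?N z \<bullet> ?N z)) *\<^sub>R (axis 2 1 :: real^2))"
 have QL: "Q z (?L z u) = u" if z: "z \<in> ph ` U" for z u
 proof -
  have lin: "linear (?L z)" using chart_derivative(1)[OF c z] has_derivative_linear by blast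
  have n0: "?N z \<bullet> ?N z ~= 0" using chart_normal_nonzero[OF c z] by simp
  have "?L z u = ?L z (u $ 1 *\<^sub>R axis 1 1 + u $ 2 *\<^sub>R axis 2 1)" by (rule arg_cong[OF real2_basis])
  then have Lu: "?L z u = u $ 1 *\<^sub>R ?L z (axis 1 1) + u $ 2 *\<^sub>R ?L z (axis 2 1)"
   unfolding linear_add[OF lin] linear_scale[OF lin] .
  have "cross3 (?L z u) (?L z (axis 2 1)) = u $ 1 *\<^sub>R ?N z" "cross3 (?L z (axis 1 1)) (?L z u) = u $ 2 *\<^sub>R ?N z"
   unfolding Lu chart_normal_def by (simp_all add: cross_add_left cross_add_right cross_mult_left cross_mult_right)
  then show ?thesis unfolding Q_def using n0 real2_basis[of u] by simp
 qed
 have Qlin: "linear (Q z)" for z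
  unfolding Q_def by (intro linearI) (simp_all add: cross_add_left cross_add_right cross_mult_left cross_mult_right
   inner_add_left add_divide_distrib scaleR_add_left scaleR_add_right)
 let ?S = "{t \<in> {0..1}. \<gamma> t \<in> U}"
 have cph: "continuous_on ?S (%s. ph (\<gamma> s))"
  by (rule continuous_on_compose2[of U ph]) (use cU(3) cont in \<open>auto simp: homeomorphism_def intro: continuous_on_subset\<close>)
 have cL: "continuous_on ?S (%s. ?L (ph (\<gamma> s)) v)" for v
 proof (cases "?S = {}")
  case True show ?thesis unfolding True by (rule continuous_on_empty)
 next
  case False
  then obtain s where "\<gamma> s \<in> U" by blast
  then have s: "ph (\<gamma> s) \<in> ph ` U" by blast
  show ?thesis by (rule continuous_on_compose2[OF chart_derivative(3)[OF c s] cph]) auto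
 qed
 have cN: "continuous_on ?S (%s. ?N (ph (\<gamma> s)))" unfolding chart_normal_def by (intro continuous_on_cross cL)
 have nz: "\<forall>s\<in>?S. ?N (ph (\<gamma> s)) \<bullet> ?N (ph (\<gamma> s)) ~= 0" using chart_normal_nonzero[OF c] by simp
 have "\<exists>D. continuous_on ?S D & (\<forall>t\<in>{0..1}. \<gamma> t \<in> U --> (ph \<circ> \<gamma> has_vector_derivative D t) (at t within {0..1}))"
 proof (intro exI[of _ "%t. Q (ph (\<gamma> t)) w"] conjI ballI impI)
  show "continuous_on ?S (%t. Q (ph (\<gamma> t)) w)" unfolding Q_def
   by (intro continuous_on_add continuous_on_scaleR continuous_on_divide continuous_on_inner continuous_on_cross continuous_on_const cL cN nz)
  fix t assume t: "t \<in> {0..1}" "\<gamma> t \<in> U"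
  let ?z = "ph (\<gamma> t)"
  have z: "?z \<in> ph ` U" using t(2) by blast
  obtain W B where W: "open W" "\<gamma> t \<in> W" "W <= U" "B > 0"
   "!!y z. y \<in> W ==> z \<in> W ==> norm (ph y - ph z) <= B * norm (F y - F z)"
   "!!y z. y \<in> W ==> z \<in> W ==> \<bar>normal (\<gamma> t) \<bullet> (F y - F z)\<bar> <= 1 * norm (F y - F z)"
   by (rule chart_bilipschitz[OF c t(2) zero_less_one]) (rule that)
  obtain q where q: "q > 0" "!!v. norm (Q ?z v) <= q * norm v"
  proof -
   have "bounded_linear (Q ?z)" using Qlin linear_conv_bounded_linear by blast
   then show ?thesis using bounded_linear.pos_bounded[of "Q ?z"] that by (auto simp: mult.commute)
  qed
  obtain T where T: "open T" "T Int {0..1} = \<gamma> -` W Int {0..1}"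
   using cont W(1) unfolding continuous_on_open_invariant by blast
  have "t \<in> T" using T(2) t W(2) by blast
  then obtain d1 where d1: "d1 > 0" "ball t d1 <= T" using T(1) open_contains_ball by blast
  show "(ph \<circ> \<gamma> has_vector_derivative Q ?z w) (at t within {0..1})"
   unfolding has_vector_derivative_def has_derivative_within_alt
  proof (intro conjI allI impI)
   show "bounded_linear (%h. h *\<^sub>R Q ?z w)" by (rule bounded_linear_scaleR_left)
   fix e :: real assume e: "e > 0"
   define e' where "e' = e / (q * (B * norm w + 1))"
   have pos: "q * (B * norm w + 1) > 0" using q(1) W(4) by (intro mult_pos_pos add_nonneg_pos mult_nonneg_nonneg) auto
   have e': "e' > 0" using e pos by (simp add: e'_def)
   obtain d2 where d2: "d2 > 0" "\<forall>u. norm (u - ?z) < d2 --> norm (?f u - ?f ?z - ?L ?z (u - ?z)) <= e' * norm (u - ?z)"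
    using chart_derivative(1)[OF c z] e' unfolding has_derivative_at_alt by blast
   define d where "d = min d1 (d2 / (B * norm w + 1))"
   have Bw: "B * norm w + 1 > 0" using W(4) by (intro add_nonneg_pos mult_nonneg_nonneg) auto
   have "d > 0" using d1(1) d2(1) Bw by (simp add: d_def)
   moreover have "norm ((ph \<circ> \<gamma>) s - (ph \<circ> \<gamma>) t - (s - t) *\<^sub>R Q ?z w) <= e * norm (s - t)"
    if s: "s \<in> {0..1}" "norm (s - t) < d" for s
   proof -
    have "s \<in> T" using d1(2) s(2) by (auto simp: d_def dist_norm norm_minus_commute subset_iff)
    then have sW: "\<gamma> s \<in> W" using T(2) s(1) by blast
    have Fd: "F (\<gamma> s) - F (\<gamma> t) = (s - t) *\<^sub>R w" using lift s(1) t(1) by (simp add: algebra_simps)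
    let ?u = "ph (\<gamma> s)"
    have "norm (?u - ?z) <= B * norm ((s - t) *\<^sub>R w)" using W(5)[OF sW W(2)] unfolding Fd .
    also have "B * norm ((s - t) *\<^sub>R w) = (B * norm w) * \<bar>s - t\<bar>" by (simp only: norm_scaleR mult_ac)
    also have "\<dots> <= (B * norm w + 1) * \<bar>s - t\<bar>" by (rule mult_right_mono) simp_all
    finally have u1: "norm (?u - ?z) <= (B * norm w + 1) * \<bar>s - t\<bar>" .
    have "\<bar>s - t\<bar> < d2 / (B * norm w + 1)" using s(2) by (simp add: d_def)
    then have "(B * norm w + 1) * \<bar>s - t\<bar> < d2" using Bw by (simp add: pos_less_divide_eq mult.commute)
    with u1 have "norm (?u - ?z) < d2" by linarith
    then have lo: "norm (?f ?u - ?f ?z - ?L ?z (?u - ?z)) <= e' * norm (?u - ?z)" using d2(2) by blast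
    have ff: "?f ?u = F (\<gamma> s)" "?f ?z = F (\<gamma> t)" using chart_position[OF c] sW W(3) t(2) by blast+
    have "?u - ?z - (s - t) *\<^sub>R Q ?z w = - Q ?z ((s - t) *\<^sub>R w - ?L ?z (?u - ?z))"
     unfolding linear_diff[OF Qlin] linear_scale[OF Qlin] QL[OF z] by simp
    then have "norm (?u - ?z - (s - t) *\<^sub>R Q ?z w) <= q * norm ((s - t) *\<^sub>R w - ?L ?z (?u - ?z))" using q(2) by simp
    also have "\<dots> <= q * (e' * ((B * norm w + 1) * \<bar>s - t\<bar>))"
     using lo[unfolded ff Fd] mult_left_mono[OF u1, of e'] q(1) e' by (intro mult_left_mono) linarith+
    also have "\<dots> = (q * (B * norm w + 1)) * e' * \<bar>s - t\<bar>" by (simp only: mult_ac)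
    also have "(q * (B * norm w + 1)) * e' = e"
     by (simp only: e'_def times_divide_eq_right nonzero_mult_div_cancel_left[OF pos[THEN less_imp_neq, symmetric]])
    finally show ?thesis by simp
   qed
   ultimately show "\<exists>d>0. \<forall>s\<in>{0..1}. norm (s - t) < d -->
    norm ((ph \<circ> \<gamma>) s - (ph \<circ> \<gamma>) t - (s - t) *\<^sub>R Q ?z w) <= e * norm (s - t)" by blast
  qed
 qed
 then show "case ch of (U, ph) => \<exists>D. continuous_on {t \<in> {0..1}. \<gamma> t \<in> U} D &
   (\<forall>t\<in>{0..1}. \<gamma> t \<in> U --> (ph \<circ> \<gamma> has_vector_derivative D t) (at t within {0..1}))" unfolding U by simp
qed

lemma line_lift_dist:
 assumes cont: "continuous_on {a<..<b} g" and lift: "!!h. h \<in> {a<..<b} ==> F (g h) = p + h *\<^sub>R v"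
  and h: "h1 \<in> {a<..<b}" "h2 \<in> {a<..<b}"
 shows "induced_dist A F (g h1) (g h2) <= \<bar>h1 - h2\<bar> * norm v"
proof -
 let ?\<gamma> = "%t. g (h1 + t * (h2 - h1))"
 have ins: "h1 + t * (h2 - h1) \<in> {a<..<b}" if "t \<in> {0..1}" for t
  using convexD_alt[of "{a<..<b}" h1 h2 t] h that by (simp add: algebra_simps)
 have cg: "continuous_on {0..1} ?\<gamma>"
  by (rule continuous_on_compose2[OF cont]) (use ins in \<open>auto intro!: continuous_intros\<close>)
 have l: "F (?\<gamma> t) = (p + h1 *\<^sub>R v) + t *\<^sub>R ((h2 - h1) *\<^sub>R v)" if "t \<in> {0..1}" for t
  using lift[OF ins[OF that]] by (simp add: algebra_simps)
 have "regular_path A ?\<gamma> 0 1" by (rule regular_path.piece) (simp, rule line_lift_C1[OF cg l])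
 then have "induced_dist A F (g h1) (g h2) <= induced_length F ?\<gamma>" by (rule induced_dist_le) simp_all
 also have "induced_length F ?\<gamma> = integral {0..1} (%t :: real. norm ((h2 - h1) *\<^sub>R v))" unfolding induced_length_def
 proof (rule integral_spike[of "{0, 1}"])
  fix t :: real assume t: "t \<in> {0..1} - {0, 1}"
  have "vector_derivative (F \<circ> ?\<gamma>) (at t) = vector_derivative (%t. (p + h1 *\<^sub>R v) + t *\<^sub>R ((h2 - h1) *\<^sub>R v)) (at t)"
   by (rule vector_derivative_cong_open[of "{0<..<1}"]) (use t l in auto)
  also have "\<dots> = (h2 - h1) *\<^sub>R v" by (rule vector_derivative_at) (auto intro!: derivative_eq_intros)
  finally show "norm ((h2 - h1) *\<^sub>R v) = norm (vector_derivative (F \<circ> ?\<gamma>) (at t))" by simp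
 qed simp
 finally show ?thesis by (simp add: abs_minus_commute)
qed

text \<open>The lift of a segment of length \<open>\<bar>h1 - h2\<bar> * norm v\<close> joins its end points, so the lift is a Cauchy family
 as the parameter tends to \<open>b\<close>. Convergence in the induced distance implies convergence in the topology of the surface.\<close>

lemma complete_line_limit:
 assumes conn: "connected (UNIV :: 'm set)" and complete: "complete_immersion A F" and ab: "a < b"
  and cont: "continuous_on {a<..<b} g" and lift: "!!h. h \<in> {a<..<b} ==> F (g h) = p + h *\<^sub>R v"
 shows "\<exists>s y. (\<forall>i::nat. s i \<in> {a<..<b}) & s \<longlonglongrightarrow> b & (%i. g (s i)) \<longlonglongrightarrow> y"
proof -
 interpret M: Metric_space UNIV "induced_dist A F" by (rule Metric_space_induced_dist[OF conn])
 define s where "s = (%n::nat. b - (b - a) * inverse (real (Suc (Suc n))))"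
 have s: "s n \<in> {a<..<b}" for n
 proof -
  have i: "inverse (real (Suc (Suc n))) > 0" "inverse (real (Suc (Suc n))) < 1" by (simp_all add: field_simps)
  have "(b - a) * inverse (real (Suc (Suc n))) > 0" using i(1) ab by (intro mult_pos_pos) auto
  moreover have "(b - a) * inverse (real (Suc (Suc n))) < (b - a) * 1" using i(2) ab by (intro mult_strict_left_mono) auto
  ultimately show ?thesis by (simp add: s_def)
 qed
 have "(%n. b - (b - a) * inverse (real (Suc (Suc n)))) \<longlonglongrightarrow> b - (b - a) * 0"
  by (intro tendsto_intros LIMSEQ_Suc[OF LIMSEQ_inverse_real_of_nat])
 then have lim: "s \<longlonglongrightarrow> b" by (simp add: s_def)
 have "M.MCauchy (%n. g (s n))" unfolding M.MCauchy_def
 proof (intro conjI allI impI)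
  fix eps :: real assume e: "eps > 0"
  have v: "norm v + 1 > 0" by (intro add_nonneg_pos) auto
  then have "eps / (norm v + 1) > 0" using e by simp
  then obtain N where N: "\<forall>m\<ge>N. \<forall>n\<ge>N. dist (s m) (s n) < eps / (norm v + 1)"
   using LIMSEQ_imp_Cauchy[OF lim] unfolding Cauchy_def by blast
  have "induced_dist A F (g (s n)) (g (s n')) < eps" if "N <= n" "N <= n'" for n n'
  proof -
   have "induced_dist A F (g (s n)) (g (s n')) <= \<bar>s n - s n'\<bar> * norm v" by (rule line_lift_dist[OF cont lift s s])
   also have "\<dots> <= \<bar>s n - s n'\<bar> * (norm v + 1)" by (intro mult_left_mono) auto
   also have "\<dots> < eps" using N that v by (simp add: dist_real_def pos_less_divide_eq)
   finally show ?thesis .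
  qed
  then show "\<exists>N. \<forall>n n'. N <= n --> N <= n' --> induced_dist A F (g (s n)) (g (s n')) < eps" by blast
 qed simp
 then obtain y where y: "limitin M.mtopology (%n. g (s n)) y sequentially"
  using complete unfolding complete_immersion_def M.mcomplete_def by blast
 have "(%n. g (s n)) \<longlonglongrightarrow> y"
 proof (rule topological_tendstoI)
  fix U assume "open U" "y \<in> U"
  then obtain r where r: "r > 0" "!!z. induced_dist A F y z < r ==> z \<in> U" by (rule small_induced_balls[OF conn]) (rule that)
  have "\<forall>\<^sub>F n in sequentially. induced_dist A F (g (s n)) y < r"
   using y r(1) unfolding M.limitin_metric by simp
  then show "\<forall>\<^sub>F n in sequentially. g (s n) \<in> U"
   by (rule eventually_mono) (rule r(2), simp add: M.commute)
 qed
 then show ?thesis using s lim by blast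
qed

end

section \<open>From a figure-8 cross-cut to a central cylinder\<close>

context immersed_surface begin

text \<open>The curve need not be lifted continuously to the surface. If \<open>x\<close> is the only point of the compact set \<open>\<Gamma>\<close> over
 \<open>\<beta> s\<close>, then arbitrary preimages of nearby points of the curve converge to \<open>x\<close>, and the
 secant estimate at \<open>x\<close> applies.\<close>

lemma image_curve_tangent:
 assumes \<Gamma>: "compact \<Gamma>" and sub: "!!t. \<beta> t \<in> F ` \<Gamma>" and d: "(\<beta> has_vector_derivative d) (at s)"
  and one: "!!y. y \<in> \<Gamma> ==> F y = \<beta> s ==> y = x"
 shows "nu x \<bullet> d = 0"
proof -
 have le: "\<bar>nu x \<bullet> d\<bar> <= eps * norm d" if eps: "eps > 0" for eps
 proof -
  obtain U where U: "open U" "x \<in> U" "\<forall>y\<in>U. \<forall>z\<in>U. \<bar>nu x \<bullet> (F y - F z)\<bar> <= eps * norm (F y - F z)"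
   using secant[OF eps, of x] by blast
  define \<tau> where "\<tau> = (%n::nat. s + inverse (real (Suc n)))"
  have "(%n. s + inverse (real (Suc n))) \<longlonglongrightarrow> s + 0" by (intro tendsto_intros LIMSEQ_inverse_real_of_nat)
  then have \<tau>: "\<tau> \<longlonglongrightarrow> s" by (simp add: \<tau>_def)
  have "\<forall>n. \<exists>y. y \<in> \<Gamma> & F y = \<beta> (\<tau> n)"
  proof
   fix n show "\<exists>y. y \<in> \<Gamma> & F y = \<beta> (\<tau> n)" using sub[of "\<tau> n"] by auto
  qed
  from choice[OF this] obtain y where y: "\<forall>n. y n \<in> \<Gamma> & F (y n) = \<beta> (\<tau> n)" by (rule exE)
  have y\<Gamma>: "y n \<in> \<Gamma>" for n using y by blast
  obtain l ph where l: "l \<in> \<Gamma>" "strict_mono ph" "(%i. y (ph i)) \<longlonglongrightarrow> l" by (rule compact_subseq[OF \<Gamma> y\<Gamma>])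
  have \<tau>ph: "(%i. \<tau> (ph i)) \<longlonglongrightarrow> s" using LIMSEQ_subseq_LIMSEQ[OF \<tau> l(2)] by (simp add: o_def)
  have "(%i. \<beta> (\<tau> (ph i))) \<longlonglongrightarrow> \<beta> s"
   by (rule isCont_tendsto_compose[OF has_vector_derivative_continuous[OF d] \<tau>ph])
  moreover have "(%i. \<beta> (\<tau> (ph i))) \<longlonglongrightarrow> F l" using F_tendsto[OF l(3)] y by simp
  ultimately have Fl: "F l = \<beta> s" using LIMSEQ_unique by blast
  then have lx: "l = x" by (rule one[OF l(1)])
  let ?q = "%i. (\<beta> (\<tau> (ph i)) - \<beta> s) /\<^sub>R (\<tau> (ph i) - s)"
  have "filterlim (%i. \<tau> (ph i)) (at s) sequentially"
   by (rule filterlim_atI[OF \<tau>ph]) (simp add: \<tau>_def)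
  from filterlim_compose[OF vector_derivative_quotient[OF d] this] have q: "?q \<longlonglongrightarrow> d" .
  have ev: "\<forall>\<^sub>F i in sequentially. y (ph i) \<in> U" by (rule topological_tendstoD[OF l(3) U(1)]) (use lx U(2) in simp)
  have "\<forall>\<^sub>F i in sequentially. \<bar>nu x \<bullet> ?q i\<bar> <= eps * norm (?q i)"
   using ev
  proof (rule eventually_mono)
   fix i assume yU: "y (ph i) \<in> U"
   have "F (y (ph i)) = \<beta> (\<tau> (ph i))" using y by blast
   then have b: "\<bar>nu x \<bullet> (\<beta> (\<tau> (ph i)) - \<beta> s)\<bar> <= eps * norm (\<beta> (\<tau> (ph i)) - \<beta> s)"
    using U(3)[rule_format, OF yU U(2)] Fl unfolding lx by simp
   have "\<bar>nu x \<bullet> ?q i\<bar> = \<bar>inverse (\<tau> (ph i) - s)\<bar> * \<bar>nu x \<bullet> (\<beta> (\<tau> (ph i)) - \<beta> s)\<bar>"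
    by (simp only: inner_scaleR_right abs_mult)
   also have "\<dots> <= \<bar>inverse (\<tau> (ph i) - s)\<bar> * (eps * norm (\<beta> (\<tau> (ph i)) - \<beta> s))"
    by (rule mult_left_mono[OF b]) simp
   also have "\<dots> = eps * norm (?q i)" by (simp only: norm_scaleR mult_ac)
   finally show "\<bar>nu x \<bullet> ?q i\<bar> <= eps * norm (?q i)" .
  qed
  moreover have "(%i. \<bar>nu x \<bullet> ?q i\<bar>) \<longlonglongrightarrow> \<bar>nu x \<bullet> d\<bar>" "(%i. eps * norm (?q i)) \<longlonglongrightarrow> eps * norm d"
   by (intro tendsto_intros q)+
  ultimately show ?thesis by (intro tendsto_le[OF trivial_limit_sequentially])
 qed
 have "\<bar>nu x \<bullet> d\<bar> <= 0"
 proof (rule field_le_epsilon)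
  fix e :: real assume e: "e > 0"
  have p: "norm d + 1 > 0" by (intro add_nonneg_pos) auto
  then have "\<bar>nu x \<bullet> d\<bar> <= e / (norm d + 1) * norm d" using le[of "e / (norm d + 1)"] e by simp
  also have "\<dots> <= e / (norm d + 1) * (norm d + 1)" using e p by (intro mult_left_mono) auto
  also have "\<dots> = e" using p by simp
  finally show "\<bar>nu x \<bullet> d\<bar> <= 0 + e" by simp
 qed
 then show ?thesis by simp
qed

end

text \<open>By polarization \<open>f\<close> preserves inner products, which determine the length of \<open>f (x + y) - f x - f y\<close>.\<close>

lemma isometry_linear:
 fixes f :: "'a::real_inner => 'b::real_inner"
 assumes 0: "f 0 = 0" and iso: "!!x y. dist (f x) (f y) = dist x y"
 shows "linear f" "norm (f x) = norm x"
proof -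
 have n: "norm (f x) = norm x" for x using iso[of x 0] 0 by simp
 then show "norm (f x) = norm x" .
 have ip: "f x \<bullet> f y = x \<bullet> y" for x y
  unfolding dot_norm_neg using iso[of x y] n by (simp add: dist_norm)
 have sq: "z = 0" if "z \<bullet> z = 0" for z :: 'b using that by simp
 show "linear f"
 proof (rule linearI)
  fix x y
  have "(f (x + y) - f x - f y) \<bullet> (f (x + y) - f x - f y) = 0"
   by (simp add: inner_diff_left inner_diff_right ip inner_add_left inner_add_right inner_commute)
  from sq[OF this] show "f (x + y) = f x + f y" by (simp add: algebra_simps)
 next
  fix r x
  have "(f (r *\<^sub>R x) - r *\<^sub>R f x) \<bullet> (f (r *\<^sub>R x) - r *\<^sub>R f x) = 0"
   by (simp add: inner_diff_left inner_diff_right ip)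
  from sq[OF this] show "f (r *\<^sub>R x) = r *\<^sub>R f x" by simp
 qed
qed

lemma figure8_centre_tangents:
 assumes f8: "clean_figure8_in P X" and sym: "!!p. p \<in> X ==> 2 *\<^sub>R c - p \<in> X" and cP: "c \<in> P"
 obtains \<beta> s t d1 d2 where "!!r :: real. \<beta> r \<in> X" "\<beta> s = c" "\<beta> t = c"
  "(\<beta> has_vector_derivative d1) (at s)" "(\<beta> has_vector_derivative d2) (at t)"
  "!!k l. k *\<^sub>R d1 = l *\<^sub>R d2 ==> k = 0 & l = 0"
proof -
 obtain J :: "real^2 => real^3" and \<alpha> where J: "\<forall>x y. dist (J x) (J y) = dist x y" "range J = P"
  and \<alpha>: "clean_figure8 \<alpha>" and X: "X = J ` \<alpha> ` sphere 0 1"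
  using f8 unfolding clean_figure8_in_def by blast
 define L where "L = (%x. J x - J 0)"
 have L0: "L 0 = 0" and Li: "dist (L x) (L y) = dist x y" for x y using J(1) by (simp_all add: L_def dist_norm)
 have L: "linear L" "!!x. norm (L x) = norm x" by (rule isometry_linear[OF L0 Li])+
 have JL: "J x = J 0 + L x" for x by (simp add: L_def)
 have Jinj: "x = y" if "J x = J y" for x y using J(1)[rule_format, of x y] that by simp
 obtain c0 where c0: "c = J c0" using cP J(2) by blast
 have "2 *\<^sub>R c0 - z \<in> \<alpha> ` sphere 0 1" if z: "z \<in> \<alpha> ` sphere 0 1" for z
 proof -
  have "J (2 *\<^sub>R c0 - z) = 2 *\<^sub>R c - J z"
   unfolding c0 JL[of "2 *\<^sub>R c0 - z"] JL[of c0] JL[of z] linear_diff[OF L(1)] linear_scale[OF L(1)] by (simp add: algebra_simps scaleR_2)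
  moreover have "2 *\<^sub>R c - J z \<in> X" by (rule sym) (use z X in blast)
  ultimately obtain w where w: "w \<in> \<alpha> ` sphere 0 1" "J (2 *\<^sub>R c0 - z) = J w" unfolding X by auto
  from Jinj[OF w(2)] w(1) show ?thesis by simp
 qed
 then obtain s t where st: "\<alpha> (cis s) = c0" "\<alpha> (cis t) = c0" "det2 (velocity \<alpha> s) (velocity \<alpha> t) ~= 0"
  by (rule figure8_center_double[OF \<alpha>])
 have "immersed_loop \<alpha>" using \<alpha> by (simp add: clean_figure8_def clean_loop_def)
 note D = immersed_loop_derivatives(1)[OF this]
 have bl: "bounded_linear L" using L(1) linear_conv_bounded_linear by blast
 let ?\<beta> = "%r. J 0 + L (\<alpha> (cis r))"
 have d: "(?\<beta> has_vector_derivative L (velocity \<alpha> r)) (at r)" for r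
  using has_vector_derivative_add[OF has_vector_derivative_const bounded_linear.has_vector_derivative[OF bl D[of r]]] by simp
 show thesis
 proof (rule that[OF _ _ _ d d])
  show "?\<beta> r \<in> X" for r
  proof -
   have "J (\<alpha> (cis r)) \<in> X" unfolding X by (intro imageI) simp
   then show ?thesis using JL[of "\<alpha> (cis r)"] by simp
  qed
  show "?\<beta> s = c" "?\<beta> t = c" using st(1,2) c0 JL[of c0] by simp_all
  fix k l assume "k *\<^sub>R L (velocity \<alpha> s) = l *\<^sub>R L (velocity \<alpha> t)"
  then have "L (k *\<^sub>R velocity \<alpha> s - l *\<^sub>R velocity \<alpha> t) = 0" unfolding linear_diff[OF L(1)] linear_scale[OF L(1)] by simp
  then have "norm (k *\<^sub>R velocity \<alpha> s - l *\<^sub>R velocity \<alpha> t) = 0" using L(2)[of "k *\<^sub>R velocity \<alpha> s - l *\<^sub>R velocity \<alpha> t"] by simp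
  then have eq: "k *\<^sub>R velocity \<alpha> s = l *\<^sub>R velocity \<alpha> t" by simp
  have c1: "k * velocity \<alpha> s $ i = l * velocity \<alpha> t $ i" for i using arg_cong[OF eq, of "%v. v $ i"] by simp
  have "k * det2 (velocity \<alpha> s) (velocity \<alpha> t) = (k * velocity \<alpha> s $ 1) * velocity \<alpha> t $ 2 - (k * velocity \<alpha> s $ 2) * velocity \<alpha> t $ 1"
   by (simp add: det2_def algebra_simps)
  also have "\<dots> = 0" unfolding c1 by simp
  finally have "k = 0" using st(3) by simp
  moreover have "l * det2 (velocity \<alpha> s) (velocity \<alpha> t) = velocity \<alpha> s $ 1 * (l * velocity \<alpha> t $ 2) - velocity \<alpha> s $ 2 * (l * velocity \<alpha> t $ 1)"
   by (simp add: det2_def algebra_simps)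
  then have "l * det2 (velocity \<alpha> s) (velocity \<alpha> t) = 0" unfolding c1[symmetric] by simp
  then have "l = 0" using st(3) by simp
  ultimately show "k = 0 & l = 0" by blast
 qed
qed

context surface_immersion begin

lemma central_surface_normal:
 assumes conn: "connected (UNIV :: 'm set)" and complete: "complete_immersion A F"
  and ccp: "central_cross_cut_property A F" and nc: normal_crossings
 shows "central_surface F normal"
proof -
 interpret immersed_surface F normal by (rule immersed_surface_normal)
 show ?thesis
 proof (rule central_surface.intro[OF immersed_surface_normal], rule central_surface_axioms.intro)
  show "normal x ~= 0" for x by (rule normal_nonzero)
  show "cross3 (normal x) (normal y) ~= 0" if "x ~= y" "F x = F y" for x y
   using nc[unfolded normal_crossings_def, THEN conjunct1, rule_format, of x y] that by simp
  show "\<exists>s y. (\<forall>i::nat. s i \<in> {a<..<b}) & s \<longlonglongrightarrow> b & (%i. g (s i)) \<longlonglongrightarrow> y"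
   if "a < b" "continuous_on {a<..<b} g" "!!h. h \<in> {a<..<b} ==> F (g h) = p + h *\<^sub>R v" for a b g p v
   by (rule complete_line_limit[OF conn complete that])
  show "\<exists>n. norm (n - m) < r & (\<forall>C\<in>components (slice \<omega> n). compact C --> (\<exists>c. centred C c))" if r: "r > 0" for r m \<omega>
  proof -
   obtain n where n: "norm (n - m) < r" "n ~= 0" "generic \<omega> n" by (rule generic_dense[OF nc r])
   let ?P = "{y. n \<bullet> (y - \<omega>) = 1}"
   have gp: "in_general_position A F ?P" by (rule crossings_general_position[OF n(2) nc n(3)])
   have P: "is_plane ?P" unfolding is_plane_def
    by (intro exI[of _ n] exI[of _ "1 + n \<bullet> \<omega>"]) (use n(2) in \<open>auto simp: inner_diff_right\<close>)
   have "\<exists>c. centred C c" if C: "C \<in> components (slice \<omega> n)" "compact C" for C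
   proof -
    have sl: "slice \<omega> n = F -` ?P" by (auto simp: slice_def)
    have "clean_cross_cut A F ?P C"
     using C P gp unfolding clean_cross_cut_def cross_cut_def meets_transversally_def in_general_position_def sl by blast
    then have "central (F ` C)" using ccp unfolding central_cross_cut_property_def by blast
    then obtain c where "(%x. 2 *\<^sub>R c - x) ` F ` C = F ` C" unfolding central_def by blast
    then have "centred C c" unfolding centred_def by blast
    then show ?thesis by blast
   qed
   then show ?thesis using n(1) by blast
  qed
 qed
qed

text \<open>The two branches of the figure-8 through its centre have independent tangents. With a single preimage of the centre,
 both would be tangent to the line in which the tangent plane meets \<open>P\<close>. A third preimage is excluded by
 general position.\<close>

lemma figure8_centred_loop:
 assumes nc: normal_crossings and g: "generic \<omega> e" and e: "e ~= 0"
  and \<Gamma>: "\<Gamma> \<in> components (F -` {y. e \<bullet> (y - \<omega>) = 1})" "compact \<Gamma>" and cen: "central (F ` \<Gamma>)"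
  and f8: "clean_figure8_in {y. e \<bullet> (y - \<omega>) = 1} (F ` \<Gamma>)"
 obtains c x1 x2 where "immersed_surface.centred_loop F normal \<omega> e \<Gamma> c x1 x2"
proof -
 interpret immersed_surface F normal by (rule immersed_surface_normal)
 let ?P = "{y. e \<bullet> (y - \<omega>) = 1}"
 have sl: "slice \<omega> e = F -` ?P" by (auto simp: slice_def)
 have sub: "\<Gamma> <= F -` ?P" and ne: "\<Gamma> ~= {}" and con: "connected \<Gamma>"
  using in_components_subset[OF \<Gamma>(1)] in_components_nonempty[OF \<Gamma>(1)] in_components_connected[OF \<Gamma>(1)] by blast+
 have tr: "cross3 (normal x) e ~= 0" if "x \<in> \<Gamma>" for x
  using g[unfolded generic_def, THEN conjunct1, rule_format, of x] sub that by blast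
 have ind: "indep3 (normal x) (normal y) e" if "x \<in> \<Gamma>" "y \<in> \<Gamma>" "x ~= y" "F x = F y" for x y
 proof (rule triple_nonzero_indep3)
  show "cross3 (normal x) (normal y) \<bullet> e ~= 0"
   using g[unfolded generic_def, THEN conjunct2, THEN conjunct1, rule_format, of x y] sub that by blast
 qed
 have N0: "\<exists>N0. open N0 & slice \<omega> e Int N0 = \<Gamma>"
 proof (intro exI conjI)
  let ?N = "\<Union>{U. open U & slice \<omega> e Int U <= \<Gamma>}"
  show "open ?N" by (intro open_Union) blast
  show "slice \<omega> e Int ?N = \<Gamma>"
  proof
   show "slice \<omega> e Int ?N <= \<Gamma>" by blast
   show "\<Gamma> <= slice \<omega> e Int ?N"
   proof
    fix x assume x: "x \<in> \<Gamma>"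
    then have xs: "x \<in> slice \<omega> e" using sub unfolding sl by blast
    obtain U dl where U: "open U" "x \<in> U" "dl > 0" "!!n. norm (n - e) < dl ==> connected (slice \<omega> n Int U)"
     by (rule section_box[OF xs tr[OF x] open_UNIV UNIV_I]) (rule that)
    have "connected (slice \<omega> e Int U)" using U(4)[of e] U(3) by simp
    moreover have "\<Gamma> Int (slice \<omega> e Int U) ~= {}" using x xs U(2) by blast
    ultimately have "slice \<omega> e Int U <= \<Gamma>" using components_maximal[OF \<Gamma>(1), of "slice \<omega> e Int U"] unfolding sl by blast
    then show "x \<in> slice \<omega> e Int ?N" using U(1,2) xs by blast
   qed
  qed
 qed
 obtain c where c: "(%x. 2 *\<^sub>R c - x) ` F ` \<Gamma> = F ` \<Gamma>" using cen unfolding central_def by blast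
 then have sym: "2 *\<^sub>R c - p \<in> F ` \<Gamma>" if "p \<in> F ` \<Gamma>" for p using that by blast
 have cP: "c \<in> ?P"
 proof -
  obtain x where x: "x \<in> \<Gamma>" using ne by blast
  have 1: "e \<bullet> (F x - \<omega>) = 1" using sub x by blast
  obtain x' where x': "x' \<in> \<Gamma>" "2 *\<^sub>R c - F x = F x'" using sym[of "F x"] x by blast
  have 2: "e \<bullet> (F x' - \<omega>) = 1" using sub x'(1) by blast
  show ?thesis using 1 2 unfolding x'(2)[symmetric] by (simp add: inner_diff_right)
 qed
 obtain \<beta> s t d1 d2 where \<beta>: "!!r :: real. \<beta> r \<in> F ` \<Gamma>" "\<beta> s = c" "\<beta> t = c"
  "(\<beta> has_vector_derivative d1) (at s)" "(\<beta> has_vector_derivative d2) (at t)"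
  and free: "!!k l. k *\<^sub>R d1 = l *\<^sub>R d2 ==> k = 0 & l = 0"
  by (rule figure8_centre_tangents[OF f8 _ cP]) (erule sym, rule that)
 obtain x1 where x1: "x1 \<in> \<Gamma>" "F x1 = c" using \<beta>(1)[of s] \<beta>(2) by auto
 have ed: "e \<bullet> d = 0" if "(\<beta> has_vector_derivative d) (at r)" for d r
 proof -
  have "((%r. e \<bullet> \<beta> r) has_vector_derivative e \<bullet> d) (at r)"
   by (rule bounded_linear.has_vector_derivative[OF bounded_linear_inner_right that])
  moreover have "e \<bullet> \<beta> r = 1 + e \<bullet> \<omega>" for r
  proof -
   obtain y where "y \<in> \<Gamma>" "\<beta> r = F y" using \<beta>(1)[of r] by blast
   then show ?thesis using sub by (auto simp: inner_diff_right)
  qed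
  then have "(%r. e \<bullet> \<beta> r) = (%r. 1 + e \<bullet> \<omega>)" by (rule ext)
  ultimately have "((%r. 1 + e \<bullet> \<omega>) has_vector_derivative e \<bullet> d) (at r)" by (simp only:)
  then show ?thesis using vector_derivative_unique_at[OF _ has_vector_derivative_const] by blast
 qed
 have "\<exists>x2\<in>\<Gamma>. F x2 = c & x2 ~= x1"
 proof (rule ccontr)
  assume "\<not> (\<exists>x2\<in>\<Gamma>. F x2 = c & x2 ~= x1)"
  then have one: "y = x1" if "y \<in> \<Gamma>" "F y = c" for y using that by blast
  have n1: "normal x1 \<bullet> d1 = 0" by (rule image_curve_tangent[OF \<Gamma>(2) \<beta>(1,4)]) (simp add: \<beta>(2) one)
  have n2: "normal x1 \<bullet> d2 = 0" by (rule image_curve_tangent[OF \<Gamma>(2) \<beta>(1,5)]) (simp add: \<beta>(3) one)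
  obtain k where k: "d1 = k *\<^sub>R cross3 (normal x1) e"
   using cross3_multiple[OF tr[OF x1(1)], of d1] n1 ed[OF \<beta>(4)] by (metis inner_commute)
  obtain l where l: "d2 = l *\<^sub>R cross3 (normal x1) e"
   using cross3_multiple[OF tr[OF x1(1)], of d2] n2 ed[OF \<beta>(5)] by (metis inner_commute)
  have "l *\<^sub>R d1 = k *\<^sub>R d2" unfolding k l by (simp add: mult.commute)
  from free[OF this] have "l = 0" "k = 0" by blast+
  then have "1 *\<^sub>R d1 = 1 *\<^sub>R d2" unfolding k l by simp
  from free[OF this] show False by simp
 qed
 then obtain x2 where x2: "x2 \<in> \<Gamma>" "F x2 = c" "x2 ~= x1" by blast
 have two: "y = x1 \<or> y = x2" if y: "F y = c" for y
 proof (rule ccontr)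
  assume "\<not> (y = x1 \<or> y = x2)"
  then have "distinct [x1, x2, y]" using x2(3) by auto
  then have "e \<bullet> (F x1 - \<omega>) ~= 1"
   using g[unfolded generic_def, THEN conjunct2, THEN conjunct2, rule_format, of x1 x2 y] x1(2) x2(2) y by simp
  then show False using sub x1(1) by blast
 qed
 have "centred_loop \<omega> e \<Gamma> c x1 x2" unfolding centred_loop_def
 proof (intro conjI ballI impI \<Gamma>(2) con N0 tr ind)
  show "x1 ~= x2" using x2(3) by simp
  show "{x \<in> \<Gamma>. F x = c} = {x1, x2}" using x1 x2 two by blast
  show "centred \<Gamma> c" unfolding centred_def using sym by blast
 qed
 then show thesis by (rule that)
qed

end

theorem theorem3p6:
  fixes A :: "'m::{t2_space, second_countable_topology} chart set"
    and F :: "'m \<Rightarrow> real^3"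
    and P :: "(real^3) set"
  assumes "smooth_surface A"
    and "connected (UNIV :: 'm set)"
    and "C2_immersion A F"
    and "complete_immersion A F"
    and "central_cross_cut_property A F"
    and "is_plane P"
    and "in_general_position A F P"
    and "\<exists>\<Gamma>. clean_cross_cut A F P \<Gamma> \<and> clean_figure8_in P (F ` \<Gamma>)"
  shows "central_cylinder A F"
proof -
  interpret S: surface_immersion A F by (rule surface_immersion.intro[OF assms(1,3)])
  obtain a b where a: "a \<noteq> 0" "P = {x. a \<bullet> x = b}" using assms(6) unfolding is_plane_def by blast
  define \<omega> where "\<omega> = ((b - 1) / (a \<bullet> a)) *\<^sub>R a"
  have "a \<bullet> \<omega> = b - 1" unfolding \<omega>_def using a(1) by simp
  then have P: "P = {y. a \<bullet> (y - \<omega>) = 1}" unfolding a(2) by (auto simp: inner_diff_right)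
  have nc: "S.normal_crossings" and g: "S.generic \<omega> a"
    using S.general_position_crossings[OF a(1), of \<omega>] assms(7) unfolding P by blast+
  obtain \<Gamma> where \<Gamma>: "clean_cross_cut A F P \<Gamma>" "clean_figure8_in P (F ` \<Gamma>)" using assms(8) by blast
  have cc: "cross_cut A F P \<Gamma>" using \<Gamma>(1) by (simp add: clean_cross_cut_def)
  then have comp: "\<Gamma> \<in> components (F -` P)" "compact \<Gamma>" by (simp_all add: cross_cut_def)
  have cen: "central (F ` \<Gamma>)" using assms(5) \<Gamma>(1) unfolding central_cross_cut_property_def by blast
  interpret central_surface F S.normal by (rule S.central_surface_normal[OF assms(2,4,5) nc])
  obtain c x1 x2 where loop: "centred_loop \<omega> a \<Gamma> c x1 x2"
    by (rule S.figure8_centred_loop[OF nc g a(1) comp[unfolded P] cen \<Gamma>(2)[unfolded P]])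
  obtain v \<Psi> where v: "a \<bullet> v = 1" and r: "ruling \<Gamma> v UNIV \<Psi>" by (rule global_ruling[OF loop])
  have FP: "F (\<Psi> x h) = F x + h *\<^sub>R v" if "x \<in> \<Gamma>" for x h by (rule rulingD(3)[OF r that UNIV_I])
  have range: "range F = {F x + h *\<^sub>R v | x h. x \<in> \<Gamma>}"
  proof (intro subset_antisym subsetI)
    fix p assume "p \<in> range F"
    then obtain z where z: "p = F z" by blast
    obtain x h where "x \<in> \<Gamma>" "z = \<Psi> x h" using ruling_surjective[OF loop v r assms(2), of z] by blast
    then show "p \<in> {F x + h *\<^sub>R v | x h. x \<in> \<Gamma>}" using FP z by blast
  next
    fix p assume "p \<in> {F x + h *\<^sub>R v | x h. x \<in> \<Gamma>}"
    then obtain x h where "x \<in> \<Gamma>" "p = F x + h *\<^sub>R v" by blast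
    then show "p \<in> range F" using FP[of x h] by (metis rangeI)
  qed
  have shift: "p + t *\<^sub>R v \<in> range F" if "p \<in> range F" for p t
  proof -
    obtain x h where "x \<in> \<Gamma>" "p = F x + h *\<^sub>R v" using \<open>p \<in> range F\<close> unfolding range by blast
    then have "p + t *\<^sub>R v = F x + (h + t) *\<^sub>R v" by (simp add: algebra_simps)
    then show ?thesis unfolding range using \<open>x \<in> \<Gamma>\<close> by blast
  qed
  have reflect: "2 *\<^sub>R c - p \<in> range F" if "p \<in> range F" for p
  proof -
    obtain x h where x: "x \<in> \<Gamma>" "p = F x + h *\<^sub>R v" using \<open>p \<in> range F\<close> unfolding range by blast
    have "centred \<Gamma> c" using loop unfolding centred_loop_def by blast
    then obtain x' where x': "x' \<in> \<Gamma>" "2 *\<^sub>R c - F x = F x'" using x(1) unfolding centred_def by blast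
    have "2 *\<^sub>R c - p = (2 *\<^sub>R c - F x) + (- h) *\<^sub>R v" unfolding x(2) by (simp add: algebra_simps)
    then show ?thesis unfolding range x'(2) using x'(1) by blast
  qed
  show ?thesis unfolding central_cylinder_def
  proof (intro conjI)
    show "\<exists>P \<Gamma>. cross_cut A F P \<Gamma>" using cc by blast
    have "v \<noteq> 0" using v by auto
    moreover have "(\<lambda>x. x + t *\<^sub>R v) ` range F = range F" for t
    proof (intro subset_antisym subsetI)
      fix p assume "p \<in> (\<lambda>x. x + t *\<^sub>R v) ` range F"
      then obtain q where "q \<in> range F" "p = q + t *\<^sub>R v" by blast
      then show "p \<in> range F" using shift by blast
    next
      fix p assume "p \<in> range F"
      from shift[OF this, of "- t"] have "p + (- t) *\<^sub>R v \<in> range F" .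
      moreover have "p = (p + (- t) *\<^sub>R v) + t *\<^sub>R v" by simp
      ultimately show "p \<in> (\<lambda>x. x + t *\<^sub>R v) ` range F" by (rule image_eqI[rotated])
    qed
    ultimately show "\<exists>v. v \<noteq> 0 \<and> (\<forall>t::real. (\<lambda>x. x + t *\<^sub>R v) ` range F = range F)" by blast
    have "(\<lambda>x. 2 *\<^sub>R c - x) ` range F = range F"
    proof (intro subset_antisym subsetI)
      fix p assume "p \<in> (\<lambda>x. 2 *\<^sub>R c - x) ` range F"
      then obtain q where "q \<in> range F" "p = 2 *\<^sub>R c - q" by blast
      then show "p \<in> range F" using reflect by blast
    next
      fix p assume "p \<in> range F"
      from reflect[OF this] have "2 *\<^sub>R c - p \<in> range F" .
      moreover have "p = 2 *\<^sub>R c - (2 *\<^sub>R c - p)" by simp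
      ultimately show "p \<in> (\<lambda>x. 2 *\<^sub>R c - x) ` range F" by (rule image_eqI[rotated])
    qed
    then show "central (range F)" unfolding central_def by blast
  qed
qed

end
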